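(* Let $\ell$ be an odd squarefree positive integer, and for real $X,Y\ge1$ let $$S_\ell(X,Y)=\sum_{\substack{1\le m\le X\\ m\text{ odd}}}\ \sum_{\substack{1\le n\le Y\\ n\text{ odd}}}\left(\frac{m}{\ell n}\right),$$ where $\left(\frac{\cdot}{\cdot}\right)$ is the Jacobi symbol. For $\alpha\ge 0$ define $$C(\alpha)=\sqrt{\alpha}+\frac{1}{2\pi}\sum_{k=1}^{\infty}\frac{1}{k^2}\int_0^{\alpha}\sqrt{y}\left(1-\cos\left(\frac{2\pi k^2}{y}\right)+\sin\left(\frac{2\pi k^2}{y}\right)\right)dy,$$ and put $C_\ell(\alpha)=C(\alpha\ell)$. Then, uniformly for all large $X$ and $Y$ (i.e. the ratio of the two sides tends to $1$ as $\min(X,Y)\to\infty$, uniformly in the ratio $Y/X$), $$S_\ell(X,Y)\sim\frac{1}{\sigma(\ell)}\cdot\frac{2}{\pi^2}\,C_\ell\!\left(\frac{Y}{X}\right)X^{3/2},$$ where $\sigma(\ell)$ is the sum of the positive divisors of $\ell$. *)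

theory Defs
  imports "HOL-Analysis.Analysis" "HOL-Number_Theory.Number_Theory"
    "HOL-Computational_Algebra.Squarefree"
begin

text \<open>The Jacobi symbol \<open>(a/n)\<close>, meaningful for odd positive \<open>n\<close>: the product of the
  Legendre symbols over the prime factors of \<open>n\<close>, taken with multiplicity.\<close>

definition Jacobi :: "int \<Rightarrow> nat \<Rightarrow> int" where
  "Jacobi a n = (\<Prod>p\<in>#prime_factorization n. Legendre a (int p))"

definition jacobi_sum :: "nat \<Rightarrow> real \<Rightarrow> real \<Rightarrow> int" where
  "jacobi_sum l X Y = (\<Sum>m\<in>{m. 1 \<le> m \<and> real m \<le> X \<and> odd m}.
               \<Sum>n\<in>{n. 1 \<le> n \<and> real n \<le> Y \<and> odd n}. Jacobi (int m) (l * n))"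

text \<open>The sum over \<open>k \<ge> 1\<close> is reindexed by \<open>Suc k\<close>. The integrand is \<open>0\<close> at \<open>y = 0\<close>, which is
  also its limit from the right, so it is continuous on \<open>{0..\<alpha>}\<close>. It is
  bounded by \<open>3 * sqrt \<alpha>\<close> there, so the series converges absolutely.\<close>

definition C_trans :: "real \<Rightarrow> real" where
  "C_trans \<alpha> = sqrt \<alpha> + 1 / (2 * pi) *
     (\<Sum>k. 1 / real (Suc k) ^ 2 *
        integral {0..\<alpha>} (\<lambda>y. sqrt y *
          (1 - cos (2 * pi * real (Suc k) ^ 2 / y) + sin (2 * pi * real (Suc k) ^ 2 / y))))"

definition C_twist :: "nat \<Rightarrow> real \<Rightarrow> real" where
  "C_twist l \<alpha> = C_trans (\<alpha> * real l)"

definition divisor_sum :: "nat \<Rightarrow> nat" where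
  "divisor_sum n = (\<Sum>d | d dvd n. d)"

end

theory Submission
  imports Defs
begin

text \<open>The sum \<open>PJ m q\<close> of \<open>d ((m/d\<^sup>2) / (q/d\<^sup>2))\<close> over the \<open>d\<close> with \<open>d\<^sup>2 | m\<close> and \<open>d\<^sup>2 | q\<close> agrees with the Jacobi symbol when
  \<open>(m, q) = 1\<close> and, up to the factor \<open>eps q * sqrt q\<close>, is its own discrete Fourier transform modulo \<open>q\<close>,
  without any primitivity assumption on the odd modulus. The Jacobi symbol is recovered from it by
  Moebius inversion over \<open>d\<close>, so it suffices to sum \<open>PJ m q\<close> over odd \<open>m \<le> X\<close> and over odd
  \<open>q \<le> Q = l Y\<close> divisible by a divisor \<open>r\<close> of \<open>l\<close>.

  When one of \<open>X\<close>, \<open>Q\<close> exceeds the other by a small power, a Polya-Vinogradov bound in the longer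
  variable leaves only the squares in the shorter one. In the remaining range the sum over \<open>m\<close>, smoothed
  by averaging over shifts, is turned by duality into a sum over frequencies \<open>k\<close> of \<open>PJ (2 k) q\<close>; summing
  over \<open>q\<close> first, only those \<open>k\<close> for which \<open>2 k\<close> is a square survive, and \<open>k = 2 j\<^sup>2\<close> produces the \<open>j\<close>-th
  integral in \<open>C_trans\<close>. Since \<open>C_trans \<alpha>\<close> is bounded below by a multiple of \<open>sqrt \<alpha> + \<alpha>\<close>, all errors are
  relatively small, and dominated convergence over \<open>d\<close> gives the theorem. The constant is the
  Euler product of the sum of \<open>mu d * gcd l d / d\<^sup>2\<close> over odd \<open>d\<close>.\<close>

text \<open>For \<open>q\<close> with square factors the Fourier transform of
  \<open>m -> (m/q)\<close> is no longer a multiple of the symbol itself. The weights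
  \<open>d\<close> in \<open>PJ\<close> are chosen so that the imprimitive terms are permuted by the
  transform. The price, an inversion with weight \<open>d\<close>, is affordable because the main
  term of \<open>SP\<close> at \<open>(X / d^2, Q / d^2)\<close> is smaller by \<open>d^3\<close>.

  The kernel \<open>1 - cos + sin\<close> reflects the phase of the Gauss sum: it is 1 or
  \<open>\<i>\<close> according to \<open>q\<close> modulo 4, so opposite frequencies pair to
  cosines in one class and to sines in the other, and summing over \<open>m <= X\<close> integrates
  these to \<open>sin\<close> and \<open>1 - cos\<close>. Restricting to odd \<open>m\<close>
  doubles the frequency inside \<open>PJ\<close> and adds a sign \<open>(-1) ^ k\<close>, which is 1
  at \<open>k = 2 j^2\<close>. Squares have a mean value because
  \<open>PJ (j^2) q = PJ q (j^2)\<close> for odd \<open>j\<close> turns a sum over moduli into a sum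
  over periods.

  Every error is measured against \<open>X sqrt Q + Q sqrt X\<close>. Writing
  \<open>X = z ^ 400\<close> makes the auxiliary lengths integer powers of \<open>z\<close> up to
  rounding.\<close>

section \<open>Legendre and Jacobi symbols: multiplicativity, reciprocity, the values at -1 and
  2\<close>

lemma Legendre_values: "Legendre a p \<in> {-1, 0, 1}"
  by (simp add: Legendre_def)

text \<open>Euler's criterion gives the congruence modulo \<open>p\<close>; both sides lie in {-1,
  0, 1}, so they differ by at most 2, which is less than \<open>p\<close>.\<close>

lemma Legendre_mult:
  assumes "prime p" "2 < p"
  shows "Legendre (a * b) (int p) = Legendre a (int p) * Legendre b (int p)"
proof -
  have "[Legendre (a * b) (int p) = (a * b) ^ ((p - 1) div 2)] (mod int p)"
    by (rule euler_criterion[OF assms])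
  moreover have "[Legendre a (int p) * Legendre b (int p) = a ^ ((p - 1) div 2) * b ^ ((p - 1) div 2)] (mod int p)"
    by (intro cong_mult euler_criterion assms)
  ultimately have "[Legendre (a * b) (int p) = Legendre a (int p) * Legendre b (int p)] (mod int p)"
    by (metis cong_sym cong_trans power_mult_distrib)
  then have d: "int p dvd Legendre (a * b) (int p) - Legendre a (int p) * Legendre b (int p)"
    by (simp add: cong_iff_dvd_diff)
  have "\<bar>Legendre (a * b) (int p) - Legendre a (int p) * Legendre b (int p)\<bar> < int p"
    using Legendre_values[of "a * b" "int p"] Legendre_values[of a "int p"]
      Legendre_values[of b "int p"] assms(2) by auto
  then have "Legendre (a * b) (int p) - Legendre a (int p) * Legendre b (int p) = 0"
    using d zdvd_not_zless[of "\<bar>Legendre (a * b) (int p) - Legendre a (int p) * Legendre b (int p)\<bar>" "int p"]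
    by fastforce
  then show ?thesis by simp
qed

lemma Legendre_cong: "[a = b] (mod p) \<Longrightarrow> Legendre a p = Legendre b p"
  by (simp add: Legendre_def QuadRes_def cong_def)

lemma Jacobi_1 [simp]: "Jacobi a (Suc 0) = 1" "Jacobi a 1 = 1"
  by (simp_all add: Jacobi_def)

lemma Jacobi_prime: "prime p \<Longrightarrow> Jacobi a p = Legendre a (int p)"
  by (simp add: Jacobi_def prime_factorization_prime)

lemma Jacobi_mult_right:
  "m > 0 \<Longrightarrow> n > 0 \<Longrightarrow> Jacobi a (m * n) = Jacobi a m * Jacobi a n"
  by (simp add: Jacobi_def prime_factorization_mult)

lemma odd_prime_gt_2: "odd n \<Longrightarrow> prime p \<Longrightarrow> p dvd n \<Longrightarrow> 2 < (p::nat)"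
  by (metis dvd_trans le_neq_implies_less prime_ge_2_nat)

text \<open>Adds one odd prime at a time, with multiplicity: the form in which most laws of the
  Jacobi symbol are lifted from the Legendre symbol.\<close>

lemma odd_prime_induct [consumes 1, case_names one step]:
  assumes "odd n"
    and "P 1" and "\<And>p n. prime p \<Longrightarrow> 2 < p \<Longrightarrow> odd n \<Longrightarrow> P n \<Longrightarrow> P (p * n)"
  shows "P (n::nat)"
  using assms(1)
proof (induction n rule: less_induct)
  case (less n)
  show ?case
  proof (cases "n = 1")
    case False
    then obtain p where p: "prime p" "p dvd n" using prime_factor_nat by blast
    then obtain k where k: "n = p * k" by blast
    have "2 < p" using odd_prime_gt_2 less.prems p by blast
    moreover have "odd k" "k < n" using k less.prems \<open>2 < p\<close> by (auto intro: Nat.gr0I)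
    ultimately show ?thesis using assms(3) p less.IH k by blast
  qed (use assms(2) in simp)
qed

lemma Jacobi_values: "Jacobi a n \<in> {-1, 0, 1}"
proof -
  have "(\<Prod>p\<in>#M. Legendre a (int p)) \<in> {-1, 0, 1}" for M :: "nat multiset"
  proof (induction M)
    case (add x M)
    then show ?case using Legendre_values[of a "int x"] by auto
  qed simp
  then show ?thesis by (simp add: Jacobi_def)
qed

lemma abs_Jacobi_le_1: "\<bar>Jacobi a n\<bar> \<le> 1"
  using Jacobi_values[of a n] by auto

lemma Jacobi_mult_left: "odd n \<Longrightarrow> Jacobi (a * b) n = Jacobi a n * Jacobi b n"
proof (induction n rule: odd_prime_induct)
  case (step p n)
  then show ?case
    by (simp add: Jacobi_mult_right Jacobi_prime prime_gt_0_nat odd_pos Legendre_mult)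
qed simp

lemma Jacobi_cong: "[a = b] (mod int n) \<Longrightarrow> Jacobi a n = Jacobi b n"
proof -
  assume *: "[a = b] (mod int n)"
  have "Legendre a (int p) = Legendre b (int p)" if "p \<in># prime_factorization n" for p
    using that * by (intro Legendre_cong cong_dvd_modulus[OF *]) (auto dest: in_prime_factors_imp_dvd)
  then show ?thesis unfolding Jacobi_def
    by (intro arg_cong[of _ _ prod_mset] image_mset_cong) auto
qed

lemma Jacobi_eq_0_iff: "odd n \<Longrightarrow> Jacobi a n = 0 \<longleftrightarrow> \<not> coprime a (int n)"
proof (induction n rule: odd_prime_induct)
  case (step p n)
  have "Legendre a (int p) = 0 \<longleftrightarrow> \<not> coprime a (int p)"
    using step.hyps(1)
    by (metis Legendre_def cong_0_iff coprime_absorb_left coprime_commute not_prime_unit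
        prime_imp_coprime prime_nat_int_transfer zero_neq_neg_one zero_neq_one)
  then show ?case using step
    by (simp add: Jacobi_mult_right Jacobi_prime prime_gt_0_nat odd_pos)
qed simp

lemma Jacobi_square_left: "odd n \<Longrightarrow> coprime a (int n) \<Longrightarrow> Jacobi (a ^ 2) n = 1"
  using Jacobi_values[of a n] Jacobi_eq_0_iff[of n a]
  by (auto simp: power2_eq_square Jacobi_mult_left)

lemma Jacobi_square_left': "odd n \<Longrightarrow> Jacobi (a ^ 2) n = (if coprime a (int n) then 1 else 0)"
  using Jacobi_square_left[of n a] Jacobi_eq_0_iff[of n "a ^ 2"] by auto

lemma Jacobi_1_left [simp]: "odd n \<Longrightarrow> Jacobi 1 n = 1"
  using Jacobi_square_left[of n 1] by simp

lemma Jacobi_square_right: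
  "odd n \<Longrightarrow> Jacobi a (n ^ 2) = (if coprime a (int n) then 1 else 0)"
  using Jacobi_values[of a n] Jacobi_eq_0_iff[of n a]
  by (auto simp: power2_eq_square Jacobi_mult_right odd_pos)

text \<open>The sign of the reciprocity law for odd \<open>m\<close> and \<open>n\<close>, -1 to the
  power \<open>(m - 1) / 2 * (n - 1) / 2\<close>, written through residues modulo 4 so that its
  multiplicativity is a finite check.\<close>

definition rsgn :: "nat \<Rightarrow> nat \<Rightarrow> int" where
  "rsgn m n = (if m mod 4 = 3 \<and> n mod 4 = 3 then -1 else 1)"

lemma rsgn_commute: "rsgn m n = rsgn n m"
  by (auto simp: rsgn_def)

lemma odd_mod_4: "odd (n::nat) \<Longrightarrow> n mod 4 = 1 \<or> n mod 4 = 3"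
  by presburger

lemma rsgn_mult_right: "odd m \<Longrightarrow> odd n \<Longrightarrow> rsgn k (m * n) = rsgn k m * rsgn k n"
  using odd_mod_4[of m] odd_mod_4[of n] mod_mult_eq[of m 4 n, symmetric]
  by (auto simp: rsgn_def)

lemma Jacobi_minus_1: "odd n \<Longrightarrow> Jacobi (-1) n = (if n mod 4 = 1 then 1 else -1)"
proof (induction n rule: odd_prime_induct)
  case (step p n)
  have "[Legendre (-1) (int p) = (-1) ^ ((p - 1) div 2)] (mod int p)"
    by (rule euler_criterion) (use step in auto)
  then have d: "int p dvd Legendre (-1) (int p) - (-1) ^ ((p - 1) div 2)"
    by (simp add: cong_iff_dvd_diff)
  have "\<bar>Legendre (-1) (int p) - (-1) ^ ((p - 1) div 2)\<bar> \<le> 2"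
    using Legendre_values[of "-1" "int p"] by (cases "even ((p - 1) div 2)") auto
  then have "Legendre (-1) (int p) = (-1) ^ ((p - 1) div 2)"
    using d dvd_imp_le_int[of "Legendre (-1) (int p) - (-1) ^ ((p - 1) div 2)" "int p"] step.hyps(2)
    by fastforce
  moreover have "odd p" using step.hyps prime_odd_nat by blast
  moreover from this have "even ((p - 1) div 2) \<longleftrightarrow> p mod 4 = 1"
    by presburger
  ultimately have "Legendre (-1) (int p) = (if p mod 4 = 1 then 1 else -1)"
    by auto
  then show ?case using step odd_mod_4[of n] odd_mod_4[of p] \<open>odd p\<close> mod_mult_eq[of p 4 n, symmetric]
    by (auto simp: Jacobi_mult_right Jacobi_prime prime_gt_0_nat odd_pos)
qed auto

lemma Legendre_reciprocity:
  assumes "prime p" "2 < p" "prime q" "2 < q"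
  shows "Legendre (int p) (int q) = rsgn p q * Legendre (int q) (int p)"
proof (cases "p = q")
  case True
  then show ?thesis by (simp add: Legendre_def cong_0_iff)
next
  case False
  have op: "odd p" and oq: "odd q" using assms prime_odd_nat by auto
  have "Legendre (int p) (int q) * Legendre (int q) (int p) = (-1) ^ ((p - 1) div 2 * ((q - 1) div 2))"
    by (rule Quadratic_Reciprocity) (use assms False in auto)
  moreover have "even ((p - 1) div 2) \<longleftrightarrow> p mod 4 = 1" "even ((q - 1) div 2) \<longleftrightarrow> q mod 4 = 1"
    using op oq by presburger+
  ultimately have "Legendre (int p) (int q) * Legendre (int q) (int p) = rsgn p q"
    using odd_mod_4[OF op] odd_mod_4[OF oq]
    by (auto simp: rsgn_def power_mult)
  then show ?thesis
    using Legendre_values[of "int p" "int q"] Legendre_values[of "int q" "int p"]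
    by (auto simp: rsgn_def split: if_splits)
qed

text \<open>Two nested inductions over prime factors, the inner one on \<open>n\<close> with a fixed
  prime on top. Arguments with a common factor are covered because both symbols then vanish.\<close>

lemma Jacobi_reciprocity:
  assumes "odd m" "odd n"
  shows "Jacobi (int m) n = rsgn m n * Jacobi (int n) m"
  using assms(1)
proof (induction m rule: odd_prime_induct)
  case one
  then show ?case using assms(2) by (simp add: rsgn_def)
next
  case (step p m)
  have op: "odd p" using step.hyps prime_odd_nat by blast
  have "Jacobi (int p) n = rsgn p n * Jacobi (int n) p"
    using assms(2)
  proof (induction n rule: odd_prime_induct)
    case one
    then show ?case using op by (simp add: rsgn_def)
  next
    case (step q n)
    then have "odd q" using prime_odd_nat by blast
    with step show ?case using Legendre_reciprocity[OF \<open>prime p\<close> \<open>2 < p\<close>, of q] op \<open>prime p\<close>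
      by (simp add: Jacobi_mult_right Jacobi_mult_left Jacobi_prime prime_gt_0_nat odd_pos
          rsgn_mult_right Legendre_mult \<open>2 < p\<close>)
  qed
  then show ?case using step op
    by (simp add: Jacobi_mult_right Jacobi_mult_left prime_gt_0_nat odd_pos assms(2)
        rsgn_mult_right rsgn_commute[of _ n])
qed

text \<open>Reciprocity between \<open>n\<close> and \<open>n + 2\<close> takes the place of Gauss's
  lemma: modulo \<open>n + 2\<close> the number \<open>n\<close> is -2, modulo \<open>n\<close> the
  number \<open>n + 2\<close> is 2, and the sign is 1 since consecutive odd numbers are not both 3
  modulo 4. Iterating from 1 gives \<open>Jacobi 2 n\<close>.\<close>

lemma Jacobi_2_step:
  assumes "odd n" 
  shows "Jacobi 2 (n + 2) = Jacobi (-1) (n + 2) * Jacobi 2 n"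
proof -
  have o: "odd (n + 2)" using assms by simp
  have sq: "Jacobi (-1) (n + 2) * Jacobi (-1) (n + 2) = 1"
    using Jacobi_minus_1[OF o] by auto
  have "Jacobi (int n) (n + 2) = Jacobi (-1 * 2) (n + 2)"
    by (rule Jacobi_cong) (simp add: cong_iff_dvd_diff add.commute)
  also have "\<dots> = Jacobi (-1) (n + 2) * Jacobi 2 (n + 2)"
    by (rule Jacobi_mult_left[OF o])
  finally have 1: "Jacobi (int n) (n + 2) = Jacobi (-1) (n + 2) * Jacobi 2 (n + 2)" .
  have "Jacobi (int n) (n + 2) = rsgn n (n + 2) * Jacobi (int (n + 2)) n"
    by (rule Jacobi_reciprocity[OF assms o])
  also have "rsgn n (n + 2) = 1"
    using assms by (auto simp: rsgn_def) presburger
  also have "Jacobi (int (n + 2)) n = Jacobi 2 n"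
    by (rule Jacobi_cong) (simp add: cong_iff_dvd_diff)
  finally have 2: "Jacobi (int n) (n + 2) = Jacobi 2 n" by simp
  have "Jacobi 2 (n + 2) = (Jacobi (-1) (n + 2) * Jacobi (-1) (n + 2)) * Jacobi 2 (n + 2)"
    using sq by simp
  also have "\<dots> = Jacobi (-1) (n + 2) * Jacobi 2 n"
    using 1 2 by (simp only: mult.assoc)
  finally show ?thesis .
qed

lemma Jacobi_2:
  assumes "odd n"
  shows "Jacobi 2 n = (if n mod 8 = 1 \<or> n mod 8 = 7 then 1 else -1)"
proof -
  have "Jacobi 2 (2 * k + 1) = (if (2 * k + 1) mod 8 = 1 \<or> (2 * k + 1) mod 8 = 7 then 1 else -1)" for k
  proof (induction k)
    case (Suc k)
    have "Jacobi 2 (2 * Suc k + 1) = Jacobi (-1) (2 * Suc k + 1) * Jacobi 2 (2 * k + 1)"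
      using Jacobi_2_step[of "2 * k + 1"] by simp
    moreover have "(2 * Suc k + 1) mod 8 = ((2 * k + 1) mod 8 + 2) mod 8"
      by (simp add: mod_simps)
    moreover have "(2 * Suc k + 1) mod 4 = ((2 * Suc k + 1) mod 8) mod 4"
      by (rule mod_mod_cancel[symmetric]) simp
    moreover have "(2 * k + 1) mod 8 = 1 \<or> (2 * k + 1) mod 8 = 3 \<or> (2 * k + 1) mod 8 = 5 \<or> (2 * k + 1) mod 8 = 7"
      by presburger
    ultimately show ?case using Suc Jacobi_minus_1[of "2 * Suc k + 1"] by auto
  qed simp
  then show ?thesis using assms by (metis oddE)
qed

section \<open>Additive characters and sums over complete residue systems\<close>

definition cise :: "real \<Rightarrow> complex" where "cise x = cis (2 * pi * x)"

lemma cise_add: "cise (x + y) = cise x * cise y"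
  by (simp add: cise_def cis_mult algebra_simps)

lemma cise_0 [simp]: "cise 0 = 1"
  by (simp add: cise_def)

lemma cise_minus: "cise (- x) = cnj (cise x)"
  by (simp add: cise_def cis_cnj)

lemma cise_diff: "cise (x - y) = cise x * cnj (cise y)"
  using cise_add[of x "- y"] by (simp add: cise_minus)

lemma norm_cise [simp]: "norm (cise x) = 1"
  by (simp add: cise_def)

lemma cise_nonzero [simp]: "cise x \<noteq> 0"
  by (simp add: cise_def)

lemma cise_of_int [simp]: "cise (of_int k) = 1"
  unfolding cise_def by (rule cis_multiple_2pi) auto

lemma cise_of_nat [simp]: "cise (of_nat k) = 1"
  using cise_of_int[of "int k"] by simp

lemma cise_power: "cise x ^ n = cise (real n * x)"
  unfolding cise_def Complex.DeMoivre by (simp add: mult_ac)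

lemma cise_cong:
  assumes "[a = b] (mod int q)" "q > 0"
  shows "cise (of_int a / real q) = cise (of_int b / real q)"
proof -
  obtain k where k: "a = b + int q * k"
    using assms(1) cong_iff_lin[of b a "int q"] by (auto simp: cong_sym_eq)
  have "of_int a / real q = of_int b / real q + of_int k"
    using assms(2) k by (simp add: field_simps)
  then show ?thesis by (simp add: cise_add)
qed

lemma cise_eq_1_iff: "cise x = 1 \<longleftrightarrow> x \<in> \<int>"
proof
  assume "cise x = 1"
  then have "cos (2 * pi * x) = 1" by (simp add: cise_def complex_eq_iff)
  then obtain n where "2 * pi * x = of_int n * 2 * pi" using cos_one_2pi_int by blast
  then have "x = of_int n" by simp
  then show "x \<in> \<int>" by simp
qed (auto elim: Ints_cases)

lemma norm_cise_minus_1: "norm (cise x - 1) = 2 * \<bar>sin (pi * x)\<bar>"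
proof -
  have "cise x - 1 = cise (x / 2) * (cise (x / 2) - cise (- (x / 2)))"
    by (simp add: algebra_simps flip: cise_add)
  also have "cise (x / 2) - cise (- (x / 2)) = 2 * \<i> * of_real (sin (pi * x))"
    by (simp add: cise_def complex_eq_iff)
  finally show ?thesis by (simp add: norm_mult)
qed

lemma sum_cise_geometric:
  assumes "cise x \<noteq> 1"
  shows "(\<Sum>a<n. cise (real a * x)) = (cise (real n * x) - 1) / (cise x - 1)"
  using geometric_sum[OF assms, of n] by (simp add: cise_power)

lemma sum_cise_orthogonal:
  assumes "q > 0"
  shows "(\<Sum>a<q. cise (real a * of_int k / real q)) = (if int q dvd k then of_nat q else 0)"
proof (cases "int q dvd k")
  case True
  then obtain j where "k = int q * j" by blast
  then have "cise (real a * of_int k / real q) = 1" for a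
    using assms cise_of_int[of "int a * j"] by simp
  then show ?thesis using True by simp
next
  case False
  have "cise (of_int k / real q) \<noteq> 1"
  proof
    assume "cise (of_int k / real q) = 1"
    then obtain j where "of_int k / real q = of_int j" by (auto simp: cise_eq_1_iff elim: Ints_cases)
    then have "real_of_int k = real_of_int (j * int q)" using assms by (simp add: field_simps)
    then have "k = j * int q" by (simp only: of_int_eq_iff)
    then show False using False by simp
  qed
  moreover have "cise (real q * (of_int k / real q)) = 1" using assms by simp
  ultimately show ?thesis
    using sum_cise_geometric[of "of_int k / real q" q] False by simp
qed

lemma sum_complete_residues:
  fixes F :: "int \<Rightarrow> 'a :: comm_monoid_add"
  assumes "q > 0" and per: "\<And>a b. [a = b] (mod int q) \<Longrightarrow> F a = F b"
    and inj: "inj_on (\<lambda>a. f a mod int q) {..<q}"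
  shows "(\<Sum>a<q. F (f a)) = (\<Sum>a<q. F (int a))"
proof -
  have "inj_on (\<lambda>a. nat (f a mod int q)) {..<q}"
    using inj assms(1) by (auto simp: inj_on_def nat_eq_iff)
  moreover have "(\<lambda>a. nat (f a mod int q)) ` {..<q} \<subseteq> {..<q}"
    using assms(1) by (auto simp: nat_less_iff)
  ultimately have "bij_betw (\<lambda>a. nat (f a mod int q)) {..<q} {..<q}"
    by (simp add: bij_betw_def endo_inj_surj)
  then have "(\<Sum>a<q. F (int a)) = (\<Sum>a<q. F (int (nat (f a mod int q))))"
    by (rule sum.reindex_bij_betw[symmetric])
  also have "\<dots> = (\<Sum>a<q. F (f a))"
    by (intro sum.cong refl per) (use assms(1) in auto)
  finally show ?thesis by simp
qed

lemma inj_on_mod_linear: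
  assumes "coprime u (int q)"
  shows "inj_on (\<lambda>a. (u * int a + v) mod int q) {..<q}"
proof (rule inj_onI)
  fix x y assume xy: "x \<in> {..<q}" "y \<in> {..<q}" "(u * int x + v) mod int q = (u * int y + v) mod int q"
  then have "[u * int x + v = u * int y + v] (mod int q)" by (simp add: cong_def)
  then have "[int x = int y] (mod int q)"
    using assms by (simp add: cong_add_rcancel cong_mult_lcancel)
  then show "x = y" using xy by (simp add: cong_def)
qed

lemma sum_residues_linear:
  fixes F :: "int \<Rightarrow> 'a :: comm_monoid_add"
  assumes "q > 0" "\<And>a b. [a = b] (mod int q) \<Longrightarrow> F a = F b" "coprime u (int q)"
  shows "(\<Sum>a<q. F (u * int a + v)) = (\<Sum>a<q. F (int a))"
  using sum_complete_residues[OF assms(1,2) inj_on_mod_linear[OF assms(3)]] .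

text \<open>The representative \<open>a * q + b * p\<close> is chosen because it splits a fraction
  with denominator \<open>p * q\<close> into \<open>a / p + b / q\<close>, so that additive
  characters factor.\<close>

lemma sum_CRT:
  fixes F :: "int \<Rightarrow> 'a :: comm_monoid_add"
  assumes cop: "coprime p q" and pos: "p > 0" "q > 0"
    and per: "\<And>a b. [a = b] (mod int (p * q)) \<Longrightarrow> F a = F b"
  shows "(\<Sum>a<p * q. F (int a)) = (\<Sum>a<p. \<Sum>b<q. F (int (a * q + b * p)))"
proof -
  let ?h = "\<lambda>(a, b). (a * q + b * p) mod (p * q)"
  have inj: "inj_on ?h ({..<p} \<times> {..<q})"
  proof (rule inj_onI, clarify)
    fix a b c d assume *: "a < p" "b < q" "c < p" "d < q"
      "(a * q + b * p) mod (p * q) = (c * q + d * p) mod (p * q)"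
    then have "[a * q + b * p = c * q + d * p] (mod p * q)" by (simp add: cong_def)
    then have 1: "[a * q + b * p = c * q + d * p] (mod p)" and 2: "[a * q + b * p = c * q + d * p] (mod q)"
      by (auto intro: cong_dvd_modulus_nat)
    from 1 have "[a * q = c * q] (mod p)" by (simp add: cong_def)
    then have "[a = c] (mod p)" using cop by (simp add: cong_mult_rcancel_nat coprime_commute)
    moreover from 2 have "[b * p = d * p] (mod q)" by (simp add: cong_def)
    then have "[b = d] (mod q)" using cop by (simp add: cong_mult_rcancel_nat coprime_commute)
    ultimately show "a = c \<and> b = d" using * by (simp add: cong_def)
  qed
  have "?h ` ({..<p} \<times> {..<q}) = {..<p * q}"
  proof (rule card_subset_eq)
    show "?h ` ({..<p} \<times> {..<q}) \<subseteq> {..<p * q}" using pos by auto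
    show "card (?h ` ({..<p} \<times> {..<q})) = card {..<p * q}"
      using card_image[OF inj] by simp
  qed simp
  with inj have "bij_betw ?h ({..<p} \<times> {..<q}) {..<p * q}" by (simp add: bij_betw_def)
  then have "(\<Sum>a<p * q. F (int a)) = (\<Sum>x\<in>{..<p} \<times> {..<q}. F (int (?h x)))"
    by (rule sum.reindex_bij_betw[symmetric])
  also have "\<dots> = (\<Sum>x\<in>{..<p} \<times> {..<q}. F (case x of (a, b) \<Rightarrow> int (a * q + b * p)))"
    by (intro sum.cong refl per) (auto simp: cong_def zmod_int)
  also have "\<dots> = (\<Sum>a<p. \<Sum>b<q. F (int (a * q + b * p)))"
    by (simp add: sum.cartesian_product case_prod_unfold)
  finally show ?thesis .
qed

section \<open>The sign of the quadratic Gauss sum\<close>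

text \<open>Gaussian binomial coefficients, with junk values if \<open>x\<close> is a root of unity of order at most \<open>j\<close>.\<close>

definition qbin :: "complex \<Rightarrow> nat \<Rightarrow> nat \<Rightarrow> complex" where
  "qbin x m j = (\<Prod>i<j. (1 - x ^ (m - i)) / (1 - x ^ Suc i))"

lemma qbin_Suc_self: "qbin x m (Suc m) = 0"
  by (simp add: qbin_def)

lemma qbin_diagonal: "(1 - x ^ (Suc m - j)) * qbin x (Suc m) j = (1 - x ^ Suc m) * qbin x m j"
proof -
  let ?N = "\<lambda>m j. (\<Prod>i<j. 1 - x ^ (m - i))"
  have "(1 - x ^ (Suc m - j)) * ?N (Suc m) j = ?N (Suc m) (Suc j)" by simp
  also have "\<dots> = (1 - x ^ Suc m) * ?N m j"
    by (subst prod.lessThan_Suc_shift) simp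
  finally have eq: "(1 - x ^ (Suc m - j)) * ?N (Suc m) j = (1 - x ^ Suc m) * ?N m j" .
  show ?thesis unfolding qbin_def prod_dividef times_divide_eq_right eq ..
qed

lemma qbin_pascal:
  assumes "x ^ Suc j \<noteq> 1" "j \<le> m"
  shows "qbin x (Suc m) (Suc j) = qbin x m (Suc j) + x ^ (m - j) * qbin x m j"
proof -
  let ?N = "\<lambda>m j. (\<Prod>i<j. 1 - x ^ (m - i))"
  define A B where "A = x ^ (m - j)" and "B = x ^ Suc j"
  have nz: "1 - B \<noteq> 0" using assms(1) by (simp add: B_def)
  have AB: "x ^ Suc m = A * B"
    using assms(2) by (simp add: A_def B_def flip: power_add power_Suc)
  have N: "?N (Suc m) (Suc j) = (1 - x ^ Suc m) * ?N m j"
    by (subst prod.lessThan_Suc_shift) simp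
  have "qbin x (Suc m) (Suc j) = ?N (Suc m) (Suc j) / ((\<Prod>i<j. 1 - x ^ Suc i) * (1 - B))"
    by (simp only: qbin_def prod_dividef prod.lessThan_Suc B_def)
  then have "qbin x (Suc m) (Suc j) = (1 - A * B) / (1 - B) * qbin x m j"
    unfolding N AB by (simp only: qbin_def prod_dividef times_divide_times_eq mult.commute)
  also have "1 - A * B = (1 - A) + A * (1 - B)" by (simp add: algebra_simps)
  also have "((1 - A) + A * (1 - B)) / (1 - B) * qbin x m j = (1 - A) / (1 - B) * qbin x m j + A * qbin x m j"
    using nz by (simp add: add_divide_distrib distrib_right)
  also have "(1 - A) / (1 - B) * qbin x m j = qbin x m (Suc j)"
    by (simp add: qbin_def A_def B_def)
  finally show ?thesis by (simp add: A_def)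
qed

text \<open>Gauss's recursion. Pascal's rule writes the left side as a difference of two sums over
  row \<open>m + 1\<close>, which combine to the weights \<open>1 - x ^ (m + 1 - j)\<close>;
  \<open>qbin_diagonal\<close> trades these for the common factor \<open>1 - x ^ (m + 1)\<close> and
  lowers the row to \<open>m\<close>.\<close>

lemma alternating_qbin_sum_Suc:
  assumes "\<And>i. 0 < i \<Longrightarrow> i \<le> Suc (Suc m) \<Longrightarrow> x ^ i \<noteq> 1"
  shows "(\<Sum>j\<le>Suc (Suc m). (-1) ^ j * qbin x (Suc (Suc m)) j)
       = (1 - x ^ Suc m) * (\<Sum>j\<le>m. (-1) ^ j * qbin x m j)"
proof -
  let ?M = "Suc m"
  have "(\<Sum>j\<le>Suc ?M. (-1) ^ j * qbin x (Suc ?M) j)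
      = 1 + (\<Sum>j\<le>?M. (-1) ^ Suc j * qbin x (Suc ?M) (Suc j))"
    by (subst sum.atMost_Suc_shift) (simp add: qbin_def)
  also have "(\<Sum>j\<le>?M. (-1) ^ Suc j * qbin x (Suc ?M) (Suc j))
      = (\<Sum>j\<le>?M. (-1) ^ Suc j * qbin x ?M (Suc j)) - (\<Sum>j\<le>?M. (-1) ^ j * (x ^ (?M - j) * qbin x ?M j))"
    unfolding sum_subtractf[symmetric]
  proof (intro sum.cong refl)
    fix j assume "j \<in> {..?M}"
    then have "qbin x (Suc ?M) (Suc j) = qbin x ?M (Suc j) + x ^ (?M - j) * qbin x ?M j"
      by (intro qbin_pascal assms) auto
    then show "(-1) ^ Suc j * qbin x (Suc ?M) (Suc j)
      = (-1) ^ Suc j * qbin x ?M (Suc j) - (-1) ^ j * (x ^ (?M - j) * qbin x ?M j)"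
      by (simp add: algebra_simps)
  qed
  also have "1 + ((\<Sum>j\<le>?M. (-1) ^ Suc j * qbin x ?M (Suc j)) - (\<Sum>j\<le>?M. (-1) ^ j * (x ^ (?M - j) * qbin x ?M j)))
      = (\<Sum>j\<le>Suc ?M. (-1) ^ j * qbin x ?M j) - (\<Sum>j\<le>?M. (-1) ^ j * (x ^ (?M - j) * qbin x ?M j))"
    by (subst (3) sum.atMost_Suc_shift) (simp add: qbin_def)
  also have "(\<Sum>j\<le>Suc ?M. (-1) ^ j * qbin x ?M j) = (\<Sum>j\<le>?M. (-1) ^ j * qbin x ?M j)"
    by (subst sum.atMost_Suc) (simp only: qbin_Suc_self mult_zero_right add_0_right)
  also have "\<dots> - (\<Sum>j\<le>?M. (-1) ^ j * (x ^ (?M - j) * qbin x ?M j))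
      = (\<Sum>j\<le>?M. (-1) ^ j * ((1 - x ^ (?M - j)) * qbin x ?M j))"
    unfolding sum_subtractf[symmetric] by (intro sum.cong) (auto simp: algebra_simps)
  also have "\<dots> = (1 - x ^ ?M) * (\<Sum>j\<le>?M. (-1) ^ j * qbin x m j)"
    unfolding qbin_diagonal by (simp add: sum_distrib_left mult_ac del: sum.atMost_Suc power_Suc)
  also have "(\<Sum>j\<le>?M. (-1) ^ j * qbin x m j) = (\<Sum>j\<le>m. (-1) ^ j * qbin x m j)"
    by (simp add: qbin_Suc_self)
  finally show ?thesis .
qed

lemma alternating_qbin_sum:
  assumes "\<And>i. 0 < i \<Longrightarrow> i \<le> 2 * k \<Longrightarrow> x ^ i \<noteq> 1"
  shows "(\<Sum>j\<le>2 * k. (-1) ^ j * qbin x (2 * k) j) = (\<Prod>i<k. 1 - x ^ (2 * i + 1))"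
  using assms
proof (induction k)
  case (Suc k)
  then show ?case using alternating_qbin_sum_Suc[of "2 * k" x] by (simp add: mult.commute)
qed (simp add: qbin_def)

definition gauss_sum :: "nat \<Rightarrow> complex" where
  "gauss_sum n = (\<Sum>x<n. cise (real (x ^ 2) / real n))"

text \<open>In the double sum for the squared absolute value, shifting \<open>x\<close> by
  \<open>y\<close> makes the phase linear in \<open>y\<close>; orthogonality leaves only
  \<open>n | 2 x\<close>, that is \<open>x = 0\<close>, as \<open>n\<close> is odd.\<close>

lemma norm_gauss_sum:
  assumes "odd n"
  shows "norm (gauss_sum n) = sqrt (real n)"
proof -
  have n: "n > 0" using assms by (rule odd_pos)
  let ?f = "\<lambda>a::int. cise (of_int a / real n)"
  have per: "?f a = ?f b" if "[a = b] (mod int n)" for a b using cise_cong[OF that n] .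
  have "gauss_sum n * cnj (gauss_sum n) = (\<Sum>y<n. \<Sum>x<n. ?f ((int x) ^ 2 - (int y) ^ 2))"
    by (subst sum.swap) (simp add: gauss_sum_def sum_product diff_divide_distrib cise_diff)
  also have "\<dots> = (\<Sum>y<n. \<Sum>x<n. ?f ((1 * int x + int y) ^ 2 - (int y) ^ 2))"
  proof (rule sum.cong[OF refl])
    fix y
    show "(\<Sum>x<n. ?f ((int x) ^ 2 - (int y) ^ 2)) = (\<Sum>x<n. ?f ((1 * int x + int y) ^ 2 - (int y) ^ 2))"
      by (rule sum_residues_linear[where F = "\<lambda>z. ?f (z ^ 2 - (int y) ^ 2)", symmetric, OF n])
        (rule per, intro cong_diff cong_pow cong_refl, assumption, simp)
  qed
  also have "\<dots> = (\<Sum>x<n. \<Sum>y<n. ?f ((int x) ^ 2) * cise (real y * of_int (2 * int x) / real n))"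
    by (subst sum.swap) (auto intro!: sum.cong simp: power2_eq_square algebra_simps add_divide_distrib simp flip: cise_add)
  also have "\<dots> = (\<Sum>x<n. ?f ((int x) ^ 2) * (if int n dvd 2 * int x then of_nat n else 0))"
    unfolding sum_distrib_left[symmetric] sum_cise_orthogonal[OF n] ..
  also have "\<dots> = (\<Sum>x<n. if x = 0 then of_nat n else 0)"
  proof (intro sum.cong refl)
    fix x assume "x \<in> {..<n}"
    then have "int n dvd 2 * int x \<longleftrightarrow> x = 0"
      using assms by (metis coprime_dvd_mult_right_iff coprime_right_2_iff_odd dvd_0_right
          int_dvd_int_iff lessThan_iff nat_dvd_not_less neq0_conv of_nat_mult of_nat_numeral)
    then show "?f ((int x) ^ 2) * (if int n dvd 2 * int x then of_nat n else 0)
        = (if x = 0 then of_nat n else 0)" by simp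
  qed
  also have "\<dots> = of_nat n" using n by (simp add: sum.delta)
  finally have "of_real ((norm (gauss_sum n))\<^sup>2) = (of_nat n :: complex)"
    by (simp only: complex_norm_square)
  then have "(norm (gauss_sum n))\<^sup>2 = real n"
    by (metis of_real_eq_iff of_real_of_nat_eq)
  then show ?thesis by (simp add: real_sqrt_unique)
qed

text \<open>For the root of unity \<open>x = cise (- 2 / n)\<close> the quotients defining
  \<open>qbin\<close> in row \<open>n - 1\<close> collapse to \<open>- 1 / x ^ (j + 1)\<close>,
  because \<open>x ^ (n - 1 - j)\<close> is the inverse of \<open>x ^ (j + 1)\<close>. The
  alternating sum of this row is then a sum of \<open>cise (j (j + 1) / n)\<close>, a Gauss sum up
  to completing the square, while \<open>alternating_qbin_sum\<close> evaluates it as a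
  product.\<close>

lemma gauss_sum_product:
  assumes n: "n = 2 * k + 1"
  shows "gauss_sum n = (\<Prod>i<k. 2 * \<i> * of_real (sin (2 * pi * real (2 * i + 1) / real n)))"
proof -
  define x where "x = cise (- 2 / real n)"
  have npos: "n > 0" using n by simp
  have xpow: "x ^ i = cise (- 2 * real i / real n)" for i
    by (simp add: x_def cise_power mult.commute)
  have xne: "x ^ i \<noteq> 1" if "0 < i" "i \<le> 2 * k" for i
  proof
    assume "x ^ i = 1"
    then have "- 2 * real i / real n \<in> \<int>" by (simp only: xpow cise_eq_1_iff)
    then obtain j where "- 2 * real i / real n = of_int j" by (rule Ints_cases)
    then have "real_of_int (- 2 * int i) = real_of_int (j * int n)"
      using npos by (simp add: field_simps)
    then have "- 2 * int i = j * int n" by (simp only: of_int_eq_iff)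
    then have "int n dvd 2 * int i" by (metis dvd_minus_iff dvd_triv_right mult_minus_left)
    then have "n dvd 2 * i" by (metis int_dvd_int_iff of_nat_mult of_nat_numeral)
    moreover have "coprime n 2" using n by simp
    ultimately have "n dvd i" using coprime_dvd_mult_right_iff by blast
    then have "n \<le> i" using that dvd_imp_le by blast
    then show False using that n by simp
  qed
  have xn: "x ^ n = 1"
    using xpow[of n] npos cise_of_int[of "-2"] by simp
  have qb: "(-1) ^ j * qbin x (2 * k) j = cise (real (j * (j + 1)) / real n)" if "j \<le> 2 * k" for j
    using that
  proof (induction j)
    case (Suc j)
    have "x ^ (2 * k - j) * x ^ Suc j = x ^ n"
      using Suc.prems n by (simp flip: power_add)
    then have inv: "x ^ (2 * k - j) = 1 / x ^ Suc j"
      using xn by (simp add: x_def field_simps)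
    have "x ^ Suc j \<noteq> 1" using xne[of "Suc j"] Suc.prems by simp
    then have "(1 - x ^ (2 * k - j)) / (1 - x ^ Suc j) = - (1 / x ^ Suc j)"
      unfolding inv by (simp add: x_def divide_simps)
    also have "1 / x ^ Suc j = cise (2 * real (Suc j) / real n)"
    proof -
      have "cise (2 * real (Suc j) / real n) * cise (- 2 * real (Suc j) / real n) = cise 0"
        unfolding cise_add[symmetric] add_divide_distrib[symmetric] by simp
      then show ?thesis unfolding xpow by (simp add: field_simps)
    qed
    finally have "qbin x (2 * k) (Suc j) = - (qbin x (2 * k) j * cise (2 * real (Suc j) / real n))"
      by (simp add: qbin_def)
    then have "(-1) ^ Suc j * qbin x (2 * k) (Suc j)
        = ((-1) ^ j * qbin x (2 * k) j) * cise (2 * real (Suc j) / real n)"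
      by simp
    also have "\<dots> = cise (real (j * (j + 1)) / real n) * cise (2 * real (Suc j) / real n)"
      using Suc by simp
    also have "\<dots> = cise (real (Suc j * (Suc j + 1)) / real n)"
      unfolding cise_add[symmetric] add_divide_distrib[symmetric] by (simp add: algebra_simps)
    finally show ?case .
  qed (simp add: qbin_def)
  have S: "{..<n} = {..2 * k}" using n by auto
  have "(\<Sum>j<n. cise (real (j * (j + 1)) / real n)) = (\<Sum>j\<le>2 * k. (-1) ^ j * qbin x (2 * k) j)"
    unfolding S by (rule sum.cong[OF refl], rule qb[symmetric], simp)
  also have "\<dots> = (\<Prod>i<k. 1 - x ^ (2 * i + 1))"
    by (rule alternating_qbin_sum) (use xne in auto)
  finally have A: "(\<Sum>j<n. cise (real (j * (j + 1)) / real n)) = (\<Prod>i<k. 1 - x ^ (2 * i + 1))" .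
  \<comment> \<open>\<open>k + 1\<close> is the inverse of 2 modulo \<open>n = 2 k + 1\<close>, so
    \<open>(j + h)^2 - h^2 = j^2 + 2 h j\<close> is congruent to \<open>j (j + 1)\<close>.\<close>
  let ?h = "int (k + 1)"
  have "cise (real (j * (j + 1)) / real n) = cise (of_int ((1 * int j + ?h) ^ 2) / real n) * cnj (cise (of_int (?h ^ 2) / real n))" for j
  proof -
    have "cise (of_int (int (j * (j + 1))) / real n) = cise (of_int ((int j + ?h) ^ 2 - ?h ^ 2) / real n)"
    proof (rule cise_cong[OF _ npos])
      have "(int j + ?h) ^ 2 - ?h ^ 2 - int (j * (j + 1)) = int n * int j"
        using n by (simp add: power2_eq_square algebra_simps)
      then show "[int (j * (j + 1)) = (int j + ?h) ^ 2 - ?h ^ 2] (mod int n)"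
        by (metis cong_iff_dvd_diff cong_sym dvd_triv_left)
    qed
    then show ?thesis by (simp add: diff_divide_distrib cise_diff)
  qed
  then have "(\<Sum>j<n. cise (real (j * (j + 1)) / real n))
      = (\<Sum>j<n. cise (of_int ((1 * int j + ?h) ^ 2) / real n)) * cnj (cise (of_int (?h ^ 2) / real n))"
    by (simp only: sum_distrib_right)
  also have "(\<Sum>j<n. cise (of_int ((1 * int j + ?h) ^ 2) / real n)) = (\<Sum>j<n. cise (of_int ((int j) ^ 2) / real n))"
    by (rule sum_residues_linear[where F = "\<lambda>z. cise (of_int (z ^ 2) / real n)", OF npos])
      (rule cise_cong, intro cong_pow, assumption, rule npos, simp)
  also have "\<dots> = gauss_sum n" by (simp add: gauss_sum_def)
  finally have "gauss_sum n * cnj (cise (of_int (?h ^ 2) / real n)) = (\<Prod>i<k. 1 - x ^ (2 * i + 1))"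
    using A by simp
  then have "gauss_sum n * (cnj (cise (of_int (?h ^ 2) / real n)) * cise (of_int (?h ^ 2) / real n))
      = (\<Prod>i<k. 1 - x ^ (2 * i + 1)) * cise (of_int (?h ^ 2) / real n)"
    by (simp only: mult.assoc[symmetric])
  moreover have "cnj (cise y) * cise y = 1" for y
    using cise_diff[of y y] by (simp add: mult.commute)
  ultimately have B: "gauss_sum n = (\<Prod>i<k. 1 - x ^ (2 * i + 1)) * cise (of_int (?h ^ 2) / real n)"
    by simp
  have C: "1 - x ^ i = cise (- (real i / real n)) * (2 * \<i> * of_real (sin (2 * pi * real i / real n)))" for i
  proof -
    have "1 - x ^ i = cise (- (real i / real n)) * (cise (real i / real n) - cise (- (real i / real n)))"
      by (simp add: xpow right_diff_distrib flip: cise_add)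
    also have "cise (real i / real n) - cise (- (real i / real n)) = 2 * \<i> * of_real (sin (2 * pi * real i / real n))"
      by (simp add: cise_def complex_eq_iff)
    finally show ?thesis .
  qed
  \<comment> \<open>The exponents are the first \<open>k\<close> odd numbers, with sum
    \<open>k ^ 2\<close>; together with the phase from completing the square this leaves
    \<open>(k + 1)^2 - k^2 = n\<close>, a trivial phase.\<close>
  have D: "(\<Prod>i<k. cise (- (real (2 * i + 1) / real n))) = cise (- (real (k ^ 2) / real n))" for k
  proof (induction k)
    case (Suc k)
    then show ?case by (simp add: power2_eq_square add_divide_distrib algebra_simps flip: cise_add)
  qed simp
  have "cise (- (real (k ^ 2) / real n)) * cise (of_int (?h ^ 2) / real n) = cise ((of_int (?h ^ 2) - real (k ^ 2)) / real n)"
    by (simp add: diff_divide_distrib flip: cise_add)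
  also have "(of_int (?h ^ 2) - real (k ^ 2)) / real n = of_nat 1"
    using n by (simp add: power2_eq_square field_simps)
  finally have E: "cise (- (real (k ^ 2) / real n)) * cise (of_int (?h ^ 2) / real n) = 1"
    by (simp only: cise_of_nat)
  show ?thesis
    unfolding B C prod.distrib D
    using E by (simp add: algebra_simps)
qed

text \<open>The phase of the Gauss sum of an odd \<open>n\<close>; for even \<open>n\<close> the
  value has no meaning.\<close>

definition eps :: "nat \<Rightarrow> complex" where
  "eps n = (if n mod 4 = 1 then 1 else \<i>)"

text \<open>The sine with index \<open>i\<close> is positive while \<open>2 (2 i + 1) < n\<close>,
  which holds for the first \<open>(k + 1) div 2\<close> indices; the remaining
  \<open>k div 2\<close> angles lie between \<open>pi\<close> and \<open>2 * pi\<close>.\<close>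

lemma sgn_sin_product:
  assumes n: "n = 2 * k + 1"
  shows "sgn (\<Prod>i<k. sin (2 * pi * real (2 * i + 1) / real n)) = (-1) ^ (k div 2)"
proof -
  have s: "sgn (sin (2 * pi * real (2 * i + 1) / real n)) = (if i < (k + 1) div 2 then 1 else - 1)" if "i < k" for i
  proof -
    define t where "t = real (2 * (2 * i + 1)) / real n"
    have arg: "2 * pi * real (2 * i + 1) / real n = pi * t" by (simp add: t_def)
    have t0: "t > 0" using n by (simp add: t_def)
    show ?thesis
    proof (cases "i < (k + 1) div 2")
      case True
      then have "2 * (2 * i + 1) < n" using n by presburger
      then have "t < 1" using n by (simp add: t_def)
      then have "pi * t < pi" using mult_strict_left_mono[of t 1 pi] by simp
      then show ?thesis using True t0 by (simp only: arg) (simp add: sin_gt_zero)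
    next
      case False
      then have "n < 2 * (2 * i + 1)" using n by presburger
      then have "1 < t" using n by (simp add: t_def)
      then have 1: "pi < pi * t" using mult_strict_left_mono[of 1 t pi] by simp
      have "2 * i + 1 < n" using that n by simp
      then have "t < 2" using n by (simp add: t_def divide_less_eq)
      then have "pi * t < 2 * pi" using mult_strict_left_mono[of t 2 pi] by simp
      with 1 show ?thesis using False by (simp only: arg) (simp add: sin_lt_zero)
    qed
  qed
  have "sgn (\<Prod>i<k. sin (2 * pi * real (2 * i + 1) / real n))
      = (\<Prod>i<k. sgn (sin (2 * pi * real (2 * i + 1) / real n)))"
    by (induction k) (auto simp: sgn_mult)
  also have "\<dots> = (\<Prod>i<k. if i < (k + 1) div 2 then 1 else - 1)"
    by (intro prod.cong) (auto simp only: s lessThan_iff)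
  also have "\<dots> = (\<Prod>i\<in>{..<k} - {..<(k + 1) div 2}. (- 1 :: real))"
    by (intro prod.mono_neutral_cong_right) auto
  also have "\<dots> = (- 1) ^ card ({..<k} - {..<(k + 1) div 2})" by (rule prod_constant)
  also have "card ({..<k} - {..<(k + 1) div 2}) = k div 2"
    by (subst card_Diff_subset) auto
  finally show ?thesis .
qed

text \<open>The product formula supplies the sign and \<open>norm_gauss_sum\<close> the absolute
  value, so the product of sines is never evaluated.\<close>

lemma gauss_sum_eq:
  assumes "odd n"
  shows "gauss_sum n = eps n * sqrt (real n)"
proof -
  obtain k where n: "n = 2 * k + 1" using assms by (elim oddE)
  define R where "R = 2 ^ k * (\<Prod>i<k. sin (2 * pi * real (2 * i + 1) / real n))"
  have g: "gauss_sum n = \<i> ^ k * of_real R"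
    unfolding gauss_sum_product[OF n] R_def
    by (simp add: prod.distrib power_mult_distrib)
  have "\<bar>R\<bar> = sqrt (real n)"
    using norm_gauss_sum[OF assms] by (simp add: g norm_mult norm_power)
  moreover have "sgn R = (-1) ^ (k div 2)"
    using sgn_sin_product[OF n] by (simp add: R_def sgn_mult)
  ultimately have R: "R = (-1) ^ (k div 2) * sqrt (real n)"
    using sgn_mult_abs[of R] by simp
  have "\<i> ^ k * (-1) ^ (k div 2) = eps n"
  proof (cases "even k")
    case True
    then obtain j where "k = 2 * j" by blast
    then show ?thesis using n by (simp add: eps_def power_mult flip: power_mult_distrib)
  next
    case False
    then obtain j where j: "k = 2 * j + 1" by (elim oddE)
    have "n mod 4 \<noteq> 1" using n j by presburger
    moreover have "\<i> ^ k * (-1) ^ (k div 2) = \<i> * (- 1 * - 1) ^ j"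
      unfolding power_mult_distrib using j by (simp add: power_mult)
    ultimately show ?thesis by (simp add: eps_def)
  qed
  then show ?thesis by (simp add: g R mult.assoc[symmetric])
qed

lemma card_square_roots_mod_prime:
  assumes "prime p" "2 < p" "a < p"
  shows "int (card {x\<in>{..<p}. x ^ 2 mod p = a}) = 1 + Legendre (int a) (int p)"
proof (cases "a = 0")
  case True
  have "{x\<in>{..<p}. x ^ 2 mod p = a} = {0}"
    using assms True by (auto simp: mod_eq_0_iff_dvd prime_dvd_power_iff dest: dvd_imp_le)
  then show ?thesis using True by (simp add: Legendre_def)
next
  case False
  have na: "\<not> [int a = 0] (mod int p)"
    using False assms by (auto simp: cong_0_iff dest: dvd_imp_le)
  have root_iff: "x ^ 2 mod p = a \<longleftrightarrow> [int x ^ 2 = int a] (mod int p)" for x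
    using assms by (metis cong_def cong_int_iff mod_less of_nat_power)
  show ?thesis
  proof (cases "QuadRes (int p) (int a)")
    case True
    then obtain y0 where y0: "[y0 ^ 2 = int a] (mod int p)" by (auto simp: QuadRes_def)
    define y where "y = nat (y0 mod int p)"
    have yp: "y < p" using assms by (simp add: y_def nat_less_iff)
    have "[int y = y0] (mod int p)" using assms by (simp add: y_def cong_def)
    then have y: "[int y ^ 2 = int a] (mod int p)" using y0 cong_pow cong_trans by blast
    then have ypos: "y > 0" using na by (metis bot_nat_0.not_eq_extremum cong_sym of_nat_0 zero_power2)
    have "{x\<in>{..<p}. x ^ 2 mod p = a} = {y, p - y}"
    proof (rule equalityI; rule subsetI)
      fix x assume "x \<in> {x\<in>{..<p}. x ^ 2 mod p = a}"
      then have x: "x < p" "[int x ^ 2 = int y ^ 2] (mod int p)"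
        using y root_iff cong_trans cong_sym by blast+
      then have "int p dvd (int x - int y) * (int x + int y)"
        by (simp add: cong_iff_dvd_diff power2_eq_square algebra_simps)
      then have "int p dvd int x - int y \<or> int p dvd int (x + y)"
        using assms(1) prime_dvd_mult_iff[of "int p"] by simp
      then show "x \<in> {y, p - y}"
      proof
        assume "int p dvd int x - int y"
        then have "[int x = int y] (mod int p)" by (simp add: cong_iff_dvd_diff)
        then show ?thesis using x yp by (simp add: cong_def)
      next
        assume "int p dvd int (x + y)"
        then have "p dvd x + y" by presburger
        then obtain c where c: "x + y = p * c" by blast
        with x yp ypos have "p * c < p * 2" "p * c > 0" by linarith+
        then have "c = 1" by (metis mult_less_cancel1 less_2_cases nat_0_less_mult_iff neq0_conv One_nat_def)
        then show ?thesis using c by auto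
      qed
    next
      fix x assume "x \<in> {y, p - y}"
      moreover have "[int (p - y) ^ 2 = (- int y) ^ 2] (mod int p)"
        using yp by (intro cong_pow) (simp add: cong_iff_dvd_diff of_nat_diff)
      then have "[int (p - y) ^ 2 = int a] (mod int p)"
        using cong_trans[OF _ y] by (simp only: power2_minus)
      ultimately have "[int x ^ 2 = int a] (mod int p)" using y by blast
      moreover have "x < p" using \<open>x \<in> {y, p - y}\<close> yp ypos by auto
      ultimately show "x \<in> {x\<in>{..<p}. x ^ 2 mod p = a}"
        using root_iff[of x] by blast
    qed
    moreover have "y \<noteq> p - y"
      using assms prime_odd_nat[of p] yp by (metis add_diff_inverse_nat mult_2 dvd_triv_left less_imp_le_nat not_le)
    ultimately show ?thesis using True na by (simp add: Legendre_def)
  next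
    case nq: False
    then have "{x\<in>{..<p}. x ^ 2 mod p = a} = {}"
      using root_iff by (auto simp: QuadRes_def)
    then show ?thesis using nq na by (simp add: Legendre_def)
  qed
qed

text \<open>For \<open>k = 1\<close>, group the Gauss sum by the value of \<open>x ^ 2\<close>: the
  residue \<open>a\<close> has \<open>1 + (a/p)\<close> square roots, and the constant 1 sums to
  zero against the character. Units \<open>k\<close> follow by substitution, and for
  \<open>p | k\<close> the same count shows that the symbols sum to zero.\<close>

lemma sum_Legendre_cise:
  assumes "prime p" "2 < p"
  shows "(\<Sum>a<p. of_int (Jacobi (int a) p) * cise (real a * of_int k / real p))
    = eps p * sqrt (real p) * of_int (Jacobi k p)"
proof -
  have op: "odd p" using assms prime_odd_nat by blast
  have pp: "p > 0" using assms by simp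
  let ?S = "\<lambda>k. (\<Sum>a<p. of_int (Jacobi (int a) p) * cise (real a * of_int k / real p))"
  have "gauss_sum p = (\<Sum>x<p. cise (real (x ^ 2 mod p) / real p))"
    unfolding gauss_sum_def
  proof (intro sum.cong refl)
    fix x
    have "[int (x ^ 2) = int (x ^ 2 mod p)] (mod int p)"
      by (simp add: cong_def zmod_int)
    from cise_cong[OF this pp]
    show "cise (real (x ^ 2) / real p) = cise (real (x ^ 2 mod p) / real p)"
      by (simp only: of_int_of_nat_eq)
  qed
  also have "\<dots> = (\<Sum>a<p. \<Sum>x\<in>{x\<in>{..<p}. x ^ 2 mod p = a}. cise (real (x ^ 2 mod p) / real p))"
    by (rule sum.group[symmetric]) (use pp in auto)
  also have "\<dots> = (\<Sum>a<p. of_int (1 + Jacobi (int a) p) * cise (real a / real p))"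
  proof (intro sum.cong refl)
    fix a assume "a \<in> {..<p}"
    then have c: "int (card {x\<in>{..<p}. x ^ 2 mod p = a}) = 1 + Jacobi (int a) p"
      using card_square_roots_mod_prime[OF assms] assms by (simp add: Jacobi_prime)
    have "(\<Sum>x\<in>{x\<in>{..<p}. x ^ 2 mod p = a}. cise (real (x ^ 2 mod p) / real p))
        = of_nat (card {x\<in>{..<p}. x ^ 2 mod p = a}) * cise (real a / real p)"
      by simp
    then show "(\<Sum>x\<in>{x\<in>{..<p}. x ^ 2 mod p = a}. cise (real (x ^ 2 mod p) / real p))
        = of_int (1 + Jacobi (int a) p) * cise (real a / real p)"
      by (simp only: c[symmetric] of_int_of_nat_eq)
  qed
  also have "\<dots> = (\<Sum>a<p. cise (real a * of_int 1 / real p)) + ?S 1"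
    by (simp add: algebra_simps sum.distrib)
  also have "(\<Sum>a<p. cise (real a * of_int 1 / real p)) = 0"
    unfolding sum_cise_orthogonal[OF pp] using assms by (auto dest: zdvd_imp_le)
  finally have S1: "?S 1 = eps p * sqrt (real p)"
    using gauss_sum_eq[OF op] by simp
  show ?thesis
  proof (cases "coprime k (int p)")
    case True
    let ?F = "\<lambda>a. of_int (Jacobi a p) * cise (of_int a / real p) :: complex"
    have per: "?F a = ?F b" if "[a = b] (mod int p)" for a b
      using Jacobi_cong[OF that] cise_cong[OF that pp] by simp
    have sq: "Jacobi k p * Jacobi k p = 1"
      using Jacobi_square_left[OF op True] by (simp add: power2_eq_square Jacobi_mult_left op)
    have "?S 1 = (\<Sum>a<p. ?F (int a))" by simp
    also have "\<dots> = (\<Sum>a<p. ?F (k * int a + 0))"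
      by (rule sum_residues_linear[OF pp per True, symmetric])
    also have "\<dots> = of_int (Jacobi k p) * ?S k"
      by (simp add: sum_distrib_left Jacobi_mult_left op mult_ac)
    finally have "of_int (Jacobi k p) * ?S 1 = of_int (Jacobi k p * Jacobi k p) * ?S k"
      by (simp add: mult.assoc)
    then show ?thesis using S1 sq by (simp add: mult_ac)
  next
    case False
    then have z: "Jacobi k p = 0" using Jacobi_eq_0_iff[OF op] by simp
    have "int p dvd k" using False assms prime_imp_coprime[of "int p" k] by (auto simp: coprime_commute)
    then obtain j where "k = int p * j" by blast
    then have "cise (real a * of_int k / real p) = 1" for a
      using pp cise_of_int[of "int a * j"] by simp
    moreover have "(\<Sum>a<p. 1 + Jacobi (int a) p) = int p"
    proof -
      have "(\<Sum>a<p. 1 + Jacobi (int a) p) = (\<Sum>a<p. int (card {x\<in>{..<p}. x ^ 2 mod p = a}))"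
        using card_square_roots_mod_prime[OF assms] assms by (simp add: Jacobi_prime)
      also have "\<dots> = int (\<Sum>a<p. \<Sum>x\<in>{x\<in>{..<p}. x ^ 2 mod p = a}. 1)" by simp
      also have "(\<Sum>a<p. \<Sum>x\<in>{x\<in>{..<p}. x ^ 2 mod p = a}. 1) = (\<Sum>x<p. 1)"
        by (rule sum.group) (use pp in auto)
      finally show ?thesis by simp
    qed
    then have "(\<Sum>a<p. Jacobi (int a) p) = 0" by (simp add: sum.distrib)
    then have "(\<Sum>a<p. of_int (Jacobi (int a) p) :: complex) = 0"
      by (metis of_int_0 of_int_sum)
    ultimately show ?thesis using z by simp
  qed
qed

lemma eps_mult: "odd p \<Longrightarrow> odd q \<Longrightarrow> eps (p * q) = of_int (rsgn p q) * eps p * eps q"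
  using odd_mod_4[of p] odd_mod_4[of q] mod_mult_eq[of p 4 q, symmetric]
  by (auto simp: eps_def rsgn_def)

text \<open>By CRT the transform factors up to the cross symbols \<open>(n/p) (p/n)\<close>, whose
  product is exactly the sign by which \<open>eps (p * n)\<close> differs from
  \<open>eps p * eps n\<close>.\<close>

lemma sum_Jacobi_cise:
  assumes "odd q" "squarefree q"
  shows "(\<Sum>a<q. of_int (Jacobi (int a) q) * cise (real a * of_int k / real q))
    = eps q * sqrt (real q) * of_int (Jacobi k q)"
  using assms
proof (induction q arbitrary: k rule: odd_prime_induct)
  case one
  then show ?case by (simp add: eps_def)
next
  case (step p n)
  have op: "odd p" using step.hyps prime_odd_nat by blast
  have cop: "coprime p n" "squarefree n"
  proof -
    have "\<not> p dvd n"
      using squarefreeD[OF step.prems, of p] step.hyps(1) by (auto simp: power2_eq_square)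
    then show "coprime p n" using step.hyps(1) prime_imp_coprime by blast
    show "squarefree n" using squarefree_multD[OF step.prems] by blast
  qed
  have pos: "p > 0" "n > 0" using step.hyps by (auto simp: odd_pos)
  let ?F = "\<lambda>a. of_int (Jacobi a (p * n)) * cise (of_int (a * k) / real (p * n)) :: complex"
  have "(\<Sum>a<p * n. of_int (Jacobi (int a) (p * n)) * cise (real a * of_int k / real (p * n))) = (\<Sum>a<p * n. ?F (int a))"
    by simp
  also have "\<dots> = (\<Sum>a<p. \<Sum>b<n. ?F (int (a * n + b * p)))"
    by (rule sum_CRT[OF cop(1) pos])
      (use pos in \<open>metis Jacobi_cong cise_cong cong_scalar_right nat_0_less_mult_iff\<close>)
  also have "\<dots> = (\<Sum>a<p. \<Sum>b<n. of_int (Jacobi (int n) p * Jacobi (int p) n) *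
      (of_int (Jacobi (int a) p) * cise (real a * of_int k / real p)) *
      (of_int (Jacobi (int b) n) * cise (real b * of_int k / real n)))"
  proof (intro sum.cong refl)
    fix a b
    have "Jacobi (int (a * n + b * p)) p = Jacobi (int a * int n) p"
      by (rule Jacobi_cong) (simp add: cong_iff_dvd_diff)
    moreover have "Jacobi (int (a * n + b * p)) n = Jacobi (int b * int p) n"
      by (rule Jacobi_cong) (simp add: cong_iff_dvd_diff)
    moreover have "of_int (int (a * n + b * p) * k) / real (p * n) = real a * of_int k / real p + real b * of_int k / real n"
      using pos by (simp add: field_simps)
    ultimately show "?F (int (a * n + b * p)) = of_int (Jacobi (int n) p * Jacobi (int p) n) *
      (of_int (Jacobi (int a) p) * cise (real a * of_int k / real p)) *
      (of_int (Jacobi (int b) n) * cise (real b * of_int k / real n))"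
      using pos op step.hyps by (simp add: Jacobi_mult_right Jacobi_mult_left cise_add)
  qed
  also have "\<dots> = of_int (Jacobi (int n) p * Jacobi (int p) n) *
      (\<Sum>a<p. of_int (Jacobi (int a) p) * cise (real a * of_int k / real p)) *
      (\<Sum>b<n. of_int (Jacobi (int b) n) * cise (real b * of_int k / real n))"
    by (simp only: mult.assoc sum_product) (simp only: sum_distrib_left)
  also have "\<dots> = of_int (Jacobi (int n) p * Jacobi (int p) n) *
      (eps p * sqrt (real p) * of_int (Jacobi k p)) * (eps n * sqrt (real n) * of_int (Jacobi k n))"
    using sum_Legendre_cise[OF step.hyps(1,2)] step.IH cop by simp
  also have "Jacobi (int n) p * Jacobi (int p) n = rsgn p n"
  proof -
    have "coprime (int n) (int p)" using cop by (simp add: coprime_commute)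
    then have "Jacobi (int n) p * Jacobi (int n) p = 1"
      using Jacobi_square_left[OF op] by (simp add: power2_eq_square Jacobi_mult_left op)
    then show ?thesis using Jacobi_reciprocity[OF op \<open>odd n\<close>] by (simp add: mult.left_commute)
  qed
  also have "of_int (rsgn p n) * (eps p * sqrt (real p) * of_int (Jacobi k p)) * (eps n * sqrt (real n) * of_int (Jacobi k n))
     = eps (p * n) * sqrt (real (p * n)) * of_int (Jacobi k (p * n))"
    using pos op step.hyps by (simp add: eps_mult Jacobi_mult_right real_sqrt_mult rsgn_commute[of n p] mult_ac)
  finally show ?case .
qed

lemma norm_eps [simp]: "norm (eps q) = 1"
  by (simp add: eps_def)

section \<open>The self-dual modification of the Jacobi symbol\<close>

definition mu :: "nat \<Rightarrow> int" where
  "mu n = (if squarefree n then (- 1) ^ card (prime_factors n) else 0)"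

lemma abs_mu_le_1: "\<bar>mu n\<bar> \<le> 1"
  by (simp add: mu_def)

lemma mu_1 [simp]: "mu 1 = 1" "mu (Suc 0) = 1"
  by (simp_all add: mu_def)

lemma mu_prime_mult:
  assumes "prime p" "\<not> p dvd d"
  shows "mu (p * d) = - mu d"
proof (cases "squarefree d")
  case True
  have cop: "coprime p d" using assms prime_imp_coprime by blast
  have "d > 0" using assms(2) by (auto intro: Nat.gr0I)
  then have "prime_factors (p * d) = insert p (prime_factors d)"
    using assms(1) by (simp add: prime_factors_product prime_prime_factors prime_gt_0_nat)
  moreover have "squarefree (p * d)"
    using squarefree_mult_coprime[OF cop squarefree_prime[OF assms(1)] True] .
  moreover have "p \<notin> prime_factors d" using assms(2) by auto
  ultimately show ?thesis using True by (simp add: mu_def)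
next
  case False
  then show ?thesis using squarefree_multD[of p d] by (auto simp: mu_def)
qed

text \<open>A fixed prime \<open>p\<close> of \<open>n\<close> pairs each squarefree divisor
  \<open>d\<close> prime to \<open>p\<close> with \<open>p * d\<close>, which has the opposite
  sign.\<close>

lemma sum_mu_dvd:
  assumes "n > 0"
  shows "(\<Sum>d | d dvd n. mu d) = (if n = 1 then 1 else 0)"
proof (cases "n = 1")
  case False
  then obtain p where p: "prime p" "p dvd n" using prime_factor_nat by blast
  define D where "D = {d. d dvd n \<and> squarefree d \<and> \<not> p dvd d}"
  have fin: "finite {d. d dvd n}" using assms by simp
  have finD: "finite D" by (rule finite_subset[OF _ fin]) (auto simp: D_def)
  have "{d. d dvd n \<and> squarefree d \<and> p dvd d} = times p ` D"
  proof (intro equalityI subsetI)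
    fix d assume "d \<in> {d. d dvd n \<and> squarefree d \<and> p dvd d}"
    then obtain e where e: "d = p * e" "p * e dvd n" "squarefree (p * e)" by auto
    have "\<not> p dvd e"
      using squarefreeD[OF e(3), of p] p(1) by (auto simp: power2_eq_square)
    then have "e \<in> D" using e squarefree_multD[OF e(3)] by (auto simp: D_def intro: dvd_mult_right)
    then show "d \<in> times p ` D" using e by blast
  next
    fix d assume "d \<in> times p ` D"
    then obtain e where e: "d = p * e" "e dvd n" "squarefree e" "\<not> p dvd e" by (auto simp: D_def)
    have cop: "coprime p e" using e p prime_imp_coprime by blast
    then have "p * e dvd n" using e p divides_mult by blast
    moreover have "squarefree (p * e)"
      using squarefree_mult_coprime[OF cop squarefree_prime[OF p(1)]] e by simp
    ultimately show "d \<in> {d. d dvd n \<and> squarefree d \<and> p dvd d}" using e by simp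
  qed
  moreover have "inj_on (times p) D" using p by (auto simp: inj_on_def)
  ultimately have "(\<Sum>d\<in>{d. d dvd n \<and> squarefree d \<and> p dvd d}. mu d) = (\<Sum>d\<in>D. mu (p * d))"
    by (simp add: sum.reindex)
  also have "\<dots> = - (\<Sum>d\<in>D. mu d)"
    unfolding sum_negf[symmetric] by (intro sum.cong refl mu_prime_mult p) (auto simp: D_def)
  finally have *: "(\<Sum>d\<in>{d. d dvd n \<and> squarefree d \<and> p dvd d}. mu d) = - (\<Sum>d\<in>D. mu d)" .
  have "(\<Sum>d | d dvd n. mu d) = (\<Sum>d\<in>D \<union> {d. d dvd n \<and> squarefree d \<and> p dvd d}. mu d)"
    using fin by (intro sum.mono_neutral_right) (auto simp: D_def mu_def)
  also have "\<dots> = (\<Sum>d\<in>D. mu d) + (\<Sum>d\<in>{d. d dvd n \<and> squarefree d \<and> p dvd d}. mu d)"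
    by (rule sum.union_disjoint) (use fin finD in \<open>auto simp: D_def intro: finite_subset\<close>)
  finally show ?thesis using False * by simp
qed simp

lemma sum_mu_coprime:
  assumes "n > 0"
  shows "(\<Sum>c | c dvd n \<and> int c dvd m. mu c) = (if coprime m (int n) then 1 else 0)"
proof -
  have "{c. c dvd n \<and> int c dvd m} = {c. c dvd gcd n (nat \<bar>m\<bar>)}"
    by (simp only: gcd_greatest_iff dvd_nat_abs_iff)
  moreover have "gcd n (nat \<bar>m\<bar>) > 0" using assms by simp
  moreover have "gcd n (nat \<bar>m\<bar>) = 1 \<longleftrightarrow> coprime m (int n)"
    by (metis coprime_commute coprime_iff_gcd_eq_1 gcd_int_def nat_int of_nat_1 of_nat_eq_iff abs_of_nat)
  ultimately show ?thesis by (simp add: sum_mu_dvd)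
qed

text \<open>The factors \<open>d\<close> make this imprimitive modification of the Jacobi symbol self-dual under the
  discrete Fourier transform modulo \<open>q\<close>, for every odd \<open>q\<close>.\<close>

definition PJ :: "int \<Rightarrow> nat \<Rightarrow> int" where
  "PJ m q = (\<Sum>d | d\<^sup>2 dvd q \<and> int (d\<^sup>2) dvd m. int d * Jacobi (m div int (d\<^sup>2)) (q div d\<^sup>2))"

lemma finite_square_divisors [simp]: "q > 0 \<Longrightarrow> finite {d. d\<^sup>2 dvd (q::nat) \<and> Q d}"
proof -
  assume "q > 0"
  then have "{d. d\<^sup>2 dvd q \<and> Q d} \<subseteq> {d. d dvd q}" by (auto simp: power2_eq_square dest: dvd_mult_left)
  then show ?thesis by (rule finite_subset) (use \<open>q > 0\<close> in simp)
qed

lemma finite_square_divisors' [simp]: "q > 0 \<Longrightarrow> finite {d. d\<^sup>2 dvd (q::nat)}"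
  using finite_square_divisors[of q "\<lambda>_. True"] by simp

lemma square_divisor_odd:
  assumes "odd q" "d\<^sup>2 dvd (q::nat)"
  shows "odd d" "odd (q div d\<^sup>2)" "d > 0" "q div d\<^sup>2 > 0" "q = d\<^sup>2 * (q div d\<^sup>2)"
proof -
  obtain k where k: "q = d\<^sup>2 * k" using assms by blast
  then have "odd (d\<^sup>2)" "odd k" using assms(1) by auto
  then show "odd d" "d > 0" by (auto intro: Nat.gr0I)
  then show "odd (q div d\<^sup>2)" "q div d\<^sup>2 > 0" "q = d\<^sup>2 * (q div d\<^sup>2)" using k \<open>odd k\<close> by (auto simp: odd_pos)
qed

lemma sum_multiples:
  fixes F :: "nat \<Rightarrow> 'a :: comm_monoid_add"
  assumes "g > 0"
  shows "(\<Sum>a<g * N. if g dvd a then F a else 0) = (\<Sum>t<N. F (g * t))"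
proof -
  have "(\<Sum>a<g * N. if g dvd a then F a else 0) = sum F (times g ` {..<N})"
    using assms by (intro sum.mono_neutral_cong_right) auto
  also have "\<dots> = (\<Sum>t<N. F (g * t))"
    using assms by (subst sum.reindex) (auto simp: inj_on_def)
  finally show ?thesis .
qed

text \<open>The sum over the \<open>M\<close> blocks of length \<open>q\<close> is a complete
  character sum, which vanishes unless \<open>M\<close> divides \<open>k\<close>.\<close>

lemma sum_periodic_cise:
  assumes "q > 0" "M > 0" and per: "\<And>t j. G (t + q * j) = (G t :: complex)"
  shows "(\<Sum>t<q * M. G t * cise (real t * of_int k / real (q * M)))
    = (if int M dvd k then of_nat M * (\<Sum>t<q. G t * cise (real t * of_int (k div int M) / real q)) else 0)"
proof -
  let ?f = "\<lambda>t. G t * cise (real t * of_int k / real (q * M))"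
  have "(\<Sum>t<q * M. ?f t) = (\<Sum>j<M. \<Sum>t=j * q..<j * q + q. ?f t)"
    using sum.nat_group[of ?f q M] by (simp add: mult.commute)
  also have "\<dots> = (\<Sum>j<M. \<Sum>t<q. ?f (t + q * j))"
    using sum.shift_bounds_nat_ivl[of ?f 0 "_ * q" q]
    by (simp only: lessThan_atLeast0 add_0_left mult.commute[of q] add.commute[of q])
  also have "\<dots> = (\<Sum>j<M. \<Sum>t<q. ?f t * cise (real j * of_int k / real M))"
  proof (intro sum.cong refl)
    fix j t
    have "real (t + q * j) * of_int k / real (q * M) = real t * of_int k / real (q * M) + real j * of_int k / real M"
      using assms by (simp add: field_simps)
    then show "?f (t + q * j) = ?f t * cise (real j * of_int k / real M)"
      using per by (simp only: cise_add mult.assoc)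
  qed
  also have "\<dots> = (\<Sum>t<q. ?f t) * (\<Sum>j<M. cise (real j * of_int k / real M))"
    by (subst sum.swap) (simp only: sum_product)
  also have "\<dots> = (if int M dvd k then of_nat M * (\<Sum>t<q. ?f t) else 0)"
    unfolding sum_cise_orthogonal[OF assms(2)] by simp
  also have "\<dots> = (if int M dvd k then of_nat M * (\<Sum>t<q. G t * cise (real t * of_int (k div int M) / real q)) else 0)"
  proof (cases "int M dvd k")
    case True
    then obtain j where "k = int M * j" by blast
    then show ?thesis using assms by simp
  qed simp
  finally show ?thesis .
qed

lemma squarefree_decomp_odd:
  assumes "odd (q::nat)"
  obtains q0 s where "q = q0 * s\<^sup>2" "squarefree q0" "odd q0" "odd s" "q0 > 0" "s > 0"
    "\<And>d. d\<^sup>2 dvd q \<longleftrightarrow> d dvd s"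
proof -
  have 1: "q = squarefree_part q * (square_part q)\<^sup>2" by (rule squarefree_decompose)
  then have "odd (squarefree_part q)" "odd (square_part q)"
    using assms by (metis even_mult_iff, metis even_mult_iff even_power pos2)
  then show ?thesis
    using that[OF 1] by (auto simp: dvd_square_part_iff odd_pos)
qed

lemma Jacobi_square_factor:
  assumes "odd q0" "odd t" "t > 0"
  shows "Jacobi m (q0 * t\<^sup>2) = Jacobi m q0 * (\<Sum>c | c dvd t \<and> int c dvd m. mu c)"
  using assms by (simp add: Jacobi_mult_right odd_pos Jacobi_square_right sum_mu_coprime)

text \<open>A pair stands for a factorisation \<open>s = d * c * e\<close>; leaving \<open>e\<close>
  implicit makes the exchange of \<open>d\<close> and \<open>e\<close> an involution on
  pairs.\<close>

definition divisor_pairs :: "nat \<Rightarrow> (nat \<times> nat) set" where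
  "divisor_pairs s = {(d, c). d * c dvd s}"

lemma divisor_pairs_Sigma: "s > 0 \<Longrightarrow> divisor_pairs s = (SIGMA d:{d. d dvd s}. {c. c dvd s div d})"
  by (auto simp: divisor_pairs_def dvd_div_iff_mult mult.commute dest: dvd_mult_left dvd_mult_right)

text \<open>With \<open>e = s / d\<close>, the symbol modulo \<open>q / d^2 = q0 * e^2\<close> is
  the symbol modulo \<open>q0\<close> times the indicator of being prime to \<open>e\<close>.
  Opening the indicator by Moebius over \<open>c\<close> leaves only the symbol modulo
  \<open>q0\<close>, whose transform is known when \<open>q0\<close> is squarefree.\<close>

lemma PJ_pairs:
  assumes q: "q = q0 * s\<^sup>2" "odd q0" "odd s" "s > 0" and sq: "\<And>d. d\<^sup>2 dvd q \<longleftrightarrow> d dvd s"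
  shows "PJ m q = (\<Sum>(d, c)\<in>divisor_pairs s. if int (c * d\<^sup>2) dvd m
     then int d * mu c * Jacobi (m div int (d\<^sup>2)) q0 else 0)"
proof -
  have "PJ m q = (\<Sum>d | d dvd s. if int (d\<^sup>2) dvd m then int d * Jacobi (m div int (d\<^sup>2)) (q div d\<^sup>2) else 0)"
    unfolding PJ_def sq using q(4) by (intro sum.mono_neutral_cong_left) auto
  also have "\<dots> = (\<Sum>d | d dvd s. \<Sum>c | c dvd s div d. if int (c * d\<^sup>2) dvd m
     then int d * mu c * Jacobi (m div int (d\<^sup>2)) q0 else 0)"
  proof (intro sum.cong refl)
    fix d assume "d \<in> {d. d dvd s}"
    then obtain e where e: "s = d * e" by auto
    have de: "d > 0" "e > 0" "odd d" "odd e" using q e by auto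
    have qd: "q div d\<^sup>2 = q0 * e\<^sup>2" "s div d = e" using e q de by (simp_all add: power_mult_distrib)
    show "(if int (d\<^sup>2) dvd m then int d * Jacobi (m div int (d\<^sup>2)) (q div d\<^sup>2) else 0)
      = (\<Sum>c | c dvd s div d. if int (c * d\<^sup>2) dvd m
     then int d * mu c * Jacobi (m div int (d\<^sup>2)) q0 else 0)"
    proof (cases "int (d\<^sup>2) dvd m")
      case True
      then obtain x where x: "m = int (d\<^sup>2) * x" by blast
      have iff: "int (c * d\<^sup>2) dvd m \<longleftrightarrow> int c dvd x" for c
        using de by (simp add: x mult.commute[of "int c"])
      have "(\<Sum>c | c dvd e. if int (c * d\<^sup>2) dvd m then int d * mu c * Jacobi (m div int (d\<^sup>2)) q0 else 0)
         = (\<Sum>c | c dvd e \<and> int c dvd x. int d * mu c * Jacobi x q0)"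
        using de iff x by (intro sum.mono_neutral_cong_right) auto
      also have "\<dots> = int d * (Jacobi x q0 * (\<Sum>c | c dvd e \<and> int c dvd x. mu c))"
        by (simp add: sum_distrib_left mult_ac)
      finally show ?thesis
        using True x de q(2-4) by (simp only: qd) (simp add: Jacobi_square_factor)
    next
      case False
      then have "\<not> int (c * d\<^sup>2) dvd m" for c by (metis dvd_mult_right of_nat_mult)
      then show ?thesis using False by simp
    qed
  qed
  also have "\<dots> = (\<Sum>(d, c)\<in>divisor_pairs s. if int (c * d\<^sup>2) dvd m
     then int d * mu c * Jacobi (m div int (d\<^sup>2)) q0 else 0)"
    using q(4) unfolding divisor_pairs_Sigma[OF q(4)]
    by (intro sum.Sigma) (auto simp: dvd_div_eq_0_iff dvd_pos_nat)
  finally show ?thesis .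
qed

text \<open>Writing \<open>s = d c e\<close>, the Fourier transform exchanges the roles of \<open>d\<close> and \<open>e\<close>.\<close>

theorem PJ_self_dual:
  assumes "odd q"
  shows "(\<Sum>a<q. of_int (PJ (int a) q) * cise (real a * of_int k / real q))
    = eps q * sqrt (real q) * of_int (PJ k q)"
proof -
  obtain q0 s where q: "q = q0 * s\<^sup>2" "squarefree q0" "odd q0" "odd s" "q0 > 0" "s > 0"
    and sq: "\<And>d. d\<^sup>2 dvd q \<longleftrightarrow> d dvd s" by (rule squarefree_decomp_odd[OF assms]) blast
  let ?T = "\<lambda>(d, c) m. if int (c * d\<^sup>2) dvd m then int d * mu c * Jacobi (m div int (d\<^sup>2)) q0 else 0"
  let ?D = "divisor_pairs s"
  let ?e = "\<lambda>a. cise (real a * of_int k / real q)"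
  let ?i = "\<lambda>(d, c). (s div (d * c), c)"
  have P: "PJ m q = (\<Sum>x\<in>?D. ?T x m)" for m
    using PJ_pairs[OF q(1) q(3,4,6) sq] by (simp add: case_prod_unfold)
  \<comment> \<open>The term of \<open>(d, c)\<close> lives on the multiples of
    \<open>c * d^2\<close>; after dividing them out it has period \<open>q0\<close> within
    \<open>q0 * c * e^2\<close>, so its transform lives on the multiples of \<open>c * e^2\<close>.
    The weights \<open>d\<close> and \<open>c * e^2\<close> multiply to \<open>s * e\<close>, and
    \<open>e\<close> is the weight of the exchanged term.\<close>
  have FT: "(\<Sum>a<q. of_int (?T x (int a)) * ?e a) = eps q0 * sqrt (real q0) * of_nat s * of_int (?T (?i x) k)"
    if "x \<in> ?D" for x
  proof -
    obtain d c where x: "x = (d, c)" by force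
    with that obtain e where e: "s = d * c * e" by (auto simp: divisor_pairs_def)
    have pos: "d > 0" "c > 0" "e > 0" using e q by auto
    have qq: "q = (c * d\<^sup>2) * (q0 * (c * e\<^sup>2))"
      unfolding q(1) e by (simp add: power2_eq_square algebra_simps)
    have "(\<Sum>a<q. of_int (?T x (int a)) * ?e a)
       = (\<Sum>a<(c * d\<^sup>2) * (q0 * (c * e\<^sup>2)). if c * d\<^sup>2 dvd a
           then of_int (int d * mu c * Jacobi (int a div int (d\<^sup>2)) q0) * ?e a else 0)"
      unfolding qq[symmetric] by (intro sum.cong refl) (simp add: x flip: of_nat_mult of_nat_power)
    also have "\<dots> = (\<Sum>t<q0 * (c * e\<^sup>2). of_int (int d * mu c * Jacobi (int (c * d\<^sup>2 * t) div int (d\<^sup>2)) q0) * ?e (c * d\<^sup>2 * t))"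
      by (rule sum_multiples) (use pos in simp)
    also have "\<dots> = (\<Sum>t<q0 * (c * e\<^sup>2). of_int (int d * mu c * Jacobi (int c) q0) *
        (of_int (Jacobi (int t) q0) * cise (real t * of_int k / real (q0 * (c * e\<^sup>2)))))"
    proof (intro sum.cong refl)
      fix t
      have "int (c * d\<^sup>2 * t) div int (d\<^sup>2) = int c * int t"
        using pos by (simp add: mult.commute[of "int c"] mult.assoc)
      moreover have "real (c * d\<^sup>2 * t) * of_int k / real q = real t * of_int k / real (q0 * (c * e\<^sup>2))"
        unfolding qq using pos q by (simp add: field_simps)
      ultimately show "of_int (int d * mu c * Jacobi (int (c * d\<^sup>2 * t) div int (d\<^sup>2)) q0) * ?e (c * d\<^sup>2 * t)
        = of_int (int d * mu c * Jacobi (int c) q0) *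
        (of_int (Jacobi (int t) q0) * cise (real t * of_int k / real (q0 * (c * e\<^sup>2))))"
        using q by (simp add: Jacobi_mult_left)
    qed
    also have "\<dots> = of_int (int d * mu c * Jacobi (int c) q0) *
       (\<Sum>t<q0 * (c * e\<^sup>2). of_int (Jacobi (int t) q0) * cise (real t * of_int k / real (q0 * (c * e\<^sup>2))))"
      by (simp only: sum_distrib_left)
    also have "(\<Sum>t<q0 * (c * e\<^sup>2). of_int (Jacobi (int t) q0) * cise (real t * of_int k / real (q0 * (c * e\<^sup>2))))
      = (if int (c * e\<^sup>2) dvd k then of_nat (c * e\<^sup>2) * (\<Sum>t<q0. of_int (Jacobi (int t) q0) *
          cise (real t * of_int (k div int (c * e\<^sup>2)) / real q0)) else 0)"
    proof (rule sum_periodic_cise)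
      show "of_int (Jacobi (int (t + q0 * j)) q0) = (of_int (Jacobi (int t) q0) :: complex)" for t j
        by (subst Jacobi_cong[of "int (t + q0 * j)" "int t"]) (auto simp: cong_iff_dvd_diff)
    qed (use q pos in auto)
    also have "\<dots> = (if int (c * e\<^sup>2) dvd k then of_nat (c * e\<^sup>2) * (eps q0 * sqrt (real q0) *
        of_int (Jacobi (k div int (c * e\<^sup>2)) q0)) else 0)"
      by (simp only: sum_Jacobi_cise[OF q(3,2)])
    also have "of_int (int d * mu c * Jacobi (int c) q0) * \<dots> = eps q0 * sqrt (real q0) * of_nat s * of_int (?T (e, c) k)"
    proof (cases "int (c * e\<^sup>2) dvd k")
      case True
      then obtain y where y: "k = int (c * e\<^sup>2) * y" by blast
      have "k div int (e\<^sup>2) = int c * y" "k div int (c * e\<^sup>2) = y"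
        using pos by (simp_all add: y mult.commute[of "int c"] mult.assoc)
      then show ?thesis
        using True q by (simp add: e Jacobi_mult_left power2_eq_square mult_ac)
    qed simp
    also have "(e, c) = ?i x" using pos by (simp add: x e)
    finally show ?thesis .
  qed
  have "(\<Sum>a<q. of_int (PJ (int a) q) * ?e a) = (\<Sum>a<q. \<Sum>x\<in>?D. of_int (?T x (int a)) * ?e a)"
    by (simp only: P of_int_sum sum_distrib_right)
  also have "\<dots> = (\<Sum>x\<in>?D. \<Sum>a<q. of_int (?T x (int a)) * ?e a)" by (rule sum.swap)
  also have "\<dots> = (\<Sum>x\<in>?D. eps q0 * sqrt (real q0) * of_nat s * of_int (?T (?i x) k))"
    by (intro sum.cong refl FT)
  also have "\<dots> = eps q0 * sqrt (real q0) * of_nat s * of_int (\<Sum>x\<in>?D. ?T (?i x) k)"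
    by (simp only: sum_distrib_left of_int_sum)
  also have "(\<Sum>x\<in>?D. ?T (?i x) k) = (\<Sum>x\<in>?D. ?T x k)"
  proof (rule sum.reindex_bij_witness[where i = ?i and j = ?i])
    fix x assume "x \<in> ?D"
    obtain d c where xdc: "x = (d, c)" by force
    with \<open>x \<in> ?D\<close> obtain e where "s = d * c * e" by (auto simp: divisor_pairs_def)
    with xdc have x: "x = (d, c)" "s = d * c * e" by auto
    then have "d > 0" "c > 0" "e > 0" using q by auto
    then show "?i (?i x) = x" "?i x \<in> ?D" "?i (?i x) = x" "?i x \<in> ?D"
      using x by (simp_all add: divisor_pairs_def mult_ac)
  qed auto
  also have "\<dots> = PJ k q" by (simp only: P)
  \<comment> \<open>\<open>s\<close> is odd, so \<open>s ^ 2\<close> is 1 modulo 4 and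
    \<open>q\<close>, \<open>q0\<close> have the same phase.\<close>
  also have "eps q0 * sqrt (real q0) * of_nat s = eps q * sqrt (real q)"
  proof -
    have "s mod 4 = 1 \<or> s mod 4 = 3" using q odd_mod_4 by blast
    then have "s\<^sup>2 mod 4 = 1" by (auto simp: power2_eq_square mod_mult_eq[of s 4 s, symmetric])
    then have "q mod 4 = q0 mod 4" by (simp add: q(1) mod_mult_right_eq[of q0 "s\<^sup>2" 4, symmetric])
    then have "eps q = eps q0" by (simp add: eps_def)
    then show ?thesis by (simp add: q(1) real_sqrt_mult)
  qed
  finally show ?thesis .
qed

section \<open>Periodicity, multiplicativity, size and inversion of \<open>PJ\<close>\<close>

lemma PJ_cong:
  assumes "[m = n] (mod int q)" "q > 0"
  shows "PJ m q = PJ n q"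
proof -
  obtain x where x: "m = n + int q * x" using assms(1) cong_iff_lin[of n m "int q"] by (auto simp: cong_sym_eq)
  show ?thesis unfolding PJ_def
  proof (rule sum.cong)
    fix d assume "d \<in> {d. d\<^sup>2 dvd q \<and> int (d\<^sup>2) dvd n}"
    then have dv: "d\<^sup>2 dvd q" "int (d\<^sup>2) dvd n" by blast+
    from dv(1) obtain y where y: "q = d\<^sup>2 * y" by (rule dvdE)
    from dv(2) obtain z where z: "n = int (d\<^sup>2) * z" by (rule dvdE)
    have d: "d > 0" using assms(2) y by (auto intro: Nat.gr0I)
    have m: "m = int (d\<^sup>2) * (z + int y * x)" using x y z by (simp add: algebra_simps)
    have "m div int (d\<^sup>2) = z + int y * x" "n div int (d\<^sup>2) = z" "q div d\<^sup>2 = y"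
      using d m y z by simp_all
    then show "int d * Jacobi (m div int (d\<^sup>2)) (q div d\<^sup>2) = int d * Jacobi (n div int (d\<^sup>2)) (q div d\<^sup>2)"
      using Jacobi_cong[of "z + int y * x" z y] by (simp add: cong_iff_dvd_diff)
  qed (auto simp: x dvd_add_left_iff intro: dvd_mult2)
qed

text \<open>A unit \<open>u\<close> does not affect which \<open>d\<close> occur, and it has the
  same symbol modulo \<open>q\<close> and modulo \<open>q / d^2\<close>, since its symbol modulo
  \<open>d^2\<close> is 1.\<close>

lemma PJ_mult_coprime:
  assumes "odd q" "coprime u (int q)"
  shows "PJ (u * m) q = Jacobi u q * PJ m q"
proof -
  have cop: "coprime (int (d\<^sup>2)) u" if "d\<^sup>2 dvd q" for d
    using assms(2) that by (meson coprime_commute coprime_divisors dvd_refl int_dvd_int_iff)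
  have "PJ (u * m) q = (\<Sum>d | d\<^sup>2 dvd q \<and> int (d\<^sup>2) dvd m. Jacobi u q * (int d * Jacobi (m div int (d\<^sup>2)) (q div d\<^sup>2)))"
    unfolding PJ_def
  proof (rule sum.cong)
    show "{d. d\<^sup>2 dvd q \<and> int (d\<^sup>2) dvd u * m} = {d. d\<^sup>2 dvd q \<and> int (d\<^sup>2) dvd m}"
      using cop by (auto simp: coprime_dvd_mult_right_iff)
  next
    fix d assume "d \<in> {d. d\<^sup>2 dvd q \<and> int (d\<^sup>2) dvd m}"
    then have d: "d\<^sup>2 dvd q" "int (d\<^sup>2) dvd m" by auto
    note sd = square_divisor_odd[OF assms(1) d(1)]
    have "coprime u (int d)"
      using cop[OF d(1)] by (simp add: coprime_commute)
    then have "Jacobi u q = Jacobi u (q div d\<^sup>2)"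
      using sd Jacobi_mult_right[of "d\<^sup>2" "q div d\<^sup>2" u] by (simp add: Jacobi_square_right)
    moreover have "u * m div int (d\<^sup>2) = u * (m div int (d\<^sup>2))"
      using d(2) by (rule div_mult_swap[symmetric])
    ultimately show "int d * Jacobi (u * m div int (d\<^sup>2)) (q div d\<^sup>2)
       = Jacobi u q * (int d * Jacobi (m div int (d\<^sup>2)) (q div d\<^sup>2))"
      using sd by (simp add: Jacobi_mult_left)
  qed
  then show ?thesis by (simp add: PJ_def sum_distrib_left)
qed

lemma PJ_minus: "odd q \<Longrightarrow> PJ (- m) q = (if q mod 4 = 1 then 1 else -1) * PJ m q"
  using PJ_mult_coprime[of q "-1" m] by (simp add: Jacobi_minus_1)

lemma PJ_4_mult:
  assumes "odd q"
  shows "PJ (4 * m) q = PJ m q"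
proof -
  have "coprime (2 :: int) (int q)" using assms by simp
  then have "coprime ((2 :: int)\<^sup>2) (int q)" by (rule coprime_power_left_iff[THEN iffD2, OF disjI1])
  then show ?thesis
    using PJ_mult_coprime[OF assms, of "2\<^sup>2" m] Jacobi_square_left[of q 2] assms by simp
qed

lemma PJ_2_mult: "odd q \<Longrightarrow> PJ (2 * m) q = Jacobi 2 q * PJ m q"
  by (rule PJ_mult_coprime) simp_all

lemma gcd_square_quotient:
  assumes "odd q" "d\<^sup>2 dvd q" "int (d\<^sup>2) dvd m"
  shows "gcd m (int q) = int (d\<^sup>2) \<longleftrightarrow> coprime (m div int (d\<^sup>2)) (int (q div d\<^sup>2))"
proof -
  obtain x where x: "m = int (d\<^sup>2) * x" using assms(3) by blast
  note sd = square_divisor_odd[OF assms(1,2)]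
  have "int q = int (d\<^sup>2) * int (q div d\<^sup>2)" using sd(5) by (metis of_nat_mult)
  then have "gcd m (int q) = int (d\<^sup>2) * gcd x (int (q div d\<^sup>2))"
    unfolding x by (metis abs_of_nat gcd_mult_distrib_int)
  then show ?thesis using sd(3) by (simp add: x coprime_iff_gcd_eq_1)
qed

lemma PJ_eq_0:
  assumes "odd q" "\<And>d. gcd m (int q) \<noteq> int (d\<^sup>2)"
  shows "PJ m q = 0"
  unfolding PJ_def
proof (rule sum.neutral, rule ballI)
  fix d assume "d \<in> {d. d\<^sup>2 dvd q \<and> int (d\<^sup>2) dvd m}"
  then have d: "d\<^sup>2 dvd q" "int (d\<^sup>2) dvd m" by blast+
  then have "\<not> coprime (m div int (d\<^sup>2)) (int (q div d\<^sup>2))"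
    using assms(2)[of d] gcd_square_quotient[OF assms(1) d] by blast
  then show "int d * Jacobi (m div int (d\<^sup>2)) (q div d\<^sup>2) = 0"
    using Jacobi_eq_0_iff square_divisor_odd[OF assms(1) d(1)] by simp
qed

text \<open>A term of \<open>PJ\<close> survives only if \<open>m / d^2\<close> and
  \<open>q / d^2\<close> are coprime, which says \<open>gcd m q = d^2\<close>. So at most one
  \<open>d\<close> contributes, and \<open>PJ\<close> is the symbol of the cofactors magnified by
  the square root of the gcd.\<close>

lemma PJ_eq:
  assumes "odd q" "gcd m (int q) = int (d\<^sup>2)"
  shows "PJ m q = int d * Jacobi (m div int (d\<^sup>2)) (q div d\<^sup>2)"
proof -
  have dd: "d\<^sup>2 dvd q" "int (d\<^sup>2) dvd m"
    using assms(2) by (metis gcd_dvd2 int_dvd_int_iff, metis gcd_dvd1)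
  have "PJ m q = (\<Sum>e\<in>{d}. int e * Jacobi (m div int (e\<^sup>2)) (q div e\<^sup>2))"
    unfolding PJ_def
  proof (rule sum.mono_neutral_right)
    show "finite {d. d\<^sup>2 dvd q \<and> int (d\<^sup>2) dvd m}" using assms(1) by (simp add: odd_pos)
    show "\<forall>e\<in>{d. d\<^sup>2 dvd q \<and> int (d\<^sup>2) dvd m} - {d}. int e * Jacobi (m div int (e\<^sup>2)) (q div e\<^sup>2) = 0"
    proof
      fix e assume "e \<in> {d. d\<^sup>2 dvd q \<and> int (d\<^sup>2) dvd m} - {d}"
      then have e: "e\<^sup>2 dvd q" "int (e\<^sup>2) dvd m" "e \<noteq> d" by blast+
      then have "gcd m (int q) \<noteq> int (e\<^sup>2)"
        using assms(2) by (metis of_nat_eq_iff power2_eq_iff_nonneg zero_le)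
      then have "\<not> coprime (m div int (e\<^sup>2)) (int (q div e\<^sup>2))"
        using gcd_square_quotient[OF assms(1) e(1,2)] by blast
      then show "int e * Jacobi (m div int (e\<^sup>2)) (q div e\<^sup>2) = 0"
        using Jacobi_eq_0_iff square_divisor_odd[OF assms(1) e(1)] by simp
    qed
  qed (use dd in auto)
  then show ?thesis by simp
qed

lemma abs_PJ_le:
  assumes "odd q"
  shows "\<bar>real_of_int (PJ m q)\<bar> \<le> sqrt (real_of_int (gcd m (int q)))"
proof (cases "\<exists>d. gcd m (int q) = int (d\<^sup>2)")
  case True
  then obtain d where d: "gcd m (int q) = int (d\<^sup>2)" by blast
  have "\<bar>PJ m q\<bar> \<le> int d"
    unfolding PJ_eq[OF assms d] abs_mult by (simp add: mult_left_le abs_Jacobi_le_1)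
  then have "\<bar>real_of_int (PJ m q)\<bar> \<le> real d" by linarith
  then show ?thesis by (simp add: d)
next
  case False
  then show ?thesis using PJ_eq_0[OF assms] by simp
qed

lemma abs_PJ_le_sqrt_left:
  assumes "odd q" "m \<noteq> 0"
  shows "\<bar>real_of_int (PJ m q)\<bar> \<le> sqrt \<bar>real_of_int m\<bar>"
proof -
  have "gcd m (int q) \<le> \<bar>m\<bar>" using assms(2) by (metis abs_ge_zero gcd_dvd1 dvd_abs_iff zdvd_imp_le zero_less_abs_iff)
  then have "sqrt (real_of_int (gcd m (int q))) \<le> sqrt \<bar>real_of_int m\<bar>"
    by (metis of_int_abs of_int_le_iff real_sqrt_le_iff)
  then show ?thesis using abs_PJ_le[OF assms(1), of m] by linarith
qed

lemma PJ_0: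
  assumes "odd q"
  shows "real_of_int (PJ 0 q) = (if \<exists>s. q = s\<^sup>2 then sqrt (real q) else 0)"
proof (cases "\<exists>s. q = s\<^sup>2")
  case True
  then obtain s where s: "q = s\<^sup>2" by blast
  then have "PJ 0 q = int s * Jacobi (0 div int (s\<^sup>2)) (q div s\<^sup>2)"
    using assms by (intro PJ_eq) auto
  moreover have "s > 0" using s assms by (auto intro: Nat.gr0I)
  ultimately show ?thesis using True s by auto
next
  case False
  then have "gcd 0 (int q) \<noteq> int (d\<^sup>2)" for d by (metis abs_of_nat gcd_0_left_int of_nat_eq_iff)
  then show ?thesis using False PJ_eq_0[OF assms] by simp
qed

lemma PJ_square_nonneg:
  assumes "odd q"
  shows "PJ (j\<^sup>2) q \<ge> 0"
  unfolding PJ_def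
proof (rule sum_nonneg, clarify)
  fix d assume d: "d\<^sup>2 dvd q" "int (d\<^sup>2) dvd j\<^sup>2"
  then have "int d dvd j" by simp
  then obtain x where x: "j = int d * x" by blast
  note sd = square_divisor_odd[OF assms d(1)]
  have "j\<^sup>2 div int (d\<^sup>2) = x\<^sup>2" using sd(3) by (simp add: x power_mult_distrib)
  then show "0 \<le> int d * Jacobi (j\<^sup>2 div int (d\<^sup>2)) (q div d\<^sup>2)"
    using sd(2) by (simp add: Jacobi_square_left')
qed

text \<open>Both sides are \<open>d\<close> if the gcd is \<open>d^2\<close> and 0 if it is not a
  square, because the cofactor symbols are 1. This turns a sum over moduli at a fixed odd square
  into a sum over arguments for a fixed modulus, which is periodic.\<close>

lemma PJ_square_commute:
  assumes "odd q" "odd j"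
  shows "PJ ((int j)\<^sup>2) q = PJ (int q) (j\<^sup>2)"
proof (cases "\<exists>d. gcd ((int j)\<^sup>2) (int q) = int (d\<^sup>2)")
  case True
  then obtain d where d: "gcd ((int j)\<^sup>2) (int q) = int (d\<^sup>2)" by blast
  have d': "gcd (int q) (int (j\<^sup>2)) = int (d\<^sup>2)" using d by (simp add: gcd.commute)
  have o: "odd (j\<^sup>2)" using assms(2) by simp
  have dd: "d\<^sup>2 dvd q" "d\<^sup>2 dvd j\<^sup>2"
    using d d' by (metis gcd_dvd2 int_dvd_int_iff)+
  note sq = square_divisor_odd[OF assms(1) dd(1)] and sj = square_divisor_odd[OF o dd(2)]
  from dd(2) obtain x where x: "j = d * x" by auto
  then have ox: "odd x" using assms(2) by simp
  have e: "(int j)\<^sup>2 div int (d\<^sup>2) = (int x)\<^sup>2" "j\<^sup>2 div d\<^sup>2 = x\<^sup>2"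
    using sq(3) by (simp_all add: x power_mult_distrib)
  have "coprime ((int j)\<^sup>2 div int (d\<^sup>2)) (int (q div d\<^sup>2))"
    using gcd_square_quotient[OF assms(1) dd(1)] dd(2) d
    by (metis of_nat_dvd_iff of_nat_power)
  then have "coprime ((int x)\<^sup>2) (int (q div d\<^sup>2))" by (simp only: e)
  then have c: "coprime (int x) (int (q div d\<^sup>2))" by simp
  then have c': "coprime (int q div int (d\<^sup>2)) (int x)" by (simp add: coprime_commute zdiv_int)
  show ?thesis
    unfolding PJ_eq[OF assms(1) d] PJ_eq[OF o d'] e
    using c c' sq ox by (simp add: Jacobi_square_left Jacobi_square_right)
next
  case False
  then have "PJ ((int j)\<^sup>2) q = 0" using PJ_eq_0[OF assms(1)] by blast
  moreover have "PJ (int q) (j\<^sup>2) = 0"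
    by (rule PJ_eq_0) (use False assms(2) in \<open>auto simp: gcd.commute\<close>)
  ultimately show ?thesis by simp
qed

text \<open>Inserting the definition of \<open>PJ\<close> and putting \<open>f = d * e\<close>, the
  weights combine to \<open>mu d * f\<close>; the sum of \<open>mu d\<close> over
  \<open>d | f\<close> leaves \<open>f = 1\<close>.\<close>

lemma Jacobi_eq_sum_PJ:
  assumes "odd q"
  shows "Jacobi m q = (\<Sum>d | d\<^sup>2 dvd q \<and> int (d\<^sup>2) dvd m. mu d * int d * PJ (m div int (d\<^sup>2)) (q div d\<^sup>2))"
proof -
  define A where "A = {f. f\<^sup>2 dvd q \<and> int (f\<^sup>2) dvd m}"
  have finA: "finite A" using assms by (simp add: A_def odd_pos)
  have inner: "{e. e\<^sup>2 dvd q div d\<^sup>2 \<and> int (e\<^sup>2) dvd m div int (d\<^sup>2)} = {e. d * e \<in> A}" 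
    and fin: "finite {e. d * e \<in> A}" if "d \<in> A" for d
  proof -
    from that have dv: "d\<^sup>2 dvd q" "int (d\<^sup>2) dvd m" unfolding A_def by blast+
    from dv(1) obtain x where x: "q = d\<^sup>2 * x" by (rule dvdE)
    from dv(2) obtain y where y: "m = int (d\<^sup>2) * y" by (rule dvdE)
    note xy = x y
    have "d > 0" using xy assms by (auto intro: Nat.gr0I)
    then show "{e. e\<^sup>2 dvd q div d\<^sup>2 \<and> int (e\<^sup>2) dvd m div int (d\<^sup>2)} = {e. d * e \<in> A}"
      by (simp add: xy A_def power_mult_distrib)
    have "inj_on (times d) {e. d * e \<in> A}" using \<open>d > 0\<close> by (simp add: inj_on_def)
    then show "finite {e. d * e \<in> A}"
      by (rule inj_on_finite[OF _ _ finA]) auto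
  qed
  have "(\<Sum>d\<in>A. mu d * int d * PJ (m div int (d\<^sup>2)) (q div d\<^sup>2))
     = (\<Sum>d\<in>A. \<Sum>e | d * e \<in> A. mu d * (int (d * e) * Jacobi (m div int ((d * e)\<^sup>2)) (q div (d * e)\<^sup>2)))"
  proof (intro sum.cong refl)
    fix d assume d: "d \<in> A"
    have "m div int (d\<^sup>2) div int (e\<^sup>2) = m div int ((d * e)\<^sup>2)" "q div d\<^sup>2 div e\<^sup>2 = q div (d * e)\<^sup>2" for e
      by (simp_all add: power_mult_distrib div_mult2_eq zdiv_zmult2_eq)
    then show "mu d * int d * PJ (m div int (d\<^sup>2)) (q div d\<^sup>2)
       = (\<Sum>e | d * e \<in> A. mu d * (int (d * e) * Jacobi (m div int ((d * e)\<^sup>2)) (q div (d * e)\<^sup>2)))"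
      unfolding PJ_def inner[OF d] by (simp add: sum_distrib_left mult_ac)
  qed
  also have "\<dots> = (\<Sum>(d, e)\<in>(SIGMA d:A. {e. d * e \<in> A}). mu d * (int (d * e) * Jacobi (m div int ((d * e)\<^sup>2)) (q div (d * e)\<^sup>2)))"
    by (rule sum.Sigma) (use finA fin in auto)
  also have "\<dots> = (\<Sum>(f, d)\<in>(SIGMA f:A. {d. d dvd f}). mu d * (int f * Jacobi (m div int (f\<^sup>2)) (q div f\<^sup>2)))"
  proof (rule sum.reindex_bij_witness[where i = "\<lambda>(f, d). (d, f div d)" and j = "\<lambda>(d, e). (d * e, d)"])
    fix a assume "a \<in> (SIGMA d:A. {e. d * e \<in> A})"
    then show "(\<lambda>(f, d). (d, f div d)) ((\<lambda>(d, e). (d * e, d)) a) = a" "(\<lambda>(d, e). (d * e, d)) a \<in> (SIGMA f:A. {d. d dvd f})"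
      using assms by (auto simp: A_def)
  next
    fix b assume b: "b \<in> (SIGMA f:A. {d. d dvd f})"
    obtain f d where fd: "b = (f, d)" by force
    with b obtain e where "f = d * e" "f \<in> A" by auto
    with fd have f: "b = (f, d)" "f = d * e" "f \<in> A" by auto
    then have pos: "d > 0" "e > 0" using assms by (auto simp: A_def intro: Nat.gr0I)
    have "d\<^sup>2 dvd f\<^sup>2" by (simp add: f)
    then have "d \<in> A" using f(3) by (auto simp: A_def intro: dvd_trans of_nat_dvd_iff[THEN iffD2])
    then show "(\<lambda>(d, e). (d * e, d)) ((\<lambda>(f, d). (d, f div d)) b) = b"
        "(\<lambda>(f, d). (d, f div d)) b \<in> (SIGMA d:A. {e. d * e \<in> A})"
      using f pos by auto
  qed auto
  also have "\<dots> = (\<Sum>f\<in>A. \<Sum>d | d dvd f. mu d * (int f * Jacobi (m div int (f\<^sup>2)) (q div f\<^sup>2)))"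
    by (rule sum.Sigma[symmetric]) (use finA assms in \<open>auto simp: A_def intro!: finite_divisors_nat Nat.gr0I\<close>)
  also have "\<dots> = (\<Sum>f\<in>A. if f = 1 then Jacobi m q else 0)"
  proof (intro sum.cong refl)
    fix f assume "f \<in> A"
    then have "f > 0" using assms by (auto simp: A_def intro: Nat.gr0I)
    then show "(\<Sum>d | d dvd f. mu d * (int f * Jacobi (m div int (f\<^sup>2)) (q div f\<^sup>2))) = (if f = 1 then Jacobi m q else 0)"
      by (simp add: sum_mu_dvd flip: sum_distrib_right)
  qed
  also have "\<dots> = Jacobi m q" using finA by (simp add: A_def)
  finally show ?thesis by (simp add: A_def)
qed

section \<open>An inequality of Polya-Vinogradov type\<close>

lemma sin_ge_third:
  fixes x :: real
  assumes "0 \<le> x" "x \<le> 2"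
  shows "x / 3 \<le> sin x"
proof -
  have "\<bar>sin x - (\<Sum>m<3. sin_coeff m * x ^ m)\<bar> \<le> inverse (fact 3) * \<bar>x\<bar> ^ 3"
    by (rule Maclaurin_sin_bound)
  moreover have "(\<Sum>m<3. sin_coeff m * x ^ m) = x"
    by (simp add: numeral_3_eq_3 sin_coeff_def)
  moreover have "inverse (fact 3) * \<bar>x\<bar> ^ 3 = x ^ 3 / 6" using assms by (simp add: fact_numeral)
  moreover have "x ^ 3 \<le> x * 4"
    using assms mult_left_mono[of "x\<^sup>2" 4 x] power_mono[of x 2 2] by (simp add: power3_eq_cube power2_eq_square)
  ultimately show ?thesis by linarith
qed

lemma inverse_sin_le:
  assumes "0 < x" "x \<le> 1 / 2"
  shows "sin (pi * x) > 0" "1 / sin (pi * x) \<le> 3 / (2 * x)"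
proof -
  have "pi * x \<le> pi * (1 / 2)" using assms by (intro mult_left_mono) auto
  then have "pi * x \<le> 2" using pi_less_4 by linarith
  then have "pi * x / 3 \<le> sin (pi * x)" using assms by (intro sin_ge_third) auto
  moreover have "2 * x / 3 \<le> pi * x / 3" using assms pi_ge_two by simp
  ultimately have *: "2 * x / 3 \<le> sin (pi * x)" by linarith
  then show "sin (pi * x) > 0" using assms by simp
  have "1 / sin (pi * x) \<le> 1 / (2 * x / 3)"
    using * assms by (intro divide_left_mono) (auto intro!: mult_pos_pos)
  then show "1 / sin (pi * x) \<le> 3 / (2 * x)" by simp
qed

lemma inverse_sin_le':
  assumes "0 < x" "x < 1"
  shows "sin (pi * x) > 0" "1 / sin (pi * x) \<le> 3 / (2 * x) + 3 / (2 * (1 - x))"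
proof -
  have "sin (pi * x) > 0 \<and> 1 / sin (pi * x) \<le> 3 / (2 * x) + 3 / (2 * (1 - x))"
  proof (cases "x \<le> 1 / 2")
    case True
    then show ?thesis using inverse_sin_le[of x] assms
      by (auto intro: order_trans)
  next
    case False
    have "sin (pi * (1 - x)) = sin (pi * x)" by (simp add: right_diff_distrib sin_diff)
    then show ?thesis using inverse_sin_le[of "1 - x"] assms False
      by (auto intro: order_trans)
  qed
  then show "sin (pi * x) > 0" "1 / sin (pi * x) \<le> 3 / (2 * x) + 3 / (2 * (1 - x))" by auto
qed

lemma norm_sum_cise_le:
  assumes "sin (pi * x) \<noteq> 0"
  shows "norm (\<Sum>a<n. cise (real a * x)) \<le> 1 / \<bar>sin (pi * x)\<bar>"
proof -
  have "norm (cise x - 1) \<noteq> 0" using assms by (simp add: norm_cise_minus_1)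
  then have "cise x \<noteq> 1" by auto
  then have "norm (\<Sum>a<n. cise (real a * x)) = norm (cise (real n * x) - 1) / norm (cise x - 1)"
    by (simp add: sum_cise_geometric norm_divide)
  also have "\<dots> \<le> 2 / norm (cise x - 1)"
    using norm_triangle_ineq4[of "cise (real n * x)" 1] by (intro divide_right_mono) auto
  finally show ?thesis by (simp add: norm_cise_minus_1)
qed

lemma sum_inverse_le_ln: "n > 0 \<Longrightarrow> (\<Sum>u = 1..n. 1 / real u) \<le> 1 + ln (real n)"
proof (induction n rule: nat_induct_non_zero)
  case (Suc n)
  have "ln (real n / real (Suc n)) \<le> real n / real (Suc n) - 1"
    using Suc by (intro ln_le_minus_one) simp
  then have "1 / real (Suc n) \<le> ln (real (Suc n)) - ln (real n)"
    using Suc by (simp add: ln_div field_simps)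
  then show ?case using Suc by simp
qed simp

text \<open>Near either end of the period \<open>1 / sin\<close> is bounded by a harmonic term, and
  the reflection \<open>u -> N - u\<close> makes the two harmonic sums equal.\<close>

lemma sum_inverse_sin_le:
  assumes "N > 1"
  shows "(\<Sum>u = 1..<N. 1 / sin (pi * (real u / real N))) \<le> 3 * real N * (1 + ln (real N))"
proof -
  have "(\<Sum>u = 1..<N. 1 / sin (pi * (real u / real N))) \<le> (\<Sum>u = 1..<N. 3 / 2 * real N * (1 / real u) + 3 / 2 * real N * (1 / real (N - u)))"
  proof (rule sum_mono)
    fix u assume u: "u \<in> {1..<N}"
    have "1 / sin (pi * (real u / real N)) \<le> 3 / (2 * (real u / real N)) + 3 / (2 * (1 - real u / real N))"
      using u by (intro inverse_sin_le') auto
    also have "1 - real u / real N = real (N - u) / real N" using u by (simp add: field_simps)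
    finally show "1 / sin (pi * (real u / real N)) \<le> 3 / 2 * real N * (1 / real u) + 3 / 2 * real N * (1 / real (N - u))"
      by simp
  qed
  also have "\<dots> = 3 / 2 * real N * (\<Sum>u = 1..<N. 1 / real u) + 3 / 2 * real N * (\<Sum>u = 1..<N. 1 / real (N - u))"
    by (simp only: sum.distrib sum_distrib_left)
  also have "(\<Sum>u = 1..<N. 1 / real (N - u)) = (\<Sum>u = 1..<N. 1 / real u)"
    by (rule sum.reindex_bij_witness[where i = "\<lambda>u. N - u" and j = "\<lambda>u. N - u"]) auto
  finally have "(\<Sum>u = 1..<N. 1 / sin (pi * (real u / real N))) \<le> 3 * real N * (\<Sum>u = 1..<N. 1 / real u)"
    by (simp only: mult.assoc)
  moreover have "(\<Sum>u = 1..<N. 1 / real u) \<le> (\<Sum>u = 1..N. 1 / real u)"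
    by (rule sum_mono2) auto
  moreover have "(\<Sum>u = 1..N. 1 / real u) \<le> 1 + ln (real N)" using assms by (intro sum_inverse_le_ln) simp
  ultimately show ?thesis
    by (meson dual_order.trans mult_left_mono mult_nonneg_nonneg of_nat_0_le_iff zero_le_numeral)
qed

text \<open>The twist modulo 8 is carried along so that weights depending on \<open>n\<close> modulo
  8 can be expanded later. Inserting the Gauss sum produces geometric sums with frequencies
  \<open>a / q + t / 8 = w / (8 q)\<close>. The \<open>w\<close> are distinct and, by the assumption
  on \<open>q\<close> and \<open>t\<close>, nonzero modulo \<open>8 q\<close>, so they cost at most
  the full sum of \<open>1 / sin\<close>.\<close>

lemma Jacobi_twisted_sum_squarefree:
  assumes q: "odd q" "squarefree q" and nt: "q > 1 \<or> \<not> 8 dvd t"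
  shows "norm (\<Sum>n<Z. of_int (Jacobi (int n) q) * cise (real n * of_int t / 8))
    \<le> 192 * sqrt (real q) * (1 + ln (real q))"
proof -
  have qpos: "q > 0" using q odd_pos by blast
  define N where "N = 8 * q"
  have N: "N > 1" "int N = 8 * int q" using qpos by (auto simp: N_def)
  define w where "w a = nat ((8 * int a + t * int q) mod int N)" for a
  define A where "A = {a. a < q \<and> coprime (int a) (int q)}"
  define g where "g u = 1 / sin (pi * (real u / real N))" for u
  have finA: "finite A" by (simp add: A_def)
  have w_int: "int (w a) = (8 * int a + t * int q) mod int N" for a using N by (simp add: w_def)
  have w_ne0: "w a \<noteq> 0" if "a \<in> A" for a
  proof
    assume "w a = 0"
    then have "int N dvd 8 * int a + t * int q" using w_int[of a] by (simp add: dvd_eq_mod_eq_0)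
    then have d: "8 * int q dvd 8 * int a + t * int q" by (simp add: N)
    then have "int q dvd 8 * int a" by (metis dvd_add_left_iff dvd_mult_right dvd_triv_right)
    moreover have "coprime (int q) (8 * int a)"
    proof -
      have "coprime (int q) (2 ^ 3)" by (rule coprime_power_right_iff[THEN iffD2]) (use q in simp)
      then have "coprime (int q) 8" by simp
      then show ?thesis using that by (simp add: A_def coprime_commute)
    qed
    ultimately have "is_unit (int q)"
      using coprime_common_divisor[of "int q" "8 * int a" "int q"] by simp
    then have "q = 1" by simp
    moreover from this have "a = 0" using that by (simp add: A_def)
    ultimately have "8 dvd t" using d by simp
    with nt \<open>q = 1\<close> show False by simp
  qed
  have w_range: "w a \<in> {1..<N}" if "a \<in> A" for a
    using w_ne0[OF that] N by (simp add: w_def nat_less_iff)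
  have w_inj: "inj_on w A"
  proof (rule inj_onI)
    fix a b assume ab: "a \<in> A" "b \<in> A" "w a = w b"
    then have "[8 * int a + t * int q = 8 * int b + t * int q] (mod 8 * int q)"
      using w_int[of a] w_int[of b] by (simp add: cong_def N)
    then have "8 * int q dvd 8 * (int a - int b)"
      by (simp add: cong_iff_dvd_diff algebra_simps)
    then have "int q dvd int a - int b"
      using dvd_mult_cancel_left[of 8 "int q" "int a - int b"] by simp
    then have "[int a = int b] (mod int q)" by (simp only: cong_iff_dvd_diff)
    then show "a = b" using ab by (simp add: A_def cong_def)
  qed
  have sin_pos: "sin (pi * (real u / real N)) > 0" if "u \<in> {1..<N}" for u
    using that by (intro inverse_sin_le'(1)) auto
  have inner: "norm (\<Sum>n<Z. cise (real n * (real a / real q + of_int t / 8))) \<le> g (w a)" if "a \<in> A" for a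
  proof -
    have e1: "real a / real q + of_int t / 8 = of_int (8 * int a + t * int q) / real N"
      using qpos by (simp add: N_def field_simps)
    have "cise (real n * (real a / real q + of_int t / 8)) = cise (real n * (real (w a) / real N))" for n
    proof -
      have "[int n * (8 * int a + t * int q) = int n * int (w a)] (mod int N)"
        unfolding w_int by (intro cong_mult) (simp_all add: cong_def)
      from cise_cong[OF this] show ?thesis using N by (simp add: e1)
    qed
    then have "norm (\<Sum>n<Z. cise (real n * (real a / real q + of_int t / 8))) = norm (\<Sum>n<Z. cise (real n * (real (w a) / real N)))"
      by simp
    also have "\<dots> \<le> 1 / \<bar>sin (pi * (real (w a) / real N))\<bar>"
      using sin_pos[OF w_range[OF that]] by (intro norm_sum_cise_le) auto
    finally show ?thesis using sin_pos[OF w_range[OF that]] by (simp add: g_def)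
  qed
  have "eps q * sqrt (real q) * (\<Sum>n<Z. of_int (Jacobi (int n) q) * cise (real n * of_int t / 8))
     = (\<Sum>n<Z. (\<Sum>a<q. of_int (Jacobi (int a) q) * cise (real a * of_int (int n) / real q)) * cise (real n * of_int t / 8))"
    by (simp only: sum_Jacobi_cise[OF q] sum_distrib_left mult.assoc)
  also have "\<dots> = (\<Sum>a<q. of_int (Jacobi (int a) q) * (\<Sum>n<Z. cise (real n * (real a / real q + of_int t / 8))))"
    unfolding sum_distrib_left sum_distrib_right
    by (subst sum.swap) (intro sum.cong refl, simp add: cise_add distrib_left mult_ac)
  also have "\<dots> = (\<Sum>a\<in>A. of_int (Jacobi (int a) q) * (\<Sum>n<Z. cise (real n * (real a / real q + of_int t / 8))))"
    by (rule sum.mono_neutral_right) (auto simp: A_def Jacobi_eq_0_iff q)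
  finally have "sqrt (real q) * norm (\<Sum>n<Z. of_int (Jacobi (int n) q) * cise (real n * of_int t / 8))
     = norm (\<Sum>a\<in>A. of_int (Jacobi (int a) q) * (\<Sum>n<Z. cise (real n * (real a / real q + of_int t / 8))))"
    by (metis (no_types, lifting) abs_of_nonneg mult_1 norm_eps norm_mult norm_of_real of_nat_0_le_iff real_sqrt_ge_zero)
  also have "\<dots> \<le> (\<Sum>a\<in>A. g (w a))"
  proof (rule sum_norm_le)
    fix a assume a: "a \<in> A"
    have "norm (of_int (Jacobi (int a) q) :: complex) \<le> 1"
      using abs_Jacobi_le_1[of "int a" q] by (simp flip: of_int_abs)
    then show "norm (of_int (Jacobi (int a) q) * (\<Sum>n<Z. cise (real n * (real a / real q + of_int t / 8)))) \<le> g (w a)"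
      unfolding norm_mult using inner[OF a] mult_mono[of _ 1 _ "g (w a)"] by fastforce
  qed
  also have "\<dots> = sum g (w ` A)" by (simp add: sum.reindex w_inj)
  also have "\<dots> \<le> sum g {1..<N}"
    using w_range sin_pos by (intro sum_mono2) (auto simp: g_def intro: less_imp_le)
  also have "\<dots> \<le> 3 * real N * (1 + ln (real N))"
    unfolding g_def by (rule sum_inverse_sin_le[OF N(1)])
  also have "\<dots> = 24 * real q * (1 + ln (real N))" by (simp add: N_def)
  \<comment> \<open>\<open>ln (8 q) = ln 8 + ln q\<close> and \<open>ln 8 <= 7\<close>, so
    \<open>1 + ln (8 q)\<close> is at most \<open>8 (1 + ln q)\<close>; hence
    \<open>192 = 24 * 8\<close>.\<close>
  also have "\<dots> \<le> 24 * real q * (8 * (1 + ln (real q)))"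
  proof (rule mult_left_mono)
    have "ln (real N) = ln 8 + ln (real q)" using qpos by (simp add: N_def ln_mult)
    moreover have "ln (8::real) \<le> 7" using ln_le_minus_one[of 8] by simp
    moreover have "ln (real q) \<ge> 0" using qpos by simp
    moreover have "1 + a \<le> 8 * (1 + c)" if "a = b + c" "b \<le> 7" "0 \<le> c" for a b c :: real
      using that by (simp add: distrib_left)
    ultimately show "1 + ln (real N) \<le> 8 * (1 + ln (real q))" by blast
  qed simp
  also have "\<dots> = (sqrt (real q) * sqrt (real q)) * 192 * (1 + ln (real q))"
    by (simp del: distrib_left_numeral)
  also have "\<dots> = sqrt (real q) * (192 * sqrt (real q) * (1 + ln (real q)))"
    by (simp only: mult_ac)
  finally show ?thesis using qpos by simp
qed

text \<open>For \<open>q = q0 * s^2\<close> the condition of being prime to \<open>s\<close> is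
  opened by Moebius over \<open>c | s\<close>. There are at most \<open>s\<close> such
  \<open>c\<close>, and \<open>s * sqrt q0 = sqrt q\<close>, so nothing is lost against the
  squarefree bound.\<close>

lemma Jacobi_twisted_sum:
  assumes q: "odd q" and nt: "(\<nexists>s. q = s\<^sup>2) \<or> \<not> 8 dvd t"
  shows "norm (\<Sum>n<Z. of_int (Jacobi (int n) q) * cise (real n * of_int t / 8))
    \<le> 192 * sqrt (real q) * (1 + ln (real q))"
proof -
  obtain q0 s where qs: "q = q0 * s\<^sup>2" "squarefree q0" "odd q0" "odd s" "q0 > 0" "s > 0"
    by (rule squarefree_decomp_odd[OF q]) blast
  have q0: "q0 > 1 \<or> \<not> 8 dvd t"
    using nt qs(1,5) by (cases "q0 = 1") auto
  let ?B = "192 * sqrt (real q0) * (1 + ln (real q0))"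
  have multsum: "norm (\<Sum>n\<in>{n. n < Z \<and> c dvd n}. of_int (Jacobi (int n) q0) * cise (real n * of_int t / 8)) \<le> ?B"
    if c: "c dvd s" for c
  proof -
    have cpos: "c > 0" "odd c" using c qs by auto
    \<comment> \<open>\<open>Z / c\<close> rounded up: the number of multiples of \<open>c\<close>
      below \<open>Z\<close>, with 0 included.\<close>
    define K where "K = (Z + c - 1) div c"
    have iK: "c * i < Z \<longleftrightarrow> i < K" for i
    proof -
      have "i < K \<longleftrightarrow> Suc i \<le> K" by auto
      also have "\<dots> \<longleftrightarrow> Suc i * c \<le> Z + c - 1"
        unfolding K_def using cpos(1) by (rule less_eq_div_iff_mult_less_eq)
      also have "\<dots> \<longleftrightarrow> c * i < Z" using cpos(1) by (auto simp: mult.commute[of i c])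
      finally show ?thesis by simp
    qed
    have "{n. n < Z \<and> c dvd n} = times c ` {..<K}" by (auto simp: iK elim!: dvdE)
    then have "(\<Sum>n\<in>{n. n < Z \<and> c dvd n}. of_int (Jacobi (int n) q0) * cise (real n * of_int t / 8))
       = (\<Sum>i<K. of_int (Jacobi (int (c * i)) q0) * cise (real (c * i) * of_int t / 8))"
      using cpos by (simp add: sum.reindex inj_on_def)
    also have "\<dots> = of_int (Jacobi (int c) q0) * (\<Sum>i<K. of_int (Jacobi (int i) q0) * cise (real i * of_int (int c * t) / 8))"
      using qs by (simp add: Jacobi_mult_left sum_distrib_left mult_ac)
    also have "norm \<dots> \<le> 1 * ?B"
      unfolding norm_mult
    proof (rule mult_mono)
      show "norm (of_int (Jacobi (int c) q0) :: complex) \<le> 1"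
        using abs_Jacobi_le_1[of "int c" q0] by (simp flip: of_int_abs)
      have "coprime (8 :: int) (int c)"
      proof -
        have "coprime ((2 :: int) ^ 3) (int c)" by (rule coprime_power_left_iff[THEN iffD2]) (use cpos in simp)
        then show ?thesis by simp
      qed
      then have "8 dvd int c * t \<longleftrightarrow> 8 dvd t" by (simp add: coprime_dvd_mult_right_iff)
      then show "norm (\<Sum>i<K. of_int (Jacobi (int i) q0) * cise (real i * of_int (int c * t) / 8)) \<le> ?B"
        using q0 by (intro Jacobi_twisted_sum_squarefree qs) auto
    qed auto
    finally show ?thesis by simp
  qed
  have J: "Jacobi (int n) q = (\<Sum>c | c dvd s. if c dvd n then mu c * Jacobi (int n) q0 else 0)" for n
  proof -
    have "Jacobi (int n) q = (\<Sum>c | c dvd s \<and> int c dvd int n. mu c * Jacobi (int n) q0)"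
      using qs by (simp add: Jacobi_square_factor sum_distrib_left mult.commute)
    also have "\<dots> = (\<Sum>c | c dvd s. if c dvd n then mu c * Jacobi (int n) q0 else 0)"
      using qs by (intro sum.mono_neutral_cong_left) auto
    finally show ?thesis .
  qed
  have "(\<Sum>n<Z. of_int (Jacobi (int n) q) * cise (real n * of_int t / 8))
     = (\<Sum>n<Z. \<Sum>c | c dvd s. if c dvd n then of_int (mu c) * (of_int (Jacobi (int n) q0) * cise (real n * of_int t / 8)) else 0)"
    unfolding J of_int_sum sum_distrib_right by (intro sum.cong refl) simp
  also have "\<dots> = (\<Sum>c | c dvd s. \<Sum>n<Z. if c dvd n then of_int (mu c) * (of_int (Jacobi (int n) q0) * cise (real n * of_int t / 8)) else 0)"
    by (rule sum.swap)
  also have "\<dots> = (\<Sum>c | c dvd s. of_int (mu c) * (\<Sum>n\<in>{n. n < Z \<and> c dvd n}. of_int (Jacobi (int n) q0) * cise (real n * of_int t / 8)))"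
    unfolding sum_distrib_left by (intro sum.cong refl sum.mono_neutral_cong_right) auto
  also have "norm \<dots> \<le> (\<Sum>c | c dvd s. ?B)"
  proof (rule sum_norm_le)
    fix c assume c: "c \<in> {c. c dvd s}"
    have "norm (of_int (mu c) :: complex) \<le> 1"
      using abs_mu_le_1[of c] by (simp flip: of_int_abs)
    then show "norm (of_int (mu c) * (\<Sum>n\<in>{n. n < Z \<and> c dvd n}. of_int (Jacobi (int n) q0) * cise (real n * of_int t / 8))) \<le> ?B"
      unfolding norm_mult using multsum[of c] c mult_mono[of _ 1 _ ?B] by fastforce
  qed
  also have "\<dots> \<le> real s * ?B"
  proof -
    have "{c. c dvd s} \<subseteq> {1..s}" using qs by (auto intro: dvd_imp_le Suc_leI Nat.gr0I)
    then have "card {c. c dvd s} \<le> s" using card_mono[of "{1..s}"] by fastforce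
    then show ?thesis using qs(5) by (simp add: mult_right_mono)
  qed
  also have "\<dots> = 192 * (real s * sqrt (real q0)) * (1 + ln (real q0))" by simp
  also have "real s * sqrt (real q0) = sqrt (real q)" by (simp add: qs(1) real_sqrt_mult)
  also have "192 * sqrt (real q) * (1 + ln (real q0)) \<le> 192 * sqrt (real q) * (1 + ln (real q))"
  proof -
    have "q0 \<le> q" using qs by simp
    then show ?thesis using qs(5) by (intro mult_left_mono) auto
  qed
  finally show ?thesis .
qed

text \<open>Fourier expansion of the weight modulo 8: 8 frequencies with coefficients at most 1,
  hence \<open>1536 = 8 * 192\<close>. For a square \<open>q\<close> only frequency 0 escapes the
  bound, and its coefficient is the mean of \<open>w\<close>.\<close>

lemma Jacobi_periodic_sum:
  fixes w :: "nat \<Rightarrow> real"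
  assumes q: "odd q" and per: "\<And>n. w n = w (n mod 8)" and w1: "\<And>n. \<bar>w n\<bar> \<le> 1"
    and nt: "(\<nexists>s. q = s\<^sup>2) \<or> (\<Sum>i<8. w i) = 0"
  shows "\<bar>\<Sum>n<Z. w n * of_int (Jacobi (int n) q)\<bar> \<le> 1536 * sqrt (real q) * (1 + ln (real q))"
proof -
  define c where "c t = (\<Sum>i<8. of_real (w i) * cise (- (real i * real t / 8))) / 8" for t
  have c1: "norm (c t) \<le> 1" for t
  proof -
    have "norm (\<Sum>i<8. of_real (w i) * cise (- (real i * real t / 8))) \<le> (\<Sum>i<(8::nat). 1)"
      using w1 by (intro sum_norm_le) (simp add: norm_mult)
    then show ?thesis by (simp add: c_def norm_divide)
  qed
  have inv: "of_real (w n) = (\<Sum>t<8. c t * cise (real n * of_int (int t) / 8))" for n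
  proof -
    have "(\<Sum>t<8. c t * cise (real n * of_int (int t) / 8))
       = (\<Sum>t<8. \<Sum>i<8. of_real (w i) / 8 * cise (real t * of_int (int n - int i) / real 8))"
      unfolding c_def sum_divide_distrib sum_distrib_right
      by (intro sum.cong refl) (simp add: cise_diff cise_minus algebra_simps diff_divide_distrib)
    also have "\<dots> = (\<Sum>i<8. of_real (w i) / 8 * (if int 8 dvd int n - int i then of_nat 8 else 0))"
      by (subst sum.swap) (simp only: sum_cise_orthogonal[of 8, simplified] sum_distrib_left[symmetric] of_nat_numeral sum_cise_orthogonal)
    also have "\<dots> = (\<Sum>i<8. if i = n mod 8 then of_real (w i) else 0)"
    proof (intro sum.cong refl)
      fix i :: nat assume "i \<in> {..<8}"
      then have i8: "i mod 8 = i" by simp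
      have "int 8 dvd int n - int i \<longleftrightarrow> int n mod 8 = int i mod 8" by (simp add: mod_eq_dvd_iff)
      also have "int n mod 8 = int (n mod 8)" by (simp add: zmod_int)
      also have "int i mod 8 = int (i mod 8)" by (simp add: zmod_int)
      also have "int (n mod 8) = int (i mod 8) \<longleftrightarrow> n mod 8 = i mod 8" by (rule of_nat_eq_iff)
      finally have "int 8 dvd int n - int i \<longleftrightarrow> i = n mod 8" using i8 by auto
      then show "of_real (w i) / 8 * (if int 8 dvd int n - int i then of_nat 8 else 0) = (if i = n mod 8 then of_real (w i) else (0::complex))"
        by simp
    qed
    also have "\<dots> = of_real (w n)" using per[of n] by simp
    finally show ?thesis by simp
  qed
  let ?S = "\<lambda>t. \<Sum>n<Z. of_int (Jacobi (int n) q) * cise (real n * of_int (int t) / 8)"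
  let ?B = "192 * sqrt (real q) * (1 + ln (real q))"
  have Bpos: "?B \<ge> 0" using odd_pos[OF q] by simp
  have "of_real (\<Sum>n<Z. w n * of_int (Jacobi (int n) q)) = (\<Sum>n<Z. (\<Sum>t<8. c t * cise (real n * of_int (int t) / 8)) * of_int (Jacobi (int n) q))"
    by (simp add: inv)
  also have "\<dots> = (\<Sum>t<8. c t * ?S t)"
    unfolding sum_distrib_left sum_distrib_right by (subst sum.swap) (simp add: mult_ac)
  finally have eq: "of_real (\<Sum>n<Z. w n * of_int (Jacobi (int n) q)) = (\<Sum>t<8. c t * ?S t)" .
  have "\<bar>\<Sum>n<Z. w n * of_int (Jacobi (int n) q)\<bar> = norm (\<Sum>t<8. c t * ?S t)"
    unfolding eq[symmetric] by (simp only: norm_of_real)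
  also have "\<dots> \<le> (\<Sum>t<(8::nat). ?B)"
  proof (rule sum_norm_le)
    fix t :: nat assume t: "t \<in> {..<8}"
    show "norm (c t * ?S t) \<le> ?B"
    proof (cases "(\<nexists>s. q = s\<^sup>2) \<or> \<not> 8 dvd int t")
      case True
      have "norm (?S t) \<le> ?B" by (rule Jacobi_twisted_sum[OF q True])
      then show ?thesis unfolding norm_mult using mult_mono[OF c1[of t]] by fastforce
    next
      case False
      then have "t = 0" using t by (auto dest: zdvd_imp_le)
      moreover have "(\<Sum>i<8. w i) = 0" using nt False by blast
      then have "c 0 = 0" by (simp add: c_def flip: of_real_sum)
      ultimately show ?thesis using Bpos by simp
    qed
  qed
  finally show ?thesis by simp
qed

text \<open>Write \<open>k = 2 ^ a * k'\<close> with \<open>k'\<close> odd: reciprocity turns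
  \<open>(k/n)\<close> into \<open>(n/k')\<close> times a weight depending on \<open>n\<close>
  modulo 8. If \<open>k'\<close> is a square, then \<open>a\<close> is odd because \<open>k\<close>
  is not a square, and \<open>(2/n)\<close> takes both signs on the classes \<open>b\<close> and
  \<open>b + 4\<close> modulo 8, so the weight has mean zero.\<close>

lemma Jacobi_class_sum:
  assumes k: "k > 0" "\<nexists>s. k = s\<^sup>2" and b: "b = 1 \<or> b = 3"
  shows "\<bar>\<Sum>n<Z. if n mod 4 = b then real_of_int (Jacobi (int k) n) else 0\<bar> \<le> 1536 * sqrt (real k) * (1 + ln (real k))"
proof -
  obtain a k' where k': "k = 2 ^ a * k'" "odd k'"
    using k(1) by (metis dvd_def gcd_nat.extremum multiplicity_decompose' not_prime_unit even_zero mult.commute neq0_conv two_is_prime_nat prime_elem_not_unit prime_imp_prime_elem zero_neq_one)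
  define J2 :: "nat \<Rightarrow> int" where "J2 n = (if n mod 8 = 1 \<or> n mod 8 = 7 then 1 else -1)" for n
  define w where "w n = (if n mod 4 = b then real_of_int (J2 n ^ a * rsgn k' n) else 0)" for n
  have mm: "n mod 8 mod 4 = n mod 4" for n :: nat by (rule mod_mod_cancel) simp
  have oddb: "odd n" if "n mod 4 = b" for n using that b by presburger
  have "\<bar>\<Sum>n<Z. w n * of_int (Jacobi (int n) k')\<bar> \<le> 1536 * sqrt (real k') * (1 + ln (real k'))"
  proof (rule Jacobi_periodic_sum[OF k'(2)])
    show "w n = w (n mod 8)" for n by (simp add: w_def J2_def rsgn_def mm)
    show "\<bar>w n\<bar> \<le> 1" for n by (simp add: w_def J2_def rsgn_def abs_mult power_abs)
    show "(\<nexists>s. k' = s\<^sup>2) \<or> sum w {..<8} = 0"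
    proof (cases "\<exists>s. k' = s\<^sup>2")
      case True
      then obtain s where s: "k' = s\<^sup>2" by blast
      have "odd a"
      proof
        assume "even a"
        then obtain c where "a = 2 * c" by blast
        then have "k = (2 ^ c)\<^sup>2 * s\<^sup>2" using k' s by (simp only: power_even_eq)
        then have "k = (2 ^ c * s)\<^sup>2" by (simp only: power_mult_distrib)
        then show False using k by blast
      qed
      moreover have "{..<8} = {0, 1, 2, 3, 4, 5, 6, 7 :: nat}" by auto
      ultimately have "sum w {..<8} = 0"
        using b by (elim disjE) (simp_all add: w_def J2_def rsgn_def)
      then show ?thesis by simp
    qed simp
  qed
  also have "(\<Sum>n<Z. w n * of_int (Jacobi (int n) k')) = (\<Sum>n<Z. if n mod 4 = b then real_of_int (Jacobi (int k) n) else 0)"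
  proof (intro sum.cong refl)
    fix n
    show "w n * of_int (Jacobi (int n) k') = (if n mod 4 = b then real_of_int (Jacobi (int k) n) else 0)"
    proof (cases "n mod 4 = b")
      case True
      have on: "odd n" by (rule oddb[OF True])
      have "Jacobi (2 ^ a) n = J2 n ^ a" for a
        using on by (induction a) (simp_all add: Jacobi_mult_left Jacobi_2 J2_def)
      then have "Jacobi (int k) n = J2 n ^ a * (rsgn k' n * Jacobi (int n) k')"
        using on Jacobi_reciprocity[OF k'(2) on] by (simp add: k'(1) Jacobi_mult_left)
      then show ?thesis using True by (simp add: w_def)
    qed (simp add: w_def)
  qed
  also have "1536 * sqrt (real k') * (1 + ln (real k')) \<le> 1536 * sqrt (real k) * (1 + ln (real k))"
  proof -
    have "k' \<le> k" "k' > 0" using k' k by (auto intro: Nat.gr0I)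
    then show ?thesis by (intro mult_mono) auto
  qed
  finally show ?thesis .
qed

lemma Jacobi_odd_sum:
  assumes q: "odd q" "\<nexists>s. q = s\<^sup>2"
  shows "\<bar>\<Sum>n<Z. if odd n then real_of_int (Jacobi (int n) q) else 0\<bar> \<le> 1536 * sqrt (real q) * (1 + ln (real q))"
proof -
  have "\<bar>\<Sum>n<Z. (if odd n then 1 else 0) * real_of_int (Jacobi (int n) q)\<bar> \<le> 1536 * sqrt (real q) * (1 + ln (real q))"
    by (rule Jacobi_periodic_sum[OF q(1)]) (use q(2) in \<open>simp_all add: dvd_mod_iff\<close>)
  then show ?thesis by (simp add: if_distrib[of "\<lambda>x. x * _"] cong: if_cong)
qed

section \<open>Mean values over the modulus\<close>

lemma sum_multiples_less:
  fixes F :: "nat \<Rightarrow> 'a :: comm_monoid_add"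
  assumes "g > 0"
  shows "(\<Sum>q<Z. if g dvd q then F q else 0) = (\<Sum>t<(Z + g - 1) div g. F (g * t))"
proof -
  let ?K = "(Z + g - 1) div g"
  have iK: "g * i < Z \<longleftrightarrow> i < ?K" for i
  proof -
    have "i < ?K \<longleftrightarrow> Suc i \<le> ?K" by auto
    also have "\<dots> \<longleftrightarrow> Suc i * g \<le> Z + g - 1"
      using assms by (rule less_eq_div_iff_mult_less_eq)
    also have "\<dots> \<longleftrightarrow> g * i < Z" using assms by (auto simp: mult.commute[of i g])
    finally show ?thesis by simp
  qed
  have "{n. n < Z \<and> g dvd n} = times g ` {..<?K}" by (auto simp: iK elim!: dvdE)
  then have "(\<Sum>q\<in>{n. n < Z \<and> g dvd n}. F q) = (\<Sum>t<?K. F (g * t))"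
    using assms by (simp add: sum.reindex inj_on_def)
  moreover have "(\<Sum>q<Z. if g dvd q then F q else 0) = (\<Sum>q\<in>{n. n < Z \<and> g dvd n}. F q)"
    by (intro sum.mono_neutral_cong_right) auto
  ultimately show ?thesis by simp
qed

text \<open>By nonnegativity the incomplete last period lies between nothing and a full
  period.\<close>

lemma sum_periodic_bounds:
  fixes f :: "nat \<Rightarrow> real"
  assumes L: "L > 0" and per: "\<And>t. f (t + L) = f t" and nn: "\<And>t. f t \<ge> 0"
  shows "\<bar>(\<Sum>t<T. f t) - real T * (\<Sum>t<L. f t) / real L\<bar> \<le> (\<Sum>t<L. f t)"
proof -
  let ?S = "\<Sum>t<L. f t"
  have S0: "?S \<ge> 0" using nn by (simp add: sum_nonneg)
  have perj: "f (t + j * L) = f t" for t j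
  proof (induction j)
    case (Suc j)
    then show ?case using per[of "t + j * L"] by (simp add: algebra_simps)
  qed simp
  have full: "(\<Sum>t<n * L. f t) = real n * ?S" for n
  proof -
    have "(\<Sum>t<n * L. f t) = (\<Sum>j<n. \<Sum>t=j * L..<j * L + L. f t)"
      using sum.nat_group[of f L n] by simp
    also have "\<dots> = (\<Sum>j<n. \<Sum>t<L. f (t + j * L))"
      using sum.shift_bounds_nat_ivl[of f 0 "_ * L" L]
      by (simp only: lessThan_atLeast0 add_0_left add.commute[of L])
    finally show ?thesis by (simp add: perj)
  qed
  let ?n = "T div L"
  have lo: "real ?n * ?S \<le> (\<Sum>t<T. f t)"
    unfolding full[symmetric] by (intro sum_mono2) (auto simp: nn)
  have "T \<le> (?n + 1) * L"
    by (metis Suc_eq_plus1 dividend_less_times_div less_imp_le_nat mult.commute mult_Suc_right L add.commute)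
  then have hi: "(\<Sum>t<T. f t) \<le> real (?n + 1) * ?S"
    unfolding full[symmetric] by (intro sum_mono2) (auto simp: nn)
  have "real (?n * L) \<le> real T" by (simp only: of_nat_le_iff div_times_less_eq_dividend)
  then have n1: "real ?n \<le> real T / real L" using L by (simp add: pos_le_divide_eq)
  have n2: "real T / real L \<le> real (?n + 1)"
    using \<open>T \<le> (?n + 1) * L\<close> L by (simp add: pos_divide_le_eq flip: of_nat_mult del: of_nat_add of_nat_Suc)
  have "real ?n * ?S \<le> real T / real L * ?S" "real T / real L * ?S \<le> real (?n + 1) * ?S"
    using n1 n2 S0 by (intro mult_right_mono; simp)+
  then show ?thesis using lo hi by (simp add: abs_le_iff algebra_simps)
qed

text \<open>By duality the sum over \<open>t\<close> becomes a complete character sum, so only those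
  \<open>a\<close> with \<open>j^2 | a * r\<close> survive. If \<open>gcd a (j^2) = d^2\<close> and
  \<open>j = d * x\<close>, then \<open>x^2\<close> is prime to \<open>a / d^2\<close> and so
  divides the squarefree \<open>r\<close>; hence \<open>x = 1\<close> and \<open>a = 0\<close>. What
  is left is \<open>PJ 0 (j^2) = j\<close>.\<close>

lemma sum_PJ_square_modulus:
  assumes j: "odd j" and r: "squarefree r"
  shows "(\<Sum>t<j\<^sup>2. PJ (int (r * t)) (j\<^sup>2)) = int (j\<^sup>2)"
proof -
  have oj: "odd (j\<^sup>2)" and jpos: "j > 0" using j by (auto simp: odd_pos)
  have q0: "j\<^sup>2 > 0" using jpos by simp
  have "j mod 4 = 1 \<or> j mod 4 = 3" using j odd_mod_4 by blast
  then have "j\<^sup>2 mod 4 = 1" by (auto simp: power2_eq_square mod_mult_eq[of j 4 j, symmetric])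
  then have e: "eps (j\<^sup>2) * sqrt (real (j\<^sup>2)) = of_nat j" by (simp add: eps_def)
  have z: "PJ (int a) (j\<^sup>2) = 0" if a: "a < j\<^sup>2" "a \<noteq> 0" "int (j\<^sup>2) dvd int a * int r" for a
  proof (cases "\<exists>d. gcd (int a) (int (j\<^sup>2)) = int (d\<^sup>2)")
    case True
    then obtain d where d: "gcd (int a) (int (j\<^sup>2)) = int (d\<^sup>2)" by blast
    then have g: "gcd a (j\<^sup>2) = d\<^sup>2" by (metis gcd_int_int_eq of_nat_eq_iff)
    then have "d\<^sup>2 dvd j\<^sup>2" by (metis gcd_dvd2)
    then obtain x where x: "j = d * x" by auto
    have "d\<^sup>2 dvd a" using g by (metis gcd_dvd1)
    then obtain y where y: "a = d\<^sup>2 * y" by blast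
    have dpos: "d > 0" using x jpos by (auto intro: Nat.gr0I)
    have "d\<^sup>2 * gcd y (x\<^sup>2) = d\<^sup>2 * 1" using g by (simp add: x y power_mult_distrib gcd_mult_distrib_nat)
    then have "gcd y (x\<^sup>2) = 1" using dpos by (simp only: mult_cancel1) simp
    then have "coprime (x\<^sup>2) y" by (simp only: coprime_iff_gcd_eq_1 gcd.commute[of "x\<^sup>2" y])
    moreover have "j\<^sup>2 dvd a * r" using a(3) by (metis int_dvd_int_iff of_nat_mult)
    then have "d\<^sup>2 * x\<^sup>2 dvd d\<^sup>2 * (y * r)" by (simp add: x y power_mult_distrib mult.assoc)
    then have "x\<^sup>2 dvd y * r" using dpos by simp
    ultimately have "x\<^sup>2 dvd r" by (simp add: coprime_dvd_mult_right_iff del: coprime_power_left_iff)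
    then have "x = 1" using squarefreeD[OF r] by simp
    then have "j\<^sup>2 dvd a" using x y by simp
    then show ?thesis using a by (auto dest: dvd_imp_le)
  next
    case False
    then show ?thesis using PJ_eq_0[OF oj] by blast
  qed
  have "of_nat j * of_int (\<Sum>t<j\<^sup>2. PJ (int (r * t)) (j\<^sup>2)) = (\<Sum>t<j\<^sup>2. of_nat j * of_int (PJ (int (r * t)) (j\<^sup>2)) :: complex)"
    by (simp only: of_int_sum sum_distrib_left)
  also have "\<dots> = (\<Sum>t<j\<^sup>2. \<Sum>a<j\<^sup>2. of_int (PJ (int a) (j\<^sup>2)) * cise (real a * of_int (int (r * t)) / real (j\<^sup>2)))"
    by (simp only: PJ_self_dual[OF oj] e)
  also have "\<dots> = (\<Sum>a<j\<^sup>2. of_int (PJ (int a) (j\<^sup>2)) * (\<Sum>t<j\<^sup>2. cise (real t * of_int (int a * int r) / real (j\<^sup>2))))"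
    unfolding sum_distrib_left by (subst sum.swap) (simp add: mult_ac)
  also have "\<dots> = (\<Sum>a<j\<^sup>2. if a = 0 then of_int (PJ 0 (j\<^sup>2)) * of_nat (j\<^sup>2) else 0)"
    unfolding sum_cise_orthogonal[OF q0] by (intro sum.cong refl) (auto simp: z)
  also have "\<dots> = of_int (PJ 0 (j\<^sup>2)) * of_nat (j\<^sup>2)" using q0 by (simp add: sum.delta)
  also have "PJ 0 (j\<^sup>2) = int j"
  proof -
    have "real_of_int (PJ 0 (j\<^sup>2)) = real j" using PJ_0[OF oj] by auto
    then show ?thesis by linarith
  qed
  finally have "(of_nat j :: complex) * of_int (\<Sum>t<j\<^sup>2. PJ (int (r * t)) (j\<^sup>2)) = of_nat j * of_int (int (j\<^sup>2))"
    by simp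
  then have "(of_int (\<Sum>t<j\<^sup>2. PJ (int (r * t)) (j\<^sup>2)) :: complex) = of_int (int (j\<^sup>2))"
    using jpos by (simp only: mult_cancel_left of_nat_eq_0_iff) auto
  then show ?thesis by (simp only: of_int_eq_iff)
qed

text \<open>Fixing the class modulo 4 fixes \<open>eps q\<close> and the reciprocity sign, so the
  two classes can be given different weights in the dual sum.\<close>

definition class_sum :: "nat \<Rightarrow> nat \<Rightarrow> nat \<Rightarrow> nat \<Rightarrow> real" where
  "class_sum r b k Z = (\<Sum>q<Z. if q mod 4 = b \<and> r dvd q then real_of_int (PJ (int k) q) else 0)"

text \<open>\<open>PJ_square_commute\<close> makes the summand a nonnegative function of
  \<open>t = q / r\<close> with period \<open>4 * j^2\<close>. CRT separates the condition modulo 4,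
  which selects one class of \<open>t\<close>, from the residue modulo \<open>j^2\<close>, over
  which the sum is \<open>j^2\<close>. The mean is thus 1/4 per \<open>t\<close>, and the error is
  about one period.\<close>

lemma class_sum_odd_square:
  assumes r: "odd r" "squarefree r" and b: "b = 1 \<or> b = 3" and j: "odd j"
  shows "\<bar>class_sum r b (j\<^sup>2) Z - real Z / (4 * real r)\<bar> \<le> 2 * real (j\<^sup>2)"
proof -
  have rpos: "r > 0" and jpos: "j > 0" using r j by (auto simp: odd_pos)
  define G where "G t = real_of_int (PJ (int (r * t)) (j\<^sup>2))" for t
  define f where "f t = (if r * t mod 4 = b then G t else 0)" for t
  define K where "K = (Z + r - 1) div r"
  have oj: "odd (j\<^sup>2)" "j\<^sup>2 > 0" using j jpos by auto
  have j4: "j\<^sup>2 mod 4 = 1"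
    using odd_mod_4[OF j] by (auto simp: power2_eq_square mod_mult_eq[of j 4 j, symmetric])
  have odd_b: "odd n" if "n mod 4 = b" for n using that b by presburger
  have G: "real_of_int (PJ (int (j\<^sup>2)) (r * t)) = G t" if "odd (r * t)" for t
    using PJ_square_commute[OF that j] by (simp add: G_def)
  have "class_sum r b (j\<^sup>2) Z = (\<Sum>q<Z. if r dvd q then (if q mod 4 = b then real_of_int (PJ (int (j\<^sup>2)) q) else 0) else 0)"
    unfolding class_sum_def by (intro sum.cong) auto
  also have "\<dots> = (\<Sum>t<K. if r * t mod 4 = b then real_of_int (PJ (int (j\<^sup>2)) (r * t)) else 0)"
    unfolding K_def by (rule sum_multiples_less[OF rpos])
  also have "\<dots> = (\<Sum>t<K. f t)"
  proof (rule sum.cong[OF refl])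
    fix t
    show "(if r * t mod 4 = b then real_of_int (PJ (int (j\<^sup>2)) (r * t)) else 0) = f t"
      unfolding f_def using G[of t] odd_b[of "r * t"] by (cases "r * t mod 4 = b") simp_all
  qed
  finally have cs: "class_sum r b (j\<^sup>2) Z = (\<Sum>t<K. f t)" .
  have Gcong: "G t = G u" if "[t = u] (mod j\<^sup>2)" for t u
  proof -
    have "[r * t = r * u] (mod j\<^sup>2)" using that by (rule cong_scalar_left)
    then have "[int (r * t) = int (r * u)] (mod int (j\<^sup>2))" by (simp only: cong_int_iff)
    from PJ_cong[OF this oj(2)] show ?thesis by (simp only: G_def)
  qed
  have per: "f (t + 4 * j\<^sup>2) = f t" for t
  proof -
    have "G (t + 4 * j\<^sup>2) = G t" by (rule Gcong) (simp add: cong_def)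
    moreover have "r * (t + 4 * j\<^sup>2) mod 4 = r * t mod 4"
      by (metis (no_types, lifting) distrib_left mod_mult_self2 mult.left_commute)
    ultimately show ?thesis by (simp add: f_def)
  qed
  have nn: "f t \<ge> 0" for t
  proof (cases "r * t mod 4 = b")
    case True
    then have o: "odd (r * t)" by (rule odd_b)
    then have "G t = real_of_int (PJ ((int j)\<^sup>2) (r * t))" using G by simp
    then show ?thesis using PJ_square_nonneg[OF o, of "int j"] True by (simp add: f_def)
  qed (simp add: f_def)
  \<comment> \<open>\<open>sum_CRT\<close> expects a function on the integers; \<open>F\<close> is
    the periodic extension of \<open>f\<close>.\<close>
  define F where "F x = f (nat (x mod int (4 * j\<^sup>2)))" for x :: int
  have Fnat: "F (int x) = f x" for x
  proof -
    have perj: "f (t + i * (4 * j\<^sup>2)) = f t" for t i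
    proof (induction i)
      case (Suc i)
      then show ?case using per[of "t + i * (4 * j\<^sup>2)"] by (simp add: algebra_simps)
    qed simp
    have "F (int x) = f (x mod (4 * j\<^sup>2))" by (simp add: F_def flip: zmod_int of_nat_mult of_nat_power)
    also have "\<dots> = f (x mod (4 * j\<^sup>2) + x div (4 * j\<^sup>2) * (4 * j\<^sup>2))" by (rule perj[symmetric])
    also have "x mod (4 * j\<^sup>2) + x div (4 * j\<^sup>2) * (4 * j\<^sup>2) = x" by (rule mod_div_mult_eq)
    finally show ?thesis .
  qed
  have "coprime 4 (j\<^sup>2)"
  proof -
    have "coprime (2\<^sup>2) (j\<^sup>2)" using j by (intro coprime_power_left_iff[THEN iffD2] disjI1 coprime_power_right_iff[THEN iffD2]) simp
    then show ?thesis by simp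
  qed
  then have "(\<Sum>a<4 * j\<^sup>2. F (int a)) = (\<Sum>a<4. \<Sum>c<j\<^sup>2. F (int (a * j\<^sup>2 + c * 4)))"
    by (rule sum_CRT) (use oj in \<open>auto simp: F_def cong_def\<close>)
  then have "(\<Sum>a<4 * j\<^sup>2. f a) = (\<Sum>a<4. \<Sum>c<j\<^sup>2. f (a * j\<^sup>2 + c * 4))"
    by (simp only: Fnat)
  also have "\<dots> = (\<Sum>a<4. \<Sum>c<j\<^sup>2. if r * a mod 4 = b then G (c * 4) else 0)"
  proof (intro sum.cong refl)
    fix a c
    have "G (a * j\<^sup>2 + c * 4) = G (c * 4)" by (rule Gcong) (simp add: cong_def)
    moreover have "r * (a * j\<^sup>2 + c * 4) mod 4 = r * a mod 4"
    proof -
      have "r * (a * j\<^sup>2 + c * 4) mod 4 = (r * a) * j\<^sup>2 mod 4"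
        by (simp add: distrib_left mult.assoc[symmetric])
      also have "\<dots> = (r * a) * (j\<^sup>2 mod 4) mod 4" by (rule mod_mult_right_eq[symmetric])
      finally show ?thesis by (simp add: j4)
    qed
    ultimately show "f (a * j\<^sup>2 + c * 4) = (if r * a mod 4 = b then G (c * 4) else 0)" by (simp add: f_def)
  qed
  also have "\<dots> = (\<Sum>a<4. if r * a mod 4 = b then (\<Sum>c<j\<^sup>2. G (c * 4)) else 0)"
    by (intro sum.cong) auto
  also have "\<dots> = (\<Sum>c<j\<^sup>2. G (c * 4))"
  proof -
    have X: "(\<Sum>a<4. if r * a mod 4 = b then x else 0) = x" for x :: real
    proof -
      have "{..<4} = {0, 1, 2, 3 :: nat}" by auto
      moreover have "r * a mod 4 = (r mod 4) * a mod 4" for a by (simp add: mod_mult_left_eq)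
      ultimately have "(\<Sum>a<4. if r * a mod 4 = b then x else 0) = (\<Sum>a\<in>{0, 1, 2, 3 :: nat}. if (r mod 4) * a mod 4 = b then x else 0)"
        by (simp only:)
      also have "\<dots> = x" using odd_mod_4[OF r(1)] b by (elim disjE) simp_all
      finally show ?thesis .
    qed
    show ?thesis by (rule X)
  qed
  also have "\<dots> = (\<Sum>c<j\<^sup>2. G c)"
  proof -
    have c4: "coprime (4 :: int) (int (j\<^sup>2))"
    proof -
      have "coprime (int 4) (int (j\<^sup>2))" using \<open>coprime 4 (j\<^sup>2)\<close> by (simp only: coprime_int_iff)
      then show ?thesis by simp
    qed
    have "(\<Sum>c<j\<^sup>2. real_of_int (PJ (int r * (4 * int c + 0)) (j\<^sup>2))) = (\<Sum>c<j\<^sup>2. real_of_int (PJ (int r * int c) (j\<^sup>2)))"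
      by (rule sum_residues_linear[where F = "\<lambda>x. real_of_int (PJ (int r * x) (j\<^sup>2))"])
        (use oj c4 in \<open>auto intro!: PJ_cong cong_scalar_left\<close>)
    then show ?thesis by (simp add: G_def mult.commute[of _ 4])
  qed
  also have "\<dots> = real (j\<^sup>2)"
    using sum_PJ_square_modulus[OF j r(2)] unfolding G_def by (metis of_int_of_nat_eq of_int_sum)
  finally have S: "(\<Sum>a<4 * j\<^sup>2. f a) = real (j\<^sup>2)" .
  have "\<bar>(\<Sum>t<K. f t) - real K * (\<Sum>t<4 * j\<^sup>2. f t) / real (4 * j\<^sup>2)\<bar> \<le> (\<Sum>t<4 * j\<^sup>2. f t)"
    using oj per nn by (intro sum_periodic_bounds) auto
  then have 1: "\<bar>class_sum r b (j\<^sup>2) Z - real K / 4\<bar> \<le> real (j\<^sup>2)"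
    unfolding cs S using oj by simp
  have "K * r \<le> Z + r - 1" "Z \<le> K * r"
  proof -
    show "K * r \<le> Z + r - 1" unfolding K_def by simp
    show "Z \<le> K * r"
    proof (rule ccontr)
      assume "\<not> Z \<le> K * r"
      then have "Suc K * r \<le> Z + r - 1" by simp
      then have "Suc K \<le> K" unfolding K_def by (subst less_eq_div_iff_mult_less_eq[OF rpos]) (simp add: K_def)
      then show False by simp
    qed
  qed
  then have "real (K * r) \<le> real (Z + r)" "real Z \<le> real (K * r)"
    by (simp_all only: of_nat_le_iff)
  then have "real K \<le> real Z / real r + 1" "real Z / real r \<le> real K"
    using rpos by (simp_all add: field_simps)
  moreover have "real Z / (4 * real r) = (real Z / real r) / 4" by simp
  ultimately have "\<bar>real K / 4 - real Z / (4 * real r)\<bar> \<le> 1 / 4" by linarith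
  moreover have "1 \<le> real (j\<^sup>2)" using oj by (metis One_nat_def Suc_leI of_nat_1 of_nat_le_iff)
  ultimately show ?thesis using 1 by linarith
qed

lemma class_sum_square:
  assumes r: "odd r" "squarefree r" and b: "b = 1 \<or> b = 3" and "j > 0"
  shows "\<bar>class_sum r b (j\<^sup>2) Z - real Z / (4 * real r)\<bar> \<le> 2 * real (j\<^sup>2)"
  using assms(4)
proof (induction j rule: less_induct)
  case (less j)
  show ?case
  proof (cases "odd j")
    case True
    then show ?thesis using class_sum_odd_square[OF r b] by blast
  next
    case False
    then obtain i where i: "j = 2 * i" by blast
    have odd_b: "odd n" if "n mod 4 = b" for n using that b by presburger
    have "class_sum r b (j\<^sup>2) Z = class_sum r b (i\<^sup>2) Z"
      unfolding class_sum_def using odd_b by (intro sum.cong) (auto simp: i power_mult_distrib PJ_4_mult)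
    moreover have "\<bar>class_sum r b (i\<^sup>2) Z - real Z / (4 * real r)\<bar> \<le> 2 * real (i\<^sup>2)"
      using less i by auto
    ultimately show ?thesis by (simp add: i power_mult_distrib)
  qed
qed

text \<open>Bounds the number of terms of \<open>PJ\<close>. It is bounded on average over long
  intervals, which is why it is kept as a factor until the last summation.\<close>

definition tau2 :: "nat \<Rightarrow> nat" where
  "tau2 n = card {d. d\<^sup>2 dvd n}"

text \<open>Only the primes of \<open>r\<close> outside \<open>d\<close> impose a condition on
  \<open>q\<close>: as \<open>r\<close> is squarefree, \<open>r / gcd r d\<close> is prime to
  \<open>d\<close>.\<close>

lemma squarefree_dvd_square_mult:
  assumes "squarefree (r::nat)" "r > 0"
  shows "r dvd d\<^sup>2 * q \<longleftrightarrow> r div gcd r d dvd q"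
proof
  define g r' where "g = gcd r d" and "r' = r div gcd r d"
  have gr: "r = g * r'" by (simp add: g_def r'_def)
  have gpos: "g > 0" using assms(2) by (simp add: g_def)
  {
    assume "r dvd d\<^sup>2 * q"
    have "coprime r' g"
    proof (rule coprimeI)
      fix c assume "c dvd r'" "c dvd g"
      then have "c\<^sup>2 dvd g * r'" unfolding power2_eq_square by (intro mult_dvd_mono)
      then show "is_unit c" using squarefreeD assms(1) gr by blast
    qed
    moreover have "coprime r' (d div g)"
      using div_gcd_coprime[of r d] assms(2) by (simp add: g_def r'_def)
    moreover have "d = g * (d div g)" by (simp add: g_def)
    ultimately have "coprime r' d" by (metis coprime_mult_right_iff)
    moreover have "r' dvd d * (d * q)"
      using \<open>r dvd d\<^sup>2 * q\<close> gr by (metis dvd_mult_right mult.assoc power2_eq_square)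
    ultimately show "r div gcd r d dvd q" unfolding r'_def[symmetric] by (simp add: coprime_dvd_mult_right_iff)
  }
  {
    assume "r div gcd r d dvd q"
    then have "g * r' dvd d * q" unfolding r'_def[symmetric] by (intro mult_dvd_mono) (simp add: g_def)
    then show "r dvd d\<^sup>2 * q" unfolding gr by (simp add: power2_eq_square mult.assoc)
  }
qed

text \<open>The sum over \<open>q\<close> is moved inside the sum over \<open>d^2 | k\<close>. There
  \<open>q = d^2 * r' * t\<close>, and \<open>t\<close> runs over a class modulo 4 with the symbol
  of the non-square \<open>k / d^2\<close>. The weight \<open>d\<close> is absorbed by
  \<open>d * sqrt (k / d^2) = sqrt k\<close>, so every \<open>d\<close> costs the same.\<close>

lemma class_sum_nonsquare:
  assumes r: "odd r" "squarefree r" and b: "b = 1 \<or> b = 3" and k: "k > 0" "\<nexists>s. k = s\<^sup>2"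
  shows "\<bar>class_sum r b k Z\<bar> \<le> 1536 * sqrt (real k) * (1 + ln (real k)) * real (tau2 k)"
proof -
  let ?B = "1536 * sqrt (real k) * (1 + ln (real k))"
  have rpos: "r > 0" using r by (auto simp: odd_pos)
  have odd_b: "odd n" if "n mod 4 = b" for n using that b by presburger
  let ?T = "\<lambda>d q. if q mod 4 = b \<and> r dvd q \<and> d\<^sup>2 dvd q then real d * real_of_int (Jacobi (int (k div d\<^sup>2)) (q div d\<^sup>2)) else 0"
  have "class_sum r b k Z = (\<Sum>q<Z. \<Sum>d | d\<^sup>2 dvd k. ?T d q)"
    unfolding class_sum_def
  proof (intro sum.cong refl)
    fix q
    show "(if q mod 4 = b \<and> r dvd q then real_of_int (PJ (int k) q) else 0) = (\<Sum>d | d\<^sup>2 dvd k. ?T d q)"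
    proof (cases "q mod 4 = b \<and> r dvd q")
      case True
      have "real_of_int (PJ (int k) q) = (\<Sum>d | d\<^sup>2 dvd q \<and> int (d\<^sup>2) dvd int k. real d * real_of_int (Jacobi (int (k div d\<^sup>2)) (q div d\<^sup>2)))"
        unfolding PJ_def of_int_sum by (simp add: zdiv_int)
      also have "\<dots> = (\<Sum>d | d\<^sup>2 dvd q \<and> d\<^sup>2 dvd k. real d * real_of_int (Jacobi (int (k div d\<^sup>2)) (q div d\<^sup>2)))"
        by (simp only: int_dvd_int_iff)
      also have "\<dots> = (\<Sum>d | d\<^sup>2 dvd k. ?T d q)"
        using k(1) True by (intro sum.mono_neutral_cong_left) auto
      finally show ?thesis using True by simp
    qed auto
  qed
  also have "\<dots> = (\<Sum>d | d\<^sup>2 dvd k. \<Sum>q<Z. ?T d q)" by (rule sum.swap)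
  finally have eq: "class_sum r b k Z = (\<Sum>d | d\<^sup>2 dvd k. \<Sum>q<Z. ?T d q)" .
  have "\<bar>\<Sum>d | d\<^sup>2 dvd k. \<Sum>q<Z. ?T d q\<bar> \<le> (\<Sum>d | d\<^sup>2 dvd k. ?B)"
  proof (rule order_trans[OF sum_abs], rule sum_mono)
    fix d assume "d \<in> {d. d\<^sup>2 dvd k}"
    then obtain k' where k': "k = d\<^sup>2 * k'" by auto
    have dpos: "d > 0" and k'pos: "k' > 0" using k k' by (auto intro: Nat.gr0I)
    have k'ns: "\<nexists>s. k' = s\<^sup>2" using k k' by (metis power_mult_distrib)
    have B0: "?B \<ge> 0" using k by simp
    show "\<bar>\<Sum>q<Z. ?T d q\<bar> \<le> ?B"
    proof (cases "odd d")
      case False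
      then have "?T d q = 0" for q using odd_b[of q] by (auto dest: dvd_trans[of "2" "d\<^sup>2" q])
      then have "(\<Sum>q<Z. ?T d q) = 0" by (intro sum.neutral) blast
      then show ?thesis using B0 by simp
    next
      case True
      define r' where "r' = r div gcd r d"
      have "r = gcd r d * r'" by (simp add: r'_def)
      then have or': "odd r'" using r by (metis even_mult_iff)
      then have r'pos: "r' > 0" by (rule odd_pos)
      define g where "g = d\<^sup>2 * r'"
      have gpos: "g > 0" using dpos r'pos by (simp add: g_def)
      have rg: "r dvd q \<and> d\<^sup>2 dvd q \<longleftrightarrow> g dvd q" for q
      proof
        assume "r dvd q \<and> d\<^sup>2 dvd q"
        then obtain x where x: "q = d\<^sup>2 * x" "r dvd d\<^sup>2 * x" by auto
        then have "r' dvd x" using squarefree_dvd_square_mult[OF r(2) rpos] by (simp add: r'_def)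
        then show "g dvd q" using x by (simp add: g_def)
      next
        assume "g dvd q"
        then obtain x where "q = g * x" by (rule dvdE)
        then have x: "q = d\<^sup>2 * (r' * x)" by (simp add: g_def mult.assoc)
        then have "r dvd q" using squarefree_dvd_square_mult[OF r(2) rpos, of d "r' * x"] by (simp add: r'_def)
        then show "r dvd q \<and> d\<^sup>2 dvd q" using x by simp
      qed
      define c where "c = b * r' mod 4"
      have c13: "c = 1 \<or> c = 3"
        using b odd_mod_4[OF or'] by (auto simp: c_def mod_mult_right_eq[of _ r' 4, symmetric])
      have d4: "d\<^sup>2 mod 4 = 1"
        using odd_mod_4[OF True] by (auto simp: power2_eq_square mod_mult_eq[of d 4 d, symmetric])
      have gmod: "g * t mod 4 = b \<longleftrightarrow> t mod 4 = c" for t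
      proof -
        have "g * t mod 4 = (d\<^sup>2 mod 4) * (r' * t) mod 4" by (simp add: g_def mod_mult_left_eq mult.assoc)
        also have "\<dots> = (r' mod 4) * (t mod 4) mod 4" by (simp add: d4 mod_mult_eq)
        finally have 1: "g * t mod 4 = (r' mod 4) * (t mod 4) mod 4" .
        have 2: "c = b * (r' mod 4) mod 4" by (simp add: c_def mod_mult_right_eq)
        have "t mod 4 = 0 \<or> t mod 4 = 1 \<or> t mod 4 = 2 \<or> t mod 4 = 3" by presburger
        then show ?thesis using 1 2 b odd_mod_4[OF or'] by auto
      qed
      have "(\<Sum>q<Z. ?T d q) = (\<Sum>q<Z. if g dvd q then (if q mod 4 = b then real d * real_of_int (Jacobi (int k') (q div d\<^sup>2)) else 0) else 0)"
        using rg k' dpos by (intro sum.cong refl) auto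
      also have "\<dots> = (\<Sum>t<(Z + g - 1) div g. if g * t mod 4 = b then real d * real_of_int (Jacobi (int k') (g * t div d\<^sup>2)) else 0)"
        by (rule sum_multiples_less[OF gpos])
      also have "\<dots> = (\<Sum>t<(Z + g - 1) div g. real d * real_of_int (Jacobi (int k') r') * (if t mod 4 = c then real_of_int (Jacobi (int k') t) else 0))"
      proof (intro sum.cong refl)
        fix t
        have "g * t div d\<^sup>2 = r' * t" using dpos by (simp add: g_def mult.assoc)
        moreover have "t > 0" if "t mod 4 = c" using that c13 by (auto intro: Nat.gr0I)
        ultimately show "(if g * t mod 4 = b then real d * real_of_int (Jacobi (int k') (g * t div d\<^sup>2)) else 0)
          = real d * real_of_int (Jacobi (int k') r') * (if t mod 4 = c then real_of_int (Jacobi (int k') t) else 0)"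
          using gmod r'pos by (simp add: Jacobi_mult_right)
      qed
      also have "\<dots> = real d * real_of_int (Jacobi (int k') r') * (\<Sum>t<(Z + g - 1) div g. if t mod 4 = c then real_of_int (Jacobi (int k') t) else 0)"
        by (simp only: sum_distrib_left)
      also have "\<bar>\<dots>\<bar> = real d * \<bar>real_of_int (Jacobi (int k') r')\<bar> * \<bar>\<Sum>t<(Z + g - 1) div g. if t mod 4 = c then real_of_int (Jacobi (int k') t) else 0\<bar>"
        by (simp add: abs_mult)
      also have "\<dots> \<le> real d * 1 * (1536 * sqrt (real k') * (1 + ln (real k')))"
        using Jacobi_class_sum[OF k'pos k'ns c13] abs_Jacobi_le_1[of "int k'" r']
        by (intro mult_mono) (auto simp flip: of_int_abs)
      also have "\<dots> = 1536 * sqrt (real k) * (1 + ln (real k'))"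
        by (simp add: k' real_sqrt_mult)
      also have "\<dots> \<le> ?B"
        using k' dpos k'pos by (intro mult_left_mono) auto
      finally show ?thesis .
    qed
  qed
  moreover have "(\<Sum>d | d\<^sup>2 dvd k. ?B) = real (tau2 k) * ?B" by (simp only: sum_constant tau2_def)
  ultimately show ?thesis by (simp only: eq mult.commute[of "real (tau2 k)"])
qed

lemma sum_inverse_squares_le: "n > 0 \<Longrightarrow> (\<Sum>d = 1..n. 1 / real d ^ 2) \<le> 2 - 1 / real n"
proof (induction n rule: nat_induct_non_zero)
  case (Suc n)
  have "1 / real (Suc n) ^ 2 \<le> 1 / (real n * real (Suc n))"
    using Suc by (intro divide_left_mono) (auto simp: power2_eq_square)
  also have "\<dots> = 1 / real n - 1 / real (Suc n)" using Suc by (simp add: field_simps)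
  finally show ?case using Suc by simp
qed simp

lemma sum_inverse_squares_le_2: "(\<Sum>d = 1..n. 1 / real d ^ 2) \<le> 2"
  using sum_inverse_squares_le[of n] by (cases "n = 0") (auto intro: order_trans)

lemma card_multiples_le:
  assumes "g > 0"
  shows "real (card {m \<in> {a<..a + h}. g dvd m}) \<le> real h / real g + 1"
proof -
  have "{m \<in> {a<..a + h}. g dvd m} \<subseteq> times g ` {a div g<..(a + h) div g}"
  proof
    fix m assume "m \<in> {m \<in> {a<..a + h}. g dvd m}"
    then obtain t where t: "m = g * t" "a < g * t" "g * t \<le> a + h" by auto
    have "a div g < t" using t(2) assms by (simp add: div_less_iff_less_mult mult.commute)
    moreover have "t \<le> (a + h) div g" using t(3) assms by (simp add: less_eq_div_iff_mult_less_eq mult.commute)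
    ultimately show "m \<in> times g ` {a div g<..(a + h) div g}" using t by auto
  qed
  then have "card {m \<in> {a<..a + h}. g dvd m} \<le> card {a div g<..(a + h) div g}"
    by (rule surj_card_le[OF finite_greaterThanAtMost])
  then have "card {m \<in> {a<..a + h}. g dvd m} \<le> (a + h) div g - a div g"
    by (simp only: card_greaterThanAtMost)
  moreover have "a div g \<le> (a + h) div g" by (simp add: div_le_mono)
  ultimately have 1: "real (card {m \<in> {a<..a + h}. g dvd m}) \<le> real ((a + h) div g) - real (a div g)"
    by linarith
  have "real ((a + h) div g * g) \<le> real (a + h)" by (simp only: of_nat_le_iff div_times_less_eq_dividend)
  then have 2: "real ((a + h) div g) \<le> real a / real g + real h / real g"
    using assms by (simp add: field_simps)
  have "a < (a div g + 1) * g" using dividend_less_times_div[of g a] assms by (simp add: mult.commute)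
  then have "real a < real ((a div g + 1) * g)" by (simp only: of_nat_less_iff)
  then have 3: "real a / real g < real (a div g) + 1" using assms by (simp add: field_simps)
  show ?thesis using 1 2 3 by linarith
qed

text \<open>Each \<open>d\<close> counts at most \<open>h / d^2 + 1\<close> multiples of
  \<open>d^2\<close>, only \<open>d <= sqrt (a + h)\<close> occur, and the sum of
  \<open>1 / d^2\<close> is at most 2.\<close>

lemma sum_tau2_le: "(\<Sum>m\<in>{a<..a + h}. real (tau2 m)) \<le> 2 * real h + sqrt (real (a + h))"
proof -
  define D where "D = nat \<lfloor>sqrt (real (a + h))\<rfloor>"
  have D: "real D \<le> sqrt (real (a + h))" by (simp add: D_def)
  have "(\<Sum>m\<in>{a<..a + h}. real (tau2 m)) = (\<Sum>m\<in>{a<..a + h}. \<Sum>d = 1..D. if d\<^sup>2 dvd m then 1 else 0)"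
  proof (rule sum.cong[OF refl])
    fix m assume m: "m \<in> {a<..a + h}"
    have "{d. d\<^sup>2 dvd m} = {d \<in> {1..D}. d\<^sup>2 dvd m}"
    proof (intro equalityI subsetI)
      fix d assume "d \<in> {d. d\<^sup>2 dvd m}"
      then have d: "d\<^sup>2 dvd m" by simp
      then have "d \<noteq> 0" using m by (auto intro: Nat.gr0I)
      moreover have "d\<^sup>2 \<le> a + h" using d m by (auto dest: dvd_imp_le)
      then have "real (d\<^sup>2) \<le> real (a + h)" by (simp only: of_nat_le_iff)
      then have "real d \<le> sqrt (real (a + h))" by (intro real_le_rsqrt) simp
      then have "d \<le> D" by (simp add: D_def le_nat_floor)
      ultimately show "d \<in> {d \<in> {1..D}. d\<^sup>2 dvd m}" using d by simp
    qed simp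
    then show "real (tau2 m) = (\<Sum>d = 1..D. if d\<^sup>2 dvd m then 1 else 0)"
      using sum.inter_filter[of "{1..D}" "\<lambda>_. 1 :: real" "\<lambda>d. d\<^sup>2 dvd m"] by (simp add: tau2_def)
  qed
  also have "\<dots> = (\<Sum>d = 1..D. \<Sum>m\<in>{a<..a + h}. if d\<^sup>2 dvd m then 1 else 0)" by (rule sum.swap)
  also have "\<dots> = (\<Sum>d = 1..D. real (card {m \<in> {a<..a + h}. d\<^sup>2 dvd m}))"
    by (simp add: sum.If_cases Int_def)
  also have "\<dots> \<le> (\<Sum>d = 1..D. real h * (1 / real d ^ 2) + 1)"
  proof (rule sum_mono)
    fix d assume "d \<in> {1..D}"
    then show "real (card {m \<in> {a<..a + h}. d\<^sup>2 dvd m}) \<le> real h * (1 / real d ^ 2) + 1"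
      using card_multiples_le[of "d\<^sup>2" a h] by simp
  qed
  also have "\<dots> = real h * (\<Sum>d = 1..D. 1 / real d ^ 2) + real D"
    by (simp only: sum.distrib sum_distrib_left[symmetric] sum_constant) simp
  also have "\<dots> \<le> real h * 2 + sqrt (real (a + h))"
    by (intro add_mono mult_left_mono sum_inverse_squares_le_2 D) simp
  finally show ?thesis by simp
qed

lemma card_odd_less: "card {j. j < n \<and> odd j} = n div 2"
proof (induction n)
  case (Suc n)
  have "{j. j < Suc n \<and> odd j} = (if odd n then insert n {j. j < n \<and> odd j} else {j. j < n \<and> odd j})"
    by (auto simp: less_Suc_eq)
  moreover have "finite {j. j < n \<and> odd j}" by simp
  ultimately show ?case using Suc by (auto split: if_splits)
qed simp

lemma card_odd_squares:
  assumes r: "odd r" and X: "X \<ge> 0"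
  shows "\<bar>real (card {j. odd j \<and> r dvd j \<and> j\<^sup>2 < nat \<lfloor>X\<rfloor> + 1}) - sqrt X / (2 * real r)\<bar> \<le> 1"
    "finite {j. odd j \<and> r dvd j \<and> j\<^sup>2 < nat \<lfloor>X\<rfloor> + 1}"
    "real (card {j. odd j \<and> r dvd j \<and> j\<^sup>2 < nat \<lfloor>X\<rfloor> + 1}) \<le> sqrt X + 1"
proof -
  have rpos: "r > 0" using r by (rule odd_pos)
  define y n where "y = sqrt X / real r" and "n = nat \<lfloor>y\<rfloor>"
  have y0: "y \<ge> 0" using X by (simp add: y_def)
  have iff: "(r * t)\<^sup>2 < nat \<lfloor>X\<rfloor> + 1 \<longleftrightarrow> t < n + 1" for t
  proof -
    have "(r * t)\<^sup>2 < nat \<lfloor>X\<rfloor> + 1 \<longleftrightarrow> (r * t)\<^sup>2 \<le> nat \<lfloor>X\<rfloor>" by auto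
    also have "\<dots> \<longleftrightarrow> real ((r * t)\<^sup>2) \<le> X" using X by (simp add: le_nat_iff le_floor_iff)
    also have "\<dots> \<longleftrightarrow> real (r * t) \<le> sqrt X" using real_le_rsqrt[of "real (r * t)" X] sqrt_ge_absD[of "real (r * t)" X]
      by auto
    also have "\<dots> \<longleftrightarrow> real t \<le> y" using rpos by (simp add: y_def field_simps)
    also have "\<dots> \<longleftrightarrow> t < n + 1" using y0 by (simp add: n_def le_nat_iff le_floor_iff less_Suc_eq_le)
    finally show ?thesis .
  qed
  have S: "{j. odd j \<and> r dvd j \<and> j\<^sup>2 < nat \<lfloor>X\<rfloor> + 1} = times r ` {t. t < n + 1 \<and> odd t}"
  proof (intro equalityI subsetI)
    fix j assume j: "j \<in> {j. odd j \<and> r dvd j \<and> j\<^sup>2 < nat \<lfloor>X\<rfloor> + 1}"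
    then have "r dvd j" by blast
    then obtain t where "j = r * t" by (rule dvdE)
    with j have t: "j = r * t" "odd (r * t)" "(r * t)\<^sup>2 < nat \<lfloor>X\<rfloor> + 1" by auto
    then have "t < n + 1" "odd t" using iff[of t] by auto
    then show "j \<in> times r ` {t. t < n + 1 \<and> odd t}" using t(1) by blast
  next
    fix j assume "j \<in> times r ` {t. t < n + 1 \<and> odd t}"
    then obtain t where t: "j = r * t" "t < n + 1" "odd t" by blast
    then have "(r * t)\<^sup>2 < nat \<lfloor>X\<rfloor> + 1" using iff[of t] by blast
    then show "j \<in> {j. odd j \<and> r dvd j \<and> j\<^sup>2 < nat \<lfloor>X\<rfloor> + 1}" using t r by auto
  qed
  then show "finite {j. odd j \<and> r dvd j \<and> j\<^sup>2 < nat \<lfloor>X\<rfloor> + 1}" by simp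
  have "card {j. odd j \<and> r dvd j \<and> j\<^sup>2 < nat \<lfloor>X\<rfloor> + 1} = (n + 1) div 2"
    unfolding S using rpos by (subst card_image) (auto simp: inj_on_def card_odd_less)
  moreover have "real n \<le> y" "y < real n + 1" using y0 by (simp_all add: n_def)
  moreover have "2 * ((n + 1) div 2) \<le> n + 1" "n \<le> 2 * ((n + 1) div 2)" by auto
  then have "2 * real ((n + 1) div 2) \<le> real n + 1" "real n \<le> 2 * real ((n + 1) div 2)" by linarith+
  ultimately have c: "\<bar>2 * real (card {j. odd j \<and> r dvd j \<and> j\<^sup>2 < nat \<lfloor>X\<rfloor> + 1}) - y\<bar> \<le> 1" by linarith
  have y2: "sqrt X / (2 * real r) = y / 2" by (simp add: y_def)
  show "\<bar>real (card {j. odd j \<and> r dvd j \<and> j\<^sup>2 < nat \<lfloor>X\<rfloor> + 1}) - sqrt X / (2 * real r)\<bar> \<le> 1"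
    unfolding y2 using c by linarith
  have "y \<le> sqrt X / 1" unfolding y_def using rpos X by (intro divide_left_mono) auto
  then show "real (card {j. odd j \<and> r dvd j \<and> j\<^sup>2 < nat \<lfloor>X\<rfloor> + 1}) \<le> sqrt X + 1"
    using c y0 by linarith
qed

lemma squarefree_dvd_square_iff:
  assumes "squarefree (r::nat)" "r > 0"
  shows "r dvd s\<^sup>2 \<longleftrightarrow> r dvd s"
proof
  assume "r dvd s\<^sup>2"
  then have "r div gcd r s dvd 1" using squarefree_dvd_square_mult[OF assms, of s 1] by simp
  then have "r = gcd r s" by (metis dvd_div_mult_self gcd_dvd1 mult_1 nat_dvd_1_iff_1)
  then show "r dvd s" by (metis gcd_dvd2)
qed (simp add: power2_eq_square)

text \<open>Square indices carry the main term, non-squares are absorbed by the mean value of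
  \<open>tau2\<close>. It serves both the sum over arguments \<open>m\<close> with
  \<open>f = Zsum\<close> and the sum over moduli divisible by \<open>r\<close>.\<close>

lemma odd_sum_split:
  fixes f :: "nat \<Rightarrow> real"
  assumes r: "odd r" "squarefree r" and X: "X \<ge> 1" and M: "M = nat \<lfloor>X\<rfloor> + 1"
    and sq: "\<And>j. odd j \<Longrightarrow> j\<^sup>2 < M \<Longrightarrow> \<bar>f (j\<^sup>2) - A\<bar> \<le> B" and B: "B \<ge> 0"
    and nsq: "\<And>m. odd m \<Longrightarrow> m < M \<Longrightarrow> \<nexists>s. m = s\<^sup>2 \<Longrightarrow> \<bar>f m\<bar> \<le> C * real (tau2 m)" and C: "C \<ge> 0"
  shows "\<bar>(\<Sum>m<M. if odd m \<and> r dvd m then f m else 0) - A * (sqrt X / (2 * real r))\<bar> \<le> \<bar>A\<bar> + 2 * sqrt X * B + 3 * C * X"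
proof -
  have rpos: "r > 0" using r by (auto simp: odd_pos)
  have sX: "sqrt X \<ge> 1" "sqrt X \<le> X" using X by (auto simp: real_le_lsqrt power2_eq_square)
  define S where "S = {j. odd j \<and> r dvd j \<and> j\<^sup>2 < M}"
  define N where "N = {m. m < M \<and> odd m \<and> r dvd m \<and> (\<nexists>s. m = s\<^sup>2)}"
  have S: "\<bar>real (card S) - sqrt X / (2 * real r)\<bar> \<le> 1" "finite S" "real (card S) \<le> sqrt X + 1"
    using card_odd_squares[OF r(1), of X] X unfolding S_def M by auto
  have inj: "inj_on (\<lambda>j. j\<^sup>2) S" by (auto simp: inj_on_def)
  have "(\<Sum>m<M. if odd m \<and> r dvd m then f m else 0) = (\<Sum>m\<in>(\<lambda>j. j\<^sup>2) ` S \<union> N. f m)"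
    by (rule sum.mono_neutral_cong_right)
      (use r rpos in \<open>auto simp: S_def N_def squarefree_dvd_square_iff\<close>)
  also have "\<dots> = (\<Sum>m\<in>(\<lambda>j. j\<^sup>2) ` S. f m) + (\<Sum>m\<in>N. f m)"
    by (rule sum.union_disjoint) (use S in \<open>auto simp: N_def\<close>)
  also have "(\<Sum>m\<in>(\<lambda>j. j\<^sup>2) ` S. f m) = (\<Sum>j\<in>S. f (j\<^sup>2))"
    using sum.reindex[OF inj] by simp
  finally have eq: "(\<Sum>m<M. if odd m \<and> r dvd m then f m else 0) - A * (sqrt X / (2 * real r))
      = (\<Sum>j\<in>S. f (j\<^sup>2) - A) + A * (real (card S) - sqrt X / (2 * real r)) + (\<Sum>m\<in>N. f m)"
    by (simp add: sum_subtractf algebra_simps)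
  have "\<bar>\<Sum>j\<in>S. f (j\<^sup>2) - A\<bar> \<le> (\<Sum>j\<in>S. B)"
    by (rule order_trans[OF sum_abs], rule sum_mono) (auto simp: S_def intro: sq)
  also have "\<dots> \<le> 2 * sqrt X * B" 
  proof -
    have "real (card S) \<le> 2 * sqrt X" using S(3) sX by linarith
    from mult_right_mono[OF this B] show ?thesis by simp
  qed
  finally have 1: "\<bar>\<Sum>j\<in>S. f (j\<^sup>2) - A\<bar> \<le> 2 * sqrt X * B" .
  have 2: "\<bar>A * (real (card S) - sqrt X / (2 * real r))\<bar> \<le> \<bar>A\<bar>"
    unfolding abs_mult using S(1) by (simp add: mult_left_le)
  have "\<bar>\<Sum>m\<in>N. f m\<bar> \<le> (\<Sum>m\<in>N. C * real (tau2 m))"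
    by (rule order_trans[OF sum_abs], rule sum_mono) (auto simp: N_def intro: nsq)
  also have "\<dots> \<le> (\<Sum>m\<in>{0<..0 + nat \<lfloor>X\<rfloor>}. C * real (tau2 m))"
    using C by (intro sum_mono2) (auto simp: N_def M intro: Nat.gr0I)
  also have "\<dots> \<le> C * (2 * real (nat \<lfloor>X\<rfloor>) + sqrt (real (0 + nat \<lfloor>X\<rfloor>)))"
    unfolding sum_distrib_left[symmetric] by (intro mult_left_mono sum_tau2_le C)
  also have "\<dots> \<le> C * (3 * X)"
  proof -
    have "real (nat \<lfloor>X\<rfloor>) \<le> X" using X by simp
    then have "sqrt (real (0 + nat \<lfloor>X\<rfloor>)) \<le> sqrt X" by simp
    then have "2 * real (nat \<lfloor>X\<rfloor>) + sqrt (real (0 + nat \<lfloor>X\<rfloor>)) \<le> 3 * X"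
      using \<open>real (nat \<lfloor>X\<rfloor>) \<le> X\<close> sX by linarith
    then show ?thesis by (rule mult_left_mono[OF _ C])
  qed
  finally have 3: "\<bar>\<Sum>m\<in>N. f m\<bar> \<le> 3 * C * X" by simp
  show ?thesis unfolding eq using 1 2 3 by linarith
qed

section \<open>The ranges where one variable dominates\<close>

definition Zsum :: "nat \<Rightarrow> nat \<Rightarrow> nat \<Rightarrow> real" where
  "Zsum r m N = (\<Sum>q<N. if odd q \<and> r dvd q then real_of_int (PJ (int m) q) else 0)"

text \<open>The limits are exclusive, so \<open>m <= X\<close> and \<open>q <= Q\<close>. In the
  application \<open>Q\<close> is \<open>l * Y\<close> divided by a square, and \<open>r\<close> is
  a divisor of \<open>l\<close>.\<close>

definition SP :: "nat \<Rightarrow> real \<Rightarrow> real \<Rightarrow> real" where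
  "SP r X Q = (\<Sum>m<nat \<lfloor>X\<rfloor> + 1. if odd m then Zsum r m (nat \<lfloor>Q\<rfloor> + 1) else 0)"

lemma Zsum_class_sum: "Zsum r m N = class_sum r 1 m N + class_sum r 3 m N"
  unfolding Zsum_def class_sum_def sum.distrib[symmetric]
proof (rule sum.cong[OF refl])
  fix q :: nat
  have "odd q \<longleftrightarrow> q mod 4 = 1 \<or> q mod 4 = 3" by presburger
  then show "(if odd q \<and> r dvd q then real_of_int (PJ (int m) q) else 0) =
    (if q mod 4 = 1 \<and> r dvd q then real_of_int (PJ (int m) q) else 0) +
    (if q mod 4 = 3 \<and> r dvd q then real_of_int (PJ (int m) q) else 0)" by auto
qed

lemma Zsum_square:
  assumes "odd r" "squarefree r" "j > 0"
  shows "\<bar>Zsum r (j\<^sup>2) N - real N / (2 * real r)\<bar> \<le> 4 * real (j\<^sup>2)"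
proof -
  have "real N / (2 * real r) = real N / (4 * real r) + real N / (4 * real r)" by simp
  then show ?thesis
    using class_sum_square[OF assms(1,2) _ assms(3), of 1 N] class_sum_square[OF assms(1,2) _ assms(3), of 3 N]
    unfolding Zsum_class_sum by linarith
qed

lemma Zsum_nonsquare:
  assumes "odd r" "squarefree r" "m > 0" "\<nexists>s. m = s\<^sup>2"
  shows "\<bar>Zsum r m N\<bar> \<le> 3072 * sqrt (real m) * (1 + ln (real m)) * real (tau2 m)"
  using class_sum_nonsquare[OF assms(1,2) _ assms(3,4), of 1 N] class_sum_nonsquare[OF assms(1,2) _ assms(3,4), of 3 N]
  unfolding Zsum_class_sum by linarith

text \<open>There are about \<open>sqrt X / 2\<close> odd squares \<open>m\<close>, each with mean
  \<open>1 / (2 r)\<close> in \<open>q\<close>; the other \<open>m\<close> contribute only through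
  the Polya-Vinogradov bound.\<close>

lemma SP_large:
  assumes r: "odd r" "squarefree r" and X: "X \<ge> 1" and Q: "Q \<ge> 1"
  shows "\<bar>SP r X Q - Q * sqrt X / (4 * real r)\<bar> \<le> 10000 * (Q + X * sqrt X * (1 + ln X))"
proof -
  define M N where "M = nat \<lfloor>X\<rfloor> + 1" and "N = nat \<lfloor>Q\<rfloor> + 1"
  have rpos: "real r \<ge> 1" using r by (simp add: Suc_leI odd_pos)
  have MX: "real m \<le> X" if "m < M" for m using that X by (simp add: M_def) linarith
  have N: "Q \<le> real N" "real N \<le> Q + 1" using Q by (simp_all add: N_def) linarith+
  have sX: "sqrt X \<ge> 1" "sqrt X \<le> X" using X by (auto simp: real_le_lsqrt power2_eq_square)
  have L: "ln X \<ge> 0" using X by simp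
  let ?C = "3072 * sqrt X * (1 + ln X)"
  have "\<bar>(\<Sum>m<M. if odd m \<and> 1 dvd m then Zsum r m N else 0) - real N / (2 * real r) * (sqrt X / (2 * real 1))\<bar>
      \<le> \<bar>real N / (2 * real r)\<bar> + 2 * sqrt X * (4 * X) + 3 * ?C * X"
  proof (rule odd_sum_split)
    show "\<bar>Zsum r (j\<^sup>2) N - real N / (2 * real r)\<bar> \<le> 4 * X" if "odd j" "j\<^sup>2 < M" for j
      using Zsum_square[OF r, of j N] odd_pos[OF that(1)] MX[OF that(2)] by linarith
    show "\<bar>Zsum r m N\<bar> \<le> ?C * real (tau2 m)" if m: "odd m" "m < M" "\<nexists>s. m = s\<^sup>2" for m
    proof -
      have "m > 0" using m odd_pos by blast
      then have "\<bar>Zsum r m N\<bar> \<le> 3072 * sqrt (real m) * (1 + ln (real m)) * real (tau2 m)"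
        by (rule Zsum_nonsquare[OF r _ m(3)])
      also have "\<dots> \<le> ?C * real (tau2 m)"
        using MX[OF m(2)] \<open>m > 0\<close> X by (intro mult_right_mono mult_mono) auto
      finally show ?thesis .
    qed
  qed (use X L in \<open>auto simp: M_def\<close>)
  moreover have "(\<Sum>m<M. if odd m \<and> 1 dvd m then Zsum r m N else 0) = SP r X Q"
    unfolding SP_def M_def[symmetric] N_def[symmetric] by simp
  moreover have "\<bar>real N / (2 * real r)\<bar> \<le> Q"
  proof -
    have "real N / (2 * real r) \<le> real N / 2" using rpos by (intro divide_left_mono) auto
    then show ?thesis using N Q rpos by simp
  qed
  moreover have "\<bar>real N / (2 * real r) * (sqrt X / (2 * real 1)) - Q * sqrt X / (4 * real r)\<bar> \<le> X * sqrt X"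
  proof -
    have "real N / (2 * real r) * (sqrt X / (2 * real 1)) - Q * sqrt X / (4 * real r) = (real N - Q) * (sqrt X / (4 * real r))"
      using rpos by (simp add: field_simps)
    moreover have "sqrt X / (4 * real r) \<le> sqrt X / 1" using rpos sX by (intro divide_left_mono) auto
    then have "(real N - Q) * (sqrt X / (4 * real r)) \<le> 1 * sqrt X"
      using N rpos X by (intro mult_mono) auto
    moreover have "(real N - Q) * (sqrt X / (4 * real r)) \<ge> 0" using N rpos X by (intro mult_nonneg_nonneg) auto
    moreover have "sqrt X \<le> X * sqrt X" using X sX by simp
    ultimately show ?thesis by linarith
  qed
  moreover have "2 * sqrt X * (4 * X) + 3 * ?C * X + X * sqrt X \<le> 10000 * (X * sqrt X * (1 + ln X))"
  proof -
    define W where "W = X * sqrt X * (1 + ln X)"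
    have "2 * sqrt X * (4 * X) = 8 * (X * sqrt X)" by simp
    moreover have "3 * ?C * X = 9216 * W" by (simp add: W_def)
    moreover have "X * sqrt X \<le> W" using X L by (simp add: W_def)
    moreover have "0 \<le> W" using X L by (simp add: W_def)
    ultimately have "2 * sqrt X * (4 * X) + 3 * ?C * X + X * sqrt X \<le> 10000 * W" by linarith
    then show ?thesis by (simp only: W_def)
  qed
  moreover have "10000 * (Q + X * sqrt X * (1 + ln X)) = 10000 * Q + 10000 * (X * sqrt X * (1 + ln X))"
    by (rule distrib_left)
  moreover have "\<bar>u - d\<bar> \<le> T" if "\<bar>s - b\<bar> \<le> a + c + e" "s = u" "a \<le> Q" "\<bar>b - d\<bar> \<le> v"
    "c + e + v \<le> w" "T = 10000 * Q + w" for s b a c e u d v w T :: real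
    using that Q by linarith
  ultimately show ?thesis by blast
qed

text \<open>\<open>PJ_square_commute\<close> exchanges argument and modulus, so this is
  \<open>Zsum_square\<close> with \<open>r = 1\<close>.\<close>

lemma PJ_sum_square_modulus:
  assumes "odd s"
  shows "\<bar>(\<Sum>m<M. if odd m then real_of_int (PJ (int m) (s\<^sup>2)) else 0) - real M / 2\<bar> \<le> 4 * real (s\<^sup>2)"
proof -
  have "(\<Sum>m<M. if odd m then real_of_int (PJ (int m) (s\<^sup>2)) else 0) = Zsum 1 (s\<^sup>2) M"
    unfolding Zsum_def using PJ_square_commute[OF _ assms] by (intro sum.cong) auto
  then show ?thesis using Zsum_square[of 1 s M] odd_pos[OF assms] by simp
qed

lemma PJ_sum_nonsquare_modulus:
  assumes q: "odd q" "\<nexists>s. q = s\<^sup>2"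
  shows "\<bar>\<Sum>m<M. if odd m then real_of_int (PJ (int m) q) else 0\<bar> \<le> 1536 * sqrt (real q) * (1 + ln (real q)) * real (tau2 q)"
proof -
  let ?B = "1536 * sqrt (real q) * (1 + ln (real q))"
  let ?T = "\<lambda>d m. if odd m \<and> d\<^sup>2 dvd m then real d * real_of_int (Jacobi (int (m div d\<^sup>2)) (q div d\<^sup>2)) else 0"
  have qpos: "q > 0" using q odd_pos by blast
  have "(\<Sum>m<M. if odd m then real_of_int (PJ (int m) q) else 0) = (\<Sum>m<M. \<Sum>d | d\<^sup>2 dvd q. ?T d m)"
  proof (rule sum.cong[OF refl])
    fix m
    have "real_of_int (PJ (int m) q) = (\<Sum>d | d\<^sup>2 dvd q \<and> int (d\<^sup>2) dvd int m. real d * real_of_int (Jacobi (int (m div d\<^sup>2)) (q div d\<^sup>2)))"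
      unfolding PJ_def of_int_sum by (simp add: zdiv_int)
    also have "\<dots> = (\<Sum>d | d\<^sup>2 dvd q \<and> d\<^sup>2 dvd m. real d * real_of_int (Jacobi (int (m div d\<^sup>2)) (q div d\<^sup>2)))"
      by (simp only: int_dvd_int_iff)
    also have "odd m \<Longrightarrow> \<dots> = (\<Sum>d | d\<^sup>2 dvd q. ?T d m)"
      using qpos by (intro sum.mono_neutral_cong_left) auto
    finally show "(if odd m then real_of_int (PJ (int m) q) else 0) = (\<Sum>d | d\<^sup>2 dvd q. ?T d m)"
      by auto
  qed
  also have "\<dots> = (\<Sum>d | d\<^sup>2 dvd q. \<Sum>m<M. ?T d m)" by (rule sum.swap)
  finally have eq: "(\<Sum>m<M. if odd m then real_of_int (PJ (int m) q) else 0) = (\<Sum>d | d\<^sup>2 dvd q. \<Sum>m<M. ?T d m)" .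
  have "\<bar>\<Sum>d | d\<^sup>2 dvd q. \<Sum>m<M. ?T d m\<bar> \<le> (\<Sum>d | d\<^sup>2 dvd q. ?B)"
  proof (rule order_trans[OF sum_abs], rule sum_mono)
    fix d assume "d \<in> {d. d\<^sup>2 dvd q}"
    then have d: "d\<^sup>2 dvd q" by simp
    note sd = square_divisor_odd[OF q(1) d]
    define q' where "q' = q div d\<^sup>2"
    have q': "q = d\<^sup>2 * q'" "odd q'" "q' > 0" using sd by (simp_all add: q'_def)
    have ns: "\<nexists>s. q' = s\<^sup>2" using q q' by (metis power_mult_distrib)
    have gpos: "d\<^sup>2 > 0" using sd by simp
    have "(\<Sum>m<M. ?T d m) = (\<Sum>m<M. if d\<^sup>2 dvd m then (if odd m then real d * real_of_int (Jacobi (int (m div d\<^sup>2)) q') else 0) else 0)"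
      unfolding q'_def by (intro sum.cong) auto
    also have "\<dots> = (\<Sum>t<(M + d\<^sup>2 - 1) div d\<^sup>2. if odd (d\<^sup>2 * t) then real d * real_of_int (Jacobi (int (d\<^sup>2 * t div d\<^sup>2)) q') else 0)"
      by (rule sum_multiples_less[OF gpos])
    also have "\<dots> = real d * (\<Sum>t<(M + d\<^sup>2 - 1) div d\<^sup>2. if odd t then real_of_int (Jacobi (int t) q') else 0)"
      unfolding sum_distrib_left using sd by (intro sum.cong) auto
    finally have "\<bar>\<Sum>m<M. ?T d m\<bar> = real d * \<bar>\<Sum>t<(M + d\<^sup>2 - 1) div d\<^sup>2. if odd t then real_of_int (Jacobi (int t) q') else 0\<bar>"
      by (simp add: abs_mult)
    also have "\<dots> \<le> real d * (1536 * sqrt (real q') * (1 + ln (real q')))"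
      by (intro mult_left_mono Jacobi_odd_sum q' ns) simp
    also have "\<dots> = 1536 * sqrt (real q) * (1 + ln (real q'))" by (simp add: q'(1) real_sqrt_mult)
    also have "\<dots> \<le> ?B" using q' sd by (intro mult_left_mono) auto
    finally show "\<bar>\<Sum>m<M. ?T d m\<bar> \<le> ?B" .
  qed
  moreover have "(\<Sum>d | d\<^sup>2 dvd q. ?B) = real (tau2 q) * ?B" by (simp only: sum_constant tau2_def)
  ultimately show ?thesis by (simp only: eq mult.commute[of "real (tau2 q)"])
qed

text \<open>The mirror image of \<open>SP_large\<close>: about \<open>sqrt Q / (2 r)\<close> odd
  squares \<open>q\<close> are divisible by \<open>r\<close>, each contributing about
  \<open>X / 2\<close>.\<close>

lemma SP_small:
  assumes r: "odd r" "squarefree r" and X: "X \<ge> 1" and Q: "Q \<ge> 1"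
  shows "\<bar>SP r X Q - X * sqrt Q / (4 * real r)\<bar> \<le> 10000 * (X + Q * sqrt Q * (1 + ln Q))"
proof -
  define M N where "M = nat \<lfloor>X\<rfloor> + 1" and "N = nat \<lfloor>Q\<rfloor> + 1"
  define Y where "Y q = (\<Sum>m<M. if odd m then real_of_int (PJ (int m) q) else 0)" for q
  have rpos: "real r \<ge> 1" using r by (simp add: Suc_leI odd_pos)
  have NQ: "real q \<le> Q" if "q < N" for q using that Q by (simp add: N_def) linarith
  have M: "X \<le> real M" "real M \<le> X + 1" using X by (simp_all add: M_def) linarith+
  have sQ: "sqrt Q \<ge> 1" "sqrt Q \<le> Q" using Q by (auto simp: real_le_lsqrt power2_eq_square)
  have L: "ln Q \<ge> 0" using Q by simp
  let ?C = "1536 * sqrt Q * (1 + ln Q)"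
  have "\<bar>(\<Sum>q<N. if odd q \<and> r dvd q then Y q else 0) - real M / 2 * (sqrt Q / (2 * real r))\<bar>
      \<le> \<bar>real M / 2\<bar> + 2 * sqrt Q * (4 * Q) + 3 * ?C * Q"
  proof (rule odd_sum_split[OF r])
    show "\<bar>Y (j\<^sup>2) - real M / 2\<bar> \<le> 4 * Q" if "odd j" "j\<^sup>2 < N" for j
      using PJ_sum_square_modulus[OF that(1), of M] NQ[OF that(2)] unfolding Y_def by linarith
    show "\<bar>Y q\<bar> \<le> ?C * real (tau2 q)" if q: "odd q" "q < N" "\<nexists>s. q = s\<^sup>2" for q
    proof -
      have "q > 0" using q odd_pos by blast
      have "\<bar>Y q\<bar> \<le> 1536 * sqrt (real q) * (1 + ln (real q)) * real (tau2 q)"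
        unfolding Y_def by (rule PJ_sum_nonsquare_modulus[OF q(1,3)])
      also have "\<dots> \<le> ?C * real (tau2 q)"
        using NQ[OF q(2)] \<open>q > 0\<close> Q by (intro mult_right_mono mult_mono) auto
      finally show ?thesis .
    qed
  qed (use Q L in \<open>auto simp: N_def\<close>)
  moreover have "(\<Sum>q<N. if odd q \<and> r dvd q then Y q else 0) = SP r X Q"
  proof -
    have "SP r X Q = (\<Sum>m<M. \<Sum>q<N. if odd m \<and> odd q \<and> r dvd q then real_of_int (PJ (int m) q) else 0)"
      unfolding SP_def Zsum_def M_def[symmetric] N_def[symmetric] by (intro sum.cong) auto
    also have "\<dots> = (\<Sum>q<N. if odd q \<and> r dvd q then Y q else 0)"
      unfolding Y_def by (subst sum.swap) (intro sum.cong, auto)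
    finally show ?thesis by simp
  qed
  moreover have "\<bar>real M / 2\<bar> \<le> X" using M X by simp
  moreover have "\<bar>real M / 2 * (sqrt Q / (2 * real r)) - X * sqrt Q / (4 * real r)\<bar> \<le> Q * sqrt Q"
  proof -
    have "real M / 2 * (sqrt Q / (2 * real r)) - X * sqrt Q / (4 * real r) = (real M - X) * (sqrt Q / (4 * real r))"
      using rpos by (simp add: field_simps)
    moreover have "sqrt Q / (4 * real r) \<le> sqrt Q / 1" using rpos sQ by (intro divide_left_mono) auto
    then have "(real M - X) * (sqrt Q / (4 * real r)) \<le> 1 * sqrt Q"
      using M rpos Q by (intro mult_mono) auto
    moreover have "(real M - X) * (sqrt Q / (4 * real r)) \<ge> 0" using M rpos Q by (intro mult_nonneg_nonneg) auto
    moreover have "sqrt Q \<le> Q * sqrt Q" using Q sQ by simp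
    ultimately show ?thesis by linarith
  qed
  moreover have "2 * sqrt Q * (4 * Q) + 3 * ?C * Q + Q * sqrt Q \<le> 10000 * (Q * sqrt Q * (1 + ln Q))"
  proof -
    define W where "W = Q * sqrt Q * (1 + ln Q)"
    have "2 * sqrt Q * (4 * Q) = 8 * (Q * sqrt Q)" by simp
    moreover have "3 * ?C * Q = 4608 * W" by (simp add: W_def)
    moreover have "Q * sqrt Q \<le> W" using Q L by (simp add: W_def)
    moreover have "0 \<le> W" using Q L by (simp add: W_def)
    ultimately have "2 * sqrt Q * (4 * Q) + 3 * ?C * Q + Q * sqrt Q \<le> 10000 * W" by linarith
    then show ?thesis by (simp only: W_def)
  qed
  moreover have "10000 * (X + Q * sqrt Q * (1 + ln Q)) = 10000 * X + 10000 * (Q * sqrt Q * (1 + ln Q))"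
    by (rule distrib_left)
  moreover have "\<bar>u - d\<bar> \<le> T" if "\<bar>s - b\<bar> \<le> a + c + e" "s = u" "a \<le> X" "\<bar>b - d\<bar> \<le> v"
    "c + e + v \<le> w" "T = 10000 * X + w" for s b a c e u d v w T :: real
    using that X by linarith
  ultimately show ?thesis by blast
qed

section \<open>The dual sum\<close>

text \<open>Opposite frequencies pair to a cosine for moduli congruent to 1 modulo 4 and to a sine
  for moduli congruent to 3, where \<open>PJ\<close> is odd in its argument.\<close>

definition trig :: "nat \<Rightarrow> real \<Rightarrow> real" where
  "trig b x = (if b = 1 then cos (2 * pi * x) else sin (2 * pi * x))"

lemma cise_plus_cnj: "cise x + cnj (cise x) = of_real (2 * cos (2 * pi * x))"
  by (simp add: cise_def complex_eq_iff)

lemma cise_minus_cnj: "cise x - cnj (cise x) = \<i> * of_real (2 * sin (2 * pi * x))"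
  by (simp add: cise_def complex_eq_iff)

lemma cise_half_int: "cise (of_int b / 2) = (if even b then 1 else - 1)"
proof (cases "even b")
  case True
  then obtain c where "b = 2 * c" by blast
  then show ?thesis by simp
next
  case False
  then obtain c where b: "b = 2 * c + 1" by (elim oddE)
  have "cise (of_int b / 2) = cise (of_int c) * cise (1 / 2)"
    unfolding cise_add[symmetric] by (simp add: b add_divide_distrib)
  then show ?thesis using False by (simp add: cise_def)
qed

text \<open>Frequencies are written as \<open>h * b\<close> with \<open>h = (q + 1) / 2\<close> the
  inverse of 2. Modulo 1, \<open>h * b * (2 u + 1) / q\<close> equals
  \<open>b / 2 + b * (u + 1/2) / q\<close>: stepping through odd arguments then has the small
  frequency \<open>b / q\<close>, and the term \<open>b / 2\<close> becomes a sign. Since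
  \<open>(h/q) = (2/q)\<close>, the coefficient is \<open>PJ (2 b)\<close>.\<close>

lemma PJ_dual_centered:
  assumes q: "q = 2 * p + 1"
  shows "eps q * sqrt (real q) * of_int (PJ (int (2 * u + 1)) q)
    = (\<Sum>b = - int p..int p. (if even b then 1 else - 1) * of_int (PJ (2 * b) q) * cise (of_int b * (real u + 1 / 2) / real q))"
proof -
  have oq: "odd q" "q > 0" using q by auto
  define h where "h = int p + 1"
  have h2: "2 * h = int q + 1" by (simp add: h_def q)
  let ?F = "\<lambda>a. of_int (PJ a q) * cise (of_int a * of_int (int (2 * u + 1)) / real q) :: complex"
  have per: "?F a = ?F b" if "[a = b] (mod int q)" for a b
  proof -
    have "[a * int (2 * u + 1) = b * int (2 * u + 1)] (mod int q)" using that by (rule cong_scalar_right)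
    from cise_cong[OF this oq(2)] show ?thesis using PJ_cong[OF that oq(2)] by (simp only: of_int_mult)
  qed
  have "[2 * h = 1] (mod int q)" by (simp add: h2 cong_iff_dvd_diff)
  then have cop: "coprime h (int q)"
    by (metis cong_imp_coprime coprime_1_left coprime_mult_left_iff cong_sym)
  have J: "Jacobi h q = Jacobi 2 q"
  proof -
    have "Jacobi 2 q * Jacobi h q = 1"
      using Jacobi_cong[OF \<open>[2 * h = 1] (mod int q)\<close>] oq by (simp add: Jacobi_mult_left)
    then show ?thesis using Jacobi_2[OF oq(1)] by (auto split: if_splits)
  qed
  have "eps q * sqrt (real q) * of_int (PJ (int (2 * u + 1)) q) = (\<Sum>a<q. ?F (int a))"
    using PJ_self_dual[OF oq(1), of "int (2 * u + 1)"] by (simp only: of_int_of_nat_eq)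
  also have "\<dots> = (\<Sum>i<q. ?F (h * int i + (- h * int p)))"
    by (rule sum_residues_linear[where F = ?F, OF oq(2) per cop, symmetric])
  also have "\<dots> = (\<Sum>i<q. (\<lambda>b. ?F (h * b)) (int i - int p))"
    by (simp add: algebra_simps)
  also have "\<dots> = (\<Sum>b = - int p..int p. ?F (h * b))"
    by (rule sum.reindex_bij_witness[where i = "\<lambda>b. nat (b + int p)" and j = "\<lambda>i. int i - int p"]) (auto simp: q)
  also have "\<dots> = (\<Sum>b = - int p..int p. (if even b then 1 else - 1) * of_int (PJ (2 * b) q) * cise (of_int b * (real u + 1 / 2) / real q))"
  proof (rule sum.cong[OF refl])
    fix b
    have "PJ (h * b) q = PJ (2 * b) q"
      using PJ_mult_coprime[OF oq(1) cop] PJ_2_mult[OF oq(1)] J by simp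
    moreover have "of_int (h * b) * of_int (int (2 * u + 1)) / real q
       = of_int (b * int u) + of_int b / 2 + of_int b * (real u + 1 / 2) / real q"
    proof -
      have "2 * real_of_int h = real q + 1" using h2 by linarith
      then have hr: "real_of_int h = (real q + 1) / 2" by simp
      show ?thesis using oq by (simp add: hr field_simps)
    qed
    then have "cise (of_int (h * b) * of_int (int (2 * u + 1)) / real q)
       = (if even b then 1 else - 1) * cise (of_int b * (real u + 1 / 2) / real q)"
      by (simp only: cise_add cise_of_int cise_half_int mult_1)
    ultimately show "?F (h * b) = (if even b then 1 else - 1) * of_int (PJ (2 * b) q) * cise (of_int b * (real u + 1 / 2) / real q)"
      by (simp only: mult_ac)
  qed
  finally show ?thesis .
qed

lemma sum_symmetric_int:
  fixes F :: "int \<Rightarrow> 'a :: comm_monoid_add"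
  shows "(\<Sum>b = - int p..int p. F b) = F 0 + (\<Sum>k = 1..p. F (int k) + F (- int k))"
proof (induction p)
  case (Suc p)
  have "{- int (Suc p)..int (Suc p)} = insert (int (Suc p)) (insert (- int (Suc p)) {- int p..int p})" by auto
  then show ?case using Suc by (simp add: ac_simps)
qed simp

text \<open>Pairing \<open>k\<close> with \<open>-k\<close> by the parity of \<open>PJ\<close> makes
  each pair a real multiple of \<open>eps q\<close>, so the phase cancels and a real identity
  remains.\<close>

lemma PJ_dual:
  assumes q: "odd q" and b: "q mod 4 = b"
  shows "sqrt (real q) * real_of_int (PJ (int (2 * u + 1)) q) = real_of_int (PJ 0 q) +
    2 * (\<Sum>k = 1..q div 2. (- 1) ^ k * real_of_int (PJ (int (2 * k)) q) * trig b (real k * (real u + 1 / 2) / real q))"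
proof -
  define p where "p = q div 2"
  have qp: "q = 2 * p + 1" using q by (simp add: p_def)
  let ?x = "\<lambda>k. real k * (real u + 1 / 2) / real q"
  let ?s = "\<lambda>k::nat. if even k then 1 else - 1 :: complex"
  let ?g = "if b = 1 then 1 else - 1 :: complex"
  have "eps q * sqrt (real q) * of_int (PJ (int (2 * u + 1)) q)
     = of_int (PJ 0 q) + (\<Sum>k = 1..p. ?s k * of_int (PJ (int (2 * k)) q) * (cise (?x k) + ?g * cnj (cise (?x k))))"
    unfolding PJ_dual_centered[OF qp] sum_symmetric_int
  proof (intro arg_cong2[where f = "(+)"] sum.cong refl)
    fix k
    have "PJ (2 * - int k) q = (if b = 1 then 1 else - 1) * PJ (int (2 * k)) q"
      using PJ_minus[OF q, of "int (2 * k)"] b by simp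
    moreover have "cise (of_int (- int k) * (real u + 1 / 2) / real q) = cnj (cise (?x k))"
      by (simp flip: cise_minus)
    ultimately show "(if even (int k) then 1 else - 1) * of_int (PJ (2 * int k) q) * cise (of_int (int k) * (real u + 1 / 2) / real q) +
      (if even (- int k) then 1 else - 1) * of_int (PJ (2 * - int k) q) * cise (of_int (- int k) * (real u + 1 / 2) / real q)
      = ?s k * of_int (PJ (int (2 * k)) q) * (cise (?x k) + ?g * cnj (cise (?x k)))"
      by (simp add: algebra_simps)
  qed simp
  also have "(\<Sum>k = 1..p. ?s k * of_int (PJ (int (2 * k)) q) * (cise (?x k) + ?g * cnj (cise (?x k))))
     = (\<Sum>k = 1..p. eps q * of_real (2 * ((- 1) ^ k * real_of_int (PJ (int (2 * k)) q) * trig b (?x k))))"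
  proof (rule sum.cong[OF refl])
    fix k
    have "cise (?x k) + ?g * cnj (cise (?x k)) = eps q * of_real (2 * trig b (?x k))"
      using odd_mod_4[OF q] b cise_plus_cnj[of "?x k"] cise_minus_cnj[of "?x k"] by (auto simp: eps_def trig_def)
    moreover have "?s k = of_real ((- 1) ^ k)" by simp
    ultimately show "?s k * of_int (PJ (int (2 * k)) q) * (cise (?x k) + ?g * cnj (cise (?x k)))
      = eps q * of_real (2 * ((- 1) ^ k * real_of_int (PJ (int (2 * k)) q) * trig b (?x k)))"
      by (simp only: of_real_mult of_real_of_int_eq mult_ac)
  qed
  also have "\<dots> = eps q * of_real (2 * (\<Sum>k = 1..p. (- 1) ^ k * real_of_int (PJ (int (2 * k)) q) * trig b (?x k)))"
    by (simp only: sum_distrib_left of_real_sum)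
  \<comment> \<open>\<open>PJ 0 q\<close> is nonzero only for a square \<open>q\<close>; an odd
    square is 1 modulo 4 and has phase 1.\<close>
  also have "of_int (PJ 0 q) = eps q * of_int (PJ 0 q)"
  proof (cases "\<exists>s. q = s\<^sup>2")
    case True
    then obtain s where s: "q = s\<^sup>2" by blast
    then have "odd s" using q by simp
    then have "q mod 4 = 1" using odd_mod_4[of s] by (auto simp: s power2_eq_square mod_mult_eq[of s 4 s, symmetric])
    then show ?thesis by (simp add: eps_def)
  next
    case False
    then have "real_of_int (PJ 0 q) = 0" using PJ_0[OF q] by simp
    then show ?thesis by simp
  qed
  finally have "eps q * (of_real (sqrt (real q) * real_of_int (PJ (int (2 * u + 1)) q)) -
      of_real (real_of_int (PJ 0 q) + 2 * (\<Sum>k = 1..p. (- 1) ^ k * real_of_int (PJ (int (2 * k)) q) * trig b (?x k)))) = 0"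
    by (simp add: algebra_simps)
  moreover have "eps q \<noteq> 0" using norm_eps[of q] by (metis norm_zero zero_neq_one)
  ultimately have "complex_of_real (sqrt (real q) * real_of_int (PJ (int (2 * u + 1)) q)) =
      of_real (real_of_int (PJ 0 q) + 2 * (\<Sum>k = 1..p. (- 1) ^ k * real_of_int (PJ (int (2 * k)) q) * trig b (?x k)))"
    by simp
  then show ?thesis unfolding p_def by (simp only: of_real_eq_iff)
qed

text \<open>The window of \<open>M\<close> terms is averaged over its first \<open>H\<close> shifts.
  The averaging factor decays like \<open>1 / (H t)\<close>, which makes the high frequencies
  negligible.\<close>

definition smooth_exp :: "nat \<Rightarrow> nat \<Rightarrow> real \<Rightarrow> complex" where
  "smooth_exp M H t = (\<Sum>h<H. \<Sum>u<M. cise ((real (u + h) + 1 / 2) * t)) / of_nat H"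

definition smooth_trig :: "nat \<Rightarrow> nat \<Rightarrow> nat \<Rightarrow> real \<Rightarrow> real" where
  "smooth_trig b M H t = (\<Sum>h<H. \<Sum>u<M. trig b ((real (u + h) + 1 / 2) * t)) / real H"

lemma smooth_trig_eq: "smooth_trig b M H t = (if b = 1 then Re (smooth_exp M H t) else Im (smooth_exp M H t))"
  by (simp add: smooth_trig_def smooth_exp_def trig_def cise_def)

lemma abs_smooth_trig_le: "\<bar>smooth_trig b M H t\<bar> \<le> norm (smooth_exp M H t)"
  by (simp add: smooth_trig_eq abs_Re_le_cmod abs_Im_le_cmod)

lemma PJ_dual_smooth:
  assumes q: "odd q" and b: "q mod 4 = b" and H: "H > 0"
  shows "(\<Sum>h<H. \<Sum>u<M. real_of_int (PJ (int (2 * (u + h) + 1)) q)) / real H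
    = (if \<exists>s. q = s\<^sup>2 then real M else 0) +
      (\<Sum>k = 1..q div 2. (- 1) ^ k * real_of_int (PJ (int (2 * k)) q) * (2 / sqrt (real q) * smooth_trig b M H (real k / real q)))"
proof -
  have qpos: "q > 0" using q by (rule odd_pos)
  let ?a = "\<lambda>k. (- 1) ^ k * real_of_int (PJ (int (2 * k)) q)"
  have S: "(\<Sum>h<H. \<Sum>u<M. trig b ((real (u + h) + 1 / 2) * x)) = real H * smooth_trig b M H x" for x
    using H by (simp add: smooth_trig_def)
  have "real_of_int (PJ (int (2 * u + 1)) q) = real_of_int (PJ 0 q) / sqrt (real q) +
    (\<Sum>k = 1..q div 2. ?a k * (2 / sqrt (real q) * trig b ((real u + 1 / 2) * (real k / real q))))" for u
  proof -
    have "real_of_int (PJ (int (2 * u + 1)) q) = (real_of_int (PJ 0 q) +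
      2 * (\<Sum>k = 1..q div 2. ?a k * trig b (real k * (real u + 1 / 2) / real q))) / sqrt (real q)"
      unfolding PJ_dual[OF q b, symmetric] using qpos by simp
    also have "\<dots> = real_of_int (PJ 0 q) / sqrt (real q) + (\<Sum>k = 1..q div 2. ?a k * (2 / sqrt (real q) * trig b ((real u + 1 / 2) * (real k / real q))))"
      by (simp add: add_divide_distrib sum_divide_distrib sum_distrib_left mult_ac)
    finally show ?thesis .
  qed
  then have "(\<Sum>h<H. \<Sum>u<M. real_of_int (PJ (int (2 * (u + h) + 1)) q)) = (\<Sum>h<H. \<Sum>u<M. real_of_int (PJ 0 q) / sqrt (real q)) +
     (\<Sum>h<H. \<Sum>u<M. \<Sum>k = 1..q div 2. ?a k * (2 / sqrt (real q) * trig b ((real (u + h) + 1 / 2) * (real k / real q))))"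
    by (simp only: sum.distrib)
  also have "(\<Sum>h<H. \<Sum>u<M. \<Sum>k = 1..q div 2. ?a k * (2 / sqrt (real q) * trig b ((real (u + h) + 1 / 2) * (real k / real q))))
     = (\<Sum>k = 1..q div 2. \<Sum>h<H. \<Sum>u<M. ?a k * (2 / sqrt (real q) * trig b ((real (u + h) + 1 / 2) * (real k / real q))))"
    by (subst sum.swap[of _ "{1..q div 2}" "{..<M}"], subst sum.swap[of _ "{1..q div 2}" "{..<H}"]) (rule refl)
  also have "\<dots> = (\<Sum>k = 1..q div 2. ?a k * (2 / sqrt (real q) * (\<Sum>h<H. \<Sum>u<M. trig b ((real (u + h) + 1 / 2) * (real k / real q)))))"
    by (simp only: sum_distrib_left)
  also have "\<dots> = (\<Sum>k = 1..q div 2. ?a k * (2 / sqrt (real q) * (real H * smooth_trig b M H (real k / real q))))"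
    by (simp only: S)
  also have "\<dots> = real H * (\<Sum>k = 1..q div 2. ?a k * (2 / sqrt (real q) * smooth_trig b M H (real k / real q)))"
    by (simp only: sum_distrib_left mult_ac)
  also have "(\<Sum>h<H. \<Sum>u<M. real_of_int (PJ 0 q) / sqrt (real q)) = real H * (real M * (real_of_int (PJ 0 q) / sqrt (real q)))"
    by simp
  finally have "(\<Sum>h<H. \<Sum>u<M. real_of_int (PJ (int (2 * (u + h) + 1)) q)) / real H
     = real M * (real_of_int (PJ 0 q) / sqrt (real q)) + (\<Sum>k = 1..q div 2. ?a k * (2 / sqrt (real q) * smooth_trig b M H (real k / real q)))"
    using H by (simp only: distrib_left[symmetric]) simp
  also have "real M * (real_of_int (PJ 0 q) / sqrt (real q)) = (if \<exists>s. q = s\<^sup>2 then real M else 0)"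
    using PJ_0[OF q] qpos by auto
  finally show ?thesis .
qed

section \<open>Size, variation and limit of the smoothed exponential sums\<close>

lemma norm_cise_diff_le: "norm (cise x - cise y) \<le> 8 * \<bar>x - y\<bar>"
proof -
  have "cise x - cise y = cise y * (cise (x - y) - 1)" by (simp add: right_diff_distrib flip: cise_add)
  then have "norm (cise x - cise y) = 2 * \<bar>sin (pi * (x - y))\<bar>" by (simp add: norm_mult norm_cise_minus_1)
  also have "\<dots> \<le> 2 * \<bar>pi * (x - y)\<bar>" by (intro mult_left_mono abs_sin_x_le_abs_x) simp
  also have "\<dots> \<le> 8 * \<bar>x - y\<bar>" using pi_less_4 by (simp add: abs_mult mult_right_mono)
  finally show ?thesis .
qed

lemma smooth_exp_factor:
  "smooth_exp M H t = (\<Sum>h<H. cise (real h * t)) / of_nat H * (\<Sum>u<M. cise ((real u + 1 / 2) * t))"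
  unfolding smooth_exp_def by (simp add: sum_product sum_divide_distrib algebra_simps flip: cise_add)

lemma half_sum_factor: "(\<Sum>u<M. cise ((real u + 1 / 2) * t)) = cise (t / 2) * (\<Sum>u<M. cise (real u * t))"
  by (simp add: sum_distrib_left algebra_simps flip: cise_add)

lemma norm_half_sum_le:
  assumes "0 < t" "t \<le> 1 / 2"
  shows "norm (\<Sum>u<M. cise ((real u + 1 / 2) * t)) \<le> 3 / (2 * t)"
  unfolding half_sum_factor norm_mult norm_cise mult_1
  using inverse_sin_le[OF assms] norm_sum_cise_le[of t M] by auto

lemma norm_average_le:
  assumes "H > 0"
  shows "norm ((\<Sum>h<H. cise (real h * t)) / of_nat H) \<le> 1"
proof -
  have "norm (\<Sum>h<H. cise (real h * t)) \<le> (\<Sum>h<H. 1)" by (intro sum_norm_le) simp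
  then show ?thesis using assms by (simp add: norm_divide)
qed

text \<open>The bounds come from the unsmoothed geometric sum, from the decay of both factors of
  \<open>smooth_exp_factor\<close>, and from counting terms. They serve the low frequencies, the
  high frequencies and the variation in \<open>q\<close> respectively.\<close>

lemma norm_smooth_exp_le:
  assumes "0 < t" "t \<le> 1 / 2" and H: "H > 0"
  shows "norm (smooth_exp M H t) \<le> 3 / (2 * t)"
    and "norm (smooth_exp M H t) \<le> 9 / (4 * real H * t ^ 2)"
    and "norm (smooth_exp M H t) \<le> real M"
proof -
  have a: "norm (\<Sum>u<M. cise ((real u + 1 / 2) * t)) \<le> 3 / (2 * t)" by (rule norm_half_sum_le[OF assms(1,2)])
  have "norm (smooth_exp M H t) \<le> 1 * (3 / (2 * t))"
    unfolding smooth_exp_factor norm_mult by (intro mult_mono norm_average_le H a) auto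
  then show "norm (smooth_exp M H t) \<le> 3 / (2 * t)" by simp
  have "norm ((\<Sum>h<H. cise (real h * t)) / of_nat H) \<le> 3 / (2 * t) / real H"
    using inverse_sin_le[OF assms(1,2)] norm_sum_cise_le[of t H] H
    by (simp only: norm_divide norm_of_nat) (intro divide_right_mono, auto)
  then have "norm (smooth_exp M H t) \<le> 3 / (2 * t) / real H * (3 / (2 * t))"
    unfolding smooth_exp_factor norm_mult using assms by (intro mult_mono a) auto
  then show "norm (smooth_exp M H t) \<le> 9 / (4 * real H * t ^ 2)"
    by (simp add: power2_eq_square mult_ac)
  have "norm (\<Sum>u<M. cise ((real u + 1 / 2) * t)) \<le> (\<Sum>u<M. 1)" by (intro sum_norm_le) simp
  then have "norm (smooth_exp M H t) \<le> 1 * real M"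
    unfolding smooth_exp_factor norm_mult by (intro mult_mono norm_average_le H) auto
  then show "norm (smooth_exp M H t) \<le> real M" by simp
qed

lemma smooth_exp_lipschitz:
  assumes H: "H > 0" and "M > 0"
  shows "norm (smooth_exp M H s - smooth_exp M H t) \<le> 8 * real M * real (M + H) * \<bar>s - t\<bar>"
proof -
  have "norm (\<Sum>h<H. \<Sum>u<M. cise ((real (u + h) + 1 / 2) * s) - cise ((real (u + h) + 1 / 2) * t))
      \<le> (\<Sum>h<H. \<Sum>u<M. 8 * (real (M + H) * \<bar>s - t\<bar>))"
  proof (intro sum_norm_le)
    fix h u assume hu: "h \<in> {..<H}" "u \<in> {..<M}"
    have "norm (cise ((real (u + h) + 1 / 2) * s) - cise ((real (u + h) + 1 / 2) * t)) \<le> 8 * \<bar>(real (u + h) + 1 / 2) * s - (real (u + h) + 1 / 2) * t\<bar>"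
      by (rule norm_cise_diff_le)
    also have "\<bar>(real (u + h) + 1 / 2) * s - (real (u + h) + 1 / 2) * t\<bar> = (real (u + h) + 1 / 2) * \<bar>s - t\<bar>"
      by (simp add: abs_mult flip: right_diff_distrib)
    also have "8 * \<dots> \<le> 8 * (real (M + H) * \<bar>s - t\<bar>)"
    proof (intro mult_left_mono mult_right_mono)
      have "u + h + 1 \<le> M + H" using hu by auto
      then have "real (u + h + 1) \<le> real (M + H)" by (simp only: of_nat_le_iff)
      then show "real (u + h) + 1 / 2 \<le> real (M + H)" by simp
    qed auto
    finally show "norm (cise ((real (u + h) + 1 / 2) * s) - cise ((real (u + h) + 1 / 2) * t)) \<le> 8 * (real (M + H) * \<bar>s - t\<bar>)" .
  qed
  then have "norm (\<Sum>h<H. \<Sum>u<M. cise ((real (u + h) + 1 / 2) * s) - cise ((real (u + h) + 1 / 2) * t)) / real H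
      \<le> 8 * real M * real (M + H) * \<bar>s - t\<bar>"
    using H by (simp add: pos_divide_le_eq mult_ac)
  moreover have "smooth_exp M H s - smooth_exp M H t = (\<Sum>h<H. \<Sum>u<M. cise ((real (u + h) + 1 / 2) * s) - cise ((real (u + h) + 1 / 2) * t)) / of_nat H"
    by (simp add: smooth_exp_def sum_subtractf diff_divide_distrib)
  ultimately show ?thesis by (simp add: norm_divide)
qed

lemma inverse_sin_minus_inverse_le:
  assumes "0 < x" "x \<le> 2"
  shows "\<bar>1 / sin x - 1 / x\<bar> \<le> (1 :: real)"
proof -
  have "\<bar>sin x - (\<Sum>m<3. sin_coeff m * x ^ m)\<bar> \<le> inverse (fact 3) * \<bar>x\<bar> ^ 3"
    by (rule Maclaurin_sin_bound)
  moreover have "(\<Sum>m<3. sin_coeff m * x ^ m) = x"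
    by (simp add: numeral_3_eq_3 sin_coeff_def)
  moreover have "inverse (fact 3) * \<bar>x\<bar> ^ 3 = x ^ 3 / 6" using assms by (simp add: fact_numeral)
  ultimately have 1: "x - sin x \<le> x ^ 3 / 6" by linarith
  have 2: "x / 3 \<le> sin x" using sin_ge_third[of x] assms by simp
  have 3: "sin x \<le> x" using sin_x_le_x assms by simp
  have pos: "sin x > 0" using 2 assms by linarith
  have "x ^ 3 / 6 \<le> x * (x / 3)"
    using assms by (simp add: power3_eq_cube)
  also have "\<dots> \<le> x * sin x" using 2 assms by (intro mult_left_mono) auto
  finally have "x - sin x \<le> x * sin x" using 1 by linarith
  then have "(x - sin x) / (x * sin x) \<le> 1" using pos assms by simp
  moreover have "(x - sin x) / (x * sin x) = 1 / sin x - 1 / x" using pos assms by (simp add: field_simps)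
  moreover have "1 / x \<le> 1 / sin x" using 3 pos assms by (intro divide_left_mono) auto
  ultimately show ?thesis by linarith
qed

text \<open>Real and imaginary part of \<open>(cise (X * t / 2) - 1) / (2 * pi * \<i> * t)\<close>,
  the integral of \<open>cise (u * t)\<close> over \<open>u\<close> from 0 to
  \<open>X / 2\<close>.\<close>

definition limit_trig :: "nat \<Rightarrow> real \<Rightarrow> real \<Rightarrow> real" where
  "limit_trig b X t = (if b = 1 then sin (pi * X * t) else 1 - cos (pi * X * t)) / (2 * pi * t)"

text \<open>Replacing \<open>M\<close> by \<open>X / 2\<close> costs 1, replacing
  \<open>1 / sin (pi * t)\<close> by \<open>1 / (pi * t)\<close> costs 1, and removing the smoothing
  costs the square root term.\<close>

lemma smooth_trig_approx:
  assumes t: "0 < t" "t \<le> 1 / 2" and H: "H > 0" and M: "\<bar>real M - X / 2\<bar> \<le> 1 / 2"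
  shows "\<bar>smooth_trig b M H t - limit_trig b X t\<bar> \<le> 2 + 6 * sqrt (real H / t)"
proof -
  define A where "A = (\<Sum>h<H. cise (real h * t)) / of_nat H"
  define E where "E = (\<Sum>u<M. cise ((real u + 1 / 2) * t))"
  define L where "L = (cise (X * t / 2) - 1) / (2 * pi * \<i> * t)"
  have E32: "norm E \<le> 3 / (2 * t)" unfolding E_def by (rule norm_half_sum_le[OF t])
  have sinpos: "sin (pi * t) > 0" by (rule inverse_sin_le(1)[OF t])
  have "norm (A - 1) \<le> 4 * sqrt (real H * t)"
  proof -
    have "A - 1 = (\<Sum>h<H. cise (real h * t) - 1) / of_nat H"
      using H by (simp add: A_def sum_subtractf diff_divide_distrib)
    then have n: "norm (A - 1) = norm (\<Sum>h<H. cise (real h * t) - 1) / real H" by (simp add: norm_divide)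
    have "norm (\<Sum>h<H. cise (real h * t) - 1) \<le> (\<Sum>h<H. 8 * (real H * t))"
    proof (rule sum_norm_le)
      fix h assume "h \<in> {..<H}"
      then have "8 * \<bar>real h * t - 0\<bar> \<le> 8 * (real H * t)" using t by (simp add: mult_right_mono)
      then show "norm (cise (real h * t) - 1) \<le> 8 * (real H * t)"
        using norm_cise_diff_le[of "real h * t" 0] by simp
    qed
    then have 1: "norm (A - 1) \<le> 8 * (real H * t)" unfolding n using H by (simp add: pos_divide_le_eq mult_ac)
    have 2: "norm (A - 1) \<le> 2"
      using norm_triangle_ineq4[of A 1] norm_average_le[OF H, of t] by (simp add: A_def)
    \<comment> \<open>The bounds \<open>8 H t\<close> and 2 are merged into their geometric mean,
      which is uniform across \<open>t = 1 / H\<close>.\<close>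
    have "norm (A - 1) ^ 2 \<le> (4 * sqrt (real H * t)) ^ 2"
    proof -
      have "norm (A - 1) ^ 2 \<le> 2 * (8 * (real H * t))"
        unfolding power2_eq_square using 1 2 by (intro mult_mono) auto
      also have "\<dots> = (4 * sqrt (real H * t)) ^ 2" using t by (simp add: power_mult_distrib)
      finally show ?thesis .
    qed
    then show ?thesis by (rule power2_le_imp_le) (use t in simp)
  qed
  moreover have "norm (A * E - E) = norm (A - 1) * norm E"
    by (metis left_diff_distrib mult_1 norm_mult)
  ultimately have "norm (A * E - E) \<le> 4 * sqrt (real H * t) * (3 / (2 * t))"
    using E32 t by (simp only:) (intro mult_mono, auto)
  also have "\<dots> = 6 * sqrt (real H / t)"
  proof -
    have "sqrt (real H * t) / t = sqrt (real H / t)"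
      using t by (simp add: real_sqrt_mult real_sqrt_divide field_simps)
    then show ?thesis by (simp add: field_simps)
  qed
  finally have AE: "norm (A * E - E) \<le> 6 * sqrt (real H / t)" .
  have E: "E = (cise (real M * t) - 1) / (2 * \<i> * of_real (sin (pi * t)))"
  proof -
    have ne: "cise t \<noteq> 1" using norm_cise_minus_1[of t] sinpos by auto
    have "cise t - 1 = cise (t / 2) * (2 * \<i> * of_real (sin (pi * t)))"
    proof -
      have "cise t - 1 = cise (t / 2) * (cise (t / 2) - cnj (cise (t / 2)))"
        by (simp add: algebra_simps flip: cise_add cise_minus)
      then show ?thesis by (simp add: cise_minus_cnj)
    qed
    then show ?thesis
      unfolding E_def half_sum_factor sum_cise_geometric[OF ne] by simp
  qed
  have "E - (cise (real M * t) - 1) / (2 * pi * \<i> * t) = (cise (real M * t) - 1) / (2 * \<i>) * of_real (1 / sin (pi * t) - 1 / (pi * t))"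
    unfolding E using sinpos t by (simp add: field_simps)
  then have "norm (E - (cise (real M * t) - 1) / (2 * pi * \<i> * t)) = norm (cise (real M * t) - 1) / 2 * \<bar>1 / sin (pi * t) - 1 / (pi * t)\<bar>"
    by (simp only: norm_mult norm_divide norm_of_real) simp
  also have "\<dots> \<le> 1 * 1"
  proof (intro mult_mono)
    show "norm (cise (real M * t) - 1) / 2 \<le> 1" using norm_triangle_ineq4[of "cise (real M * t)" 1] by simp
    have "pi * t \<le> pi * (1 / 2)" using t by (intro mult_left_mono) auto
    then have "pi * t \<le> 2" using pi_less_4 by linarith
    then show "\<bar>1 / sin (pi * t) - 1 / (pi * t)\<bar> \<le> 1" using t by (intro inverse_sin_minus_inverse_le) auto
  qed auto
  finally have 1: "norm (E - (cise (real M * t) - 1) / (2 * pi * \<i> * t)) \<le> 1" by simp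
  have "norm ((cise (real M * t) - 1) / (2 * pi * \<i> * t) - L) = norm (cise (real M * t) - cise (X * t / 2)) / (2 * pi * t)"
    unfolding L_def using t by (simp add: norm_divide norm_mult flip: diff_divide_distrib)
  also have "\<dots> \<le> 8 * \<bar>real M * t - X * t / 2\<bar> / (2 * pi * t)"
    using t by (intro divide_right_mono norm_cise_diff_le) auto
  also have "\<bar>real M * t - X * t / 2\<bar> = \<bar>real M - X / 2\<bar> * t" 
  proof -
    have "real M * t - X * t / 2 = (real M - X / 2) * t" by (simp add: left_diff_distrib)
    then show ?thesis using t by (simp add: abs_mult)
  qed
  also have "8 * (\<bar>real M - X / 2\<bar> * t) / (2 * pi * t) = 4 * \<bar>real M - X / 2\<bar> / pi" using t by (simp add: field_simps)
  also have "\<dots> \<le> 1" using M pi_ge_two by (simp add: divide_le_eq)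
  finally have 2: "norm ((cise (real M * t) - 1) / (2 * pi * \<i> * t) - L) \<le> 1" .
  have "norm (A * E - L) \<le> 2 + 6 * sqrt (real H / t)"
    using AE 1 2 norm_triangle_ineq[of "A * E - E" "E - L"]
      norm_triangle_ineq[of "E - (cise (real M * t) - 1) / (2 * pi * \<i> * t)" "(cise (real M * t) - 1) / (2 * pi * \<i> * t) - L"]
    by simp
  moreover have "A * E = smooth_exp M H t" by (simp add: A_def E_def smooth_exp_factor)
  moreover have "limit_trig b X t = (if b = 1 then Re L else Im L)"
  proof -
    have "L = of_real (sin (pi * X * t) / (2 * pi * t)) + \<i> * of_real ((1 - cos (pi * X * t)) / (2 * pi * t))"
      unfolding L_def cise_def using t by (simp add: complex_eq_iff field_simps Re_divide Im_divide power2_eq_square)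
    then show ?thesis by (simp add: limit_trig_def)
  qed
  ultimately show ?thesis
    using abs_Re_le_cmod[of "A * E - L"] abs_Im_le_cmod[of "A * E - L"] by (simp add: smooth_trig_eq)
qed

section \<open>Partial summation, comparison with integrals, and the kernel\<close>

lemma abel_summation_bound:
  fixes d g :: "nat \<Rightarrow> real"
  assumes D: "\<And>Z. \<bar>\<Sum>q<Z. d q\<bar> \<le> D" and AB: "A \<le> B"
    and S: "\<And>q. A \<le> q \<Longrightarrow> q \<le> B \<Longrightarrow> \<bar>g q\<bar> \<le> S"
    and L: "\<And>q. A \<le> q \<Longrightarrow> q < B \<Longrightarrow> \<bar>g (Suc q) - g q\<bar> \<le> L"
  shows "\<bar>\<Sum>q\<in>{A..<B}. d q * g q\<bar> \<le> D * (2 * S + real (B - A) * L)"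
proof -
  define P where "P Z = (\<Sum>q<Z. d q)" for Z
  have PD: "\<bar>P Z\<bar> \<le> D" for Z using D by (simp add: P_def)
  have D0: "D \<ge> 0" using PD[of 0] by linarith
  have eq: "(\<Sum>q\<in>{A..<B}. d q * g q) = P B * g B - P A * g A - (\<Sum>q\<in>{A..<B}. P (Suc q) * (g (Suc q) - g q))"
    using AB
  proof (induction B rule: dec_induct)
    case (step n)
    have "P (Suc n) = P n + d n" by (simp add: P_def)
    then show ?case using step by (simp add: algebra_simps)
  qed simp
  have 1: "\<bar>P B * g B\<bar> \<le> D * S" "\<bar>P A * g A\<bar> \<le> D * S"
    unfolding abs_mult using PD S AB D0 by (auto intro!: mult_mono)
  have "\<bar>\<Sum>q\<in>{A..<B}. P (Suc q) * (g (Suc q) - g q)\<bar> \<le> (\<Sum>q\<in>{A..<B}. D * L)"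
    by (rule order_trans[OF sum_abs], rule sum_mono)
      (unfold abs_mult, use PD L D0 in \<open>auto intro!: mult_mono\<close>)
  also have "\<dots> = D * (real (B - A) * L)" by simp
  finally have "\<bar>\<Sum>q\<in>{A..<B}. d q * g q\<bar> \<le> D * S + D * S + D * (real (B - A) * L)"
    unfolding eq using 1 by linarith
  then show ?thesis by (simp add: algebra_simps)
qed

lemma sum_minus_integral_bound:
  fixes G :: "real \<Rightarrow> real"
  assumes AB: "A \<le> B" and cont: "continuous_on {real A..real B} G"
    and L: "\<And>q x. A \<le> q \<Longrightarrow> q < B \<Longrightarrow> real q \<le> x \<Longrightarrow> x \<le> real q + 1 \<Longrightarrow> \<bar>G x - G (real q)\<bar> \<le> L"
  shows "\<bar>(\<Sum>q\<in>{A..<B}. G (real q)) - integral {real A..real B} G\<bar> \<le> real (B - A) * L"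
  using AB cont L
proof (induction B rule: dec_induct)
  case (step n)
  have cont1: "continuous_on {real A..real n} G" "continuous_on {real n..real (Suc n)} G"
    by (rule continuous_on_subset[OF step.prems(1)]; use step.hyps in auto)+
  have IH: "\<bar>(\<Sum>q\<in>{A..<n}. G (real q)) - integral {real A..real n} G\<bar> \<le> real (n - A) * L"
    using step.IH cont1 step.prems(2) by auto
  have comb: "integral {real A..real n} G + integral {real n..real (Suc n)} G = integral {real A..real (Suc n)} G"
    by (rule Henstock_Kurzweil_Integration.integral_combine) (use step in \<open>auto intro!: integrable_continuous_real\<close>)
  have "norm (integral {real n..real (Suc n)} (\<lambda>x. G x - G (real n))) \<le> L * (real (Suc n) - real n)"
    by (rule integral_bound) (use step cont1 in \<open>auto intro!: continuous_intros\<close>)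
  moreover have "integral {real n..real (Suc n)} (\<lambda>x. G x - G (real n)) = integral {real n..real (Suc n)} G - G (real n)"
    by (subst integral_diff) (use cont1 in \<open>auto intro!: integrable_continuous_real\<close>)
  ultimately have "\<bar>integral {real n..real (Suc n)} G - G (real n)\<bar> \<le> L" by simp
  moreover have "real (Suc n - A) * L = real (n - A) * L + L" using step.hyps by (simp add: Suc_diff_le algebra_simps)
  moreover have "(\<Sum>q\<in>{A..<Suc n}. G (real q)) = (\<Sum>q\<in>{A..<n}. G (real q)) + G (real n)" using step.hyps by simp
  ultimately show ?case using IH comb by linarith
qed simp

text \<open>The integrand of \<open>C_trans\<close> for \<open>c = 2 * pi * k ^ 2\<close>; in the
  dual sum \<open>c\<close> also carries the factor \<open>X\<close>.\<close>

definition kern :: "real \<Rightarrow> real \<Rightarrow> real" where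
  "kern c y = sqrt y * (1 - cos (c / y) + sin (c / y))"

lemma abs_osc_le: "\<bar>1 - cos x + sin x\<bar> \<le> (3 :: real)"
  using abs_cos_le_one[of x] abs_sin_le_one[of x] by linarith

lemma abs_kern_le: "y \<ge> 0 \<Longrightarrow> \<bar>kern c y\<bar> \<le> 3 * sqrt y"
  unfolding kern_def abs_mult using abs_osc_le[of "c / y"] by (simp add: mult.commute[of 3] mult_left_mono)

lemma continuous_on_kern: "continuous_on {0..a} (kern c)"
  unfolding continuous_on_def
proof
  fix x assume x: "x \<in> {0..a}"
  show "(kern c \<longlongrightarrow> kern c x) (at x within {0..a})"
  proof (cases "x = 0")
    case True
    have "(kern c \<longlongrightarrow> 0) (at 0 within {0..a})"
    proof (rule Lim_null_comparison)
      show "\<forall>\<^sub>F y in at 0 within {0..a}. norm (kern c y) \<le> 3 * sqrt y"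
        using abs_kern_le by (auto simp: eventually_at_filter)
      have "((\<lambda>y. 3 * sqrt y) \<longlongrightarrow> 3 * sqrt 0) (at 0 within {0..a})"
        by (intro tendsto_intros)
      then show "((\<lambda>y. 3 * sqrt y) \<longlongrightarrow> 0) (at 0 within {0..a})" by simp
    qed
    then show ?thesis using True by (simp add: kern_def)
  next
    case False
    then show ?thesis unfolding kern_def by (intro tendsto_intros) auto
  qed
qed

lemma kern_integrable: "0 \<le> a \<Longrightarrow> kern c integrable_on {a..b}"
  by (rule integrable_continuous_real, rule continuous_on_subset[OF continuous_on_kern[of b]]) auto

lemma abs_integral_kern_le:
  assumes "0 \<le> a" "a \<le> b"
  shows "\<bar>integral {a..b} (kern c)\<bar> \<le> 3 * sqrt b * (b - a)"
proof -
  have "norm (integral {a..b} (kern c)) \<le> 3 * sqrt b * (b - a)"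
  proof (rule integral_bound[OF assms(2)])
    show "continuous_on {a..b} (kern c)" by (rule continuous_on_subset[OF continuous_on_kern[of b]]) (use assms in auto)
    show "norm (kern c t) \<le> 3 * sqrt b" if "t \<in> {a..b}" for t
      using abs_kern_le[of t c] that assms real_sqrt_le_mono[of t b] by (simp, linarith)
  qed
  then show ?thesis by simp
qed

lemma abs_cos_diff_le: "\<bar>cos x - cos y\<bar> \<le> \<bar>x - y :: real\<bar>"
proof -
  have "\<bar>cos x - cos y\<bar> = 2 * \<bar>sin ((x + y) / 2)\<bar> * \<bar>sin ((y - x) / 2)\<bar>"
    by (simp add: cos_diff_cos abs_mult)
  also have "\<dots> \<le> 2 * 1 * \<bar>(y - x) / 2\<bar>"
    by (intro mult_mono abs_sin_x_le_abs_x) auto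
  finally show ?thesis by simp
qed

lemma abs_sin_diff_le: "\<bar>sin x - sin y\<bar> \<le> \<bar>x - y :: real\<bar>"
  using abs_cos_diff_le[of "pi / 2 - x" "pi / 2 - y"] by (simp add: cos_diff abs_minus_commute)

lemma kern_lipschitz:
  assumes c: "c \<ge> 0" and A: "1 \<le> A" "A \<le> q" and x: "q \<le> x" "x \<le> q + 1"
  shows "\<bar>kern c x - kern c q\<bar> \<le> 3 + 2 * c / A"
proof -
  have pos: "q > 0" "x > 0" "A > 0" using A x by auto
  let ?f = "\<lambda>y. 1 - cos (c / y) + sin (c / y)"
  have "\<bar>sqrt x - sqrt q\<bar> \<le> 1"
  proof -
    have "1 \<le> sqrt q" using A by simp
    have "(sqrt x - sqrt q) * 1 \<le> (sqrt x - sqrt q) * (sqrt x + sqrt q)"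
      using x \<open>1 \<le> sqrt q\<close> by (intro mult_left_mono) (auto intro: add_increasing)
    also have "\<dots> = x - q" using pos by (simp add: algebra_simps)
    finally have "sqrt x - sqrt q \<le> x - q" by simp
    then have "sqrt x - sqrt q \<le> 1" using x by linarith
    moreover have "sqrt q \<le> sqrt x" using x by simp
    ultimately show ?thesis by simp
  qed
  then have 1: "\<bar>(sqrt x - sqrt q) * ?f x\<bar> \<le> 1 * 3"
    unfolding abs_mult by (intro mult_mono abs_osc_le) auto
  have "c / q - c / x = c * (x - q) / (q * x)" using pos by (simp add: field_simps)
  also have "\<dots> \<le> c * 1 / (q * x)" using c x pos by (intro divide_right_mono mult_left_mono) auto
  finally have cc: "c / q - c / x \<le> c / (q * x)" by simp
  have "c / x \<le> c / q" using c x pos by (intro divide_left_mono) auto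
  then have cabs: "\<bar>c / x - c / q\<bar> \<le> c / (q * x)" using cc by simp
  have "\<bar>?f x - ?f q\<bar> \<le> 2 * (c / (q * x))"
    using abs_cos_diff_le[of "c / x" "c / q"] abs_sin_diff_le[of "c / x" "c / q"] cabs by linarith
  then have "\<bar>sqrt q * (?f x - ?f q)\<bar> \<le> q * (2 * (c / (q * x)))"
    unfolding abs_mult using pos A by (intro mult_mono) (auto simp: real_le_lsqrt power2_eq_square)
  also have "\<dots> = 2 * c / x" using pos by simp
  also have "\<dots> \<le> 2 * c / A" using c x A pos by (intro divide_left_mono) auto
  finally have 2: "\<bar>sqrt q * (?f x - ?f q)\<bar> \<le> 2 * c / A" .
  have "kern c x - kern c q = (sqrt x - sqrt q) * ?f x + sqrt q * (?f x - ?f q)"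
    by (simp add: kern_def algebra_simps)
  then show ?thesis using 1 2 by linarith
qed

lemma sum_inverse_sqrt_le: "(\<Sum>k = 1..K. 1 / sqrt (real k)) \<le> 2 * sqrt (real K)"
proof (induction K)
  case (Suc K)
  define a b where "a = sqrt (real K)" and "b = sqrt (real (Suc K))"
  have ab: "a \<ge> 0" "b > 0" "a \<le> b" "b * b = a * a + 1" by (auto simp: a_def b_def)
  have "(b - a) * (b + a) = 1" using ab by (simp add: algebra_simps)
  moreover have "(b - a) * (b + a) \<le> (b - a) * (2 * b)" using ab by (intro mult_left_mono) auto
  ultimately have "1 \<le> (2 * b - 2 * a) * b" by (simp add: algebra_simps)
  then have "1 / b \<le> 2 * b - 2 * a" using ab by (simp add: pos_divide_le_eq)
  then have "1 / sqrt (real (Suc K)) \<le> 2 * sqrt (real (Suc K)) - 2 * sqrt (real K)"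
    by (simp only: a_def b_def)
  then show ?case using Suc by simp
qed simp

lemma sum_tail_three_halves:
  assumes "K > 0" "K \<le> n"
  shows "(\<Sum>k\<in>{K<..n}. sqrt (real k) / real k ^ 2) \<le> 2 / sqrt (real K) - 2 / sqrt (real n)"
  using assms(2)
proof (induction n rule: dec_induct)
  case (step n)
  have n: "n > 0" using step assms by simp
  define a b where "a = sqrt (real n)" and "b = sqrt (real (Suc n))"
  have ab: "a > 0" "b > 0" "a \<le> b" "b * b = a * a + 1" using n by (auto simp: a_def b_def)
  have bb: "real (Suc n) = b * b" by (simp add: b_def)
  have "sqrt (real (Suc n)) / real (Suc n) ^ 2 = b / (b * b) ^ 2"
    unfolding bb[symmetric] b_def by simp
  also have "\<dots> = 1 / (b * b * b)" using ab(2) by (simp add: power2_eq_square)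
  also have "\<dots> \<le> 2 / a - 2 / b"
  proof -
    have "(b - a) * (b + a) = 1" using ab by (simp add: algebra_simps)
    moreover have "(b - a) * (b + a) \<le> (b - a) * (2 * b)" using ab by (intro mult_left_mono) auto
    ultimately have h: "1 \<le> 2 * b * (b - a)" by (simp add: algebra_simps)
    have "1 / (b * b * b) \<le> 1 / (a * b * b)" using ab(1-3) by (intro divide_left_mono mult_right_mono) auto
    also have "\<dots> \<le> 2 * b * (b - a) / (a * b * b)" using h ab(1-3) by (intro divide_right_mono) auto
    also have "\<dots> = 2 / a - 2 / b" using ab(1-3) by (simp add: field_simps)
    finally show ?thesis .
  qed
  finally have "sqrt (real (Suc n)) / real (Suc n) ^ 2 \<le> 2 / sqrt (real n) - 2 / sqrt (real (Suc n))"
    by (simp add: a_def b_def)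
  moreover have "{K<..Suc n} = insert (Suc n) {K<..n}" using step by auto
  ultimately show ?case using step by simp
qed simp

text \<open>Square and non-square indices get one crude bound so that partial summation can treat
  all \<open>k\<close> alike. For non-squares \<open>1 + ln (2 k) <= 2 k\<close> and
  \<open>tau2 (2 k) <= sqrt (2 k)\<close>, and \<open>1536 * (2 k)^2 = 6144 * k^2\<close>.\<close>

lemma class_sum_even_index:
  assumes r: "odd r" "squarefree r" and b: "b = 1 \<or> b = 3" and k: "k > 0"
  shows "\<bar>class_sum r b (2 * k) Z - (if \<exists>s. 2 * k = s\<^sup>2 then real Z / (4 * real r) else 0)\<bar> \<le> 6144 * real k ^ 2"
proof (cases "\<exists>s. 2 * k = s\<^sup>2")
  case True
  then obtain s where s: "2 * k = s\<^sup>2" by blast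
  then have "s > 0" using k by (auto intro: Nat.gr0I)
  from class_sum_square[OF r b this, of Z]
  have "\<bar>class_sum r b (2 * k) Z - real Z / (4 * real r)\<bar> \<le> 2 * real (2 * k)"
    unfolding s .
  also have "\<dots> \<le> 6144 * real k ^ 2" using k by (simp add: power2_eq_square)
  finally show ?thesis using True by simp
next
  case False
  let ?k = "real (2 * k)"
  have k1: "?k \<ge> 1" using k by simp
  have "\<bar>class_sum r b (2 * k) Z\<bar> \<le> 1536 * sqrt ?k * (1 + ln ?k) * real (tau2 (2 * k))"
    by (rule class_sum_nonsquare[OF r b _ ]) (use False k in auto)
  also have "\<dots> \<le> 1536 * sqrt ?k * ?k * sqrt ?k"
  proof (intro mult_mono)
    show "1 + ln ?k \<le> ?k" using ln_le_minus_one[of ?k] k1 by simp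
    have "{d. d\<^sup>2 dvd 2 * k} \<subseteq> {1..nat \<lfloor>sqrt ?k\<rfloor>}"
    proof
      fix d assume "d \<in> {d. d\<^sup>2 dvd 2 * k}"
      then have d: "d\<^sup>2 dvd 2 * k" by simp
      then have "d > 0" using k by (auto intro: Nat.gr0I)
      have "d\<^sup>2 \<le> 2 * k" using d k by (intro dvd_imp_le) auto
      then have "real (d\<^sup>2) \<le> ?k" by (simp only: of_nat_le_iff)
      then have "real d \<le> sqrt ?k" by (intro real_le_rsqrt) simp
      then show "d \<in> {1..nat \<lfloor>sqrt ?k\<rfloor>}" using \<open>d > 0\<close> by (simp add: le_nat_floor)
    qed
    then have "tau2 (2 * k) \<le> nat \<lfloor>sqrt ?k\<rfloor>"
      unfolding tau2_def using card_mono[of "{1..nat \<lfloor>sqrt ?k\<rfloor>}"] by fastforce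
    moreover have "real (nat \<lfloor>sqrt ?k\<rfloor>) \<le> sqrt ?k" by simp
    ultimately show "real (tau2 (2 * k)) \<le> sqrt ?k" by linarith
  qed (use k1 in auto)
  also have "\<dots> = 1536 * (sqrt ?k * sqrt ?k) * ?k" by (simp only: mult_ac)
  also have "\<dots> = 6144 * real k ^ 2" by (simp add: power2_eq_square)
  finally show ?thesis using False by simp
qed

text \<open>\<open>M\<close> counts the odd \<open>m <= X\<close>, \<open>H\<close> is the smoothing
  length, moduli below \<open>A\<close> are estimated trivially, and \<open>J\<close> main terms are
  retained. The condition on \<open>A\<close> puts all frequencies \<open>k <= 2 * J^2\<close> into
  the range \<open>k <= q / 2\<close> as soon as \<open>q >= A\<close>.\<close>

locale dual_sum =
  fixes r M H J A N :: nat and X Q :: real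
  assumes r: "odd r" "squarefree r" and X: "X \<ge> 1" and Q: "Q \<ge> 1"
    and M: "M = (nat \<lfloor>X\<rfloor> + 1) div 2" and N: "N = nat \<lfloor>Q\<rfloor> + 1"
    and H: "H > 0" and J: "J > 0" and A: "4 * J\<^sup>2 \<le> A" "A \<le> N"
begin

text \<open>Chosen so that \<open>2 * j^2 <= K\<close> holds exactly for
  \<open>j <= J\<close>.\<close>

definition K :: nat where "K = 2 * J\<^sup>2"

definition G :: "nat \<Rightarrow> nat \<Rightarrow> nat \<Rightarrow> real" where
  "G b k q = 2 / sqrt (real q) * smooth_trig b M H (real k / real q)"

definition a :: "nat \<Rightarrow> nat \<Rightarrow> nat \<Rightarrow> real" where
  "a b k q = (if q mod 4 = b \<and> r dvd q then real_of_int (PJ (int (2 * k)) q) else 0)"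

text \<open>The contribution of the nonzero frequencies for the moduli in class
  \<open>b\<close>.\<close>

definition V :: "nat \<Rightarrow> real" where
  "V b = (\<Sum>q<N. \<Sum>k = 1..q div 2. (- 1) ^ k * a b k q * G b k q)"

definition SPbar :: real where
  "SPbar = (\<Sum>h<H. \<Sum>u<M. Zsum r (2 * (u + h) + 1) N) / real H"

lemma rpos: "real r \<ge> 1" using r by (simp add: Suc_leI odd_pos)

lemma Kpos: "K > 0" using J by (simp add: K_def)

lemma A1: "A \<ge> 1" "2 * K \<le> A"
proof -
  have "J\<^sup>2 \<ge> 1" using J by (simp add: Suc_le_eq)
  then show "A \<ge> 1" "2 * K \<le> A" using A(1) by (auto simp: K_def)
qed

lemma N_bounds: "Q \<le> real N" "real N \<le> Q + 1" "real N \<ge> 1"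
  using Q unfolding N by simp_all linarith+

lemma M_bounds: "\<bar>real M - X / 2\<bar> \<le> 1 / 2" "M > 0" "real M \<le> X"
proof -
  have "2 * M \<le> nat \<lfloor>X\<rfloor> + 1" "nat \<lfloor>X\<rfloor> \<le> 2 * M" by (auto simp: M)
  then have "2 * real M \<le> real (nat \<lfloor>X\<rfloor>) + 1" "real (nat \<lfloor>X\<rfloor>) \<le> 2 * real M" by linarith+
  moreover have "real (nat \<lfloor>X\<rfloor>) \<le> X" "X < real (nat \<lfloor>X\<rfloor>) + 1" using X by simp_all
  ultimately show "\<bar>real M - X / 2\<bar> \<le> 1 / 2" "real M \<le> X" using X unfolding abs_le_iff by linarith+
  have "nat \<lfloor>X\<rfloor> \<ge> 1" using X by (simp add: le_nat_floor)
  then show "M > 0" by (simp add: M)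
qed

lemma G_bound:
  assumes "k > 0" "2 * k \<le> q"
  shows "\<bar>G b k q\<bar> \<le> 3 * sqrt (real q) / real k"
    and "\<bar>G b k q\<bar> \<le> 9 / 2 * (real q * sqrt (real q)) / (real H * real k ^ 2)"
proof -
  have q: "real q > 0" using assms by simp
  have s: "sqrt (real q) * sqrt (real q) = real q" by simp
  have t: "0 < real k / real q" "real k / real q \<le> 1 / 2" using assms by (simp_all add: field_simps)
  note b = norm_smooth_exp_le[OF t H, of M] abs_smooth_trig_le[of b M H "real k / real q"]
  have "\<bar>G b k q\<bar> = 2 / sqrt (real q) * \<bar>smooth_trig b M H (real k / real q)\<bar>"
    by (simp add: G_def abs_mult)
  also have "\<dots> \<le> 2 / sqrt (real q) * (3 / (2 * (real k / real q)))"
    using b by (intro mult_left_mono) auto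
  also have "\<dots> = 3 * (sqrt (real q) * sqrt (real q)) / (sqrt (real q) * real k)" using q assms by (simp add: field_simps)
  also have "\<dots> = 3 * sqrt (real q) / real k" using q by (simp del: real_sqrt_mult_self)
  finally show "\<bar>G b k q\<bar> \<le> 3 * sqrt (real q) / real k" .
  have "\<bar>G b k q\<bar> = 2 / sqrt (real q) * \<bar>smooth_trig b M H (real k / real q)\<bar>"
    by (simp add: G_def abs_mult)
  also have "\<dots> \<le> 2 / sqrt (real q) * (9 / (4 * real H * (real k / real q) ^ 2))"
    using b by (intro mult_left_mono) auto
  also have "\<dots> = 9 / 2 * (real q * (sqrt (real q) * sqrt (real q))) / (real H * real k ^ 2 * sqrt (real q))"
    using q assms H by (simp add: field_simps power2_eq_square)
  also have "\<dots> = 9 / 2 * (real q * sqrt (real q)) / (real H * real k ^ 2)" using q by (simp del: real_sqrt_mult_self)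
  finally show "\<bar>G b k q\<bar> \<le> 9 / 2 * (real q * sqrt (real q)) / (real H * real k ^ 2)" .
qed

lemma a_bound:
  assumes "k > 0" "b = 1 \<or> b = 3"
  shows "\<bar>a b k q\<bar> \<le> 3 / 2 * sqrt (real k)"
proof (cases "q mod 4 = b \<and> r dvd q")
  case True
  then have "q mod 4 = 1 \<or> q mod 4 = 3" using assms(2) by auto
  then have "odd q" by presburger
  then have "\<bar>a b k q\<bar> \<le> sqrt \<bar>real_of_int (int (2 * k))\<bar>"
    unfolding a_def using True assms abs_PJ_le_sqrt_left[of q "int (2 * k)"] by simp
  also have "\<dots> = sqrt 2 * sqrt (real k)" by (simp add: real_sqrt_mult)
  also have "\<dots> \<le> 3 / 2 * sqrt (real k)"
    by (intro mult_right_mono real_le_lsqrt) (auto simp: power2_eq_square)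
  finally show ?thesis .
next
  case False
  then have "a b k q = 0" by (auto simp: a_def)
  then show ?thesis by simp
qed

lemma head_bound:
  assumes b: "b = 1 \<or> b = 3" and L: "L \<le> K" "L \<le> q div 2"
  shows "\<bar>\<Sum>k = 1..L. (- 1) ^ k * a b k q * G b k q\<bar> \<le> 9 * sqrt (real q) * sqrt (real K)"
proof -
  have "\<bar>\<Sum>k = 1..L. (- 1) ^ k * a b k q * G b k q\<bar> \<le> (\<Sum>k = 1..L. 9 / 2 * sqrt (real q) * (1 / sqrt (real k)))"
  proof (rule order_trans[OF sum_abs], rule sum_mono)
    fix k assume k: "k \<in> {1..L}"
    then have kp: "k > 0" "2 * k \<le> q" using L by auto
    have "\<bar>(- 1) ^ k * a b k q * G b k q\<bar> = \<bar>a b k q\<bar> * \<bar>G b k q\<bar>" by (simp add: abs_mult power_abs)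
    also have "\<dots> \<le> (3 / 2 * sqrt (real k)) * (3 * sqrt (real q) / real k)"
      using a_bound[OF kp(1) b] G_bound(1)[OF kp] by (intro mult_mono) auto
    also have "\<dots> = 9 / 2 * sqrt (real q) * (sqrt (real k) / (sqrt (real k) * sqrt (real k)))" by simp
    also have "\<dots> = 9 / 2 * sqrt (real q) * (1 / sqrt (real k))" using kp by (simp del: real_sqrt_mult_self)
    finally show "\<bar>(- 1) ^ k * a b k q * G b k q\<bar> \<le> 9 / 2 * sqrt (real q) * (1 / sqrt (real k))" .
  qed
  also have "\<dots> = 9 / 2 * sqrt (real q) * (\<Sum>k = 1..L. 1 / sqrt (real k))" by (simp only: sum_distrib_left)
  also have "\<dots> \<le> 9 / 2 * sqrt (real q) * (2 * sqrt (real K))"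
    using sum_inverse_sqrt_le[of L] L by (intro mult_left_mono) (auto intro: order_trans)
  finally show ?thesis by simp
qed

text \<open>\<open>a\<close> grows at most like \<open>sqrt k\<close> and the smoothed
  \<open>G\<close> decays like \<open>1 / k^2\<close>, so the tail beyond \<open>K\<close> is of
  order \<open>1 / sqrt K\<close>; the unsmoothed decay \<open>1 / k\<close> would give no tail
  estimate.\<close>

lemma tail_bound:
  assumes b: "b = 1 \<or> b = 3"
  shows "\<bar>\<Sum>k\<in>{K<..q div 2}. (- 1) ^ k * a b k q * G b k q\<bar> \<le> 14 * (real q * sqrt (real q)) / (real H * sqrt (real K))"
proof (cases "K \<le> q div 2")
  case True
  let ?c = "27 / 4 * (real q * sqrt (real q)) / real H"
  have "\<bar>\<Sum>k\<in>{K<..q div 2}. (- 1) ^ k * a b k q * G b k q\<bar> \<le> (\<Sum>k\<in>{K<..q div 2}. ?c * (sqrt (real k) / real k ^ 2))"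
  proof (rule order_trans[OF sum_abs], rule sum_mono)
    fix k assume k: "k \<in> {K<..q div 2}"
    then have kp: "k > 0" "2 * k \<le> q" by auto
    have "\<bar>(- 1) ^ k * a b k q * G b k q\<bar> = \<bar>a b k q\<bar> * \<bar>G b k q\<bar>" by (simp add: abs_mult power_abs)
    also have "\<dots> \<le> (3 / 2 * sqrt (real k)) * (9 / 2 * (real q * sqrt (real q)) / (real H * real k ^ 2))"
      using a_bound[OF kp(1) b] G_bound(2)[OF kp] by (intro mult_mono) auto
    also have "\<dots> = ?c * (sqrt (real k) / real k ^ 2)" by (simp add: mult_ac)
    finally show "\<bar>(- 1) ^ k * a b k q * G b k q\<bar> \<le> ?c * (sqrt (real k) / real k ^ 2)" .
  qed
  also have "\<dots> = ?c * (\<Sum>k\<in>{K<..q div 2}. sqrt (real k) / real k ^ 2)" by (simp only: sum_distrib_left)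
  also have "\<dots> \<le> ?c * (2 / sqrt (real K))"
  proof (rule mult_left_mono)
    have "0 \<le> 2 / sqrt (real (q div 2))" by simp
    then show "(\<Sum>k\<in>{K<..q div 2}. sqrt (real k) / real k ^ 2) \<le> 2 / sqrt (real K)"
      using sum_tail_three_halves[OF Kpos True] by linarith
  qed simp
  also have "\<dots> = (27 / 2) * ((real q * sqrt (real q)) / (real H * sqrt (real K)))" by simp
  also have "\<dots> \<le> 14 * ((real q * sqrt (real q)) / (real H * sqrt (real K)))" by (intro mult_right_mono) auto
  finally show ?thesis by simp
qed simp

text \<open>High frequencies are small by the smoothing and moduli below \<open>A\<close> because
  there are few of them. Afterwards the range of \<open>k\<close> no longer depends on
  \<open>q\<close>, and the summations can be interchanged.\<close>

lemma V_truncate: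
  assumes b: "b = 1 \<or> b = 3"
  shows "\<bar>V b - (\<Sum>k = 1..K. (- 1) ^ k * (\<Sum>q\<in>{A..<N}. a b k q * G b k q))\<bar>
    \<le> 14 * real N ^ 2 * sqrt (real N) / (real H * sqrt (real K)) + 9 * real A * sqrt (real A) * sqrt (real K)"
proof -
  let ?t = "\<lambda>q k. (- 1) ^ k * a b k q * G b k q"
  have split: "(\<Sum>k = 1..q div 2. ?t q k) = (\<Sum>k = 1..min K (q div 2). ?t q k) + (\<Sum>k\<in>{K<..q div 2}. ?t q k)" for q
  proof -
    have S: "{1..q div 2} = {1..min K (q div 2)} \<union> {K<..q div 2}" by auto
    show ?thesis unfolding S by (rule sum.union_disjoint) auto
  qed
  have "V b = (\<Sum>q<N. \<Sum>k = 1..min K (q div 2). ?t q k) + (\<Sum>q<N. \<Sum>k\<in>{K<..q div 2}. ?t q k)"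
    unfolding V_def split sum.distrib ..
  also have "(\<Sum>q<N. \<Sum>k = 1..min K (q div 2). ?t q k) = (\<Sum>q<A. \<Sum>k = 1..min K (q div 2). ?t q k) + (\<Sum>q\<in>{A..<N}. \<Sum>k = 1..min K (q div 2). ?t q k)"
    by (simp only: lessThan_atLeast0, rule sum.atLeastLessThan_concat[symmetric]) (use A in auto)
  also have "(\<Sum>q\<in>{A..<N}. \<Sum>k = 1..min K (q div 2). ?t q k) = (\<Sum>q\<in>{A..<N}. \<Sum>k = 1..K. ?t q k)"
  proof (rule sum.cong[OF refl])
    fix q assume "q \<in> {A..<N}"
    then have "min K (q div 2) = K" using A1 by auto
    then show "(\<Sum>k = 1..min K (q div 2). ?t q k) = (\<Sum>k = 1..K. ?t q k)" by simp
  qed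
  also have "\<dots> = (\<Sum>k = 1..K. (- 1) ^ k * (\<Sum>q\<in>{A..<N}. a b k q * G b k q))"
    by (subst sum.swap) (simp only: sum_distrib_left mult.assoc)
  finally have eq: "V b - (\<Sum>k = 1..K. (- 1) ^ k * (\<Sum>q\<in>{A..<N}. a b k q * G b k q))
     = (\<Sum>q<A. \<Sum>k = 1..min K (q div 2). ?t q k) + (\<Sum>q<N. \<Sum>k\<in>{K<..q div 2}. ?t q k)" by simp
  have "\<bar>\<Sum>q<A. \<Sum>k = 1..min K (q div 2). ?t q k\<bar> \<le> (\<Sum>q<A. 9 * sqrt (real A) * sqrt (real K))"
  proof (rule order_trans[OF sum_abs], rule sum_mono)
    fix q assume "q \<in> {..<A}"
    then have "9 * sqrt (real q) * sqrt (real K) \<le> 9 * sqrt (real A) * sqrt (real K)" by (intro mult_mono) auto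
    then show "\<bar>\<Sum>k = 1..min K (q div 2). ?t q k\<bar> \<le> 9 * sqrt (real A) * sqrt (real K)"
      using head_bound[OF b, of "min K (q div 2)" q] by simp
  qed
  then have 1: "\<bar>\<Sum>q<A. \<Sum>k = 1..min K (q div 2). ?t q k\<bar> \<le> 9 * real A * sqrt (real A) * sqrt (real K)" by simp
  let ?B = "14 * (real N * sqrt (real N)) / (real H * sqrt (real K))"
  have "\<bar>\<Sum>q<N. \<Sum>k\<in>{K<..q div 2}. ?t q k\<bar> \<le> (\<Sum>q<N. ?B)"
  proof (rule order_trans[OF sum_abs], rule sum_mono)
    fix q assume "q \<in> {..<N}"
    then have "14 * (real q * sqrt (real q)) / (real H * sqrt (real K)) \<le> ?B"
      by (intro divide_right_mono mult_left_mono mult_mono) auto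
    then show "\<bar>\<Sum>k\<in>{K<..q div 2}. ?t q k\<bar> \<le> ?B" using tail_bound[OF b, of q] by linarith
  qed
  also have "\<dots> = 14 * real N ^ 2 * sqrt (real N) / (real H * sqrt (real K))" by (simp add: power2_eq_square)
  finally show ?thesis unfolding eq using 1 by linarith
qed

text \<open>A step in \<open>q\<close> moves the argument \<open>k / q\<close> by at most
  \<open>K / A^2\<close>, which \<open>smooth_exp_lipschitz\<close> controls; the second term is the
  change of \<open>1 / sqrt q\<close>.\<close>

lemma G_lipschitz:
  assumes "k > 0" "k \<le> K" "A \<le> q"
  shows "\<bar>G b k (Suc q) - G b k q\<bar> \<le> 16 * X * (X + real H) * real K / (real A ^ 2 * sqrt (real A)) + X / (real A * sqrt (real A))"
proof -
  have qpos: "real q \<ge> 1" and qA: "real A \<le> real q" using assms A1 by auto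
  have Apos: "real A > 0" using A1 by simp
  have sq: "sqrt (real q) > 0" "sqrt (real q) \<le> sqrt (real (Suc q))" "sqrt (real A) \<le> sqrt (real q)" using qpos qA by auto
  define T where "T n = smooth_trig b M H (real k / real n)" for n
  have kq: "0 < real k / real n" "real k / real n \<le> 1 / 2" if "n \<ge> q" for n
    using assms A1 that qpos by (auto simp: field_simps)
  have Tb: "\<bar>T q\<bar> \<le> X"
    using norm_smooth_exp_le(3)[OF kq[of q, OF order_refl] H, of M] abs_smooth_trig_le[of b M H "real k / real q"] M_bounds
    by (simp add: T_def)
  have "\<bar>T (Suc q) - T q\<bar> \<le> norm (smooth_exp M H (real k / real (Suc q)) - smooth_exp M H (real k / real q))"
    unfolding T_def smooth_trig_eq
    by (auto simp flip: minus_complex.sel intro: abs_Re_le_cmod abs_Im_le_cmod)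
  also have "\<dots> \<le> 8 * real M * real (M + H) * \<bar>real k / real (Suc q) - real k / real q\<bar>"
    by (rule smooth_exp_lipschitz[OF H M_bounds(2)])
  also have "\<bar>real k / real (Suc q) - real k / real q\<bar> \<le> real K / real A ^ 2"
  proof -
    have "real k / real (Suc q) - real k / real q = - (real k / (real q * real (Suc q)))" using qpos by (simp add: field_simps)
    then have "\<bar>real k / real (Suc q) - real k / real q\<bar> = real k / (real q * real (Suc q))" by simp
    also have "\<dots> \<le> real K / (real A * real A)"
      using assms Apos qA by (intro frac_le mult_mono) auto
    finally show ?thesis by (simp add: power2_eq_square)
  qed
  finally have Td: "\<bar>T (Suc q) - T q\<bar> \<le> 8 * real M * real (M + H) * (real K / real A ^ 2)" 
    by (simp add: mult_left_mono)
  also have "\<dots> \<le> 8 * X * (X + real H) * (real K / real A ^ 2)"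
    using M_bounds X by (intro mult_right_mono mult_mono) auto
  finally have Td: "\<bar>T (Suc q) - T q\<bar> \<le> 8 * X * (X + real H) * (real K / real A ^ 2)" .
  have "G b k (Suc q) - G b k q = 2 / sqrt (real (Suc q)) * (T (Suc q) - T q) + (2 / sqrt (real (Suc q)) - 2 / sqrt (real q)) * T q"
    by (simp add: G_def T_def algebra_simps)
  moreover have "\<bar>2 / sqrt (real (Suc q)) * (T (Suc q) - T q)\<bar> \<le> 2 / sqrt (real A) * (8 * X * (X + real H) * (real K / real A ^ 2))"
    unfolding abs_mult
  proof (rule mult_mono[OF _ Td])
    have "2 / sqrt (real (Suc q)) \<le> 2 / sqrt (real A)" using sq Apos by (intro divide_left_mono) auto
    then show "\<bar>2 / sqrt (real (Suc q))\<bar> \<le> 2 / sqrt (real A)" by simp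
  qed auto
  moreover have "\<bar>(2 / sqrt (real (Suc q)) - 2 / sqrt (real q)) * T q\<bar> \<le> 1 / (real A * sqrt (real A)) * X"
    unfolding abs_mult
  proof (rule mult_mono[OF _ Tb])
    define x y where "x = sqrt (real q)" and "y = sqrt (real (Suc q))"
    have xy: "x > 0" "x \<le> y" "y * y = x * x + 1" "x * x = real q" using qpos by (auto simp: x_def y_def)
    have "(y - x) * (y + x) = 1" using xy by (simp add: algebra_simps)
    moreover have "(y - x) * (2 * x) \<le> (y - x) * (y + x)" using xy by (intro mult_left_mono) auto
    ultimately have h: "2 * (y - x) \<le> 1 / x" using xy by (simp add: field_simps)
    have "2 / x - 2 / y = 2 * (y - x) / (x * y)" using xy by (simp add: field_simps)
    also have "\<dots> \<le> (1 / x) / (x * x)" using h xy(1,2) by (intro frac_le mult_left_mono) auto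
    also have "\<dots> = 1 / (real q * x)" by (simp add: xy(4)[symmetric])
    also have "\<dots> \<le> 1 / (real A * sqrt (real A))"
      using qA Apos sq xy unfolding x_def by (intro divide_left_mono mult_mono) auto
    finally have "2 / x - 2 / y \<le> 1 / (real A * sqrt (real A))" .
    moreover have "2 / y \<le> 2 / x" using xy by (intro divide_left_mono) auto
    ultimately show "\<bar>2 / sqrt (real (Suc q)) - 2 / sqrt (real q)\<bar> \<le> 1 / (real A * sqrt (real A))"
      unfolding x_def y_def by linarith
  qed auto
  ultimately have "\<bar>G b k (Suc q) - G b k q\<bar> \<le> 2 / sqrt (real A) * (8 * X * (X + real H) * (real K / real A ^ 2)) + 1 / (real A * sqrt (real A)) * X"
    by linarith
  then show ?thesis by (simp add: mult_ac)
qed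

definition lip :: real where
  "lip = 16 * X * (X + real H) * real K / (real A ^ 2 * sqrt (real A)) + X / (real A * sqrt (real A))"

text \<open>The mean value of \<open>a b k q\<close> over \<open>q\<close>, as found in
  \<open>class_sum_even_index\<close>.\<close>

definition sqind :: "nat \<Rightarrow> real" where
  "sqind k = (if \<exists>s. 2 * k = s\<^sup>2 then 1 / (4 * real r) else 0)"

text \<open>Minus its mean, \<open>a b k\<close> has bounded partial sums, while
  \<open>G b k\<close> varies slowly with \<open>q\<close>.\<close>

lemma abel_step:
  assumes b: "b = 1 \<or> b = 3" and k: "k > 0" "k \<le> K"
  shows "\<bar>(\<Sum>q\<in>{A..<N}. a b k q * G b k q) - sqind k * (\<Sum>q\<in>{A..<N}. G b k q)\<bar>
    \<le> 6144 * real K ^ 2 * (6 * sqrt (real N) + real N * lip)"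
proof -
  have lip0: "lip \<ge> 0" using X by (simp add: lip_def)
  have "(\<Sum>q\<in>{A..<N}. a b k q * G b k q) - sqind k * (\<Sum>q\<in>{A..<N}. G b k q) = (\<Sum>q\<in>{A..<N}. (a b k q - sqind k) * G b k q)"
    by (simp add: sum_subtractf sum_distrib_left algebra_simps)
  also have "\<bar>\<dots>\<bar> \<le> 6144 * real k ^ 2 * (2 * (3 * sqrt (real N)) + real (N - A) * lip)"
  proof (rule abel_summation_bound)
    show "\<bar>\<Sum>q<Z. a b k q - sqind k\<bar> \<le> 6144 * real k ^ 2" for Z
    proof -
      have "(\<Sum>q<Z. a b k q - sqind k) = class_sum r b (2 * k) Z - (if \<exists>s. 2 * k = s\<^sup>2 then real Z / (4 * real r) else 0)"
        by (simp add: sum_subtractf class_sum_def a_def sqind_def)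
      then show ?thesis using class_sum_even_index[OF r b k(1)] by simp
    qed
    show "\<bar>G b k q\<bar> \<le> 3 * sqrt (real N)" if q: "A \<le> q" "q \<le> N" for q
    proof -
      have "2 * k \<le> q" using k A1 q by linarith
      then have "\<bar>G b k q\<bar> \<le> 3 * sqrt (real q) / real k" by (rule G_bound(1)[OF k(1)])
      also have "\<dots> \<le> 3 * sqrt (real q) / 1" using k by (intro divide_left_mono) auto
      also have "\<dots> \<le> 3 * sqrt (real N)" using q by simp
      finally show ?thesis .
    qed
    show "\<bar>G b k (Suc q) - G b k q\<bar> \<le> lip" if "A \<le> q" for q
      unfolding lip_def by (rule G_lipschitz[OF k that])
  qed (rule A(2))
  also have "\<dots> \<le> 6144 * real K ^ 2 * (6 * sqrt (real N) + real N * lip)"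
  proof (rule mult_mono)
    have "real (N - A) * lip \<le> real N * lip" using lip0 by (intro mult_right_mono) auto
    then show "2 * (3 * sqrt (real N)) + real (N - A) * lip \<le> 6 * sqrt (real N) + real N * lip" by simp
    show "6144 * real k ^ 2 \<le> 6144 * real K ^ 2" using k by (intro mult_left_mono power_mono) auto
  qed (use lip0 in auto)
  finally show ?thesis .
qed

text \<open>\<open>2 k\<close> is a square exactly for \<open>k = 2 j^2\<close>; such
  \<open>k\<close> are even, so the alternating sign disappears.\<close>

lemma sum_even_squares:
  "(\<Sum>k = 1..K. (- 1) ^ k * (sqind k * F k)) = (\<Sum>j = 1..J. F (2 * j\<^sup>2)) / (4 * real r)"
proof -
  have "(\<Sum>k = 1..K. (- 1) ^ k * (sqind k * F k)) = (\<Sum>k\<in>(\<lambda>j. 2 * j\<^sup>2) ` {1..J}. F k / (4 * real r))"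
  proof (rule sum.mono_neutral_cong_right)
    show "(\<lambda>j. 2 * j\<^sup>2) ` {1..J} \<subseteq> {1..K}" by (auto simp: K_def)
    show "\<forall>k\<in>{1..K} - (\<lambda>j. 2 * j\<^sup>2) ` {1..J}. (- 1) ^ k * (sqind k * F k) = 0"
    proof
      fix k assume k: "k \<in> {1..K} - (\<lambda>j. 2 * j\<^sup>2) ` {1..J}"
      have "\<nexists>s. 2 * k = s\<^sup>2"
      proof
        assume "\<exists>s. 2 * k = s\<^sup>2"
        then obtain s where s: "2 * k = s\<^sup>2" by blast
        then have "even s" by (metis dvd_triv_left even_power)
        then obtain j where "s = 2 * j" by blast
        then have kj: "k = 2 * j\<^sup>2" using s by (simp add: power2_eq_square)
        then have "j\<^sup>2 \<le> J\<^sup>2" "j > 0" using k by (auto simp: K_def intro: Nat.gr0I)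
        then have "j \<in> {1..J}" by (simp add: power_mono_iff)
        then show False using k kj by blast
      qed
      then show "(- 1) ^ k * (sqind k * F k) = 0" by (simp add: sqind_def)
    qed
    show "(- 1) ^ k * (sqind k * F k) = F k / (4 * real r)" if k: "k \<in> (\<lambda>j. 2 * j\<^sup>2) ` {1..J}" for k
    proof -
      from k obtain j where j: "k = 2 * j\<^sup>2" by blast
      then have "2 * k = (2 * j)\<^sup>2" by (simp add: power2_eq_square)
      then have "\<exists>s. 2 * k = s\<^sup>2" by blast
      then show ?thesis using j by (simp add: sqind_def)
    qed
  qed simp
  also have "\<dots> = (\<Sum>j = 1..J. F (2 * j\<^sup>2) / (4 * real r))"
    by (subst sum.reindex) (auto simp: inj_on_def power2_eq_iff_nonneg)
  finally show ?thesis by (simp add: sum_divide_distrib)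
qed

text \<open>In the limit the cosine sums of class 1 give \<open>sin\<close> and the sine sums of
  class 3 give \<open>1 - cos\<close>; both enter with the same density, and their sum is the kernel
  of \<open>C_trans\<close>.\<close>

lemma limit_pair:
  assumes j: "j > 0" and q: "q > 0"
  shows "2 / sqrt (real q) * (limit_trig 1 X (real (2 * j\<^sup>2) / real q) + limit_trig 3 X (real (2 * j\<^sup>2) / real q))
    = kern (2 * pi * real j ^ 2 * X) (real q) / (2 * pi * real j ^ 2)"
proof -
  have s: "sqrt (real q) > 0" using q by simp
  have s2: "real q = sqrt (real q) * sqrt (real q)" by simp
  have e: "pi * X * (real (2 * j\<^sup>2) / real q) = 2 * pi * real j ^ 2 * X / real q" by simp
  define F where "F = 1 - cos (2 * pi * real j ^ 2 * X / real q) + sin (2 * pi * real j ^ 2 * X / real q)"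
  let ?x = "2 * pi * real j ^ 2 * X / real q" and ?D = "2 * pi * (real (2 * j\<^sup>2) / real q)"
  have l1: "limit_trig 1 X (real (2 * j\<^sup>2) / real q) = sin ?x / ?D" unfolding limit_trig_def e by simp
  have l3: "limit_trig 3 X (real (2 * j\<^sup>2) / real q) = (1 - cos ?x) / ?D" unfolding limit_trig_def e by simp
  have "limit_trig 1 X (real (2 * j\<^sup>2) / real q) + limit_trig 3 X (real (2 * j\<^sup>2) / real q) = F / ?D"
    unfolding l1 l3 F_def add_divide_distrib[symmetric] by (simp only: add.commute)
  also have "\<dots> = F * real q / (4 * pi * real j ^ 2)" by simp
  also have "2 / sqrt (real q) * \<dots> = F * (sqrt (real q) * sqrt (real q)) / (sqrt (real q) * (2 * pi * real j ^ 2))"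
    using s by (simp add: field_simps)
  also have "\<dots> = sqrt (real q) * F / (2 * pi * real j ^ 2)" using s by (simp add: mult_ac del: real_sqrt_mult_self)
  finally show ?thesis by (simp add: kern_def F_def)
qed

text \<open>With \<open>t = 2 j^2 / q\<close> the prefactor \<open>2 / sqrt q\<close> cancels the
  growth of \<open>sqrt (H / t)\<close> in \<open>q\<close>, so the error is uniform in
  \<open>q\<close>; the factor \<open>1 / j\<close> makes its sum over \<open>j\<close>
  logarithmic.\<close>

lemma G_pair_approx:
  assumes j: "j > 0" "j \<le> J" and q: "A \<le> q"
  shows "\<bar>G 1 (2 * j\<^sup>2) q + G 3 (2 * j\<^sup>2) q - kern (2 * pi * real j ^ 2 * X) (real q) / (2 * pi * real j ^ 2)\<bar>
    \<le> 8 + 24 * sqrt (real H) / real j"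
proof -
  have jJ: "j\<^sup>2 \<le> J\<^sup>2" using j by (simp add: power_mono)
  have qpos: "q > 0" using q A1 by simp
  have s: "sqrt (real q) \<ge> 1" using qpos by simp
  let ?t = "real (2 * j\<^sup>2) / real q"
  have "real (4 * j\<^sup>2) \<le> real q" using jJ A(1) q by (simp only: of_nat_le_iff)
  then have t: "0 < ?t" "?t \<le> 1 / 2" using j qpos by (simp_all add: field_simps)
  have one: "\<bar>G b (2 * j\<^sup>2) q - 2 / sqrt (real q) * limit_trig b X ?t\<bar> \<le> 4 + 12 * sqrt (real H) / real j" for b
  proof -
    have "G b (2 * j\<^sup>2) q - 2 / sqrt (real q) * limit_trig b X ?t = 2 / sqrt (real q) * (smooth_trig b M H ?t - limit_trig b X ?t)"
      by (simp only: G_def right_diff_distrib)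
    moreover have "\<bar>2 / sqrt (real q)\<bar> = 2 / sqrt (real q)" by simp
    ultimately have "\<bar>G b (2 * j\<^sup>2) q - 2 / sqrt (real q) * limit_trig b X ?t\<bar> = 2 / sqrt (real q) * \<bar>smooth_trig b M H ?t - limit_trig b X ?t\<bar>"
      by (simp only: abs_mult)
    also have "\<dots> \<le> 2 / sqrt (real q) * (2 + 6 * sqrt (real H / ?t))"
      by (intro mult_left_mono smooth_trig_approx t H M_bounds) simp
    also have "\<dots> = 4 / sqrt (real q) + 12 * (sqrt (real H) * sqrt (real q) / (sqrt (real q) * sqrt (real (2 * j\<^sup>2))))"
      by (simp add: distrib_left real_sqrt_mult real_sqrt_divide)
    also have "\<dots> = 4 / sqrt (real q) + 12 * (sqrt (real H) / sqrt (real (2 * j\<^sup>2)))" using s by simp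
    also have "\<dots> \<le> 4 / 1 + 12 * (sqrt (real H) / real j)"
    proof (intro add_mono mult_left_mono divide_left_mono)
      show "real j \<le> sqrt (real (2 * j\<^sup>2))" by (rule real_le_rsqrt) simp
    qed (use s j qpos in auto)
    finally show ?thesis by simp
  qed
  have "G 1 (2 * j\<^sup>2) q + G 3 (2 * j\<^sup>2) q - kern (2 * pi * real j ^ 2 * X) (real q) / (2 * pi * real j ^ 2)
     = (G 1 (2 * j\<^sup>2) q - 2 / sqrt (real q) * limit_trig 1 X ?t) + (G 3 (2 * j\<^sup>2) q - 2 / sqrt (real q) * limit_trig 3 X ?t)"
    unfolding limit_pair[OF j(1) qpos, symmetric] by (simp add: algebra_simps)
  then show ?thesis using one[of 1] one[of 3] by linarith
qed

text \<open>The variation of the kernel grows with \<open>c\<close>, hence like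
  \<open>j^2 * X\<close>; the division by \<open>2 * pi * j^2\<close> makes the error uniform in
  \<open>j\<close>.\<close>

lemma kern_sum_approx:
  assumes j: "j > 0"
  shows "\<bar>(\<Sum>q\<in>{A..<N}. kern (2 * pi * real j ^ 2 * X) (real q)) - integral {0..Q} (kern (2 * pi * real j ^ 2 * X))\<bar> / (2 * pi * real j ^ 2)
    \<le> real N * (3 + 16 * X / real A) + 3 * sqrt (real N) + 3 * real A * sqrt (real A)"
proof -
  define c where "c = 2 * pi * real j ^ 2 * X"
  have c0: "c \<ge> 0" using X by (simp add: c_def)
  have A1': "real A \<ge> 1" using A1 by simp
  have AN: "real A \<le> real N" using A by simp
  have j1: "real j ^ 2 \<ge> 1" using j by simp
  have "\<bar>(\<Sum>q\<in>{A..<N}. kern c (real q)) - integral {real A..real N} (kern c)\<bar> \<le> real (N - A) * (3 + 2 * c / real A)"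
  proof (rule sum_minus_integral_bound[OF A(2)])
    show "continuous_on {real A..real N} (kern c)" by (rule continuous_on_subset[OF continuous_on_kern[of "real N"]]) auto
    show "\<bar>kern c x - kern c (real q)\<bar> \<le> 3 + 2 * c / real A" if "A \<le> q" "real q \<le> x" "x \<le> real q + 1" for q x
      using that c0 A1' by (intro kern_lipschitz) auto
  qed
  also have "\<dots> \<le> real N * (3 + 2 * c / real A)" using c0 by (intro mult_right_mono) auto
  finally have 1: "\<bar>(\<Sum>q\<in>{A..<N}. kern c (real q)) - integral {real A..real N} (kern c)\<bar> \<le> real N * (3 + 2 * c / real A)" .
  have "integral {0..real A} (kern c) + integral {real A..real N} (kern c) = integral {0..real N} (kern c)"
    by (rule Henstock_Kurzweil_Integration.integral_combine) (use AN in \<open>auto intro!: kern_integrable\<close>)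
  moreover have "integral {0..Q} (kern c) + integral {Q..real N} (kern c) = integral {0..real N} (kern c)"
    by (rule Henstock_Kurzweil_Integration.integral_combine) (use N_bounds Q in \<open>auto intro!: kern_integrable\<close>)
  moreover have "\<bar>integral {0..real A} (kern c)\<bar> \<le> 3 * sqrt (real A) * (real A - 0)"
    by (rule abs_integral_kern_le) auto
  moreover have "\<bar>integral {Q..real N} (kern c)\<bar> \<le> 3 * sqrt (real N) * (real N - Q)"
    by (rule abs_integral_kern_le) (use N_bounds Q in auto)
  moreover have "3 * sqrt (real N) * (real N - Q) \<le> 3 * sqrt (real N) * 1"
    using N_bounds by (intro mult_left_mono) auto
  ultimately have "\<bar>(\<Sum>q\<in>{A..<N}. kern c (real q)) - integral {0..Q} (kern c)\<bar>
     \<le> real N * (3 + 2 * c / real A) + (3 * sqrt (real N) + 3 * real A * sqrt (real A))"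
    using 1 by (simp add: mult_ac)
  then have "\<bar>(\<Sum>q\<in>{A..<N}. kern c (real q)) - integral {0..Q} (kern c)\<bar> / (2 * pi * real j ^ 2)
     \<le> (real N * (3 + 2 * c / real A) + (3 * sqrt (real N) + 3 * real A * sqrt (real A))) / (2 * pi * real j ^ 2)"
    by (rule divide_right_mono) simp
  also have "\<dots> = real N * (3 / (2 * pi * real j ^ 2) + 2 * X / real A) + (3 * sqrt (real N) + 3 * real A * sqrt (real A)) / (2 * pi * real j ^ 2)"
  proof -
    have "(n * (3 + y) + R) / D = n * (3 / D + y / D) + R / D" for n y R D :: real
      by (simp add: add_divide_distrib distrib_left)
    moreover have "2 * c / real A / (2 * pi * real j ^ 2) = 2 * X / real A" using j by (simp add: c_def)
    ultimately show ?thesis by simp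
  qed
  also have "\<dots> \<le> real N * (3 / 1 + 16 * X / real A) + (3 * sqrt (real N) + 3 * real A * sqrt (real A)) / 1"
  proof -
    have p: "1 \<le> 2 * pi * real j ^ 2" using j1 pi_ge_two mult_mono[of 1 "2 * pi" 1 "real j ^ 2"] by simp
    show ?thesis
      using p X A1' by (intro add_mono mult_left_mono divide_left_mono divide_right_mono) auto
  qed
  finally show ?thesis by (simp add: c_def)
qed

end

context dual_sum begin

text \<open>Frequency 0 contributes \<open>M\<close> for each square modulus; the nonzero
  frequencies are sorted by the class of the modulus modulo 4.\<close>

lemma SPbar_eq:
  "SPbar = real M * real (card {s. odd s \<and> r dvd s \<and> s\<^sup>2 < N}) + V 1 + V 3"
proof -
  let ?w = "\<lambda>q. (\<Sum>h<H. \<Sum>u<M. real_of_int (PJ (int (2 * (u + h) + 1)) q)) / real H"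
  have "(\<Sum>h<H. \<Sum>u<M. Zsum r (2 * (u + h) + 1) N)
     = (\<Sum>q<N. \<Sum>h<H. \<Sum>u<M. if odd q \<and> r dvd q then real_of_int (PJ (int (2 * (u + h) + 1)) q) else 0)"
    unfolding Zsum_def
    by (subst sum.swap[of _ "{..<N}" "{..<M}"], subst sum.swap[of _ "{..<N}" "{..<H}"]) (rule refl)
  also have "\<dots> = (\<Sum>q<N. if odd q \<and> r dvd q then (\<Sum>h<H. \<Sum>u<M. real_of_int (PJ (int (2 * (u + h) + 1)) q)) else 0)"
    by (intro sum.cong) auto
  finally have "SPbar = (\<Sum>q<N. if odd q \<and> r dvd q then (\<Sum>h<H. \<Sum>u<M. real_of_int (PJ (int (2 * (u + h) + 1)) q)) else 0) / real H"
    by (simp only: SPbar_def)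
  also have "\<dots> = (\<Sum>q<N. (if odd q \<and> r dvd q then (\<Sum>h<H. \<Sum>u<M. real_of_int (PJ (int (2 * (u + h) + 1)) q)) else 0) / real H)"
    by (rule sum_divide_distrib)
  also have "\<dots> = (\<Sum>q<N. if odd q \<and> r dvd q then ?w q else 0)"
    by (rule sum.cong[OF refl]) (simp only: if_distrib[of "\<lambda>x. x / real H"] div_0)
  finally have "SPbar = (\<Sum>q<N. if odd q \<and> r dvd q then ?w q else 0)" .
  also have "(\<Sum>q<N. if odd q \<and> r dvd q then ?w q else 0) = (\<Sum>q<N. (if odd q \<and> r dvd q \<and> (\<exists>s. q = s\<^sup>2) then real M else 0)
      + (\<Sum>k = 1..q div 2. (- 1) ^ k * a 1 k q * G 1 k q) + (\<Sum>k = 1..q div 2. (- 1) ^ k * a 3 k q * G 3 k q))"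
  proof (rule sum.cong[OF refl])
    fix q
    show "(if odd q \<and> r dvd q then ?w q else 0) = (if odd q \<and> r dvd q \<and> (\<exists>s. q = s\<^sup>2) then real M else 0)
      + (\<Sum>k = 1..q div 2. (- 1) ^ k * a 1 k q * G 1 k q) + (\<Sum>k = 1..q div 2. (- 1) ^ k * a 3 k q * G 3 k q)"
    proof (cases "odd q \<and> r dvd q")
      case True
      then have o: "odd q" and rd: "r dvd q" by auto
      define b where "b = q mod 4"
      have b: "b = 1 \<or> b = 3" using odd_mod_4[OF o] by (simp add: b_def)
      have w: "?w q = (if \<exists>s. q = s\<^sup>2 then real M else 0) + (\<Sum>k = 1..q div 2. (- 1) ^ k * a b k q * G b k q)"
        unfolding PJ_dual_smooth[OF o b_def[symmetric] H] using rd by (simp add: a_def G_def b_def)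
      have z: "(\<Sum>k = 1..q div 2. (- 1) ^ k * a c k q * G c k q) = 0" if "c \<noteq> b" for c
        using that by (intro sum.neutral) (auto simp: a_def b_def)
      show ?thesis using True w b z[of 1] z[of 3] by auto
    next
      case False
      have "q mod 4 = 1 \<or> q mod 4 = 3 \<Longrightarrow> odd q" by presburger
      then have nd: "q mod 4 = 1 \<or> q mod 4 = 3 \<Longrightarrow> \<not> r dvd q" using False by blast
      have "a 1 k q = 0" "a 3 k q = 0" for k using nd by (auto simp: a_def)
      moreover have nf: "\<not> (odd q \<and> r dvd q \<and> (\<exists>s. q = s\<^sup>2))" using False by blast
      ultimately show ?thesis unfolding if_not_P[OF False] if_not_P[OF nf] by simp
    qed
  qed
  also have "\<dots> = (\<Sum>q<N. if odd q \<and> r dvd q \<and> (\<exists>s. q = s\<^sup>2) then real M else 0) + V 1 + V 3"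
    by (simp only: sum.distrib V_def)
  also have "(\<Sum>q<N. if odd q \<and> r dvd q \<and> (\<exists>s. q = s\<^sup>2) then real M else 0) = (\<Sum>q\<in>(\<lambda>s. s\<^sup>2) ` {s. odd s \<and> r dvd s \<and> s\<^sup>2 < N}. real M)"
    by (rule sum.mono_neutral_cong_right)
      (use r squarefree_dvd_square_iff[OF r(2) odd_pos[OF r(1)]] in auto)
  also have "\<dots> = real M * real (card {s. odd s \<and> r dvd s \<and> s\<^sup>2 < N})"
    by (subst sum_constant, subst card_image) (auto simp: inj_on_def)
  finally show ?thesis .
qed

lemma V_estimate:
  assumes b: "b = 1 \<or> b = 3"
  shows "\<bar>V b - (\<Sum>j = 1..J. \<Sum>q\<in>{A..<N}. G b (2 * j\<^sup>2) q) / (4 * real r)\<bar>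
    \<le> 14 * real N ^ 2 * sqrt (real N) / (real H * sqrt (real K)) + 9 * real A * sqrt (real A) * sqrt (real K)
      + 6144 * real K ^ 3 * (6 * sqrt (real N) + real N * lip)"
proof -
  let ?S = "\<lambda>k. \<Sum>q\<in>{A..<N}. a b k q * G b k q" and ?T = "\<lambda>k. \<Sum>q\<in>{A..<N}. G b k q"
  have "\<bar>(\<Sum>k = 1..K. (- 1) ^ k * ?S k) - (\<Sum>k = 1..K. (- 1) ^ k * (sqind k * ?T k))\<bar>
     = \<bar>\<Sum>k = 1..K. (- 1) ^ k * (?S k - sqind k * ?T k)\<bar>"
    by (simp add: sum_subtractf right_diff_distrib)
  also have "\<dots> \<le> (\<Sum>k = 1..K. 6144 * real K ^ 2 * (6 * sqrt (real N) + real N * lip))"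
  proof (rule order_trans[OF sum_abs], rule sum_mono)
    fix k assume "k \<in> {1..K}"
    then show "\<bar>(- 1) ^ k * (?S k - sqind k * ?T k)\<bar> \<le> 6144 * real K ^ 2 * (6 * sqrt (real N) + real N * lip)"
      using abel_step[OF b, of k] by (simp add: abs_mult power_abs)
  qed
  also have "\<dots> = 6144 * real K ^ 3 * (6 * sqrt (real N) + real N * lip)"
    by (simp add: power2_eq_square power3_eq_cube)
  finally show ?thesis using V_truncate[OF b] unfolding sum_even_squares by linarith
qed

definition main_term :: real where
  "main_term = X * sqrt Q / (4 * real r) + (\<Sum>j = 1..J. integral {0..Q} (kern (2 * pi * real j ^ 2 * X)) / (2 * pi * real j ^ 2)) / (4 * real r)"

text \<open>In this order: rounding of \<open>M\<close> and of the count of squares; truncation and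
  partial summation, for two classes; the limit of the smoothed sums; replacing sums over
  \<open>q\<close> by integrals.\<close>

definition dual_error :: real where
  "dual_error = X + sqrt Q + 2 * (14 * real N ^ 2 * sqrt (real N) / (real H * sqrt (real K)) + 9 * real A * sqrt (real A) * sqrt (real K)
      + 6144 * real K ^ 3 * (6 * sqrt (real N) + real N * lip))
    + real N * (8 * real J + 24 * sqrt (real H) * (1 + ln (real J)))
    + real J * (real N * (3 + 16 * X / real A) + 3 * sqrt (real N) + 3 * real A * sqrt (real A))"

lemma SPbar_estimate: "\<bar>SPbar - main_term\<bar> \<le> dual_error"
proof -
  define c where "c = real (card {s. odd s \<and> r dvd s \<and> s\<^sup>2 < N})"
  have cQ: "\<bar>c - sqrt Q / (2 * real r)\<bar> \<le> 1"
    using card_odd_squares(1)[OF r(1), of Q] Q unfolding c_def N by simp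
  have "\<bar>real M * (c - sqrt Q / (2 * real r))\<bar> \<le> X * 1"
    unfolding abs_mult using M_bounds X by (intro mult_mono cQ) auto
  moreover have "\<bar>(real M - X / 2) * (sqrt Q / (2 * real r))\<bar> \<le> 1 * sqrt Q"
    unfolding abs_mult
  proof (intro mult_mono)
    have "sqrt Q / (2 * real r) \<le> sqrt Q / 1" using rpos Q by (intro divide_left_mono) auto
    then show "\<bar>sqrt Q / (2 * real r)\<bar> \<le> sqrt Q" using rpos Q by simp
  qed (use M_bounds Q in auto)
  moreover have "real M * c - X * sqrt Q / (4 * real r) = real M * (c - sqrt Q / (2 * real r)) + (real M - X / 2) * (sqrt Q / (2 * real r))"
  proof -
    have "m * c - X / 2 * y = m * (c - y) + (m - X / 2) * y" for m y by (simp add: algebra_simps)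
    from this[of "real M" "sqrt Q / (2 * real r)"] show ?thesis by simp
  qed
  ultimately have 1: "\<bar>real M * c - X * sqrt Q / (4 * real r)\<bar> \<le> X + sqrt Q" by linarith
  define g where "g j = (\<Sum>q\<in>{A..<N}. G 1 (2 * j\<^sup>2) q + G 3 (2 * j\<^sup>2) q)" for j
  define k where "k j = (\<Sum>q\<in>{A..<N}. kern (2 * pi * real j ^ 2 * X) (real q))" for j
  define i where "i j = integral {0..Q} (kern (2 * pi * real j ^ 2 * X))" for j :: nat
  define D where "D j = 2 * pi * real j ^ 2" for j :: nat
  let ?B1 = "\<lambda>j. real N * (8 + 24 * sqrt (real H) / real j)"
  let ?B2 = "real N * (3 + 16 * X / real A) + 3 * sqrt (real N) + 3 * real A * sqrt (real A)"
  have gk: "\<bar>g j - k j / D j\<bar> \<le> ?B1 j" if j: "j \<in> {1..J}" for j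
  proof -
    have eq: "g j - k j / D j = (\<Sum>q\<in>{A..<N}. G 1 (2 * j\<^sup>2) q + G 3 (2 * j\<^sup>2) q - kern (2 * pi * real j ^ 2 * X) (real q) / D j)"
      by (simp add: g_def k_def sum_subtractf sum_divide_distrib sum.distrib)
    have "\<bar>g j - k j / D j\<bar> \<le> (\<Sum>q\<in>{A..<N}. 8 + 24 * sqrt (real H) / real j)"
      unfolding eq by (rule order_trans[OF sum_abs], rule sum_mono) (use j G_pair_approx in \<open>auto simp: D_def\<close>)
    also have "\<dots> = real (N - A) * (8 + 24 * sqrt (real H) / real j)"
      by (simp only: sum_constant card_atLeastLessThan)
    also have "\<dots> \<le> ?B1 j" by (intro mult_right_mono) auto
    finally show ?thesis .
  qed
  have ki: "\<bar>k j / D j - i j / D j\<bar> \<le> ?B2" if j: "j \<in> {1..J}" for j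
  proof -
    have "D j > 0" using j by (simp add: D_def)
    then have "\<bar>k j / D j - i j / D j\<bar> = \<bar>k j - i j\<bar> / D j" by (simp add: diff_divide_distrib[symmetric])
    then show ?thesis using kern_sum_approx[of j] j by (simp only: k_def i_def D_def) simp
  qed
  have "\<bar>(\<Sum>j = 1..J. g j) - (\<Sum>j = 1..J. i j / D j)\<bar> \<le> (\<Sum>j = 1..J. ?B1 j + ?B2)"
    unfolding sum_subtractf[symmetric]
  proof (rule order_trans[OF sum_abs], rule sum_mono)
    fix j assume "j \<in> {1..J}"
    then show "\<bar>g j - i j / D j\<bar> \<le> ?B1 j + ?B2" using gk[of j] ki[of j] by linarith
  qed
  also have "\<dots> = real N * (8 * real J + 24 * sqrt (real H) * (\<Sum>j = 1..J. 1 / real j)) + real J * ?B2"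
    by (simp add: sum.distrib sum_distrib_left distrib_left mult_ac)
  also have "\<dots> \<le> real N * (8 * real J + 24 * sqrt (real H) * (1 + ln (real J))) + real J * ?B2"
    using sum_inverse_le_ln[OF J] by (intro add_mono mult_left_mono) auto
  finally have 2: "\<bar>(\<Sum>j = 1..J. g j) - (\<Sum>j = 1..J. i j / D j)\<bar>
     \<le> real N * (8 * real J + 24 * sqrt (real H) * (1 + ln (real J))) + real J * ?B2" (is "_ \<le> ?E") .
  have "\<bar>(\<Sum>j = 1..J. g j) / (4 * real r) - (\<Sum>j = 1..J. i j / D j) / (4 * real r)\<bar> = \<bar>(\<Sum>j = 1..J. g j) - (\<Sum>j = 1..J. i j / D j)\<bar> / (4 * real r)"
    using rpos by (simp add: diff_divide_distrib[symmetric])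
  also have "\<dots> \<le> \<bar>(\<Sum>j = 1..J. g j) - (\<Sum>j = 1..J. i j / D j)\<bar> / 1"
    using rpos by (intro divide_left_mono) auto
  finally have 3: "\<bar>(\<Sum>j = 1..J. g j) / (4 * real r) - (\<Sum>j = 1..J. i j / D j) / (4 * real r)\<bar> \<le> ?E"
    using 2 by simp
  have 4: "(\<Sum>j = 1..J. g j) / (4 * real r) = (\<Sum>j = 1..J. \<Sum>q\<in>{A..<N}. G 1 (2 * j\<^sup>2) q) / (4 * real r)
     + (\<Sum>j = 1..J. \<Sum>q\<in>{A..<N}. G 3 (2 * j\<^sup>2) q) / (4 * real r)"
    by (simp only: g_def sum.distrib add_divide_distrib)
  have m: "main_term = X * sqrt Q / (4 * real r) + (\<Sum>j = 1..J. i j / D j) / (4 * real r)"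
    by (simp only: main_term_def i_def D_def)
  have gen: "\<bar>y + v1 + v3 - (x + s)\<bar> \<le> e0 + 2 * w + e1 + e2"
    if "\<bar>y - x\<bar> \<le> e0" "\<bar>t - s\<bar> \<le> e1 + e2" "t = s1 + s3" "\<bar>v1 - s1\<bar> \<le> w" "\<bar>v3 - s3\<bar> \<le> w"
    for y v1 v3 x s e0 w e1 e2 t s1 s3 :: real
    using that by linarith
  show ?thesis
    unfolding SPbar_eq c_def[symmetric] m dual_error_def
    by (rule gen[OF 1 3 4 V_estimate[OF disjI1[OF refl]] V_estimate[OF disjI2[OF refl]]])
qed

lemma SP_eq: "SP r X Q = (\<Sum>u<M. Zsum r (2 * u + 1) N)"
proof -
  have "SP r X Q = (\<Sum>m\<in>(\<lambda>u. 2 * u + 1) ` {..<M}. Zsum r m N)"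
    unfolding SP_def N[symmetric]
  proof (rule sum.mono_neutral_cong_right)
    show "\<forall>m\<in>{..<nat \<lfloor>X\<rfloor> + 1} - (\<lambda>u. 2 * u + 1) ` {..<M}. (if odd m then Zsum r m N else 0) = 0"
    proof
      fix m assume m: "m \<in> {..<nat \<lfloor>X\<rfloor> + 1} - (\<lambda>u. 2 * u + 1) ` {..<M}"
      have "even m"
      proof (rule ccontr)
        assume "odd m"
        then obtain u where u: "m = 2 * u + 1" by (elim oddE)
        then have "u < M" using m by (auto simp: M)
        then show False using m u by blast
      qed
      then show "(if odd m then Zsum r m N else 0) = 0" by simp
    qed
  qed (auto simp: M)
  also have "\<dots> = (\<Sum>u<M. Zsum r (2 * u + 1) N)" by (subst sum.reindex) (auto simp: inj_on_def)
  finally show ?thesis .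
qed

text \<open>Shifting the window by \<open>h < H\<close> changes it only at its two ends, by at most
  \<open>H\<close> terms each.\<close>

lemma SP_smoothing:
  "\<bar>SP r X Q - SPbar\<bar> \<le> (\<Sum>u<H. \<bar>Zsum r (2 * u + 1) N\<bar>) + (\<Sum>u\<in>{M..<M + H}. \<bar>Zsum r (2 * u + 1) N\<bar>)"
proof -
  define z where "z u = Zsum r (2 * u + 1) N" for u
  let ?E = "(\<Sum>u<H. \<bar>z u\<bar>) + (\<Sum>u\<in>{M..<M + H}. \<bar>z u\<bar>)"
  have one: "\<bar>(\<Sum>u<M. z u) - (\<Sum>u<M. z (u + h))\<bar> \<le> ?E" if h: "h < H" for h
  proof -
    have s: "(\<Sum>u<M. z (u + h)) = (\<Sum>u\<in>{h..<M + h}. z u)"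
      using sum.shift_bounds_nat_ivl[of z 0 h M] by (simp add: lessThan_atLeast0)
    have "(\<Sum>u\<in>{0..<h}. z u) + (\<Sum>u\<in>{h..<M + h}. z u) = (\<Sum>u\<in>{0..<M + h}. z u)"
      by (rule sum.atLeastLessThan_concat) auto
    moreover have "(\<Sum>u\<in>{0..<M}. z u) + (\<Sum>u\<in>{M..<M + h}. z u) = (\<Sum>u\<in>{0..<M + h}. z u)"
      by (rule sum.atLeastLessThan_concat) auto
    ultimately have eq: "(\<Sum>u<M. z u) - (\<Sum>u<M. z (u + h)) = (\<Sum>u\<in>{0..<h}. z u) - (\<Sum>u\<in>{M..<M + h}. z u)"
      unfolding s by (simp add: lessThan_atLeast0)
    have "\<bar>\<Sum>u\<in>{0..<h}. z u\<bar> \<le> (\<Sum>u<H. \<bar>z u\<bar>)"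
      by (rule order_trans[OF sum_abs], rule sum_mono2) (use h in auto)
    moreover have "\<bar>\<Sum>u\<in>{M..<M + h}. z u\<bar> \<le> (\<Sum>u\<in>{M..<M + H}. \<bar>z u\<bar>)"
      by (rule order_trans[OF sum_abs], rule sum_mono2) (use h in auto)
    ultimately show ?thesis unfolding eq by linarith
  qed
  have "SP r X Q - SPbar = (\<Sum>h<H. (\<Sum>u<M. z u) - (\<Sum>u<M. z (u + h))) / real H"
    using H by (simp add: SP_eq SPbar_def z_def sum_subtractf diff_divide_distrib)
  also have "\<bar>\<dots>\<bar> = \<bar>\<Sum>h<H. (\<Sum>u<M. z u) - (\<Sum>u<M. z (u + h))\<bar> / real H" by simp
  also have "\<dots> \<le> (\<Sum>h<H. ?E) / real H"
    by (intro divide_right_mono order_trans[OF sum_abs] sum_mono one) auto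
  also have "\<dots> = ?E" using H by simp
  finally show ?thesis by (simp add: z_def)
qed

end

text \<open>Squares with roots \<open>i\<close> and \<open>i + d\<close> differ by at least
  \<open>d^2\<close>, so all roots lie within \<open>sqrt h\<close> of the smallest one.\<close>

lemma card_squares_interval:
  "real (card {j :: nat. a < j\<^sup>2 \<and> j\<^sup>2 \<le> a + h}) \<le> sqrt (real h) + 1"
proof (cases "{j :: nat. a < j\<^sup>2 \<and> j\<^sup>2 \<le> a + h} = {}")
  case False
  define S where "S = {j :: nat. a < j\<^sup>2 \<and> j\<^sup>2 \<le> a + h}"
  have fin: "finite S"
  proof (rule finite_subset)
    show "S \<subseteq> {..a + h}"
    proof
      fix j assume "j \<in> S"
      then have "j\<^sup>2 \<le> a + h" by (simp add: S_def)
      moreover have "j \<le> j\<^sup>2" by (simp add: power2_eq_square)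
      ultimately show "j \<in> {..a + h}" by simp
    qed
  qed simp
  define i where "i = Min S"
  have "S \<noteq> {}" using False by (simp add: S_def)
  then have i: "i \<in> S" "\<And>j. j \<in> S \<Longrightarrow> i \<le> j" unfolding i_def by (auto intro: Min_in Min_le fin)
  have "S \<subseteq> {i..i + nat \<lfloor>sqrt (real h)\<rfloor>}"
  proof
    fix j assume j: "j \<in> S"
    have "i \<le> j" using i j by blast
    then obtain d where d: "j = i + d" using le_Suc_ex by blast
    have "i\<^sup>2 + d\<^sup>2 \<le> j\<^sup>2" by (simp add: d power2_sum)
    moreover have "a < i\<^sup>2" "j\<^sup>2 \<le> a + h" using i j by (auto simp: S_def)
    ultimately have "d\<^sup>2 \<le> h" by linarith
    then have "real (d\<^sup>2) \<le> real h" by (simp only: of_nat_le_iff)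
    then have "real d \<le> sqrt (real h)" by (intro real_le_rsqrt) simp
    then have "d \<le> nat \<lfloor>sqrt (real h)\<rfloor>" by (simp add: le_nat_floor)
    then show "j \<in> {i..i + nat \<lfloor>sqrt (real h)\<rfloor>}" using d by simp
  qed
  then have "card S \<le> card {i..i + nat \<lfloor>sqrt (real h)\<rfloor>}" by (intro card_mono) auto
  then have "card S \<le> nat \<lfloor>sqrt (real h)\<rfloor> + 1" by simp
  then have "real (card S) \<le> real (nat \<lfloor>sqrt (real h)\<rfloor>) + 1" by linarith
  moreover have "real (nat \<lfloor>sqrt (real h)\<rfloor>) \<le> sqrt (real h)" by simp
  ultimately show ?thesis unfolding S_def by linarith
next
  case True
  have "0 \<le> sqrt (real h)" by simp
  then show ?thesis by (simp only: True card.empty of_nat_0)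
qed

text \<open>The price of smoothing: an interval of \<open>2 * H\<close> integers contains few
  squares, each costing at most \<open>N + 4 * T\<close>, and on the non-squares the average of
  \<open>tau2\<close> applies.\<close>

lemma Zsum_interval_bound:
  assumes r: "odd r" "squarefree r" and H: "H > 0"
    and T: "T = real (2 * (a + H))"
  shows "(\<Sum>u\<in>{a..<a + H}. \<bar>Zsum r (2 * u + 1) N\<bar>)
    \<le> (sqrt (2 * real H) + 1) * (real N + 4 * T) + 3072 * sqrt T * (1 + ln T) * (4 * real H + sqrt T)"
proof -
  have rpos: "real r \<ge> 1" using r by (simp add: Suc_leI odd_pos)
  have T1: "T \<ge> 1" using H by (simp add: T)
  let ?C = "3072 * sqrt T * (1 + ln T)"
  have C0: "?C \<ge> 0" using T1 by simp
  let ?sq = "\<lambda>m::nat. \<exists>s. m = s\<^sup>2"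
  let ?I = "{2 * a<..2 * a + 2 * H}"
  have "(\<Sum>u\<in>{a..<a + H}. \<bar>Zsum r (2 * u + 1) N\<bar>) = (\<Sum>m\<in>(\<lambda>u. 2 * u + 1) ` {a..<a + H}. \<bar>Zsum r m N\<bar>)"
    by (subst sum.reindex) (auto simp: inj_on_def)
  also have "\<dots> \<le> (\<Sum>m\<in>(\<lambda>u. 2 * u + 1) ` {a..<a + H}. (if ?sq m then real N + 4 * T else 0) + ?C * real (tau2 m))"
  proof (rule sum_mono)
    fix m assume "m \<in> (\<lambda>u. 2 * u + 1) ` {a..<a + H}"
    then have m: "m > 0" "m \<le> 2 * (a + H)" by auto
    then have mT: "real m \<le> T" unfolding T by (simp only: of_nat_le_iff)
    show "\<bar>Zsum r m N\<bar> \<le> (if ?sq m then real N + 4 * T else 0) + ?C * real (tau2 m)"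
    proof (cases "?sq m")
      case True
      then obtain s where s: "m = s\<^sup>2" by blast
      then have "s > 0" using m by (auto intro: Nat.gr0I)
      have "real N / (2 * real r) \<le> real N / 1" using rpos by (intro divide_left_mono) auto
      moreover have "real N / (2 * real r) \<ge> 0" by simp
      moreover have "\<bar>Zsum r m N - real N / (2 * real r)\<bar> \<le> 4 * T"
        using Zsum_square[OF r \<open>s > 0\<close>, of N] mT unfolding s by linarith
      ultimately have "\<bar>Zsum r m N\<bar> \<le> real N + 4 * T" by linarith
      then show ?thesis using True C0 by (simp add: add_increasing2)
    next
      case False
      have "\<bar>Zsum r m N\<bar> \<le> 3072 * sqrt (real m) * (1 + ln (real m)) * real (tau2 m)"
        by (rule Zsum_nonsquare[OF r m(1) False])
      also have "\<dots> \<le> ?C * real (tau2 m)"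
        using mT m T1 by (intro mult_right_mono mult_mono) auto
      finally show ?thesis using False by simp
    qed
  qed
  also have "\<dots> \<le> (\<Sum>m\<in>?I. (if ?sq m then real N + 4 * T else 0) + ?C * real (tau2 m))"
    using C0 T1 by (intro sum_mono2) auto
  also have "\<dots> = (\<Sum>m\<in>?I. if ?sq m then real N + 4 * T else 0) + ?C * (\<Sum>m\<in>?I. real (tau2 m))"
    by (simp only: sum.distrib sum_distrib_left)
  also have "\<dots> \<le> (sqrt (2 * real H) + 1) * (real N + 4 * T) + ?C * (4 * real H + sqrt T)"
  proof (rule add_mono)
    have "(\<Sum>m\<in>?I. if ?sq m then real N + 4 * T else 0) = (\<Sum>m\<in>(\<lambda>j. j\<^sup>2) ` {j. 2 * a < j\<^sup>2 \<and> j\<^sup>2 \<le> 2 * a + 2 * H}. real N + 4 * T)"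
      by (rule sum.mono_neutral_cong_right) auto
    also have "\<dots> = real (card {j :: nat. 2 * a < j\<^sup>2 \<and> j\<^sup>2 \<le> 2 * a + 2 * H}) * (real N + 4 * T)"
      by (subst sum_constant, subst card_image) (auto simp: inj_on_def)
    also have "\<dots> \<le> (sqrt (real (2 * H)) + 1) * (real N + 4 * T)"
      using T1 by (intro mult_right_mono card_squares_interval) auto
    finally show "(\<Sum>m\<in>?I. if ?sq m then real N + 4 * T else 0) \<le> (sqrt (2 * real H) + 1) * (real N + 4 * T)" by simp
    have "(\<Sum>m\<in>?I. real (tau2 m)) \<le> 2 * real (2 * H) + sqrt (real (2 * a + 2 * H))" by (rule sum_tau2_le)
    then have "(\<Sum>m\<in>?I. real (tau2 m)) \<le> 4 * real H + sqrt T" by (simp add: T)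
    then show "?C * (\<Sum>m\<in>?I. real (tau2 m)) \<le> ?C * (4 * real H + sqrt T)" by (rule mult_left_mono[OF _ C0])
  qed
  finally show ?thesis .
qed

section \<open>The transition function\<close>

definition Kint :: "nat \<Rightarrow> real \<Rightarrow> real" where
  "Kint k \<alpha> = integral {0..\<alpha>} (kern (2 * pi * real (Suc k) ^ 2))"

lemma C_trans_Kint: "C_trans \<alpha> = sqrt \<alpha> + 1 / (2 * pi) * (\<Sum>k. 1 / real (Suc k) ^ 2 * Kint k \<alpha>)"
proof -
  have "(\<lambda>y. sqrt y * (1 - cos (2 * pi * real (Suc k) ^ 2 / y) + sin (2 * pi * real (Suc k) ^ 2 / y))) = kern (2 * pi * real (Suc k) ^ 2)" for k
    by (simp add: kern_def fun_eq_iff)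
  then show ?thesis by (simp only: C_trans_def Kint_def)
qed

text \<open>The substitution \<open>y = X * t\<close>; it is the reason why the limit function
  depends only on \<open>Q / X\<close>.\<close>

lemma integral_kern_scale:
  assumes X: "X > 0" and Q: "Q \<ge> 0"
  shows "integral {0..Q} (kern (c * X)) = X * sqrt X * integral {0..Q / X} (kern c)"
proof -
  have "(kern (c * X) has_integral integral {0..Q} (kern (c * X))) {0..Q}"
    by (intro integrable_integral kern_integrable) simp
  from has_integral_stretch_real[OF this, of X] X
  have 1: "((\<lambda>t. kern (c * X) (X * t)) has_integral (1 / X) * integral {0..Q} (kern (c * X))) ((\<lambda>x. x / X) ` {0..Q})"
    by simp
  have "(\<lambda>x. x / X) ` {0..Q} = {0..Q / X}"
  proof (intro equalityI subsetI)
    fix y assume "y \<in> {0..Q / X}"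
    then have "y * X \<in> {0..Q}" "y = (y * X) / X" using X by (auto simp: field_simps)
    then show "y \<in> (\<lambda>x. x / X) ` {0..Q}" by blast
  qed (use X in \<open>auto simp: divide_right_mono\<close>)
  moreover have "kern (c * X) (X * t) = sqrt X * kern c t" for t
    using X by (cases "t = 0") (simp_all add: kern_def real_sqrt_mult)
  ultimately have "((\<lambda>t. sqrt X * kern c t) has_integral (1 / X) * integral {0..Q} (kern (c * X))) {0..Q / X}"
    using 1 by simp
  moreover have "((\<lambda>t. sqrt X * kern c t) has_integral sqrt X * integral {0..Q / X} (kern c)) {0..Q / X}"
    by (intro has_integral_mult_right integrable_integral kern_integrable) simp
  ultimately have "(1 / X) * integral {0..Q} (kern (c * X)) = sqrt X * integral {0..Q / X} (kern c)"
    by (rule has_integral_unique)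
  then show ?thesis using X by (simp add: field_simps)
qed

lemma abs_Kint_le: "\<alpha> \<ge> 0 \<Longrightarrow> \<bar>Kint k \<alpha>\<bar> \<le> 3 * (\<alpha> * sqrt \<alpha>)"
  using abs_integral_kern_le[of 0 \<alpha>] by (simp add: Kint_def mult_ac)

lemma inverse_squares_tail:
  assumes "J > 0"
  shows "summable (\<lambda>k. 1 / real (Suc (k + J)) ^ 2)" "(\<Sum>k. 1 / real (Suc (k + J)) ^ 2) \<le> 1 / real J"
proof -
  have "(\<lambda>n. 1 / real (n + J)) \<longlonglongrightarrow> 0"
    using LIMSEQ_ignore_initial_segment[OF lim_inverse_n', of J] by (simp add: inverse_eq_divide)
  from telescope_sums'[OF this]
  have s: "(\<lambda>n. 1 / real (n + J) - 1 / real (Suc n + J)) sums (1 / real J)" by simp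
  have le: "1 / real (Suc (k + J)) ^ 2 \<le> 1 / real (k + J) - 1 / real (Suc k + J)" for k
  proof -
    have "1 / real (Suc (k + J)) ^ 2 \<le> 1 / (real (k + J) * real (Suc (k + J)))"
      using assms unfolding power2_eq_square by (intro divide_left_mono mult_right_mono) auto
    also have "\<dots> = 1 / real (k + J) - 1 / real (Suc k + J)" using assms by (simp add: field_simps)
    finally show ?thesis .
  qed
  show sm: "summable (\<lambda>k. 1 / real (Suc (k + J)) ^ 2)"
    by (rule summable_comparison_test'[OF sums_summable[OF s], of 0]) (use le in auto)
  show "(\<Sum>k. 1 / real (Suc (k + J)) ^ 2) \<le> 1 / real J"
    using suminf_le[OF le sm sums_summable[OF s]] sums_unique[OF s] by simp
qed

lemma Kint_series:
  assumes a: "\<alpha> \<ge> 0"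
  shows "summable (\<lambda>k. 1 / real (Suc k) ^ 2 * Kint k \<alpha>)"
    and "J > 0 \<Longrightarrow> \<bar>(\<Sum>k. 1 / real (Suc k) ^ 2 * Kint k \<alpha>) - (\<Sum>k<J. 1 / real (Suc k) ^ 2 * Kint k \<alpha>)\<bar> \<le> 3 * (\<alpha> * sqrt \<alpha>) / real J"
proof -
  let ?f = "\<lambda>k. 1 / real (Suc k) ^ 2 * Kint k \<alpha>"
  let ?B = "3 * (\<alpha> * sqrt \<alpha>)"
  have le: "norm (?f k) \<le> ?B * (1 / real (Suc k) ^ 2)" for k
  proof -
    have "norm (?f k) = 1 / real (Suc k) ^ 2 * \<bar>Kint k \<alpha>\<bar>" by (simp add: abs_mult)
    also have "\<dots> \<le> 1 / real (Suc k) ^ 2 * ?B" by (intro mult_left_mono abs_Kint_le a) simp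
    finally show ?thesis by (simp only: mult.commute)
  qed
  have s1: "summable (\<lambda>k. ?B * (1 / real (Suc (k + n)) ^ 2))" if "n > 0" for n
    by (rule summable_mult[OF inverse_squares_tail(1)[OF that]])
  have sn: "summable (\<lambda>k. ?f (k + n))" if "n > 0" for n
    by (rule summable_comparison_test'[OF s1[OF that], of 0]) (rule le)
  have "summable (\<lambda>k. ?f (k + 1))" by (rule sn) simp
  then show sm: "summable ?f" by (rule summable_iff_shift[THEN iffD1])
  show "\<bar>(\<Sum>k. ?f k) - (\<Sum>k<J. ?f k)\<bar> \<le> ?B / real J" if J: "J > 0"
  proof -
    have eq: "(\<Sum>k. ?f k) - (\<Sum>k<J. ?f k) = (\<Sum>k. ?f (k + J))"
      using suminf_split_initial_segment[OF sm, of J] by simp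
    have "norm (\<Sum>k. ?f (k + J)) \<le> (\<Sum>k. ?B * (1 / real (Suc (k + J)) ^ 2))"
      by (rule norm_suminf_le[OF le s1[OF J]])
    also have "\<dots> = ?B * (\<Sum>k. 1 / real (Suc (k + J)) ^ 2)"
      by (rule suminf_mult[OF inverse_squares_tail(1)[OF J]])
    also have "\<dots> \<le> ?B * (1 / real J)"
      using inverse_squares_tail(2)[OF J] a by (intro mult_left_mono) auto
    finally show ?thesis unfolding eq by simp
  qed
qed

text \<open>With \<open>\<alpha> = Q / X\<close>, the series beyond \<open>J\<close> is at most
  \<open>3 \<alpha> sqrt \<alpha> / J\<close>; the factor \<open>X sqrt X / (2 pi)\<close> brings
  this below \<open>Q sqrt Q / J\<close>.\<close>

lemma C_trans_truncate:
  assumes X: "X > 0" and Q: "Q > 0" and J: "J > 0"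
  shows "\<bar>X * sqrt Q + (\<Sum>j = 1..J. integral {0..Q} (kern (2 * pi * real j ^ 2 * X)) / (2 * pi * real j ^ 2))
     - C_trans (Q / X) * (X * sqrt X)\<bar> \<le> Q * sqrt Q / real J"
proof -
  define \<alpha> where "\<alpha> = Q / X"
  let ?f = "\<lambda>k. 1 / real (Suc k) ^ 2 * Kint k \<alpha>"
  have a: "\<alpha> > 0" using X Q by (simp add: \<alpha>_def)
  have "(\<Sum>j = 1..J. integral {0..Q} (kern (2 * pi * real j ^ 2 * X)) / (2 * pi * real j ^ 2))
     = (\<Sum>k<J. integral {0..Q} (kern (2 * pi * real (Suc k) ^ 2 * X)) / (2 * pi * real (Suc k) ^ 2))"
    by (rule sum.reindex_bij_witness[where i = Suc and j = "\<lambda>j. j - 1"]) auto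
  also have "\<dots> = (\<Sum>k<J. X * sqrt X / (2 * pi) * ?f k)"
  proof (rule sum.cong[OF refl])
    fix k
    have "integral {0..Q} (kern (2 * pi * real (Suc k) ^ 2 * X)) = X * sqrt X * Kint k \<alpha>"
      unfolding Kint_def \<alpha>_def using X Q by (intro integral_kern_scale) auto
    then show "integral {0..Q} (kern (2 * pi * real (Suc k) ^ 2 * X)) / (2 * pi * real (Suc k) ^ 2) = X * sqrt X / (2 * pi) * ?f k"
      by (simp only:) (simp add: field_simps)
  qed
  also have "\<dots> = X * sqrt X / (2 * pi) * (\<Sum>k<J. ?f k)" by (simp only: sum_distrib_left)
  finally have 1: "(\<Sum>j = 1..J. integral {0..Q} (kern (2 * pi * real j ^ 2 * X)) / (2 * pi * real j ^ 2))
     = X * sqrt X / (2 * pi) * (\<Sum>k<J. ?f k)" .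
  have sa: "sqrt X * sqrt \<alpha> = sqrt Q" using X by (simp add: \<alpha>_def flip: real_sqrt_mult)
  have "C_trans \<alpha> * (X * sqrt X) = X * (sqrt X * sqrt \<alpha>) + X * sqrt X / (2 * pi) * (\<Sum>k. ?f k)"
    unfolding C_trans_Kint by (simp add: field_simps)
  then have 2: "C_trans \<alpha> * (X * sqrt X) = X * sqrt Q + X * sqrt X / (2 * pi) * (\<Sum>k. ?f k)" by (simp only: sa)
  have "\<bar>X * sqrt Q + X * sqrt X / (2 * pi) * (\<Sum>k<J. ?f k) - C_trans \<alpha> * (X * sqrt X)\<bar>
     = X * sqrt X / (2 * pi) * \<bar>(\<Sum>k. ?f k) - (\<Sum>k<J. ?f k)\<bar>"
  proof -
    have "X * sqrt Q + X * sqrt X / (2 * pi) * (\<Sum>k<J. ?f k) - C_trans \<alpha> * (X * sqrt X)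
      = - (X * sqrt X / (2 * pi) * ((\<Sum>k. ?f k) - (\<Sum>k<J. ?f k)))" unfolding 2 by (simp only: right_diff_distrib)
    then show ?thesis using X by (simp only: abs_minus_cancel abs_mult) simp
  qed
  also have "\<dots> \<le> X * sqrt X / (2 * pi) * (3 * (\<alpha> * sqrt \<alpha>) / real J)"
    using X a Kint_series(2)[OF less_imp_le[OF a] J] by (intro mult_left_mono) auto
  also have "\<dots> = 3 / (2 * pi) * ((X * \<alpha>) * (sqrt X * sqrt \<alpha>) / real J)" by simp
  also have "(X * \<alpha>) * (sqrt X * sqrt \<alpha>) = Q * sqrt Q" unfolding sa using X by (simp add: \<alpha>_def)
  also have "3 / (2 * pi) * (Q * sqrt Q / real J) \<le> 1 * (Q * sqrt Q / real J)"
    using pi_ge_two Q by (intro mult_right_mono) (auto simp: divide_le_eq)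
  finally show ?thesis unfolding 1 \<alpha>_def by simp
qed

section \<open>The transition range\<close>

lemma nat_ceiling_bounds:
  assumes "y \<ge> (1::real)"
  shows "y \<le> real (nat \<lceil>y\<rceil>)" "real (nat \<lceil>y\<rceil>) \<le> 2 * y" "nat \<lceil>y\<rceil> > 0"
proof -
  show 1: "y \<le> real (nat \<lceil>y\<rceil>)" by (rule real_nat_ceiling_ge)
  have "real (nat \<lceil>y\<rceil>) < y + 1" using assms of_int_ceiling_le_add_one[of y] by (simp add: ceiling_less_iff) linarith
  then show "real (nat \<lceil>y\<rceil>) \<le> 2 * y" using assms by linarith
  show "nat \<lceil>y\<rceil> > 0" using assms by simp
qed

lemma sqrt_power_double: "z \<ge> 0 \<Longrightarrow> sqrt (z ^ (2 * n)) = (z :: real) ^ n"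
  by (simp add: power_even_eq)

lemma ln_power_le:
  assumes "z \<ge> (1::real)" "0 < y" "y \<le> z ^ n"
  shows "ln y \<le> real n * z"
proof -
  have "ln y \<le> ln (z ^ n)" using assms by simp
  also have "\<dots> = real n * ln z" using assms by (simp add: ln_realpow)
  also have "\<dots> \<le> real n * z" using assms ln_le_minus_one[of z] by (intro mult_left_mono) auto
  finally show ?thesis .
qed

text \<open>Here \<open>Q / X\<close> lies between \<open>1 / z ^ 2\<close> and
  \<open>z ^ 2\<close>. The main term has at least the order of \<open>X sqrt Q\<close>, which is at
  least \<open>z ^ 599\<close>, so the error saves a power of \<open>z\<close>.\<close>

lemma SP_transition:
  assumes r: "odd r" "squarefree r" and z: "z \<ge> 2" and X: "X = z ^ 400" and Q: "z ^ 398 \<le> Q" "Q \<le> z ^ 402"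
  shows "\<bar>SP r X Q - C_trans (Q / X) * (X * sqrt X) / (4 * real r)\<bar> \<le> 10 ^ 10 * z ^ 595"
proof -
  have z1: "z \<ge> 1" using z by simp
  have pw: "z ^ m \<le> z ^ n" if "m \<le> n" for m n using that z1 by (rule power_increasing)
  have pw1: "1 \<le> z ^ n" for n using z1 by (rule one_le_power)
  have pz: "0 < z ^ n" for n using z by simp
  define M where "M = (nat \<lfloor>X\<rfloor> + 1) div 2"
  define N where "N = nat \<lfloor>Q\<rfloor> + 1"
  \<comment> \<open>The exponents balance the errors, up to constants: high frequencies give
    \<open>N ^ 2 sqrt N / (H sqrt K) = z ^ 595\<close>, the ends of the smoothed window
    \<open>N sqrt H = z ^ 592\<close>, partial summation \<open>K ^ 3 N = z ^ 582\<close>, and small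
    moduli \<open>A sqrt A sqrt K = z ^ 585\<close>.\<close>
  define H where "H = nat \<lceil>z ^ 380\<rceil>"
  define J where "J = nat \<lceil>z ^ 30\<rceil>"
  define A where "A = nat \<lceil>z ^ 370\<rceil>"
  have H: "z ^ 380 \<le> real H" "real H \<le> 2 * z ^ 380" "H > 0"
    unfolding H_def by (rule nat_ceiling_bounds[OF pw1])+
  have J: "z ^ 30 \<le> real J" "real J \<le> 2 * z ^ 30" "J > 0"
    unfolding J_def by (rule nat_ceiling_bounds[OF pw1])+
  have A: "z ^ 370 \<le> real A" "real A \<le> 2 * z ^ 370" "A > 0"
    unfolding A_def by (rule nat_ceiling_bounds[OF pw1])+
  have X1: "X \<ge> 1" and Q1: "Q \<ge> 1" using pw1[of 400] pw1[of 398] X Q by auto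
  have zz: "c * z ^ n \<le> z ^ (n + 4)" if "c \<le> 16" for c n
  proof -
    have "c \<le> z ^ 4" using that power_mono[OF z, of 4] by simp
    then have "c * z ^ n \<le> z ^ 4 * z ^ n" using pz[of n] by (intro mult_right_mono) auto
    then show ?thesis by (simp add: power_add mult.commute)
  qed
  have N_low: "Q \<le> real N" and N_up: "real N \<le> Q + 1" using Q1 unfolding N_def by simp_all linarith+
  have "4 * J\<^sup>2 \<le> A"
  proof -
    have "4 * real J ^ 2 \<le> 4 * (2 * z ^ 30) ^ 2" using J by (intro mult_left_mono power_mono) auto
    also have "\<dots> = 16 * z ^ 60" by (simp add: power_mult_distrib flip: power_mult)
    also have "\<dots> \<le> z ^ 64" using zz[of 16 60] by simp
    also have "\<dots> \<le> z ^ 370" by (rule pw) simp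
    also have "\<dots> \<le> real A" by (rule A)
    finally have "real (4 * J\<^sup>2) \<le> real A" by simp
    then show ?thesis by (simp only: of_nat_le_iff)
  qed
  moreover have "A \<le> N"
  proof -
    have "real A \<le> z ^ 374" using A zz[of 2 370] by simp
    also have "\<dots> \<le> z ^ 398" by (rule pw) simp
    finally have "real A \<le> real N" using Q N_low by linarith
    then show ?thesis by simp
  qed
  ultimately interpret D: dual_sum r M H J A N X Q
    using r X1 Q1 M_def N_def H J by unfold_locales auto
  have Nz: "real N \<le> 2 * z ^ 402" using N_up Q pw1[of 402] by linarith
  have Kz: "real D.K = 2 * real J ^ 2" by (simp add: D.K_def)
  have Kup: "real D.K \<le> 8 * z ^ 60"
  proof -
    have "real J ^ 2 \<le> (2 * z ^ 30) ^ 2" using J by (intro power_mono) auto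
    also have "\<dots> = 4 * z ^ 60" by (simp add: power_mult_distrib flip: power_mult)
    finally show ?thesis unfolding Kz by simp
  qed
  have sJK: "z ^ 30 \<le> sqrt (real D.K)"
  proof -
    have "real J \<le> sqrt (real D.K)" unfolding Kz by (intro real_le_rsqrt) simp
    then show ?thesis using J by linarith
  qed
  have sq_up: "sqrt y \<le> c * z ^ n" if "y \<le> c\<^sup>2 * z ^ (2 * n)" "c \<ge> 0" for y c n
  proof -
    have "sqrt y \<le> sqrt (c\<^sup>2 * z ^ (2 * n))" using that by simp
    also have "\<dots> = c * z ^ n" using that z1 by (simp add: real_sqrt_mult sqrt_power_double)
    finally show ?thesis .
  qed
  have sK: "sqrt (real D.K) \<le> 3 * z ^ 30" by (rule sq_up) (use Kup pz[of 60] in auto)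
  have sN: "sqrt (real N) \<le> 2 * z ^ 201" by (rule sq_up) (use Nz pz[of 402] in auto)
  have sQ: "sqrt Q \<le> 1 * z ^ 201" by (rule sq_up) (use Q in auto)
  have sH: "sqrt (real H) \<le> 2 * z ^ 190" by (rule sq_up) (use H pz[of 380] in auto)
  have s2H: "sqrt (2 * real H) \<le> 2 * z ^ 190" by (rule sq_up) (use H pz[of 380] in auto)
  have sA: "sqrt (real A) \<le> 2 * z ^ 185" by (rule sq_up) (use A pz[of 370] in auto)
  have sAlow: "z ^ 185 \<le> sqrt (real A)"
    using A(1) by (intro real_le_rsqrt) (simp flip: power_mult)
  have z0: "0 \<le> z" using z by simp
  note nn = pz[THEN less_imp_le]
  have t2: "14 * real N ^ 2 * sqrt (real N) / (real H * sqrt (real D.K)) \<le> 112 * z ^ 595"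
  proof -
    have "14 * real N ^ 2 * sqrt (real N) / (real H * sqrt (real D.K)) \<le> 14 * (2 * z ^ 402) ^ 2 * (2 * z ^ 201) / (z ^ 380 * z ^ 30)"
      using Nz sN H sJK nn pz z0 by (intro frac_le mult_mono power_mono mult_pos_pos mult_nonneg_nonneg) auto
    also have "14 * (2 * z ^ 402) ^ 2 * (2 * z ^ 201) = (112 * z ^ 595) * (z ^ 380 * z ^ 30)"
      by (simp add: power_mult_distrib flip: power_mult power_add)
    finally show ?thesis using pz[of 380] pz[of 30] by simp
  qed
  have t3: "9 * real A * sqrt (real A) * sqrt (real D.K) \<le> 108 * z ^ 595"
  proof -
    have "9 * real A * sqrt (real A) * sqrt (real D.K) \<le> 9 * (2 * z ^ 370) * (2 * z ^ 185) * (3 * z ^ 30)"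
      using A sA sK nn z0 by (intro mult_mono mult_nonneg_nonneg) auto
    also have "\<dots> = 108 * z ^ 585" by (simp flip: power_add)
    also have "\<dots> \<le> 108 * z ^ 595" using pw[of 585 595] by simp
    finally show ?thesis .
  qed
  have XA: "X / real A \<le> z ^ 30"
  proof -
    have "X / real A \<le> z ^ 400 / z ^ 370" unfolding X using A pz z by (intro divide_left_mono mult_pos_pos) auto
    also have "\<dots> = z ^ 30" using z by (simp flip: power_diff)
    finally show ?thesis .
  qed
  \<comment> \<open>\<open>A\<close> is large enough for bounded variation per step:
    \<open>X ^ 2 K\<close> has order \<open>z ^ 860\<close>, against \<open>A ^ 2 sqrt A\<close> of
    order \<open>z ^ 925\<close>.\<close>
  have lip: "D.lip \<le> 385"
  proof -
    have "16 * X * (X + real H) * real D.K \<le> 16 * z ^ 400 * (3 * z ^ 400) * (8 * z ^ 60)"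
      using Kup H pw[of 380 400] nn unfolding X by (intro mult_mono mult_nonneg_nonneg add_nonneg_nonneg) auto
    also have "\<dots> = 384 * z ^ 860" by (simp flip: power_add)
    finally have n: "16 * X * (X + real H) * real D.K \<le> 384 * z ^ 860" .
    have "z ^ 370 * z ^ 370 * z ^ 185 \<le> real A * real A * sqrt (real A)"
      using A sAlow nn z0 by (intro mult_mono mult_nonneg_nonneg) auto
    then have d: "z ^ 925 \<le> real A ^ 2 * sqrt (real A)" by (simp add: power2_eq_square flip: power_add)
    have "16 * X * (X + real H) * real D.K / (real A ^ 2 * sqrt (real A)) \<le> 384 * z ^ 860 / z ^ 925"
      using n d pz nn z by (intro frac_le) auto
    also have "\<dots> \<le> 384 * z ^ 925 / z ^ 925"
      using pw[of 860 925] pz z by (intro divide_right_mono mult_left_mono) auto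
    also have "\<dots> = 384" using z by simp
    finally have 1: "16 * X * (X + real H) * real D.K / (real A ^ 2 * sqrt (real A)) \<le> 384" .
    have "z ^ 370 * z ^ 185 \<le> real A * sqrt (real A)"
      using A sAlow nn z0 by (intro mult_mono) auto
    then have "X / (real A * sqrt (real A)) \<le> z ^ 400 / (z ^ 370 * z ^ 185)"
      unfolding X using pz A z by (intro divide_left_mono mult_pos_pos) auto
    also have "\<dots> \<le> (z ^ 370 * z ^ 185) / (z ^ 370 * z ^ 185)"
      using pw[of 400 555] pz z by (intro divide_right_mono) (auto simp flip: power_add)
    also have "\<dots> = 1" using z by simp
    finally show ?thesis using 1 by (simp add: D.lip_def)
  qed
  have lip0: "D.lip \<ge> 0" using X1 by (simp add: D.lip_def)
  have t4: "6144 * real D.K ^ 3 * (6 * sqrt (real N) + real N * D.lip) \<le> 2459959296 * z ^ 595"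
  proof -
    have "6 * sqrt (real N) + real N * D.lip \<le> 6 * (2 * z ^ 201) + 2 * z ^ 402 * 385"
      using sN Nz lip lip0 nn z0 by (intro add_mono mult_mono) auto
    also have "\<dots> \<le> 782 * z ^ 402" using pw[of 201 402] by simp
    finally have 1: "6 * sqrt (real N) + real N * D.lip \<le> 782 * z ^ 402" .
    have "6144 * real D.K ^ 3 * (6 * sqrt (real N) + real N * D.lip) \<le> 6144 * (8 * z ^ 60) ^ 3 * (782 * z ^ 402)"
      using Kup 1 nn lip0 z0 by (intro mult_mono power_mono add_nonneg_nonneg mult_nonneg_nonneg) auto
    also have "\<dots> = 2459959296 * z ^ 582" by (simp add: power_mult_distrib flip: power_mult power_add)
    also have "\<dots> \<le> 2459959296 * z ^ 595" using pw[of 582 595] by simp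
    finally show ?thesis .
  qed
  have t5: "real N * (8 * real J + 24 * sqrt (real H) * (1 + ln (real J))) \<le> 3104 * z ^ 595"
  proof -
    have "ln (real J) \<le> real 34 * z" using J zz[of 2 30] by (intro ln_power_le z1) auto
    then have l: "1 + ln (real J) \<le> 35 * z" using z by simp
    have "8 * real J + 24 * sqrt (real H) * (1 + ln (real J)) \<le> 8 * (2 * z ^ 30) + 24 * (2 * z ^ 190) * (35 * z)"
      using J sH l nn z z0 by (intro add_mono mult_mono mult_nonneg_nonneg) auto
    also have "\<dots> = 16 * z ^ 30 + 1680 * z ^ 191" by (simp add: eval_nat_numeral)
    also have "\<dots> \<le> 1696 * z ^ 191" using pw[of 30 191] by simp
    finally have 1: "8 * real J + 24 * sqrt (real H) * (1 + ln (real J)) \<le> 1696 * z ^ 191" .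
    have "real N * (8 * real J + 24 * sqrt (real H) * (1 + ln (real J))) \<le> 2 * z ^ 402 * (1696 * z ^ 191)"
      using Nz 1 J nn z0 by (intro mult_mono add_nonneg_nonneg mult_nonneg_nonneg) auto
    also have "\<dots> = 3392 * z ^ 593" by (simp flip: power_add)
    also have "\<dots> \<le> 3104 * z ^ 595"
    proof -
      have "z ^ 595 = z ^ 593 * z ^ 2" by (simp flip: power_add)
      moreover have "4 \<le> z ^ 2" using power_mono[OF z, of 2] by simp
      then have "z ^ 593 * 4 \<le> z ^ 593 * z ^ 2" using nn z0 by (intro mult_left_mono) auto
      ultimately show ?thesis using nn[of 593] by linarith
    qed
    finally show ?thesis .
  qed
  have t6: "real J * (real N * (3 + 16 * X / real A) + 3 * sqrt (real N) + 3 * real A * sqrt (real A)) \<le> 112 * z ^ 595"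
  proof -
    have "16 * X / real A \<le> 16 * z ^ 30" using XA by simp
    then have "3 + 16 * X / real A \<le> 19 * z ^ 30" using pw1[of 30] by linarith
    then have "real N * (3 + 16 * X / real A) \<le> 2 * z ^ 402 * (19 * z ^ 30)"
      using Nz nn X1 z0 by (intro mult_mono add_nonneg_nonneg) auto
    also have "\<dots> = 38 * z ^ 432" by (simp flip: power_add)
    finally have a: "real N * (3 + 16 * X / real A) \<le> 38 * z ^ 432" .
    have "3 * real A * sqrt (real A) \<le> 3 * (2 * z ^ 370) * (2 * z ^ 185)"
      using A sA nn z0 by (intro mult_mono mult_nonneg_nonneg) auto
    also have "\<dots> = 12 * z ^ 555" by (simp flip: power_add)
    finally have "real N * (3 + 16 * X / real A) + 3 * sqrt (real N) + 3 * real A * sqrt (real A) \<le> 56 * z ^ 555"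
      using a sN pw[of 432 555] pw[of 201 555] by linarith
    then have "real J * (real N * (3 + 16 * X / real A) + 3 * sqrt (real N) + 3 * real A * sqrt (real A)) \<le> 2 * z ^ 30 * (56 * z ^ 555)"
      using J X1 nn z0 by (intro mult_mono add_nonneg_nonneg mult_nonneg_nonneg) auto
    also have "\<dots> = 112 * z ^ 585" by (simp flip: power_add)
    also have "\<dots> \<le> 112 * z ^ 595" using pw[of 585 595] by simp
    finally show ?thesis .
  qed
  have t1: "X + sqrt Q \<le> 2 * z ^ 595" using sQ pw[of 400 595] pw[of 201 595] unfolding X by linarith
  have de: "D.dual_error \<le> 5000000000 * z ^ 595"
  proof -
    have "a + 2 * (b + c + d) + e + f \<le> 5000000000 * w"
      if "a \<le> 2 * w" "b \<le> 112 * w" "c \<le> 108 * w" "d \<le> 2459959296 * w" "e \<le> 3104 * w" "f \<le> 112 * w" "0 \<le> w"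
      for a b c d e f w :: real
      unfolding distrib_left using that by linarith
    from this[OF t1 t2 t3 t4 t5 t6 nn[of 595]] show ?thesis unfolding D.dual_error_def .
  qed
  have sm: "(sqrt (2 * real H) + 1) * (real N + 4 * T) + 3072 * sqrt T * (1 + ln T) * (4 * real H + sqrt T) \<le> 100000000 * z ^ 595"
    if T: "T \<ge> 1" "T \<le> 6 * z ^ 400" for T
  proof -
    have "real N + 4 * T \<le> 26 * z ^ 402" using T Nz pw[of 400 402] by linarith
    moreover have "sqrt (2 * real H) + 1 \<le> 3 * z ^ 190" using s2H pw1[of 190] by linarith
    ultimately have "(sqrt (2 * real H) + 1) * (real N + 4 * T) \<le> 3 * z ^ 190 * (26 * z ^ 402)"
      using T nn z0 by (intro mult_mono) auto
    also have "\<dots> = 78 * z ^ 592" by (simp flip: power_add)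
    finally have 1: "(sqrt (2 * real H) + 1) * (real N + 4 * T) \<le> 78 * z ^ 595" using pw[of 592 595] by linarith
    have sT: "sqrt T \<le> 3 * z ^ 200" by (rule sq_up) (use T nn[of 400] in auto)
    have "ln T \<le> real 404 * z" using T zz[of 6 400] by (intro ln_power_le z1) auto
    then have lT: "1 + ln T \<le> 405 * z" using z by simp
    have "4 * real H + sqrt T \<le> 11 * z ^ 380" using H sT pw[of 200 380] by linarith
    then have "3072 * sqrt T * (1 + ln T) * (4 * real H + sqrt T) \<le> 3072 * (3 * z ^ 200) * (405 * z) * (11 * z ^ 380)"
      using sT lT T nn z z0 by (intro mult_mono mult_nonneg_nonneg add_nonneg_nonneg) auto
    also have "\<dots> = 41057280 * (z ^ 200 * z ^ 1 * z ^ 380)" by simp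
    also have "\<dots> = 41057280 * z ^ 581" by (simp only: power_add[symmetric]) simp
    also have "\<dots> \<le> 41057280 * z ^ 595" using pw[of 581 595] by simp
    finally have 2: "3072 * sqrt T * (1 + ln T) * (4 * real H + sqrt T) \<le> 41057280 * z ^ 595" .
    from add_mono[OF 1 2] have "(sqrt (2 * real H) + 1) * (real N + 4 * T) + 3072 * sqrt T * (1 + ln T) * (4 * real H + sqrt T)
      \<le> 78 * z ^ 595 + 41057280 * z ^ 595" .
    also have "\<dots> \<le> 100000000 * z ^ 595" using nn[of 595] by simp
    finally show ?thesis .
  qed
  have s1: "(\<Sum>u<H. \<bar>Zsum r (2 * u + 1) N\<bar>) \<le> 100000000 * z ^ 595"
  proof -
    have "(\<Sum>u\<in>{0..<0 + H}. \<bar>Zsum r (2 * u + 1) N\<bar>) \<le> (sqrt (2 * real H) + 1) * (real N + 4 * real (2 * (0 + H)))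
      + 3072 * sqrt (real (2 * (0 + H))) * (1 + ln (real (2 * (0 + H)))) * (4 * real H + sqrt (real (2 * (0 + H))))"
      by (rule Zsum_interval_bound[OF r H(3) refl])
    also have "\<dots> \<le> 100000000 * z ^ 595"
      by (rule sm) (use H pw[of 380 400] in auto)
    finally show ?thesis by (simp add: lessThan_atLeast0)
  qed
  have s2: "(\<Sum>u\<in>{M..<M + H}. \<bar>Zsum r (2 * u + 1) N\<bar>) \<le> 100000000 * z ^ 595"
  proof -
    have "(\<Sum>u\<in>{M..<M + H}. \<bar>Zsum r (2 * u + 1) N\<bar>) \<le> (sqrt (2 * real H) + 1) * (real N + 4 * real (2 * (M + H)))
      + 3072 * sqrt (real (2 * (M + H))) * (1 + ln (real (2 * (M + H)))) * (4 * real H + sqrt (real (2 * (M + H))))"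
      by (rule Zsum_interval_bound[OF r H(3) refl])
    also have "\<dots> \<le> 100000000 * z ^ 595"
      by (rule sm) (use H pw[of 380 400] D.M_bounds(3) in \<open>auto simp: X\<close>)
    finally show ?thesis .
  qed
  have mt: "\<bar>D.main_term - C_trans (Q / X) * (X * sqrt X) / (4 * real r)\<bar> \<le> z ^ 595"
  proof -
    let ?S = "X * sqrt Q + (\<Sum>j = 1..J. integral {0..Q} (kern (2 * pi * real j ^ 2 * X)) / (2 * pi * real j ^ 2))"
    have "D.main_term - C_trans (Q / X) * (X * sqrt X) / (4 * real r) = (?S - C_trans (Q / X) * (X * sqrt X)) / (4 * real r)"
      by (simp only: D.main_term_def add_divide_distrib diff_divide_distrib)
    then have "\<bar>D.main_term - C_trans (Q / X) * (X * sqrt X) / (4 * real r)\<bar> = \<bar>?S - C_trans (Q / X) * (X * sqrt X)\<bar> / (4 * real r)"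
      using D.rpos by simp
    also have "\<dots> \<le> \<bar>?S - C_trans (Q / X) * (X * sqrt X)\<bar> / 1"
      using D.rpos by (intro divide_left_mono) auto
    also have "\<dots> \<le> Q * sqrt Q / real J"
      using C_trans_truncate[of X Q J] X1 Q1 J by simp
    also have "\<dots> \<le> z ^ 402 * z ^ 201 / z ^ 30"
      using Q sQ J Q1 pz nn z z0 by (intro frac_le mult_mono) auto
    also have "\<dots> = z ^ 573" using z by (simp flip: power_add power_diff)
    also have "\<dots> \<le> z ^ 595" by (rule pw) simp
    finally show ?thesis .
  qed
  have "\<bar>SP r X Q - C_trans (Q / X) * (X * sqrt X) / (4 * real r)\<bar> \<le> 10000000000 * z ^ 595"
    using D.SP_smoothing D.SPbar_estimate de s1 s2 mt nn[of 595] by linarith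
  then show ?thesis by simp
qed

section \<open>Lower bounds and growth of \<open>C_trans\<close>\<close>

lemma osc_ge: "1 - cos x + sin x \<ge> (- 1 / 2 :: real)"
proof -
  have "(cos x - sin x)\<^sup>2 + (cos x + sin x)\<^sup>2 = 2 * (sin x ^ 2 + cos x ^ 2)" by (simp add: power2_eq_square algebra_simps)
  then have "(cos x - sin x)\<^sup>2 \<le> 2" by (simp add: sin_squared_eq) (metis (no_types) add.commute le_add_same_cancel2 power2_eq_square zero_le_power2 zero_le_square)
  then have "(cos x - sin x)\<^sup>2 \<le> (3 / 2)\<^sup>2" by (simp add: power2_eq_square)
  then have "cos x - sin x \<le> 3 / 2" by (rule power2_le_imp_le) simp
  then show ?thesis by simp
qed

lemma osc_nonneg:
  assumes "0 \<le> x" "x \<le> 3 * pi / 2"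
  shows "1 - cos x + sin x \<ge> (0 :: real)"
proof (cases "x \<le> pi")
  case True
  then have "sin x \<ge> 0" using assms sin_ge_zero by blast
  then show ?thesis using cos_le_one[of x] by linarith
next
  case False
  then have "cos (x - pi) \<ge> 0" using assms by (intro cos_ge_zero) auto
  then have "cos x \<le> 0" by (simp add: cos_diff)
  then show ?thesis using sin_ge_minus_one[of x] by linarith
qed

lemma osc_ge_self:
  assumes "0 \<le> x" "x \<le> pi / 2"
  shows "x \<le> 1 - cos x + sin (x :: real)"
proof -
  let ?g = "\<lambda>x::real. 1 - cos x + sin x - x"
  have "?g 0 \<le> ?g x"
  proof (rule DERIV_nonneg_imp_nondecreasing[OF assms(1)])
    fix t assume t: "0 \<le> t" "t \<le> x"
    then have s: "sin t \<ge> 0" "cos t \<ge> 0" using assms by (auto intro!: sin_ge_zero cos_ge_zero)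
    have "1\<^sup>2 \<le> (sin t + cos t)\<^sup>2"
      using s by (simp add: power2_sum)
    then have "1 \<le> sin t + cos t" by (rule power2_le_imp_le) (use s in simp)
    then have "0 \<le> sin t + cos t - 1" by simp
    moreover have "(?g has_real_derivative (sin t + cos t - 1)) (at t)"
      by (auto intro!: derivative_eq_intros)
    ultimately show "\<exists>y. (?g has_real_derivative y) (at t) \<and> 0 \<le> y" by blast
  qed
  then show ?thesis by simp
qed

lemma sum_inverse_squares_from:
  assumes "W > 0" "z > 0" "z < real W"
  shows "(\<Sum>k\<in>{W..n}. 1 / real k ^ 2) \<le> 1 / z + 1 / z ^ 2"
proof (cases "W \<le> n")
  case True
  have "(\<Sum>k\<in>{W<..n}. 1 / real k ^ 2) \<le> 1 / real W - 1 / real n"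
    using True
  proof (induction n rule: dec_induct)
    case (step n)
    have n: "real n > 0" using step assms by simp
    have "1 / real (Suc n) ^ 2 \<le> 1 / (real n * real (Suc n))"
      using n unfolding power2_eq_square by (intro divide_left_mono mult_right_mono) auto
    also have "\<dots> = 1 / real n - 1 / real (Suc n)" using n by (simp add: field_simps)
    finally have "1 / real (Suc n) ^ 2 \<le> 1 / real n - 1 / real (Suc n)" .
    moreover have "{W<..Suc n} = insert (Suc n) {W<..n}" using step by auto
    ultimately show ?case using step by simp
  qed simp
  moreover have "{W..n} = insert W {W<..n}" using True by auto
  then have "(\<Sum>k\<in>{W..n}. 1 / real k ^ 2) = 1 / real W ^ 2 + (\<Sum>k\<in>{W<..n}. 1 / real k ^ 2)" by simp
  moreover have "1 / real W \<le> 1 / z" "1 / real W ^ 2 \<le> 1 / z ^ 2"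
    using assms by (auto intro!: divide_left_mono power_mono)
  moreover have "0 \<le> 1 / real n" by simp
  ultimately show ?thesis by linarith
qed (use assms in simp)

text \<open>Put \<open>s = sqrt y\<close>. Terms with \<open>k <= s / 2\<close> have angle at most
  \<open>pi / 2\<close> and contribute at least \<open>2 * pi / y\<close> each, together at least
  \<open>1 / s\<close>. Up to \<open>17 / 20 * s\<close> the angle is at most
  \<open>3 * pi / 2\<close>, as \<open>(17 / 20)^2 < 3 / 4\<close>, and the terms are nonnegative.
  Beyond that the loss is at most half the tail of \<open>1 / k^2\<close>, which is at most
  \<open>1 / s\<close>. For \<open>n\<close> below \<open>s / 2\<close> rounded down all terms are
  nonnegative.\<close>

lemma osc_sum_nonneg:
  assumes y: "y \<ge> 4"
  shows "(\<Sum>k = 1..n. (1 - cos (2 * pi * real k ^ 2 / y) + sin (2 * pi * real k ^ 2 / y)) / real k ^ 2) \<ge> 0"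
proof -
  define s where "s = sqrt y"
  have s: "s \<ge> 2" "s * s = y" using y real_sqrt_le_mono[of 4 y] by (auto simp: s_def)
  let ?f = "\<lambda>k::nat. 1 - cos (2 * pi * real k ^ 2 / y) + sin (2 * pi * real k ^ 2 / y)"
  define P where "P = nat \<lfloor>s / 2\<rfloor>"
  define W where "W = nat \<lfloor>17 / 20 * s\<rfloor> + 1"
  have "real P = of_int \<lfloor>s / 2\<rfloor>" using s by (simp add: P_def)
  then have P: "real P \<le> s / 2" "s / 2 < real P + 1" using floor_correct[of "s / 2"] by linarith+
  have P1: "P \<ge> 1" using s by (simp add: P_def le_nat_floor)
  \<comment> \<open>Rounding down loses less than 1, which is at most \<open>s / 4\<close> once
    \<open>s >= 4\<close>; for smaller \<open>s\<close> the bound \<open>P >= 1\<close>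
    suffices.\<close>
  have P4: "real P \<ge> s / 4"
  proof (cases "s \<ge> 4")
    case True
    then show ?thesis using P by linarith
  next
    case False
    then have "s / 4 \<le> 1" by simp
    then show ?thesis using P1 by linarith
  qed
  have "real W = of_int \<lfloor>17 / 20 * s\<rfloor> + 1" using s by (simp add: W_def)
  then have W: "17 / 20 * s < real W" "W > 0" using floor_correct[of "17 / 20 * s"] by (linarith, simp add: W_def)
  have sq: "real k ^ 2 \<le> y / 4" if "k \<le> P" for k
  proof -
    have "real k \<le> s / 2" using that P by linarith
    then have "real k ^ 2 \<le> (s / 2) ^ 2" by (intro power_mono) auto
    also have "\<dots> = y / 4" using s by (simp add: power2_eq_square)
    finally show ?thesis .
  qed
  have low: "?f k / real k ^ 2 \<ge> (if k \<le> P then 2 * pi / y else 0) - (if W \<le> k then 1 / 2 * (1 / real k ^ 2) else 0)"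
    if k: "k \<ge> 1" for k
  proof -
    have kp: "real k ^ 2 > 0" using k by simp
    have arg0: "0 \<le> 2 * pi * real k ^ 2 / y" using y by simp
    consider "k \<le> P" | "P < k" "k < W" | "P < k" "W \<le> k" by linarith
    then show ?thesis
    proof cases
      case 1
      have "2 * pi * real k ^ 2 / y \<le> 2 * pi * (y / 4) / y"
        using sq[OF 1] y by (intro divide_right_mono mult_left_mono) auto
      then have "2 * pi * real k ^ 2 / y \<le> pi / 2" using y by simp
      from osc_ge_self[OF arg0 this] have "2 * pi * real k ^ 2 / y / real k ^ 2 \<le> ?f k / real k ^ 2"
        by (intro divide_right_mono) auto
      moreover have "2 * pi * real k ^ 2 / y / real k ^ 2 = 2 * pi / y" using kp by simp
      moreover have "0 \<le> (if W \<le> k then 1 / 2 * (1 / real k ^ 2) else 0)" by simp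
      ultimately show ?thesis using 1 by simp
    next
      case 2
      then have "k \<le> nat \<lfloor>17 / 20 * s\<rfloor>" by (simp add: W_def)
      then have "real k \<le> 17 / 20 * s" using s by (simp add: le_nat_iff le_floor_iff)
      then have "real k ^ 2 \<le> (17 / 20 * s) ^ 2" by (intro power_mono) auto
      also have "\<dots> = 289 / 400 * y" using s by (simp add: power2_eq_square)
      also have "\<dots> \<le> 3 / 4 * y" using y by simp
      finally have "2 * pi * real k ^ 2 / y \<le> 2 * pi * (3 / 4 * y) / y"
        using y by (intro divide_right_mono mult_left_mono) auto
      then have "2 * pi * real k ^ 2 / y \<le> 3 * pi / 2" using y by simp
      from osc_nonneg[OF arg0 this] show ?thesis using 2 by simp
    next
      case 3
      have "- 1 / 2 / real k ^ 2 \<le> ?f k / real k ^ 2" by (intro divide_right_mono osc_ge) simp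
      then show ?thesis using 3 by simp
    qed
  qed
  show ?thesis
  proof (cases "n < P")
    case True
    show ?thesis
    proof (rule sum_nonneg)
      fix k assume "k \<in> {1..n}"
      then have k: "k \<le> P" using True by auto
      have "2 * pi * real k ^ 2 / y \<le> 2 * pi * (y / 4) / y"
        using sq[OF k] y by (intro divide_right_mono mult_left_mono) auto
      also have "\<dots> = pi / 2" using y by simp
      finally have "2 * pi * real k ^ 2 / y \<le> 3 * pi / 2" using pi_gt_zero by linarith
      then show "0 \<le> ?f k / real k ^ 2" using y by (intro divide_nonneg_nonneg osc_nonneg) auto
    qed
  next
    case False
    have "(\<Sum>k = 1..n. if k \<le> P then 2 * pi / y else 0) = (\<Sum>k\<in>{1..P}. 2 * pi / y)"
      using False by (intro sum.mono_neutral_cong_right) auto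
    then have a: "(\<Sum>k = 1..n. if k \<le> P then 2 * pi / y else 0) = real P * (2 * pi / y)" by simp
    have "(\<Sum>k = 1..n. if W \<le> k then 1 / 2 * (1 / real k ^ 2) else 0) = (\<Sum>k\<in>{W..n}. 1 / 2 * (1 / real k ^ 2))"
      using W by (intro sum.mono_neutral_cong_right) auto
    also have "\<dots> = 1 / 2 * (\<Sum>k\<in>{W..n}. 1 / real k ^ 2)" by (simp only: sum_distrib_left)
    also have "\<dots> \<le> 1 / 2 * (1 / (17 / 20 * s) + 1 / (17 / 20 * s) ^ 2)"
      using W s by (intro mult_left_mono sum_inverse_squares_from) auto
    also have "\<dots> \<le> 1 / s"
    proof -
      have "1 / (17 / 20 * s) ^ 2 = 400 / 289 * (1 / s * (1 / s))" using s by (simp add: power2_eq_square)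
      also have "\<dots> \<le> 400 / 289 * (1 / s * (1 / 2))" using s by (intro mult_left_mono divide_left_mono) auto
      finally have "1 / (17 / 20 * s) ^ 2 \<le> 200 / 289 * (1 / s)" by simp
      moreover have "1 / (17 / 20 * s) = 20 / 17 * (1 / s)" by simp
      moreover have "0 < 1 / s" using s by simp
      moreover have "1 / 2 * (a + b) \<le> c" if "b \<le> 200 / 289 * c" "a = 20 / 17 * c" "0 < c" for a b c :: real
        using that by simp
      ultimately show ?thesis by blast
    qed
    finally have b: "(\<Sum>k = 1..n. if W \<le> k then 1 / 2 * (1 / real k ^ 2) else 0) \<le> 1 / s" .
    have "1 / s = s / 4 * (4 / y)" using s by (simp add: s(2)[symmetric])
    also have "\<dots> \<le> real P * (2 * pi / y)"
      using P4 pi_ge_two y s by (intro mult_mono divide_right_mono) auto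
    finally have "0 \<le> (\<Sum>k = 1..n. if k \<le> P then 2 * pi / y else 0) - (\<Sum>k = 1..n. if W \<le> k then 1 / 2 * (1 / real k ^ 2) else 0)"
      using a b by linarith
    also have "\<dots> = (\<Sum>k = 1..n. (if k \<le> P then 2 * pi / y else 0) - (if W \<le> k then 1 / 2 * (1 / real k ^ 2) else 0))"
      by (simp only: sum_subtractf)
    also have "\<dots> \<le> (\<Sum>k = 1..n. ?f k / real k ^ 2)"
      by (intro sum_mono low) auto
    finally show ?thesis .
  qed
qed

lemma Kint_ge:
  assumes a: "\<alpha> \<ge> 0"
  shows "Kint k \<alpha> \<ge> - (\<alpha> * sqrt \<alpha>) / 2"
proof -
  have "integral {0..\<alpha>} (\<lambda>y. - sqrt \<alpha> / 2) \<le> Kint k \<alpha>"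
    unfolding Kint_def
  proof (rule integral_le)
    show "kern (2 * pi * real (Suc k) ^ 2) integrable_on {0..\<alpha>}" by (rule kern_integrable) simp
    show "- sqrt \<alpha> / 2 \<le> kern (2 * pi * real (Suc k) ^ 2) y" if y: "y \<in> {0..\<alpha>}" for y
    proof -
      have "sqrt y * (- 1 / 2) \<le> kern (2 * pi * real (Suc k) ^ 2) y"
        unfolding kern_def using y by (intro mult_left_mono osc_ge) auto
      moreover have "sqrt y \<le> sqrt \<alpha>" using y by simp
      ultimately show ?thesis by linarith
    qed
  qed auto
  then show ?thesis using a by simp
qed

lemma inverse_squares_suminf: "(\<lambda>k. 1 / real (Suc k) ^ 2) sums (pi\<^sup>2 / 6)"
  using inverse_squares_sums by (simp add: add.commute)

lemma Kint_suminf_ge: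
  assumes a: "\<alpha> \<ge> 0"
  shows "1 / (2 * pi) * (\<Sum>k. 1 / real (Suc k) ^ 2 * Kint k \<alpha>) \<ge> - (\<alpha> * sqrt \<alpha>) / 6"
proof -
  have s: "(\<lambda>k. 1 / real (Suc k) ^ 2 * (- (\<alpha> * sqrt \<alpha>) / 2)) sums (pi\<^sup>2 / 6 * (- (\<alpha> * sqrt \<alpha>) / 2))"
    by (rule sums_mult2[OF inverse_squares_suminf])
  have "(\<Sum>k. 1 / real (Suc k) ^ 2 * (- (\<alpha> * sqrt \<alpha>) / 2)) \<le> (\<Sum>k. 1 / real (Suc k) ^ 2 * Kint k \<alpha>)"
    by (rule suminf_le[OF _ sums_summable[OF s] Kint_series(1)[OF a]]) (intro mult_left_mono Kint_ge a, simp)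
  then have "1 / (2 * pi) * (pi\<^sup>2 / 6 * (- (\<alpha> * sqrt \<alpha>) / 2)) \<le> 1 / (2 * pi) * (\<Sum>k. 1 / real (Suc k) ^ 2 * Kint k \<alpha>)"
    unfolding sums_unique[OF s, symmetric] by (intro mult_left_mono) auto
  moreover have "1 / (2 * pi) * (pi\<^sup>2 / 6 * (- (\<alpha> * sqrt \<alpha>) / 2)) = - (pi / 24 * (\<alpha> * sqrt \<alpha>))"
    by (simp add: power2_eq_square)
  moreover have "pi / 24 * (\<alpha> * sqrt \<alpha>) \<le> 1 / 6 * (\<alpha> * sqrt \<alpha>)"
    using pi_less_4 a by (intro mult_right_mono) auto
  ultimately show ?thesis by linarith
qed

text \<open>For \<open>\<alpha> <= 4\<close> the pointwise lower bound of the kernel loses at most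
  \<open>2 / 3 * sqrt \<alpha>\<close>. Past 4 the sum of the integrands over \<open>k\<close> is
  pointwise nonnegative by \<open>osc_sum_nonneg\<close>, so the loss stays at its bound 4/3 from
  the point 4, again at most \<open>2 / 3 * sqrt \<alpha>\<close>.\<close>

lemma C_trans_ge:
  assumes a: "\<alpha> \<ge> 0"
  shows "C_trans \<alpha> \<ge> sqrt \<alpha> / 3"
proof (cases "\<alpha> \<le> 4")
  case True
  have "\<alpha> * sqrt \<alpha> \<le> 4 * sqrt \<alpha>" using True a by (intro mult_right_mono) auto
  then show ?thesis using Kint_suminf_ge[OF a] unfolding C_trans_Kint by linarith
next
  case False
  then have a4: "\<alpha> > 4" by simp
  let ?c = "\<lambda>k. 1 / real (Suc k) ^ 2" and ?K = "\<lambda>k. kern (2 * pi * real (Suc k) ^ 2)"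
  let ?g = "\<lambda>k. ?c k * integral {4..\<alpha>} (?K k)"
  have comb: "Kint k \<alpha> = Kint k 4 + integral {4..\<alpha>} (?K k)" for k
    unfolding Kint_def by (rule Henstock_Kurzweil_Integration.integral_combine[symmetric])
      (use a4 in \<open>auto intro: kern_integrable\<close>)
  have g: "?g k = ?c k * Kint k \<alpha> - ?c k * Kint k 4" for k by (simp add: comb algebra_simps)
  have sg: "summable ?g" unfolding g by (intro summable_diff Kint_series) (use a4 in auto)
  \<comment> \<open>Positivity is shown for partial sums, so that only finite sums are interchanged
    with the integral.\<close>
  have part: "0 \<le> (\<Sum>k<n. ?g k)" for n
  proof -
    have "(\<Sum>k<n. ?g k) = (\<Sum>k<n. integral {4..\<alpha>} (\<lambda>y. ?c k * ?K k y))" by simp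
    also have "\<dots> = integral {4..\<alpha>} (\<lambda>y. \<Sum>k<n. ?c k * ?K k y)"
      by (rule integral_sum[symmetric]) (rule finite_lessThan, rule integrable_on_mult_right, rule kern_integrable, simp)
    also have "\<dots> \<ge> 0"
    proof (rule integral_nonneg)
      show "(\<lambda>y. \<Sum>k<n. ?c k * ?K k y) integrable_on {4..\<alpha>}"
        by (intro integrable_sum integrable_on_mult_right kern_integrable) auto
      fix y assume y: "y \<in> {4..\<alpha>}"
      let ?t = "\<lambda>k::nat. (1 - cos (2 * pi * real k ^ 2 / y) + sin (2 * pi * real k ^ 2 / y)) / real k ^ 2"
      have "(\<Sum>k<n. ?c k * ?K k y) = sqrt y * (\<Sum>k<n. ?t (Suc k))"
        by (simp add: kern_def sum_distrib_left mult_ac)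
      also have "(\<Sum>k<n. ?t (Suc k)) = (\<Sum>k = 1..n. ?t k)"
        by (rule sum.reindex_bij_witness[where i = "\<lambda>k. k - 1" and j = Suc]) auto
      finally show "0 \<le> (\<Sum>k<n. ?c k * ?K k y)"
        using osc_sum_nonneg[of y n] y by simp
    qed
    finally show ?thesis .
  qed
  have "0 \<le> (\<Sum>k. ?g k)"
    by (rule LIMSEQ_le_const[OF summable_LIMSEQ[OF sg]]) (use part in auto)
  then have 1: "(\<Sum>k. ?c k * Kint k 4) \<le> (\<Sum>k. ?c k * Kint k \<alpha>)"
    using suminf_diff[OF Kint_series(1)[of \<alpha>] Kint_series(1)[of 4]] a4 unfolding g by simp
  have "1 / (2 * pi) * (\<Sum>k. ?c k * Kint k 4) \<le> 1 / (2 * pi) * (\<Sum>k. ?c k * Kint k \<alpha>)"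
    by (intro mult_left_mono 1) simp
  moreover have "- 4 / 3 \<le> 1 / (2 * pi) * (\<Sum>k. ?c k * Kint k 4)" using Kint_suminf_ge[of 4] by simp
  moreover have "sqrt \<alpha> \<ge> 2" using a4 real_sqrt_le_mono[of 4 \<alpha>] by simp
  ultimately show ?thesis unfolding C_trans_Kint by linarith
qed

lemma C_trans_near_0:
  assumes a: "\<alpha> \<ge> 0"
  shows "\<bar>C_trans \<alpha> - sqrt \<alpha>\<bar> \<le> 2 * (\<alpha> * sqrt \<alpha>)"
proof -
  have "\<bar>(\<Sum>k. 1 / real (Suc k) ^ 2 * Kint k \<alpha>) - 1 / real (Suc 0) ^ 2 * Kint 0 \<alpha>\<bar> \<le> 3 * (\<alpha> * sqrt \<alpha>)"
    using Kint_series(2)[OF a, of 1] by simp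
  then have 1: "\<bar>\<Sum>k. 1 / real (Suc k) ^ 2 * Kint k \<alpha>\<bar> \<le> 6 * (\<alpha> * sqrt \<alpha>)"
    using abs_Kint_le[OF a, of 0] by simp
  have "\<bar>C_trans \<alpha> - sqrt \<alpha>\<bar> = 1 / (2 * pi) * \<bar>\<Sum>k. 1 / real (Suc k) ^ 2 * Kint k \<alpha>\<bar>"
    by (simp add: C_trans_Kint abs_mult)
  also have "\<dots> \<le> 1 / 4 * (6 * (\<alpha> * sqrt \<alpha>))"
    using pi_ge_two 1 a by (intro mult_mono) (auto intro!: divide_left_mono)
  finally show ?thesis using mult_nonneg_nonneg[OF a real_sqrt_ge_zero[OF a]] by linarith
qed

text \<open>The transition range overlaps the range where only square \<open>m\<close> matter, and comparing the
  two estimates there yields the behaviour of \<open>C_trans\<close> at infinity.\<close>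

lemma C_trans_at_top:
  assumes a: "\<alpha> \<ge> 2"
  shows "\<bar>C_trans \<alpha> - \<alpha>\<bar> \<le> 10 ^ 11 * (1 + ln \<alpha>)"
proof -
  \<comment> \<open>This is \<open>SP_transition\<close> at \<open>z = \<alpha>\<close>, with
    \<open>Q / X = \<alpha>\<close> inside its range. After division by
    \<open>X sqrt X = \<alpha> ^ 600\<close> both errors are bounded up to a logarithm.\<close>
  define X Q where "X = \<alpha> ^ 400" and "Q = \<alpha> ^ 401"
  have a1: "\<alpha> \<ge> 1" using a by simp
  have pw: "\<alpha> ^ m \<le> \<alpha> ^ n" if "m \<le> n" for m n using that a1 by (rule power_increasing)
  have X1: "X \<ge> 1" "Q \<ge> 1" using a1 by (auto simp: X_def Q_def one_le_power)
  have QX: "Q / X = \<alpha>" using a by (simp add: X_def Q_def flip: power_diff)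
  have sX: "sqrt X = \<alpha> ^ 200" using sqrt_power_double[of \<alpha> 200] a by (simp add: X_def)
  have XsX: "X * sqrt X = \<alpha> ^ 600" by (simp only: sX) (simp add: X_def flip: power_add)
  have QsX: "Q * sqrt X = \<alpha> * \<alpha> ^ 600" by (simp only: sX) (simp add: Q_def flip: power_add power_Suc)
  have lnX: "ln X = 400 * ln \<alpha>" using a by (simp add: X_def ln_realpow)
  have la: "ln \<alpha> \<ge> 0" using a by simp
  have "\<bar>SP 1 X Q - C_trans (Q / X) * (X * sqrt X) / (4 * real 1)\<bar> \<le> 10 ^ 10 * \<alpha> ^ 595"
    by (rule SP_transition) (use a pw[of 398 401] pw[of 401 402] in \<open>auto simp: X_def Q_def\<close>)
  then have 1: "\<bar>SP 1 X Q - C_trans \<alpha> * \<alpha> ^ 600 / 4\<bar> \<le> 10000000000 * \<alpha> ^ 600"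
    using pw[of 595 600] unfolding QX XsX by simp
  have "\<bar>SP 1 X Q - Q * sqrt X / (4 * real 1)\<bar> \<le> 10000 * (Q + X * sqrt X * (1 + ln X))"
    by (rule SP_large) (use X1 in auto)
  then have "\<bar>SP 1 X Q - \<alpha> * \<alpha> ^ 600 / 4\<bar> \<le> 10000 * (Q + \<alpha> ^ 600 * (1 + ln X))"
    unfolding QsX XsX by simp
  also have "\<dots> \<le> 10000 * (\<alpha> ^ 600 + \<alpha> ^ 600 * (1 + ln X))"
    using pw[of 401 600] by (simp add: Q_def)
  also have "\<dots> = 20000 * \<alpha> ^ 600 + 4000000 * (\<alpha> ^ 600 * ln \<alpha>)" unfolding lnX by (simp add: algebra_simps)
  finally have 2: "\<bar>SP 1 X Q - \<alpha> * \<alpha> ^ 600 / 4\<bar> \<le> 20000 * \<alpha> ^ 600 + 4000000 * (\<alpha> ^ 600 * ln \<alpha>)" .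
  define w where "w = \<alpha> ^ 600"
  have w: "w > 0" using a by (simp add: w_def)
  have "\<bar>C_trans \<alpha> * w - \<alpha> * w\<bar> \<le> 50000000000 * w + 50000000000 * (w * ln \<alpha>)"
    using 1 2 w mult_nonneg_nonneg[OF less_imp_le[OF w] la] unfolding w_def[symmetric] by linarith
  also have "\<dots> = 50000000000 * (1 + ln \<alpha>) * w" by (simp add: algebra_simps)
  finally have "\<bar>C_trans \<alpha> - \<alpha>\<bar> * w \<le> 50000000000 * (1 + ln \<alpha>) * w"
    using w by (simp add: abs_mult flip: left_diff_distrib)
  then have "\<bar>C_trans \<alpha> - \<alpha>\<bar> \<le> 50000000000 * (1 + ln \<alpha>)" using w by simp
  also have "\<dots> \<le> 10 ^ 11 * (1 + ln \<alpha>)" using la by (intro mult_right_mono) auto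
  finally show ?thesis .
qed

lemma one_plus_ln_le: "\<alpha> \<ge> 1 \<Longrightarrow> 1 + ln \<alpha> \<le> 3 * sqrt \<alpha>"
proof -
  assume a: "\<alpha> \<ge> 1"
  have "ln \<alpha> = 2 * ln (sqrt \<alpha>)" using a by (simp add: ln_sqrt)
  also have "\<dots> \<le> 2 * (sqrt \<alpha> - 1)" using a ln_le_minus_one[of "sqrt \<alpha>"] by simp
  finally have "ln \<alpha> \<le> 2 * sqrt \<alpha> - 2" by simp
  moreover have "sqrt \<alpha> \<ge> 0" using a by simp
  ultimately show ?thesis by linarith
qed

lemma C_trans_upper: "\<alpha> \<ge> 0 \<Longrightarrow> C_trans \<alpha> \<le> 10 ^ 12 * (sqrt \<alpha> + \<alpha>)"
proof -
  assume a: "\<alpha> \<ge> 0"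
  show ?thesis
  proof (cases "\<alpha> \<le> 4")
    case True
    have "sqrt \<alpha> \<le> 2" using True real_sqrt_le_mono[of \<alpha> 4] by simp
    then have "\<alpha> * sqrt \<alpha> \<le> \<alpha> * 2" using a by (intro mult_left_mono) auto
    moreover have "0 \<le> sqrt \<alpha>" using a by simp
    ultimately have "C_trans \<alpha> \<le> 1000000000000 * sqrt \<alpha> + 1000000000000 * \<alpha>"
      using C_trans_near_0[OF a] a by linarith
    then show ?thesis by (simp add: distrib_left)
  next
    case False
    have "1 + ln \<alpha> \<le> \<alpha>" using False ln_le_minus_one[of \<alpha>] by simp
    then have "C_trans \<alpha> \<le> 1000000000000 * \<alpha>" using C_trans_at_top[of \<alpha>] False by simp
    then show ?thesis using a by (simp add: distrib_left add_increasing)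
  qed
qed

text \<open>Cut at \<open>sqrt \<alpha> = T\<close>. Below,
  \<open>\<alpha> <= T * sqrt \<alpha>\<close>, so \<open>C_trans_ge\<close> suffices. Above,
  \<open>C_trans_at_top\<close> has error at most \<open>3 / 10 * \<alpha>\<close>, because
  \<open>T = 10 ^ 12\<close> outweighs its \<open>10 ^ 11\<close> and the 3 of
  \<open>one_plus_ln_le\<close>.\<close>

lemma C_trans_lower: "\<exists>c>0. \<forall>\<alpha>\<ge>0. C_trans \<alpha> \<ge> c * (sqrt \<alpha> + \<alpha>)"
proof -
  define T :: real where "T = 10 ^ 12"
  have T: "T \<ge> 2" by (simp add: T_def)
  define c where "c = 1 / (3 * (1 + T))"
  have c: "c > 0" "c \<le> 1 / 4" using T by (auto simp: c_def divide_le_eq)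
  have "C_trans \<alpha> \<ge> c * (sqrt \<alpha> + \<alpha>)" if a: "\<alpha> \<ge> 0" for \<alpha>
  proof (cases "sqrt \<alpha> \<le> T")
    case True
    have "\<alpha> = sqrt \<alpha> * sqrt \<alpha>" using a by simp
    also have "\<dots> \<le> T * sqrt \<alpha>" using True a by (intro mult_right_mono) auto
    finally have "sqrt \<alpha> + \<alpha> \<le> (1 + T) * sqrt \<alpha>" by (simp add: distrib_right)
    then have "c * (sqrt \<alpha> + \<alpha>) \<le> c * ((1 + T) * sqrt \<alpha>)" using c by (intro mult_left_mono) auto
    also have "\<dots> = c * (1 + T) * sqrt \<alpha>" by (simp only: mult.assoc)
    also have "c * (1 + T) = 1 / 3" using T by (simp add: c_def field_simps)
    finally show ?thesis using C_trans_ge[OF a] by linarith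
  next
    case False
    have sa: "sqrt \<alpha> \<ge> 2" using False T by linarith
    have aa: "\<alpha> = sqrt \<alpha> * sqrt \<alpha>" using a by simp
    have "2 * 2 \<le> sqrt \<alpha> * sqrt \<alpha>" using sa a by (intro mult_mono) auto
    then have a2: "\<alpha> \<ge> 2" using aa by linarith
    have s0: "sqrt \<alpha> \<ge> 0" using sa by linarith
    have "\<bar>C_trans \<alpha> - \<alpha>\<bar> \<le> 10 ^ 11 * (1 + ln \<alpha>)" by (rule C_trans_at_top[OF a2])
    also have "\<dots> \<le> 10 ^ 11 * (3 * sqrt \<alpha>)" using a2 by (intro mult_left_mono one_plus_ln_le) auto
    also have "\<dots> = (3 / 10) * (T * sqrt \<alpha>)" by (simp add: T_def)
    also have "\<dots> \<le> (3 / 10) * (sqrt \<alpha> * sqrt \<alpha>)" using False s0 a by (intro mult_left_mono mult_right_mono) auto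
    finally have "C_trans \<alpha> \<ge> \<alpha> / 2" using aa a by linarith
    moreover have "c * (sqrt \<alpha> + \<alpha>) \<le> 1 / 4 * (\<alpha> + \<alpha>)"
    proof (rule mult_mono)
      have "sqrt \<alpha> * 1 \<le> sqrt \<alpha> * sqrt \<alpha>" using sa a a2 by (intro mult_left_mono) auto
      then show "sqrt \<alpha> + \<alpha> \<le> \<alpha> + \<alpha>" using aa by simp
    qed (use c a s0 in auto)
    ultimately show ?thesis by simp
  qed
  then show ?thesis using c by blast
qed

section \<open>Uniform asymptotics of the modified sums\<close>

text \<open>Passes from an elementary main term \<open>B\<close> to the value \<open>C\<close> of
  \<open>C_trans\<close>, which is close to \<open>a\<close>; the two outer ranges are thereby
  stated with the same main term as the transition range.\<close>

lemma main_term_transfer: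
  fixes S C a B w r E1 E2 :: real
  assumes "\<bar>S - B / (4 * r)\<bar> \<le> E1" "\<bar>C - a\<bar> \<le> E2" "a * w = B" "w \<ge> 0" "r \<ge> 1"
  shows "\<bar>S - C * w / (4 * r)\<bar> \<le> E1 + E2 * w"
proof -
  have E2: "0 \<le> E2" using assms by linarith
  have "B / (4 * r) - C * w / (4 * r) = - ((C - a) * w / (4 * r))"
    unfolding assms(3)[symmetric] by (simp add: left_diff_distrib diff_divide_distrib)
  then have "\<bar>B / (4 * r) - C * w / (4 * r)\<bar> = \<bar>C - a\<bar> * w / (4 * r)"
    using assms(4,5) by (simp add: abs_mult)
  also have "\<dots> \<le> E2 * w / (4 * r)" using assms by (intro divide_right_mono mult_right_mono) auto
  also have "\<dots> \<le> E2 * w / 1" using assms E2 by (intro divide_left_mono) auto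
  finally have "\<bar>B / (4 * r) - C * w / (4 * r)\<bar> \<le> E2 * w" by simp
  then show ?thesis using assms(1) by linarith
qed

text \<open>The logarithm in \<open>C_trans_at_top\<close> is bounded by a multiple of
  \<open>sqrt (Q / X)\<close>, which is smaller than \<open>Q / X\<close> by a factor of at least
  \<open>z\<close> here.\<close>

lemma SP_asymp_large:
  assumes r: "odd r" "squarefree r" and z: "z \<ge> 2" and X: "X = z ^ 400" and Q: "Q \<ge> z ^ 402"
  shows "\<bar>SP r X Q - C_trans (Q / X) * (X * sqrt X) / (4 * real r)\<bar> \<le> 10 ^ 12 * (Q * sqrt X / z)"
proof -
  have z1: "z \<ge> 1" and z0: "z > 0" using z by auto
  have pw: "z ^ m \<le> z ^ n" if "m \<le> n" for m n using that z1 by (rule power_increasing)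
  have pw1: "1 \<le> z ^ n" for n using z1 by (rule one_le_power)
  have X1: "X \<ge> 1" "Q \<ge> 1" using pw1[of 400] pw1[of 402] X Q by auto
  have r1: "real r \<ge> 1" using r by (simp add: Suc_leI odd_pos)
  have sX: "sqrt X = z ^ 200" using sqrt_power_double[of z 200] z by (simp add: X)
  have XsX: "X * sqrt X = z ^ 600" by (simp only: sX) (simp add: X flip: power_add)
  define V where "V = Q * sqrt X / z"
  have V: "V = Q * z ^ 199" using z0 unfolding V_def sX by (simp add: field_simps flip: power_Suc)
  have V1: "z ^ 601 \<le> V"
  proof -
    have "z ^ 601 = z ^ 402 * z ^ 199" by (simp flip: power_add)
    also have "\<dots> \<le> V" unfolding V using Q z0 by (intro mult_right_mono) auto
    finally show ?thesis .
  qed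
  have V2: "Q \<le> V" using mult_left_mono[OF pw1[of 199], of Q] X1 unfolding V by simp
  have lnX: "1 + ln X \<le> 401 * z"
  proof -
    have "ln X \<le> real 400 * z" by (rule ln_power_le) (use z1 X1 X in auto)
    then show ?thesis using z1 by simp
  qed
  have "X * sqrt X * (1 + ln X) \<le> z ^ 600 * (401 * z)"
    unfolding XsX using lnX z0 by (intro mult_left_mono) auto
  also have "\<dots> = 401 * z ^ 601" using power_add[of z 600 1] by simp
  finally have e: "X * sqrt X * (1 + ln X) \<le> 401 * V" using V1 by linarith
  have E1: "\<bar>SP r X Q - Q * sqrt X / (4 * real r)\<bar> \<le> 10000 * (402 * V)"
    using SP_large[OF r X1] mult_left_mono[of "Q + X * sqrt X * (1 + ln X)" "402 * V" 10000] e V2 by linarith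
  have "z ^ 400 * z ^ 2 \<le> Q" using Q by (simp flip: power_add)
  then have al: "z ^ 2 \<le> Q / X" using X z0 by (simp add: field_simps)
  moreover have "2 * 1 \<le> z * z" using z by (intro mult_mono) auto
  ultimately have al2: "Q / X \<ge> 2" by (simp add: power2_eq_square)
  have "\<bar>C_trans (Q / X) - Q / X\<bar> \<le> 10 ^ 11 * (1 + ln (Q / X))" by (rule C_trans_at_top[OF al2])
  also have "\<dots> \<le> 10 ^ 11 * (3 * sqrt (Q / X))" using al2 by (intro mult_left_mono one_plus_ln_le) auto
  finally have E2: "\<bar>C_trans (Q / X) - Q / X\<bar> \<le> 10 ^ 11 * (3 * sqrt (Q / X))" .
  have t: "\<bar>SP r X Q - C_trans (Q / X) * (X * sqrt X) / (4 * real r)\<bar>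
      \<le> 10000 * (402 * V) + 10 ^ 11 * (3 * sqrt (Q / X)) * (X * sqrt X)"
    by (rule main_term_transfer[OF E1 E2]) (use X1 r1 in auto)
  have "sqrt (Q / X) * (X * sqrt X) = sqrt Q * z ^ 400" using X1 by (simp add: real_sqrt_divide X)
  also have "\<dots> = sqrt Q * z ^ 201 * z ^ 199" by (simp flip: power_add)
  also have "\<dots> \<le> sqrt Q * sqrt Q * z ^ 199"
  proof (intro mult_right_mono mult_left_mono)
    have "sqrt (z ^ 402) \<le> sqrt Q" using Q by simp
    moreover have "sqrt (z ^ 402) = z ^ 201" using sqrt_power_double[of z 201] z0 by simp
    ultimately show "z ^ 201 \<le> sqrt Q" by linarith
  qed (use X1 z0 in auto)
  also have "\<dots> = V" using X1 V by simp
  finally have "sqrt (Q / X) * (X * sqrt X) \<le> V" .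
  then have "10 ^ 11 * (3 * sqrt (Q / X)) * (X * sqrt X) \<le> 300000000000 * V" by simp
  then have "10000 * (402 * V) + 10 ^ 11 * (3 * sqrt (Q / X)) * (X * sqrt X) \<le> 1000000000000 * V"
    using V2 X1 by linarith
  then show ?thesis using t unfolding V_def by simp
qed

lemma SP_asymp_small:
  assumes r: "odd r" "squarefree r" and z: "z \<ge> 2" and X: "X = z ^ 400" and Q: "1 \<le> Q" "Q \<le> z ^ 398"
  shows "\<bar>SP r X Q - C_trans (Q / X) * (X * sqrt X) / (4 * real r)\<bar> \<le> 10 ^ 12 * (X * sqrt Q / z + X)"
proof -
  have z1: "z \<ge> 1" and z0: "z > 0" using z by auto
  have pw1: "1 \<le> z ^ n" for n using z1 by (rule one_le_power)
  have X1: "X \<ge> 1" using pw1[of 400] X by auto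
  have r1: "real r \<ge> 1" using r by (simp add: Suc_leI odd_pos)
  define V where "V = X * sqrt Q / z"
  have V: "V = z ^ 399 * sqrt Q" using z0 by (simp add: V_def X field_simps flip: power_Suc)
  have V0: "V \<ge> 0" unfolding V using z0 Q by simp
  have a: "Q * sqrt Q \<le> z ^ 398 * sqrt Q" using Q by (intro mult_right_mono) auto
  have b: "Q * sqrt Q \<le> V"
    using a mult_right_mono[OF power_increasing[of 398 399 z], of "sqrt Q"] z1 Q unfolding V by simp
  have lnQ: "1 + ln Q \<le> 399 * z"
  proof -
    have "ln Q \<le> real 398 * z" by (rule ln_power_le) (use z1 Q in auto)
    then show ?thesis using z1 by simp
  qed
  have "Q * sqrt Q * (1 + ln Q) \<le> z ^ 398 * sqrt Q * (399 * z)"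
    using lnQ z0 Q a by (intro mult_mono) auto
  also have "\<dots> = 399 * V" using power_add[of z 398 1] unfolding V by simp
  finally have e: "Q * sqrt Q * (1 + ln Q) \<le> 399 * V" .
  have E1: "\<bar>SP r X Q - X * sqrt Q / (4 * real r)\<bar> \<le> 10000 * (X + 399 * V)"
    using SP_small[OF r X1 Q(1)] mult_left_mono[of "X + Q * sqrt Q * (1 + ln Q)" "X + 399 * V" 10000] e by linarith
  have E2: "\<bar>C_trans (Q / X) - sqrt (Q / X)\<bar> \<le> 2 * (Q / X * sqrt (Q / X))"
    by (rule C_trans_near_0) (use X1 Q in auto)
  have t: "\<bar>SP r X Q - C_trans (Q / X) * (X * sqrt X) / (4 * real r)\<bar>
      \<le> 10000 * (X + 399 * V) + 2 * (Q / X * sqrt (Q / X)) * (X * sqrt X)"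
    by (rule main_term_transfer[OF E1 E2]) (use X1 r1 in \<open>auto simp: real_sqrt_divide\<close>)
  have "2 * (Q / X * sqrt (Q / X)) * (X * sqrt X) = 2 * (Q * sqrt Q)"
    using X1 by (simp add: real_sqrt_divide)
  then have "10000 * (X + 399 * V) + 2 * (Q / X * sqrt (Q / X)) * (X * sqrt X) \<le> 10000 * X + 3990002 * V"
    using b by (simp add: distrib_left)
  also have "\<dots> \<le> 1000000000000 * V + 1000000000000 * X" using X1 V0 by linarith
  finally show ?thesis using t unfolding V_def distrib_left by simp
qed

text \<open>The three ranges meet at \<open>z ^ 398\<close> and \<open>z ^ 402\<close>. Relative to
  \<open>X sqrt Q + Q sqrt X\<close> the saving is \<open>1 / z\<close>, except for the error
  \<open>X\<close> of the range of small \<open>Q\<close>, which saves only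
  \<open>1 / sqrt Q\<close>.\<close>

lemma SP_asymp:
  assumes r: "odd r" "squarefree r" and z: "z \<ge> 2" and X: "X = z ^ 400" and Q: "1 \<le> Q"
  shows "\<bar>SP r X Q - C_trans (Q / X) * (X * sqrt X) / (4 * real r)\<bar>
    \<le> 10 ^ 12 * ((1 / z + 1 / sqrt Q) * (X * sqrt Q + Q * sqrt X))"
proof -
  have z1: "z \<ge> 1" and z0: "z > 0" using z by auto
  have X1: "X \<ge> 1" using X z1 one_le_power by auto
  have expand: "(1 / z + 1 / sqrt Q) * (X * sqrt Q + Q * sqrt X) = X * sqrt Q / z + Q * sqrt X / z + X + Q * sqrt X / sqrt Q"
    using Q z0 by (simp add: field_simps)
  have nn: "0 \<le> X * sqrt Q / z" "0 \<le> Q * sqrt X / z" "0 \<le> Q * sqrt X / sqrt Q" using X1 z0 Q by auto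
  let ?L = "\<bar>SP r X Q - C_trans (Q / X) * (X * sqrt X) / (4 * real r)\<bar>"
  consider "z ^ 402 \<le> Q" | "Q \<le> z ^ 398" | "z ^ 398 \<le> Q" "Q \<le> z ^ 402" by linarith
  then have "?L \<le> 10 ^ 12 * (X * sqrt Q / z + Q * sqrt X / z + X + Q * sqrt X / sqrt Q)"
  proof cases
    case 1
    have "?L \<le> 10 ^ 12 * (Q * sqrt X / z)" by (rule SP_asymp_large[OF r z X 1])
    also have "\<dots> \<le> 10 ^ 12 * (X * sqrt Q / z + Q * sqrt X / z + X + Q * sqrt X / sqrt Q)"
      using nn X1 by (intro mult_left_mono) auto
    finally show ?thesis .
  next
    case 2
    have "?L \<le> 10 ^ 12 * (X * sqrt Q / z + X)" by (rule SP_asymp_small[OF r z X Q 2])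
    also have "\<dots> \<le> 10 ^ 12 * (X * sqrt Q / z + Q * sqrt X / z + X + Q * sqrt X / sqrt Q)"
      using nn by (intro mult_left_mono) auto
    finally show ?thesis .
  next
    case 3
    have "sqrt (z ^ 398) \<le> sqrt Q" using 3 by simp
    moreover have "sqrt (z ^ 398) = z ^ 199" using sqrt_power_double[of z 199] z0 by simp
    ultimately have "z ^ 199 \<le> sqrt Q" by linarith
    then have "z ^ 400 * z ^ 199 / z \<le> X * sqrt Q / z"
      unfolding X using z0 by (intro divide_right_mono mult_left_mono) auto
    moreover have "z ^ 400 * z ^ 199 / z = z ^ 598" using z0 by (simp add: field_simps flip: power_add power_Suc)
    moreover have "z ^ 595 \<le> z ^ 598" using z1 by (intro power_increasing) auto
    ultimately have v: "z ^ 595 \<le> X * sqrt Q / z" by linarith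
    have "?L \<le> 10 ^ 10 * z ^ 595" by (rule SP_transition[OF r z X 3])
    also have "\<dots> \<le> 10 ^ 12 * (X * sqrt Q / z + Q * sqrt X / z + X + Q * sqrt X / sqrt Q)"
      using nn X1 v z0 by (intro mult_mono) auto
    finally show ?thesis .
  qed
  then show ?thesis unfolding expand .
qed

lemma main_term_upper:
  assumes X: "X > 0" and Q: "Q > 0"
  shows "C_trans (Q / X) * (X * sqrt X) \<le> 10 ^ 12 * (X * sqrt Q + Q * sqrt X)"
proof -
  have "C_trans (Q / X) * (X * sqrt X) \<le> 10 ^ 12 * (sqrt (Q / X) + Q / X) * (X * sqrt X)"
    using X Q by (intro mult_right_mono C_trans_upper) auto
  also have "\<dots> = 10 ^ 12 * (X * sqrt Q + Q * sqrt X)" using X by (simp add: real_sqrt_divide field_simps)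
  finally show ?thesis .
qed

lemma main_term_lower:
  "\<exists>c>0. \<forall>X>0. \<forall>Q>0. c * (X * sqrt Q + Q * sqrt X) \<le> C_trans (Q / X) * (X * sqrt X)"
proof -
  obtain c where c: "c > 0" "\<And>\<alpha>. \<alpha> \<ge> 0 \<Longrightarrow> C_trans \<alpha> \<ge> c * (sqrt \<alpha> + \<alpha>)" using C_trans_lower by auto
  have "c * (X * sqrt Q + Q * sqrt X) \<le> C_trans (Q / X) * (X * sqrt X)" if "X > 0" "Q > 0" for X Q
  proof -
    have "c * (X * sqrt Q + Q * sqrt X) = c * (sqrt (Q / X) + Q / X) * (X * sqrt X)"
      using that by (simp add: real_sqrt_divide field_simps)
    also have "\<dots> \<le> C_trans (Q / X) * (X * sqrt X)" using that by (intro mult_right_mono c) auto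
    finally show ?thesis .
  qed
  then show ?thesis using c by blast
qed

lemma root_ge_2: "2 ^ 400 \<le> X \<Longrightarrow> 2 \<le> root 400 X"
proof -
  assume "2 ^ 400 \<le> X"
  then have "root 400 (2 ^ 400) \<le> root 400 X" by (intro real_root_le_mono) simp
  moreover have "root 400 (2 ^ 400) = 2" by (rule real_root_power_cancel) auto
  ultimately show ?thesis by linarith
qed

text \<open>The majorant for the sum over \<open>d\<close>, where the arguments
  \<open>X / d^2\<close> and \<open>Q / d^2\<close> may be small. Below 1 the sums are empty, for
  large \<open>X\<close> the asymptotics apply, and in between \<open>X\<close> is bounded and
  \<open>SP_large\<close> is enough.\<close>

lemma SP_bound:
  assumes r: "odd r" "squarefree r"
  shows "\<exists>K. \<forall>X>0. \<forall>Q>0. \<bar>SP r X Q\<bar> \<le> K * (X * sqrt Q + Q * sqrt X)"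
proof -
  define T :: real where "T = 2 ^ 400"
  \<comment> \<open>The first summand covers large \<open>X\<close> with room to spare, where
    \<open>SP_asymp\<close> and \<open>main_term_upper\<close> add up to \<open>3 * 10 ^ 12\<close>;
    the second covers \<open>1 <= X <= T\<close>.\<close>
  define K :: real where "K = 30000000000000 + 10000 * T ^ 2"
  have T: "T \<ge> 1" by (simp add: T_def)
  have r1: "real r \<ge> 1" using r by (simp add: Suc_leI odd_pos)
  have "\<bar>SP r X Q\<bar> \<le> K * (X * sqrt Q + Q * sqrt X)" if "X > 0" "Q > 0" for X Q
  proof -
    define W where "W = X * sqrt Q + Q * sqrt X"
    have W0: "W \<ge> 0" "K \<ge> 0" using that by (auto simp: W_def K_def)
    consider "X < 1 \<or> Q < 1" | "X \<ge> T" "Q \<ge> 1" | "1 \<le> X" "X \<le> T" "Q \<ge> 1" by linarith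
    then have "\<bar>SP r X Q\<bar> \<le> K * W"
    proof cases
      case 1
      then have "nat \<lfloor>X\<rfloor> = 0 \<or> nat \<lfloor>Q\<rfloor> = 0" by (auto simp: floor_le_iff nat_eq_iff2)
      moreover have "Zsum r m (0 + 1) = 0" for m by (simp add: Zsum_def)
      ultimately have "SP r X Q = 0" unfolding SP_def by (elim disjE; simp only: if_cancel sum.neutral_const) simp
      then show ?thesis using W0 by simp
    next
      case 2
      have X1: "X \<ge> 1" using 2 T by linarith
      define z where "z = root 400 X"
      have X: "X = z ^ 400" using X1 by (simp add: z_def)
      have z: "z \<ge> 2" using 2 unfolding z_def T_def by (intro root_ge_2)
      have C0: "0 \<le> C_trans (Q / X)" using C_trans_ge[of "Q / X"] that by (smt (verit) divide_nonneg_nonneg real_sqrt_ge_zero)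
      have "\<bar>C_trans (Q / X) * (X * sqrt X) / (4 * real r)\<bar> \<le> C_trans (Q / X) * (X * sqrt X) / 1"
      proof -
        have nn: "0 \<le> C_trans (Q / X) * (X * sqrt X)" using C0 that by simp
        then have "C_trans (Q / X) * (X * sqrt X) / (4 * real r) \<le> C_trans (Q / X) * (X * sqrt X) / 1"
          using r1 by (intro divide_left_mono) auto
        then show ?thesis using nn r1 by (subst abs_of_nonneg) auto
      qed
      also have "\<dots> \<le> 10 ^ 12 * W" using main_term_upper[OF that] by (simp add: W_def)
      finally have 3: "\<bar>C_trans (Q / X) * (X * sqrt X) / (4 * real r)\<bar> \<le> 10 ^ 12 * W" .
      have "1 / z \<le> 1" "1 / sqrt Q \<le> 1" using z 2 by auto
      then have "(1 / z + 1 / sqrt Q) * W \<le> 2 * W" using W0 by (intro mult_right_mono) linarith+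
      moreover have "\<bar>SP r X Q - C_trans (Q / X) * (X * sqrt X) / (4 * real r)\<bar> \<le> 10 ^ 12 * ((1 / z + 1 / sqrt Q) * W)"
        unfolding W_def by (rule SP_asymp[OF r z X 2(2)])
      moreover have "\<bar>a\<bar> \<le> 30000000000000 * w"
        if "u \<le> 2 * w" "\<bar>a - b\<bar> \<le> 10 ^ 12 * u" "\<bar>b\<bar> \<le> 10 ^ 12 * w" "0 \<le> w" for a b u w :: real
        using that by simp
      ultimately have 4: "\<bar>SP r X Q\<bar> \<le> 30000000000000 * W" using 3 W0(1) by blast
      also have "\<dots> \<le> K * W" using W0 by (intro mult_right_mono) (auto simp: K_def)
      finally show ?thesis .
    next
      case 3
      have sX: "sqrt X \<ge> 1" using 3 by simp
      have B: "Q * sqrt X \<le> W" "Q \<le> W" "sqrt X \<le> W"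
      proof -
        show 1: "Q * sqrt X \<le> W" using that by (simp add: W_def)
        have "Q * 1 \<le> Q * sqrt X" "1 * sqrt X \<le> Q * sqrt X" using 3 sX by (intro mult_left_mono mult_right_mono; simp)+
        then show "Q \<le> W" "sqrt X \<le> W" using 1 by auto
      qed
      have "X * (1 + ln X) \<le> T * T" using 3 ln_le_minus_one[of X] by (intro mult_mono) auto
      then have "X * (1 + ln X) * sqrt X \<le> T * T * W" using B T 3 by (intro mult_mono[of "X * (1 + ln X)"]) auto
      then have e: "X * sqrt X * (1 + ln X) \<le> T ^ 2 * W" by (simp add: power2_eq_square mult_ac)
      have "Q * sqrt X / (4 * real r) \<le> Q * sqrt X / 1" using that r1 by (intro divide_left_mono) auto
      then have "\<bar>Q * sqrt X / (4 * real r)\<bar> \<le> W" using B that by simp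
      then have "\<bar>SP r X Q\<bar> \<le> W + 10000 * (W + T ^ 2 * W)"
        using SP_large[OF r 3(1,3)] mult_left_mono[of "Q + X * sqrt X * (1 + ln X)" "W + T ^ 2 * W" 10000] e B by linarith
      also have "\<dots> = (10001 + 10000 * T ^ 2) * W" by (simp add: algebra_simps)
      also have "\<dots> \<le> K * W" using W0 by (intro mult_right_mono) (auto simp: K_def)
      finally show ?thesis .
    qed
    then show ?thesis unfolding W_def .
  qed
  then show ?thesis by blast
qed

lemma SP_limit:
  assumes r: "odd r" "squarefree r"
  shows "((\<lambda>(X, Q). SP r X Q / (C_trans (Q / X) * (X * sqrt X))) \<longlongrightarrow> 1 / (4 * real r)) (at_top \<times>\<^sub>F at_top)"
proof -
  obtain c where c: "c > 0" "\<And>X Q. X > 0 \<Longrightarrow> Q > 0 \<Longrightarrow> c * (X * sqrt Q + Q * sqrt X) \<le> C_trans (Q / X) * (X * sqrt X)"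
    using main_term_lower by blast
  define e where "e = (\<lambda>(X, Q). 10 ^ 12 / c * (1 / root 400 X + 1 / sqrt Q))"
  have ev: "eventually (\<lambda>(X, Q). (2::real) ^ 400 \<le> X \<and> (1::real) \<le> Q) (at_top \<times>\<^sub>F at_top)"
    unfolding case_prod_unfold by (rule eventually_prodI[OF eventually_ge_at_top eventually_ge_at_top])
  have rt: "filterlim (root 400) at_top at_top"
    unfolding filterlim_at_top
  proof
    fix Z :: real
    show "eventually (\<lambda>x. Z \<le> root 400 x) at_top"
      using eventually_ge_at_top[of "max Z 0 ^ 400"]
    proof eventually_elim
      case (elim x)
      then have "root 400 (max Z 0 ^ 400) \<le> root 400 x" by simp
      then show ?case by (simp add: real_root_power_cancel)
    qed
  qed
  have "((\<lambda>p. 10 ^ 12 / c * (1 / root 400 (fst p) + 1 / sqrt (snd p))) \<longlongrightarrow> 10 ^ 12 / c * (0 + 0)) (at_top \<times>\<^sub>F at_top)"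
    by (intro tendsto_intros tendsto_divide_0[OF tendsto_const] filterlim_at_top_imp_at_infinity
        filterlim_compose[OF rt filterlim_fst] filterlim_compose[OF sqrt_at_top filterlim_snd])
  then have lim: "(e \<longlongrightarrow> 0) (at_top \<times>\<^sub>F at_top)" by (simp add: e_def case_prod_unfold)
  show ?thesis
  proof (rule LIM_zero_cancel, rule tendsto_rabs_zero_cancel, rule tendsto_sandwich[OF _ _ tendsto_const lim])
    show "eventually (\<lambda>p. \<bar>(case p of (X, Q) \<Rightarrow> SP r X Q / (C_trans (Q / X) * (X * sqrt X))) - 1 / (4 * real r)\<bar> \<le> e p) (at_top \<times>\<^sub>F at_top)"
      using ev
    proof eventually_elim
      case (elim p)
      obtain X Q where p: "p = (X, Q)" by force
      have X2: "X \<ge> 2 ^ 400" and Q1: "Q \<ge> 1" using elim by (auto simp: p)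
      have "(0::real) < 2 ^ 400" by simp
      then have X0: "X > 0" and Q0: "Q > 0" using X2 Q1 by linarith+
      define z where "z = root 400 X"
      have X: "X = z ^ 400" using X0 by (simp add: z_def)
      have z: "z \<ge> 2" using X2 unfolding z_def by (rule root_ge_2)
      define W T where "W = X * sqrt Q + Q * sqrt X" and "T = C_trans (Q / X) * (X * sqrt X)"
      have W: "W > 0" using X0 Q0 by (auto simp: W_def intro!: add_pos_pos)
      have cT: "c * W \<le> T" using c(2)[OF X0 Q0] by (simp add: W_def T_def)
      then have T: "T > 0" using c(1) W by (smt (verit) mult_pos_pos)
      have "\<bar>SP r X Q / T - 1 / (4 * real r)\<bar> = \<bar>SP r X Q - T / (4 * real r)\<bar> / T"
      proof -
        have "SP r X Q / T - 1 / (4 * real r) = (SP r X Q - T / (4 * real r)) / T"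
          using T by (simp add: diff_divide_distrib)
        then show ?thesis using T by simp
      qed
      also have "\<dots> \<le> 10 ^ 12 * ((1 / z + 1 / sqrt Q) * W) / T"
        using SP_asymp[OF r z X Q1] T unfolding W_def[symmetric] T_def[symmetric] by (intro divide_right_mono) auto
      also have "\<dots> \<le> 10 ^ 12 * ((1 / z + 1 / sqrt Q) * W) / (c * W)"
        using cT c(1) W z Q0 T by (intro divide_left_mono) auto
      also have "\<dots> = e p" using W by (simp add: e_def p z_def)
      finally show ?case by (simp add: p T_def)
    qed
  qed simp
qed

section \<open>The constant\<close>

lemma mu_not_squarefree: "\<not> squarefree n \<Longrightarrow> mu n = 0"
  by (simp add: mu_def)

lemma summable_on_bounded_over_squares:
  fixes w :: "nat \<Rightarrow> real"
  assumes "\<And>d. \<bar>w d\<bar> \<le> K"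
  shows "(\<lambda>d. w d / real d ^ 2) summable_on A"
proof -
  have "summable (\<lambda>d. K * (1 / real d ^ 2))"
    using inverse_power_summable[of 2, where ?'a = real] by (intro summable_mult) (simp add: divide_inverse)
  then have "summable (\<lambda>d. norm (w d / real d ^ 2))"
    by (rule summable_comparison_test'[where N = 0]) (use assms in \<open>auto simp: abs_mult divide_right_mono\<close>)
  then have "(\<lambda>d. w d / real d ^ 2) summable_on UNIV" by (rule norm_summable_imp_summable_on)
  then show ?thesis by (rule summable_on_subset_banach) simp
qed

text \<open>Terms with \<open>p^2 | d\<close> vanish, so the multiples of \<open>p\<close> are
  \<open>d = p * e\<close> with \<open>e\<close> prime to \<open>p\<close>, where \<open>mu\<close>
  changes sign. Multiplicativity of \<open>w\<close> enters only at this one prime.\<close>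

lemma infsum_mu_euler_factor:
  fixes w :: "nat \<Rightarrow> real"
  assumes p: "prime p" and K: "\<And>d. \<bar>w d\<bar> \<le> K"
    and w: "\<And>e. \<not> p dvd e \<Longrightarrow> w (p * e) = c * w e"
  shows "(\<Sum>\<^sub>\<infinity>d. mu d * w d / real d ^ 2) = (1 - c / real p ^ 2) * (\<Sum>\<^sub>\<infinity>d\<in>{d. \<not> p dvd d}. mu d * w d / real d ^ 2)"
proof -
  let ?f = "\<lambda>d. mu d * w d / real d ^ 2" and ?N = "{d. \<not> p dvd d}"
  have p0: "p > 0" using p by (simp add: prime_gt_0_nat)
  have "\<bar>mu d * w d\<bar> \<le> K" for d
  proof -
    have "\<bar>mu d * w d\<bar> \<le> 1 * K"
      unfolding abs_mult using abs_mu_le_1[of d] K[of d] by (intro mult_mono) auto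
    then show ?thesis by simp
  qed
  then have sm: "?f summable_on A" for A by (rule summable_on_bounded_over_squares)
  have "infsum ?f UNIV = infsum ?f (?N \<union> {d. p dvd d})" by (rule arg_cong[where f = "infsum ?f"]) auto
  also have "\<dots> = infsum ?f ?N + infsum ?f {d. p dvd d}"
    by (rule infsum_Un_disjoint[OF sm sm]) auto
  also have "infsum ?f {d. p dvd d} = infsum ?f (times p ` ?N)"
  proof (rule infsum_cong_neutral)
    fix d assume "d \<in> {d. p dvd d} - times p ` ?N"
    then obtain e where d: "d = p * e" "p dvd e" by (auto elim!: dvdE)
    then have "p ^ 2 dvd d" by (auto simp: power2_eq_square elim!: dvdE)
    then have "\<not> squarefree d" using p unfolding squarefree_def by (metis not_prime_unit)
    then show "?f d = 0" by (simp add: mu_not_squarefree)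
  qed auto
  also have "\<dots> = infsum (\<lambda>e. ?f (p * e)) ?N"
    by (subst infsum_reindex) (use p0 in \<open>auto simp: inj_on_def o_def\<close>)
  also have "\<dots> = infsum (\<lambda>e. - c / real p ^ 2 * ?f e) ?N"
    by (rule infsum_cong) (use p in \<open>auto simp: w mu_prime_mult power_mult_distrib\<close>)
  also have "\<dots> = - c / real p ^ 2 * infsum ?f ?N"
    by (rule infsum_cmult_right') 
  finally show ?thesis by (simp add: algebra_simps)
qed

lemma infsum_inverse_squares: "(\<Sum>\<^sub>\<infinity>n\<in>{1..}. 1 / real n ^ 2) = pi\<^sup>2 / 6"
proof -
  have "((\<lambda>k. 1 / real (Suc k) ^ 2) has_sum (pi\<^sup>2 / 6)) UNIV"
    by (rule norm_summable_imp_has_sum) (use inverse_squares_suminf in \<open>auto simp: sums_iff\<close>)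
  then have "(\<Sum>\<^sub>\<infinity>k. 1 / real (Suc k) ^ 2) = pi\<^sup>2 / 6" by (rule infsumI)
  moreover have "(\<Sum>\<^sub>\<infinity>k. 1 / real (Suc k) ^ 2) = (\<Sum>\<^sub>\<infinity>n\<in>{1..}. 1 / real n ^ 2)"
    by (rule infsum_reindex_bij_witness[where j = Suc and i = "\<lambda>n. n - 1"]) auto
  ultimately show ?thesis by simp
qed

text \<open>The product with the sum of \<open>1 / e^2\<close> is rearranged by
  \<open>n = d * e\<close> into the sum over \<open>n\<close> of \<open>1 / n^2\<close> times the
  sum of \<open>mu d\<close> over \<open>d | n\<close>, which is 1.\<close>

lemma infsum_mu: "(\<Sum>\<^sub>\<infinity>d. mu d / real d ^ 2) = 6 / pi\<^sup>2"
proof -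
  let ?H = "\<lambda>(d, e). mu d / real d ^ 2 * (1 / real e ^ 2)"
  let ?A = "{1::nat..}"
  have s1: "(\<lambda>d. mu d / real d ^ 2) summable_on A" for A
    by (rule summable_on_bounded_over_squares[where K = 1]) (use abs_mu_le_1 in \<open>simp flip: of_int_abs\<close>)
  have s2: "(\<lambda>d. (if P d then 1 else 0) / real d ^ 2) summable_on A" for A P
    by (rule summable_on_bounded_over_squares[where K = 1]) auto
  have s2': "(\<lambda>d. 1 / real d ^ 2) summable_on A" for A
    using s2[of "\<lambda>_. True"] by simp
  have "Infinite_Sum.abs_summable_on ?H (?A \<times> ?A)"
    unfolding Infinite_Sum.abs_summable_on_Sigma_iff
  proof (intro conjI ballI)
    fix d show "Infinite_Sum.abs_summable_on (\<lambda>e. ?H (d, e)) ?A"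
      using summable_on_cmult_right[OF s2', of "\<bar>mu d\<bar> / real d ^ 2"] by (simp add: abs_mult)
  next
    have "(\<Sum>\<^sub>\<infinity>e\<in>?A. norm (?H (d, e))) = \<bar>mu d\<bar> / real d ^ 2 * (pi\<^sup>2 / 6)" for d
    proof -
      have "(\<Sum>\<^sub>\<infinity>e\<in>?A. norm (?H (d, e))) = (\<Sum>\<^sub>\<infinity>e\<in>?A. \<bar>mu d\<bar> / real d ^ 2 * (1 / real e ^ 2))"
        by (rule infsum_cong) (simp add: abs_mult)
      then show ?thesis by (simp only: infsum_cmult_right' infsum_inverse_squares)
    qed
    moreover have "(\<lambda>d. \<bar>mu d\<bar> / real d ^ 2) summable_on ?A"
      by (rule summable_on_bounded_over_squares[where K = 1]) (use abs_mu_le_1 in \<open>simp flip: of_int_abs\<close>)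
    ultimately show "Infinite_Sum.abs_summable_on (\<lambda>d. \<Sum>\<^sub>\<infinity>e\<in>?A. norm (?H (d, e))) ?A"
      using summable_on_cmult_left[of "\<lambda>d. \<bar>mu d\<bar> / real d ^ 2" ?A "pi\<^sup>2 / 6"] by (simp add: abs_mult)
  qed
  then have sH: "?H summable_on ?A \<times> ?A" by (rule abs_summable_summable)
  have bij: "bij_betw (\<lambda>(n, d). (d, n div d)) (Sigma ?A (\<lambda>n. {d. d dvd n})) (?A \<times> ?A)"
    by (rule bij_betwI[where g = "\<lambda>(d, e). (d * e, d)"]) (auto elim!: dvdE simp: Suc_le_eq)
  have sG: "(\<lambda>x. ?H ((\<lambda>(n, d). (d, n div d)) x)) summable_on Sigma ?A (\<lambda>n. {d. d dvd n})"
    using sH summable_on_reindex_bij_betw[OF bij, of ?H] by simp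
  have "(\<Sum>\<^sub>\<infinity>d\<in>?A. mu d / real d ^ 2) * (pi\<^sup>2 / 6) = (\<Sum>\<^sub>\<infinity>d\<in>?A. \<Sum>\<^sub>\<infinity>e\<in>?A. ?H (d, e))"
    by (simp only: prod.case infsum_cmult_right' infsum_inverse_squares infsum_cmult_left')
  also have "\<dots> = infsum ?H (?A \<times> ?A)" by (rule infsum_Sigma_banach[OF sH])
  also have "\<dots> = infsum (\<lambda>x. ?H ((\<lambda>(n, d). (d, n div d)) x)) (Sigma ?A (\<lambda>n. {d. d dvd n}))"
    by (rule infsum_reindex_bij_betw[OF bij, symmetric])
  also have "\<dots> = (\<Sum>\<^sub>\<infinity>n\<in>?A. \<Sum>\<^sub>\<infinity>d\<in>{d. d dvd n}. ?H (d, n div d))"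
    using infsum_Sigma_banach[OF sG] by simp
  also have "\<dots> = (\<Sum>\<^sub>\<infinity>n\<in>?A. if n = 1 then 1 else 0)"
  proof (rule infsum_cong)
    fix n assume "n \<in> ?A"
    then have n: "n > 0" by simp
    then have "(\<Sum>\<^sub>\<infinity>d\<in>{d. d dvd n}. ?H (d, n div d)) = (\<Sum>d | d dvd n. mu d / real n ^ 2)"
      by (subst infsum_finite) (auto intro!: sum.cong elim!: dvdE simp: power_mult_distrib)
    also have "\<dots> = real_of_int (\<Sum>d | d dvd n. mu d) / real n ^ 2" by (simp add: sum_divide_distrib)
    finally show "(\<Sum>\<^sub>\<infinity>d\<in>{d. d dvd n}. ?H (d, n div d)) = (if n = 1 then 1 else 0)"
      using sum_mu_dvd[OF n] by simp
  qed
  also have "\<dots> = (\<Sum>\<^sub>\<infinity>n\<in>{1::nat}. 1)" by (rule infsum_cong_neutral) auto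
  finally have "(\<Sum>\<^sub>\<infinity>d\<in>?A. mu d / real d ^ 2) * (pi\<^sup>2 / 6) = 1" by simp
  moreover have "(\<Sum>\<^sub>\<infinity>d\<in>?A. mu d / real d ^ 2) = (\<Sum>\<^sub>\<infinity>d. mu d / real d ^ 2)"
    by (rule infsum_cong_neutral) (auto simp: not_le Suc_le_eq)
  ultimately show ?thesis by (simp add: field_simps)
qed

lemma infsum_mu_odd: "(\<Sum>\<^sub>\<infinity>d. real_of_int (mu d) * (if odd d then 1 else 0) / real d ^ 2) = 8 / pi\<^sup>2"
proof -
  have "(\<Sum>\<^sub>\<infinity>d. real_of_int (mu d) * 1 / real d ^ 2) = (1 - 1 / real 2 ^ 2) * (\<Sum>\<^sub>\<infinity>d\<in>{d. \<not> 2 dvd d}. real_of_int (mu d) * 1 / real d ^ 2)"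
    by (rule infsum_mu_euler_factor[where K = 1]) auto
  moreover have "(\<Sum>\<^sub>\<infinity>d\<in>{d. \<not> 2 dvd d}. real_of_int (mu d) * 1 / real d ^ 2) = (\<Sum>\<^sub>\<infinity>d. real_of_int (mu d) * (if odd d then 1 else 0) / real d ^ 2)"
    by (rule infsum_cong_neutral) auto
  ultimately show ?thesis using infsum_mu by (simp add: field_simps)
qed

lemma divisor_sum_prime_mult:
  assumes "prime p" "\<not> p dvd l" "l > 0"
  shows "divisor_sum (p * l) = (1 + p) * divisor_sum l"
proof -
  have p0: "p > 0" using assms by (simp add: prime_gt_0_nat)
  have "{d. d dvd p * l} = {d. d dvd l} \<union> times p ` {d. d dvd l}"
  proof (intro equalityI subsetI)
    fix d assume "d \<in> {d. d dvd p * l}"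
    then have d: "d dvd p * l" by simp
    show "d \<in> {d. d dvd l} \<union> times p ` {d. d dvd l}"
    proof (cases "p dvd d")
      case True
      then show ?thesis using d p0 by (auto elim!: dvdE)
    next
      case False
      then have "coprime d p" using assms by (metis coprime_commute prime_imp_coprime)
      then show ?thesis using d by (simp add: coprime_dvd_mult_right_iff)
    qed
  qed auto
  moreover have "{d. d dvd l} \<inter> times p ` {d. d dvd l} = {}" using assms by (auto dest: dvd_mult_left)
  ultimately have "divisor_sum (p * l) = (\<Sum>d | d dvd l. d) + (\<Sum>d\<in>times p ` {d. d dvd l}. d)"
    unfolding divisor_sum_def using assms by (simp add: sum.union_disjoint)
  also have "(\<Sum>d\<in>times p ` {d. d dvd l}. d) = p * (\<Sum>d | d dvd l. d)"
    using p0 by (subst sum.reindex) (auto simp: inj_on_def sum_distrib_left)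
  finally show ?thesis by (simp add: divisor_sum_def algebra_simps)
qed

lemma odd_squarefree_induct [consumes 2, case_names 1 mult]:
  assumes "odd (l::nat)" "squarefree l"
    and "P 1" "\<And>p l. prime p \<Longrightarrow> odd p \<Longrightarrow> odd l \<Longrightarrow> squarefree l \<Longrightarrow> \<not> p dvd l \<Longrightarrow> P l \<Longrightarrow> P (p * l)"
  shows "P l"
  using assms(1,2)
proof (induction l rule: less_induct)
  case (less l)
  show ?case
  proof (cases "l = 1")
    case False
    then obtain p where p: "prime p" "p dvd l" using prime_factor_nat by blast
    then obtain k where l: "l = p * k" by (elim dvdE)
    have k: "k > 0" using less.prems l by (cases k) auto
    have "\<not> p dvd k"
    proof
      assume "p dvd k"
      then have "p ^ 2 dvd l" by (auto simp: l power2_eq_square)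
      then show False using less.prems(2) p(1) unfolding squarefree_def by (metis not_prime_unit)
    qed
    moreover have "squarefree k" using less.prems(2) l by (metis dvd_triv_right squarefree_mono)
    moreover have "k < l" using p(1) k l prime_gt_1_nat[of p] by simp
    ultimately show ?thesis using less p l by (auto intro!: assms(4))
  qed (use assms(3) in simp)
qed

text \<open>Adjoining a prime \<open>p\<close> to \<open>l\<close> changes the Euler factor at
  \<open>p\<close> from \<open>1 - 1 / p^2\<close> to \<open>1 - 1 / p\<close>, a division by
  \<open>1 + 1 / p\<close>. The quotient of \<open>l\<close> by its divisor sum changes by the same
  factor \<open>p / (p + 1)\<close>.\<close>

lemma infsum_mu_gcd:
  assumes "odd (l::nat)" "squarefree l"
  shows "(\<Sum>\<^sub>\<infinity>d. real_of_int (mu d) * (if odd d then real (gcd l d) else 0) / real d ^ 2) = 8 / pi\<^sup>2 * (real l / real (divisor_sum l))"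
  using assms
proof (induction l rule: odd_squarefree_induct)
  case 1
  have "divisor_sum 1 = 1" by (simp add: divisor_sum_def)
  then show ?case using infsum_mu_odd by (simp cong: if_cong)
next
  case (mult p l)
  let ?w = "\<lambda>l d. if odd d then real (gcd l d) else 0"
  let ?F = "\<lambda>l. \<Sum>\<^sub>\<infinity>d. mu d * ?w l d / real d ^ 2"
  have l0: "l > 0" and p0: "p > 0" using mult by (auto intro!: Nat.gr0I)
  have bd: "\<bar>?w k d\<bar> \<le> real k" if "k > 0" for k d using that gcd_le1_nat[of k d] by simp
  have "coprime p l" using mult by (simp add: prime_imp_coprime)
  then have g1: "gcd l (p * e) = gcd l e" and g2: "gcd (p * l) (p * e) = p * gcd l e" for e
    by (simp_all add: gcd_mult_right_left_cancel coprime_commute gcd_mult_distrib_nat)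
  have g3: "gcd (p * l) e = gcd l e" if "\<not> p dvd e" for e
  proof -
    have "coprime p e" using mult(1) that by (simp add: prime_imp_coprime)
    then show ?thesis by (simp add: gcd_mult_left_left_cancel coprime_commute)
  qed
  have 1: "?F l = (1 - 1 / real p ^ 2) * (\<Sum>\<^sub>\<infinity>d\<in>{d. \<not> p dvd d}. mu d * ?w l d / real d ^ 2)"
    by (rule infsum_mu_euler_factor[OF mult(1) bd[OF l0]]) (use mult in \<open>auto simp: g1\<close>)
  have "?F (p * l) = (1 - real p / real p ^ 2) * (\<Sum>\<^sub>\<infinity>d\<in>{d. \<not> p dvd d}. mu d * ?w (p * l) d / real d ^ 2)"
    by (rule infsum_mu_euler_factor[OF mult(1) bd]) (use mult l0 p0 in \<open>auto simp: g2 g3\<close>)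
  also have "(\<Sum>\<^sub>\<infinity>d\<in>{d. \<not> p dvd d}. mu d * ?w (p * l) d / real d ^ 2) = (\<Sum>\<^sub>\<infinity>d\<in>{d. \<not> p dvd d}. mu d * ?w l d / real d ^ 2)"
    by (rule infsum_cong) (auto simp: g3)
  finally have 2: "?F (p * l) = (1 - real p / real p ^ 2) * (\<Sum>\<^sub>\<infinity>d\<in>{d. \<not> p dvd d}. mu d * ?w l d / real d ^ 2)" .
  have "(1 + 1 / real p) * (1 - real p / real p ^ 2) = 1 - 1 / real p ^ 2"
    using p0 by (simp add: field_simps power2_eq_square)
  then have "(1 + 1 / real p) * ?F (p * l) = ?F l"
    unfolding 1 2 by (simp only: mult.assoc[symmetric])
  moreover have "1 + 1 / real p \<noteq> 0" using p0 by (simp add: field_simps)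
  moreover have "x = y / c" if "c * x = y" "c \<noteq> 0" for x y c :: real using that by auto
  ultimately have "?F (p * l) = ?F l / (1 + 1 / real p)" by blast
  also have "\<dots> = 8 / pi\<^sup>2 * (real l / real (divisor_sum l)) / (1 + 1 / real p)" by (simp only: mult.IH)
  also have "\<dots> = 8 / pi\<^sup>2 * (real (p * l) / real (divisor_sum (p * l)))"
    unfolding divisor_sum_prime_mult[OF mult(1) mult(5) l0] using p0 by (simp add: field_simps)
  finally show ?case .
qed

section \<open>Reduction to the modified sums\<close>

text \<open>The substitution \<open>q = l * n / d^2\<close>. Since \<open>l\<close> is squarefree,
  \<open>l | d^2 * q\<close> says that \<open>l / gcd l d\<close> divides \<open>q\<close>; this is
  the origin of the parameter \<open>r\<close> of \<open>SP\<close>.\<close>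

lemma sum_square_multiples:
  fixes G :: "nat \<Rightarrow> 'a :: comm_monoid_add"
  assumes l: "l > 0" "odd l" "squarefree l" and d: "odd d" and Y: "Y \<ge> 0"
  shows "(\<Sum>n\<in>{n. 1 \<le> n \<and> real n \<le> Y \<and> odd n}. if d\<^sup>2 dvd l * n then G (l * n div d\<^sup>2) else 0) =
    (\<Sum>q<nat \<lfloor>real l * Y / real d ^ 2\<rfloor> + 1. if odd q \<and> l div gcd l d dvd q then G q else 0)"
proof -
  have d0: "d > 0" using d by (rule odd_pos)
  have lt: "q < nat \<lfloor>real l * Y / real d ^ 2\<rfloor> + 1 \<longleftrightarrow> real q * real d ^ 2 \<le> real l * Y" for q
  proof -
    have "q < nat \<lfloor>real l * Y / real d ^ 2\<rfloor> + 1 \<longleftrightarrow> real q \<le> real l * Y / real d ^ 2"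
      using Y by (simp add: less_Suc_eq_le le_nat_iff le_floor_iff)
    then show ?thesis using d0 by (simp add: le_divide_eq)
  qed
  have fin: "finite {n::nat. 1 \<le> n \<and> real n \<le> Y \<and> odd n}"
    by (rule finite_subset[of _ "{..nat \<lfloor>Y\<rfloor>}"]) (use Y in \<open>auto simp: le_nat_iff le_floor_iff\<close>)
  have "(\<Sum>n\<in>{n. 1 \<le> n \<and> real n \<le> Y \<and> odd n}. if d\<^sup>2 dvd l * n then G (l * n div d\<^sup>2) else 0) =
      (\<Sum>n\<in>{n \<in> {n. 1 \<le> n \<and> real n \<le> Y \<and> odd n}. d\<^sup>2 dvd l * n}. G (l * n div d\<^sup>2))"
    by (rule sum.inter_filter[OF fin, symmetric])
  also have "\<dots> = (\<Sum>q\<in>{q \<in> {..<nat \<lfloor>real l * Y / real d ^ 2\<rfloor> + 1}. odd q \<and> l div gcd l d dvd q}. G q)"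
  proof (rule sum.reindex_bij_witness[where i = "\<lambda>q. d\<^sup>2 * q div l" and j = "\<lambda>n. l * n div d\<^sup>2"], goal_cases)
    case (1 n)
    then show ?case using l d0 by simp
  next
    case (2 n)
    then have n: "1 \<le> n" "real n \<le> Y" "odd n" "d\<^sup>2 dvd l * n" by auto
    define q where "q = l * n div d\<^sup>2"
    have q: "l * n = d\<^sup>2 * q" using n by (simp add: q_def)
    have "real q * real d ^ 2 = real (l * n)" unfolding q by simp
    also have "\<dots> \<le> real l * Y" using n by (simp add: mult_left_mono)
    finally have "q < nat \<lfloor>real l * Y / real d ^ 2\<rfloor> + 1" unfolding lt .
    moreover have "odd (l * n)" using n l by simp
    then have "odd q" unfolding q by simp
    moreover have "l dvd d\<^sup>2 * q" unfolding q[symmetric] by simp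
    then have "l div gcd l d dvd q" using squarefree_dvd_square_mult[OF l(3,1)] by simp
    ultimately show ?case by (simp add: q_def)
  next
    case (3 q)
    then have "l dvd d\<^sup>2 * q" using squarefree_dvd_square_mult[OF l(3,1)] by simp
    then show ?case using d0 by simp
  next
    case (4 q)
    then have q: "real q * real d ^ 2 \<le> real l * Y" "odd q" "l dvd d\<^sup>2 * q"
      using squarefree_dvd_square_mult[OF l(3,1)] by (auto simp only: lt mem_Collect_eq lessThan_iff)
    define n where "n = d\<^sup>2 * q div l"
    have n: "d\<^sup>2 * q = l * n" using q by (simp add: n_def)
    have "odd (d\<^sup>2 * q)" using q d by simp
    then have on: "odd n" unfolding n by simp
    have "real l * real n = real (d\<^sup>2 * q)" unfolding n by simp
    also have "\<dots> \<le> real l * Y" using q by (simp add: mult.commute)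
    finally have "real n \<le> Y" using l by simp
    moreover have "n \<ge> 1" using on by (cases n) auto
    moreover have "d\<^sup>2 dvd l * n" unfolding n[symmetric] by simp
    ultimately show ?case using on by (simp add: n_def)
  next
    case (5 n)
    then show ?case by simp
  qed
  also have "\<dots> = (\<Sum>q<nat \<lfloor>real l * Y / real d ^ 2\<rfloor> + 1. if odd q \<and> l div gcd l d dvd q then G q else 0)"
    by (rule sum.inter_filter) simp
  finally show ?thesis .
qed

lemma sum_square_multiples_1:
  fixes G :: "nat \<Rightarrow> 'a :: comm_monoid_add"
  assumes d: "odd d" and Y: "Y \<ge> 0"
  shows "(\<Sum>n\<in>{n. 1 \<le> n \<and> real n \<le> Y \<and> odd n}. if d\<^sup>2 dvd n then G (n div d\<^sup>2) else 0) =
    (\<Sum>q<nat \<lfloor>Y / real d ^ 2\<rfloor> + 1. if odd q then G q else 0)"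
  using sum_square_multiples[of 1 d Y G] assms by (simp cong: if_cong del: lessThan_Suc sum.lessThan_Suc)

lemma SP_eq_sum_Jacobi_terms:
  assumes l: "l > 0" "odd l" "squarefree l" and d: "odd d" and X: "X \<ge> 0" and Y: "Y \<ge> 0"
  shows "SP (l div gcd l d) (X / real d ^ 2) (real l * Y / real d ^ 2) =
    (\<Sum>m\<in>{m. 1 \<le> m \<and> real m \<le> X \<and> odd m}. \<Sum>n\<in>{n. 1 \<le> n \<and> real n \<le> Y \<and> odd n}.
      if d\<^sup>2 dvd l * n \<and> d\<^sup>2 dvd m then real_of_int (PJ (int (m div d\<^sup>2)) (l * n div d\<^sup>2)) else 0)"
proof -
  let ?Z = "\<lambda>m. Zsum (l div gcd l d) m (nat \<lfloor>real l * Y / real d ^ 2\<rfloor> + 1)"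
  have "SP (l div gcd l d) (X / real d ^ 2) (real l * Y / real d ^ 2) =
      (\<Sum>m\<in>{m. 1 \<le> m \<and> real m \<le> X \<and> odd m}. if d\<^sup>2 dvd m then ?Z (m div d\<^sup>2) else 0)"
    unfolding SP_def by (rule sum_square_multiples_1[OF d X, symmetric])
  also have "\<dots> = (\<Sum>m\<in>{m. 1 \<le> m \<and> real m \<le> X \<and> odd m}. \<Sum>n\<in>{n. 1 \<le> n \<and> real n \<le> Y \<and> odd n}.
      if d\<^sup>2 dvd l * n \<and> d\<^sup>2 dvd m then real_of_int (PJ (int (m div d\<^sup>2)) (l * n div d\<^sup>2)) else 0)"
  proof (rule sum.cong[OF refl])
    fix m
    have "?Z (m div d\<^sup>2) = (\<Sum>n\<in>{n. 1 \<le> n \<and> real n \<le> Y \<and> odd n}.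
        if d\<^sup>2 dvd l * n then real_of_int (PJ (int (m div d\<^sup>2)) (l * n div d\<^sup>2)) else 0)"
      unfolding Zsum_def by (rule sum_square_multiples[OF l d Y, symmetric])
    then show "(if d\<^sup>2 dvd m then ?Z (m div d\<^sup>2) else 0) = (\<Sum>n\<in>{n. 1 \<le> n \<and> real n \<le> Y \<and> odd n}.
        if d\<^sup>2 dvd l * n \<and> d\<^sup>2 dvd m then real_of_int (PJ (int (m div d\<^sup>2)) (l * n div d\<^sup>2)) else 0)"
      by (cases "d\<^sup>2 dvd m") simp_all
  qed
  finally show ?thesis .
qed

lemma jacobi_sum_eq_sum_SP:
  assumes l: "l > 0" "odd l" "squarefree l" and X: "X \<ge> 0" and Y: "Y \<ge> 0" and N: "X < real N"
  shows "real_of_int (jacobi_sum l X Y) =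
    (\<Sum>d<N. if odd d then mu d * real d * SP (l div gcd l d) (X / real d ^ 2) (real l * Y / real d ^ 2) else 0)"
proof -
  let ?M = "{m. 1 \<le> m \<and> real m \<le> X \<and> odd m}" and ?N = "{n. 1 \<le> n \<and> real n \<le> Y \<and> odd n}"
  let ?t = "\<lambda>d m n. if d\<^sup>2 dvd l * n \<and> d\<^sup>2 dvd m then real_of_int (PJ (int (m div d\<^sup>2)) (l * n div d\<^sup>2)) else 0"
  have J: "real_of_int (Jacobi (int m) (l * n)) = (\<Sum>d<N. if odd d then mu d * real d * ?t d m n else 0)"
    if m: "m \<in> ?M" and n: "n \<in> ?N" for m n
  proof -
    have o: "odd (l * n)" using l n by simp
    have "real_of_int (Jacobi (int m) (l * n)) =
        (\<Sum>d | d\<^sup>2 dvd l * n \<and> int (d\<^sup>2) dvd int m. real_of_int (mu d * int d * PJ (int m div int (d\<^sup>2)) (l * n div d\<^sup>2)))"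
      by (simp only: Jacobi_eq_sum_PJ[OF o] of_int_sum)
    also have "\<dots> = (\<Sum>d | d\<^sup>2 dvd l * n \<and> d\<^sup>2 dvd m. mu d * real d * real_of_int (PJ (int (m div d\<^sup>2)) (l * n div d\<^sup>2)))"
      by (rule sum.cong) (simp_all only: int_dvd_int_iff zdiv_int of_int_mult of_int_of_nat_eq)
    also have "\<dots> = (\<Sum>d<N. if odd d then mu d * real d * ?t d m n else 0)"
    proof (rule sum.mono_neutral_cong_left)
      show "{d. d\<^sup>2 dvd l * n \<and> d\<^sup>2 dvd m} \<subseteq> {..<N}"
      proof
        fix d assume "d \<in> {d. d\<^sup>2 dvd l * n \<and> d\<^sup>2 dvd m}"
        then have "d dvd m" by (auto simp: power2_eq_square dest: dvd_mult_left)
        then have "d \<le> m" using m by (intro dvd_imp_le) auto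
        then have "real d < real N" using m N by simp
        then show "d \<in> {..<N}" by simp
      qed
      show "\<forall>d\<in>{..<N} - {d. d\<^sup>2 dvd l * n \<and> d\<^sup>2 dvd m}. (if odd d then mu d * real d * ?t d m n else 0) = 0"
        by auto
      show "mu d * real d * real_of_int (PJ (int (m div d\<^sup>2)) (l * n div d\<^sup>2)) = (if odd d then mu d * real d * ?t d m n else 0)"
        if "d \<in> {d. d\<^sup>2 dvd l * n \<and> d\<^sup>2 dvd m}" for d
        using that square_divisor_odd[OF o] by auto
    qed simp
    finally show ?thesis .
  qed
  have "real_of_int (jacobi_sum l X Y) = (\<Sum>m\<in>?M. \<Sum>n\<in>?N. real_of_int (Jacobi (int m) (l * n)))"
    by (simp add: jacobi_sum_def)
  also have "\<dots> = (\<Sum>m\<in>?M. \<Sum>n\<in>?N. \<Sum>d<N. if odd d then mu d * real d * ?t d m n else 0)"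
    by (intro sum.cong refl J)
  also have "\<dots> = (\<Sum>m\<in>?M. \<Sum>d<N. \<Sum>n\<in>?N. if odd d then mu d * real d * ?t d m n else 0)"
    by (intro sum.cong refl sum.swap)
  also have "\<dots> = (\<Sum>d<N. \<Sum>m\<in>?M. \<Sum>n\<in>?N. if odd d then mu d * real d * ?t d m n else 0)"
    by (rule sum.swap)
  also have "\<dots> = (\<Sum>d<N. if odd d then mu d * real d * (\<Sum>m\<in>?M. \<Sum>n\<in>?N. ?t d m n) else 0)"
  proof (rule sum.cong[OF refl])
    fix d
    show "(\<Sum>m\<in>?M. \<Sum>n\<in>?N. if odd d then mu d * real d * ?t d m n else 0) =
        (if odd d then mu d * real d * (\<Sum>m\<in>?M. \<Sum>n\<in>?N. ?t d m n) else 0)"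
      by (cases "odd d") (simp_all only: not_False_eq_True not_True_eq_False if_True if_False sum_distrib_left sum.neutral_const)
  qed
  also have "\<dots> = (\<Sum>d<N. if odd d then mu d * real d * SP (l div gcd l d) (X / real d ^ 2) (real l * Y / real d ^ 2) else 0)"
    by (intro sum.cong refl if_cong arg_cong2[where f = "times"]) (rule SP_eq_sum_Jacobi_terms[OF l _ X Y, symmetric])
  finally show ?thesis .
qed

lemma SP_eq_0: "X < 1 \<Longrightarrow> SP r X Q = 0"
proof -
  assume "X < 1"
  then have "nat \<lfloor>X\<rfloor> = 0" by (simp add: floor_le_iff)
  then show ?thesis by (simp add: SP_def)
qed

text \<open>Terms with \<open>d^2 > X\<close> vanish, so the finite sum can be written as a series
  over a range that does not depend on \<open>X\<close>, as Tannery's theorem requires.\<close>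

lemma jacobi_sum_eq_suminf_SP:
  assumes l: "l > 0" "odd l" "squarefree l" and X: "X \<ge> 1" and Y: "Y \<ge> 0"
  shows "real_of_int (jacobi_sum l X Y) =
    (\<Sum>d. if odd d then mu d * real d * SP (l div gcd l d) (X / real d ^ 2) (real l * Y / real d ^ 2) else 0)"
proof -
  define N where "N = nat \<lfloor>X\<rfloor> + 1"
  have N: "X < real N" "N \<ge> 1" using X by (simp_all add: N_def) linarith
  have "real_of_int (jacobi_sum l X Y) =
      (\<Sum>d<N. if odd d then mu d * real d * SP (l div gcd l d) (X / real d ^ 2) (real l * Y / real d ^ 2) else 0)"
    by (rule jacobi_sum_eq_sum_SP[OF l _ Y N(1)]) (use X in simp)
  also have "\<dots> = (\<Sum>d. if odd d then mu d * real d * SP (l div gcd l d) (X / real d ^ 2) (real l * Y / real d ^ 2) else 0)"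
  proof (rule suminf_finite[symmetric])
    fix d assume "d \<notin> {..<N}"
    then have d: "real N \<le> real d" "1 \<le> d" using N by auto
    have "real d * 1 \<le> real d * real d" using d by (intro mult_left_mono) auto
    then have "X < real d ^ 2" using d N unfolding power2_eq_square by linarith
    then have "X / real d ^ 2 < 1" using d by simp
    then show "(if odd d then mu d * real d * SP (l div gcd l d) (X / real d ^ 2) (real l * Y / real d ^ 2) else 0) = 0"
      by (simp add: SP_eq_0)
  qed simp
  finally show ?thesis .
qed

lemma filterlim_scaled_at_top_prod:
  fixes a b :: real
  assumes "a > 0" "b > 0"
  shows "filterlim (\<lambda>(X, Y). (a * X, b * Y)) (at_top \<times>\<^sub>F at_top) (at_top \<times>\<^sub>F at_top)"
  unfolding case_prod_unfold
  by (intro filterlim_Pair filterlim_tendsto_pos_mult_at_top[OF tendsto_const] assms filterlim_fst filterlim_snd)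

text \<open>Against the weight \<open>d\<close> from the inversion the factor \<open>1 / d^3\<close>
  leaves the summable \<open>1 / d^2\<close>.\<close>

lemma main_term_scale:
  assumes "d > 0"
  shows "C_trans (Y / d ^ 2 / (X / d ^ 2)) * (X / d ^ 2 * sqrt (X / d ^ 2)) = C_trans (Y / X) * (X * sqrt X) / d ^ 3"
  using assms by (simp add: real_sqrt_divide power2_eq_square power3_eq_cube)

text \<open>Tannery's theorem: \<open>SP_limit\<close> gives the limit of each term,
  \<open>SP_bound\<close> over \<open>main_term_lower\<close> gives the majorant. With
  \<open>r = l / gcd l d\<close> the factor \<open>1 / (4 * r)\<close> is
  \<open>gcd l d / (4 * l)\<close>, so the limits sum to the constant of
  \<open>infsum_mu_gcd\<close>.\<close>

lemma jacobi_sum_limit: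
  assumes l: "l > 0" "odd l" "squarefree l"
  shows "((\<lambda>(X, Y). real_of_int (jacobi_sum l X Y) / (C_trans (real l * Y / X) * (X * sqrt X)))
    \<longlongrightarrow> 2 / pi\<^sup>2 / real (divisor_sum l)) (at_top \<times>\<^sub>F at_top)"
proof -
  define T where "T X Y = C_trans (real l * Y / X) * (X * sqrt X)" for X Y
  define r where "r d = l div gcd l d" for d
  define a where "a d p = (case p of (X, Y) \<Rightarrow>
    (if odd d then mu d * real d * SP (r d) (X / real d ^ 2) (real l * Y / real d ^ 2) else 0) / T X Y)" for d :: nat and p
  define b where "b d = mu d * (if odd d then real (gcd l d) else 0) / real d ^ 2 / (4 * real l)" for d
  let ?F = "at_top \<times>\<^sub>F at_top :: (real \<times> real) filter"
  obtain c where c: "c > 0" "\<And>X Q. X > 0 \<Longrightarrow> Q > 0 \<Longrightarrow> c * (X * sqrt Q + Q * sqrt X) \<le> C_trans (Q / X) * (X * sqrt X)"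
    using main_term_lower by blast
  have rd: "r d * gcd l d = l" for d by (simp add: r_def)
  have r: "odd (r d)" "squarefree (r d)" for d
  proof -
    have "r d dvd l" by (metis rd dvd_triv_left)
    then show "odd (r d)" "squarefree (r d)" using l by (auto intro: squarefree_mono dvd_trans)
  qed
  have pos: "eventually (\<lambda>(X, Y). 1 \<le> X \<and> 1 \<le> Y) ?F"
    unfolding case_prod_unfold by (rule eventually_prodI[OF eventually_ge_at_top eventually_ge_at_top])
  have T_scale: "C_trans (real l * Y / real d ^ 2 / (X / real d ^ 2)) * (X / real d ^ 2 * sqrt (X / real d ^ 2)) = T X Y / real d ^ 3"
    if "d > 0" for d X Y
    using main_term_scale[of "real d" "real l * Y" X] that by (simp add: T_def)
  have lim: "(a d \<longlongrightarrow> b d) ?F" for d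
  proof (cases "odd d")
    case False
    then have "a d = (\<lambda>_. 0)" "b d = 0" by (auto simp: a_def b_def fun_eq_iff)
    then show ?thesis by simp
  next
    case True
    then have d0: "d > 0" by (rule odd_pos)
    define g where "g = (\<lambda>(X, Y). SP (r d) X Y / (C_trans (Y / X) * (X * sqrt X)))"
    define s where "s = (\<lambda>(X, Y). (1 / real d ^ 2 * X, real l / real d ^ 2 * Y))"
    have "((\<lambda>p. g (s p)) \<longlongrightarrow> 1 / (4 * real (r d))) ?F"
      unfolding g_def s_def
      by (rule filterlim_compose[OF SP_limit[OF r] filterlim_scaled_at_top_prod]) (use d0 l in auto)
    from tendsto_mult_left[OF this, of "mu d / real d ^ 2"]
    have "((\<lambda>p. mu d / real d ^ 2 * g (s p)) \<longlongrightarrow> mu d / real d ^ 2 * (1 / (4 * real (r d)))) ?F" .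
    also have "(\<lambda>p. mu d / real d ^ 2 * g (s p)) = a d"
    proof
      fix p :: "real \<times> real"
      obtain X Y where p: "p = (X, Y)" by force
      have "mu d / real d ^ 2 * (SP (r d) (X / real d ^ 2) (real l * Y / real d ^ 2) / (T X Y / real d ^ 3)) = a d p"
        using True d0 by (simp add: a_def p power2_eq_square power3_eq_cube)
      moreover have "g (s p) = SP (r d) (X / real d ^ 2) (real l * Y / real d ^ 2) /
          (C_trans (real l * Y / real d ^ 2 / (X / real d ^ 2)) * (X / real d ^ 2 * sqrt (X / real d ^ 2)))"
        by (simp add: p g_def s_def)
      ultimately show "mu d / real d ^ 2 * g (s p) = a d p" unfolding T_scale[OF d0] by simp
    qed
    also have "mu d / real d ^ 2 * (1 / (4 * real (r d))) = b d"
    proof -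
      have "real l = real (r d) * real (gcd l d)" by (metis rd of_nat_mult)
      moreover have "gcd l d > 0" using l by simp
      ultimately show ?thesis using True by (simp add: b_def)
    qed
    finally show ?thesis .
  qed
  \<comment> \<open>\<open>SP_bound\<close> gives one constant per divisor of \<open>l\<close>; the
    finite sum of their absolute values serves all \<open>d\<close> at once.\<close>
  have "\<exists>K. \<forall>k\<in>{k. k dvd l}. \<forall>X>0. \<forall>Q>0. \<bar>SP k X Q\<bar> \<le> K * (X * sqrt Q + Q * sqrt X)"
  proof -
    have "\<exists>K. \<forall>X>0. \<forall>Q>0. \<bar>SP k X Q\<bar> \<le> K * (X * sqrt Q + Q * sqrt X)" if "k dvd l" for k
      by (rule SP_bound) (use that l in \<open>auto intro: squarefree_mono dvd_trans\<close>)
    then obtain K where K: "\<And>k X Q. k dvd l \<Longrightarrow> X > 0 \<Longrightarrow> Q > 0 \<Longrightarrow> \<bar>SP k X Q\<bar> \<le> K k * (X * sqrt Q + Q * sqrt X)"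
      by metis
    have "K k \<le> (\<Sum>k | k dvd l. \<bar>K k\<bar>)" if "k dvd l" for k
    proof -
      have "\<bar>K k\<bar> \<le> (\<Sum>k | k dvd l. \<bar>K k\<bar>)" using that l by (intro member_le_sum) auto
      then show ?thesis by linarith
    qed
    then have "\<bar>SP k X Q\<bar> \<le> (\<Sum>k | k dvd l. \<bar>K k\<bar>) * (X * sqrt Q + Q * sqrt X)" if "k dvd l" "X > 0" "Q > 0" for k X Q
      using K[OF that] that by (meson add_nonneg_nonneg less_imp_le mult_nonneg_nonneg mult_right_mono order_trans real_sqrt_ge_zero)
    then show ?thesis by blast
  qed
  then obtain K where K: "\<And>d X Q. X > 0 \<Longrightarrow> Q > 0 \<Longrightarrow> \<bar>SP (r d) X Q\<bar> \<le> K * (X * sqrt Q + Q * sqrt X)"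
    by (metis dvd_triv_left mem_Collect_eq rd)
  have bound: "norm (a d (X, Y)) \<le> K / c * (1 / real d ^ 2)" if X: "1 \<le> X" and Y: "1 \<le> Y" for d X Y
  proof -
    define Q where "Q = real l * Y"
    define W where "W = X * sqrt Q + Q * sqrt X"
    have Q0: "Q > 0" and X0: "X > 0" using X Y l by (auto simp: Q_def)
    have W: "W > 0" using X0 Q0 by (auto simp: W_def intro!: add_pos_pos)
    have cT: "c * W \<le> T X Y" using c(2)[OF X0 Q0] by (simp add: W_def T_def Q_def)
    have cW: "c * W > 0" using c(1) W by simp
    have T: "T X Y > 0" using cT cW by linarith
    have "0 \<le> K * W" using K[OF X0 Q0, of 1] unfolding W_def by linarith
    then have K0: "K \<ge> 0" using W by (simp add: zero_le_mult_iff)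
    show ?thesis
    proof (cases "odd d")
      case False
      then show ?thesis using K0 c by (simp add: a_def)
    next
      case True
      then have d0: "d > 0" by (rule odd_pos)
      have "\<bar>mu d * real d * SP (r d) (X / real d ^ 2) (Q / real d ^ 2)\<bar> =
          \<bar>mu d\<bar> * (real d * \<bar>SP (r d) (X / real d ^ 2) (Q / real d ^ 2)\<bar>)" by (simp add: abs_mult)
      also have "\<dots> \<le> 1 * (real d * (K * (X / real d ^ 2 * sqrt (Q / real d ^ 2) + Q / real d ^ 2 * sqrt (X / real d ^ 2))))"
        using abs_mu_le_1[of d] X0 Q0 d0 by (intro mult_mono mult_left_mono K) auto
      also have "\<dots> = K * W / real d ^ 2"
        using d0 by (simp add: W_def real_sqrt_divide field_simps power2_eq_square)
      finally have 1: "\<bar>mu d * real d * SP (r d) (X / real d ^ 2) (Q / real d ^ 2)\<bar> \<le> K * W / real d ^ 2" .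
      have "norm (a d (X, Y)) = \<bar>mu d * real d * SP (r d) (X / real d ^ 2) (Q / real d ^ 2)\<bar> / T X Y"
        using True T by (simp add: a_def Q_def)
      also have "\<dots> \<le> K * W / real d ^ 2 / (c * W)"
        using 1 cT cW K0 W by (intro frac_le) auto
      also have "\<dots> = K / c * (1 / real d ^ 2)" using W by simp
      finally show ?thesis .
    qed
  qed
  have ev: "eventually (\<lambda>(d, p). norm (a d p) \<le> K / c * (1 / real d ^ 2)) (at_top \<times>\<^sub>F ?F)"
  proof (rule eventually_mono)
    show "eventually (\<lambda>x. True \<and> (case snd x of (X, Y) \<Rightarrow> 1 \<le> X \<and> 1 \<le> Y)) (at_top \<times>\<^sub>F ?F)"
      by (rule eventually_prodI[OF _ pos]) simp
  qed (use bound in auto)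
  have sm: "summable (\<lambda>d. K / c * (1 / real d ^ 2))"
    using inverse_power_summable[of 2, where ?'a = real] by (intro summable_mult) (simp add: divide_inverse)
  have F: "?F \<noteq> bot" by (simp add: prod_filter_eq_bot)
  have lim_sum: "((\<lambda>p. \<Sum>d. a d p) \<longlongrightarrow> (\<Sum>d. b d)) ?F" and sb: "summable (\<lambda>d. norm (b d))"
    using tannerys_theorem[OF lim ev sm F] by auto
  have "(\<Sum>d. b d) = (\<Sum>\<^sub>\<infinity>d. b d)"
    using norm_summable_imp_has_sum[OF sb summable_sums[OF summable_norm_cancel[OF sb]]] by (simp add: infsumI)
  also have "\<dots> = (\<Sum>\<^sub>\<infinity>d. mu d * (if odd d then real (gcd l d) else 0) / real d ^ 2 * (1 / (4 * real l)))"
    by (simp add: b_def)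
  also have "\<dots> = (\<Sum>\<^sub>\<infinity>d. mu d * (if odd d then real (gcd l d) else 0) / real d ^ 2) * (1 / (4 * real l))"
    by (rule infsum_cmult_left')
  also have "\<dots> = 8 / pi\<^sup>2 * (real l / real (divisor_sum l)) * (1 / (4 * real l))"
    by (simp only: infsum_mu_gcd[OF l(2,3)])
  also have "\<dots> = 2 / pi\<^sup>2 / real (divisor_sum l)" using l by simp
  finally have const: "(\<Sum>d. b d) = 2 / pi\<^sup>2 / real (divisor_sum l)" .
  show ?thesis
  proof (rule Lim_transform_eventually[OF lim_sum[unfolded const]])
    show "eventually (\<lambda>p. (\<Sum>d. a d p) = (case p of (X, Y) \<Rightarrow> real_of_int (jacobi_sum l X Y) / (C_trans (real l * Y / X) * (X * sqrt X)))) ?F"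
      using pos
    proof eventually_elim
      case (elim p)
      obtain X Y where p: "p = (X, Y)" by force
      have XY: "X \<ge> 1" "Y \<ge> 0" using elim by (auto simp: p)
      let ?g = "\<lambda>d. if odd d then mu d * real d * SP (l div gcd l d) (X / real d ^ 2) (real l * Y / real d ^ 2) else 0"
      have "summable ?g"
      proof (rule summable_finite)
        show "?g d = 0" if "d \<notin> {..<nat \<lfloor>X\<rfloor> + 1}" for d
        proof -
          have d: "X < real d" "1 \<le> d" using that XY by (auto simp: not_less) linarith
          have "real d * 1 \<le> real d * real d" using d by (intro mult_left_mono) auto
          then have "X < real d ^ 2" using d unfolding power2_eq_square by linarith
          then have "X / real d ^ 2 < 1" using d by simp
          then show ?thesis by (simp add: SP_eq_0)
        qed
      qed simp
      then have "(\<Sum>d. ?g d / T X Y) = (\<Sum>d. ?g d) / T X Y" by (rule suminf_divide)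
      also have "\<dots> = real_of_int (jacobi_sum l X Y) / T X Y"
        by (simp only: jacobi_sum_eq_suminf_SP[OF l XY])
      finally show ?case by (simp add: p a_def r_def T_def cong: if_cong)
    qed
  qed
qed

theorem theorem2:
  fixes l :: nat
  assumes "l > 0" and "odd l" and "squarefree l"
  shows "((\<lambda>(X, Y). real_of_int (jacobi_sum l X Y) /
            (1 / real (divisor_sum l) * (2 / pi ^ 2) * C_twist l (Y / X) * X powr (3 / 2)))
          \<longlongrightarrow> 1) (at_top \<times>\<^sub>F at_top)"
proof -
  let ?k = "2 / pi\<^sup>2 / real (divisor_sum l)"
  have "(\<Sum>d\<in>{1}. d) \<le> divisor_sum l" unfolding divisor_sum_def using assms by (intro sum_mono2) auto
  then have k: "?k \<noteq> 0" by simp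
  have "((\<lambda>p. (case p of (X, Y) \<Rightarrow> real_of_int (jacobi_sum l X Y) / (C_trans (real l * Y / X) * (X * sqrt X))) / ?k)
      \<longlongrightarrow> ?k / ?k) (at_top \<times>\<^sub>F at_top)"
    by (intro tendsto_divide jacobi_sum_limit assms tendsto_const k)
  then have lim: "((\<lambda>p. (case p of (X, Y) \<Rightarrow> real_of_int (jacobi_sum l X Y) / (C_trans (real l * Y / X) * (X * sqrt X))) / ?k)
      \<longlongrightarrow> 1) (at_top \<times>\<^sub>F at_top)" using k by simp
  show ?thesis
  proof (rule Lim_transform_eventually[OF lim])
    have "eventually (\<lambda>(X, Y). (1::real) \<le> X \<and> (1::real) \<le> Y) (at_top \<times>\<^sub>F at_top)"
      unfolding case_prod_unfold by (rule eventually_prodI[OF eventually_ge_at_top eventually_ge_at_top])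
    then show "eventually (\<lambda>p. (case p of (X, Y) \<Rightarrow> real_of_int (jacobi_sum l X Y) / (C_trans (real l * Y / X) * (X * sqrt X))) / ?k =
        (case p of (X, Y) \<Rightarrow> real_of_int (jacobi_sum l X Y) /
            (1 / real (divisor_sum l) * (2 / pi ^ 2) * C_twist l (Y / X) * X powr (3 / 2)))) (at_top \<times>\<^sub>F at_top)"
    proof eventually_elim
      case (elim p)
      obtain X Y where p: "p = (X, Y)" by force
      have X: "X \<ge> 1" using elim by (simp add: p)
      have "X powr (3 / 2) = X powr (1 + 1 / 2)" by simp
      also have "\<dots> = X powr 1 * X powr (1 / 2)" by (rule powr_add)
      finally have "X powr (3 / 2) = X * sqrt X" using X by (simp add: powr_half_sqrt)
      then show ?case by (simp add: p C_twist_def mult_ac)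
    qed
  qed
qed

end
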